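(* Let $s(q)$ be a solution of $$\{s,q\}+\frac{\dot s^2}{2}V(s)=0,\qquad V(s)=\frac{1-\beta^2}{s^2}+\frac{1-\gamma^2}{(s-1)^2}+\frac{\beta^2+\gamma^2-\alpha^2-1}{s(s-1)},$$ with $(\alpha,\beta,\gamma)$ given by one of $$(3,3,3),\qquad \left(3,\tfrac13,\tfrac13\right),\qquad \left(\tfrac13,3,\tfrac13\right),\qquad\left(\tfrac13,\tfrac13,3\right).$$ Let $F(q)=\iint\frac{\dot s^{3/2}}{s(s-1)}\,dq\,dq$, and let $\mathcal{D}_s$ denote the $(2,3,5)$-distribution on $M_{xyzpq}$ annihilated by $$\omega_1=dy-p\,dx,\qquad \omega_2=dp-q\,dx,\qquad \omega_3=dz-F(q)\,dx.$$ Set $\omega_4=dq$, $\omega_5=dx$ and $$\theta^1=\omega_1-\frac{1}{F''}(F'\omega_2-\omega_3),\qquad \theta^2=\frac{1}{F''}(F'\omega_2-\omega_3),\qquad \theta^3=\left(1-\frac{F'F^{(3)}}{4(F'')^2}\right)\omega_2+\frac{F^{(3)}}{4(F'')^2}\omega_3,$$ $$\theta^4=\left(\frac{7(F^{(3)})^2-4F''F^{(4)}}{40(F'')^3}\right)(F'\omega_2-\omega_3)+\omega_4-\omega_5,\qquad \theta^5=-\omega_4.$$ Then Nurowski's metric $$g_{\mathcal{D}_s}=2\theta^1\theta^5-2\theta^2\theta^4+\frac43\theta^3\theta^3$$ has vanishing Weyl tensor (and hence is conformally flat), and $\mathcal{D}_s$ has the split real form of $G_2$ as its group of local symmetries.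
   Context: $M_{xyzpq}$ is a 5-manifold with local coordinates $(x,y,z,p,q)$. Dots and primes denote $d/dq$, and $\{s,q\}=\frac{d}{dq}\left(\frac{\ddot s}{\dot s}\right)-\frac12\left(\frac{\ddot s}{\dot s}\right)^2$ is the Schwarzian derivative. Integrals denote (fixed choices of) antiderivatives. All statements are local: one works where all functions involved are real, smooth and well defined (in particular $\dot s\ne0$, $s\neq0,1$). Products of 1-forms are symmetric products, $\theta\eta=\frac12(\theta\otimes\eta+\eta\otimes\theta)$. A $(2,3,5)$-distribution on a 5-manifold $M$ is a rank 2 distribution $\mathcal{D}$ such that $[\mathcal{D},\mathcal{D}]$ has rank 3 and $[[\mathcal{D},\mathcal{D}],\mathcal{D}]=TM$. That $\mathcal{D}$ "has the split real form of $G_2$ as its group of local symmetries" means that the Lie algebra of local infinitesimal symmetries (vector fields near any point whose flow preserves $\mathcal{D}$) is the 14-dimensional split real form of $\mathfrak{g}_2$. *)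

theory Defs
  imports "HOL-Analysis.Analysis"
begin

section \<open>Smooth maps, vector fields and flows\<close>

(* Meant for open S; a map is of class C^(k+1) iff it is differentiable and all its
   directional derivatives are of class C^k. *)
primrec Ck_on :: "nat \<Rightarrow> 'a::real_normed_vector set \<Rightarrow> ('a \<Rightarrow> 'b::real_normed_vector) \<Rightarrow> bool" where
  "Ck_on 0 S f \<longleftrightarrow> continuous_on S f"
| "Ck_on (Suc k) S f \<longleftrightarrow>
     f differentiable_on S \<and> (\<forall>v. Ck_on k S (\<lambda>x. frechet_derivative f (at x) v))"

definition smooth_on :: "'a::real_normed_vector set \<Rightarrow> ('a \<Rightarrow> 'b::real_normed_vector) \<Rightarrow> bool" where
  "smooth_on S f \<longleftrightarrow> (\<forall>k. Ck_on k S f)"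

type_synonym 'n vfield = "real^'n \<Rightarrow> real^'n"
type_synonym 'n one_form = "real^'n \<Rightarrow> real^'n \<Rightarrow> real"       (* base point, tangent vector *)
type_synonym 'n dist = "real^'n \<Rightarrow> (real^'n) set"              (* base point \<mapsto> subspace *)
type_synonym 'n metric = "real^'n \<Rightarrow> real^'n \<Rightarrow> real^'n \<Rightarrow> real"

definition vf_bracket :: "('n::finite) vfield \<Rightarrow> 'n vfield \<Rightarrow> 'n vfield" where
  "vf_bracket X Y v = frechet_derivative Y (at v) (X v) - frechet_derivative X (at v) (Y v)"

definition local_flow ::
    "(real^'n::finite) set \<Rightarrow> 'n vfield \<Rightarrow> real \<Rightarrow> (real^'n) set \<Rightarrow> (real \<Rightarrow> real^'n \<Rightarrow> real^'n) \<Rightarrow> bool" where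
  "local_flow U X \<epsilon> W \<phi> \<longleftrightarrow>
     smooth_on ({-\<epsilon><..<\<epsilon>} \<times> W) (\<lambda>(t, v). \<phi> t v) \<and>
     (\<forall>v\<in>W. \<phi> 0 v = v) \<and>
     (\<forall>v\<in>W. \<forall>t\<in>{-\<epsilon><..<\<epsilon>}.
        \<phi> t v \<in> U \<and> ((\<lambda>\<tau>. \<phi> \<tau> v) has_vector_derivative X (\<phi> t v)) (at t))"

(* The local flow of a smooth field exists near every point and is unique, so the
   existential quantifier below just names it. *)
definition infinitesimal_symmetry_on ::
    "(real^'n::finite) set \<Rightarrow> 'n dist \<Rightarrow> 'n vfield \<Rightarrow> bool" where
  "infinitesimal_symmetry_on U D X \<longleftrightarrow>
     open U \<and> smooth_on U X \<and>
     (\<forall>a\<in>U. \<exists>\<epsilon> W \<phi>. \<epsilon> > 0 \<and> open W \<and> a \<in> W \<and> W \<subseteq> U \<and> local_flow U X \<epsilon> W \<phi> \<and>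
        (\<forall>v\<in>W. \<forall>t\<in>{-\<epsilon><..<\<epsilon>}. frechet_derivative (\<phi> t) (at v) ` D v = D (\<phi> t v)))"


section \<open>Distributions\<close>

definition local_section :: "(real^'n::finite) set \<Rightarrow> 'n dist \<Rightarrow> 'n vfield \<Rightarrow> bool" where
  "local_section U D X \<longleftrightarrow> open U \<and> smooth_on U X \<and> (\<forall>v\<in>U. X v \<in> D v)"

definition distribution_of_rank :: "nat \<Rightarrow> (real^'n::finite) set \<Rightarrow> 'n dist \<Rightarrow> bool" where
  "distribution_of_rank k M D \<longleftrightarrow>
     (\<forall>v\<in>M. subspace (D v) \<and> dim (D v) = k \<and>
        (\<forall>w\<in>D v. \<exists>U X. v \<in> U \<and> U \<subseteq> M \<and> local_section U D X \<and> X v = w))"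

(* As sections may be multiplied by functions, [D, D] automatically contains D. *)
definition dist_bracket ::
    "(real^'n::finite) set \<Rightarrow> 'n dist \<Rightarrow> 'n dist \<Rightarrow> 'n dist" where
  "dist_bracket M D E v =
     span {vf_bracket X Y v | X Y U. v \<in> U \<and> U \<subseteq> M \<and> local_section U D X \<and> local_section U E Y}"

definition distribution_235 :: "(real^5) set \<Rightarrow> 5 dist \<Rightarrow> bool" where
  "distribution_235 M D \<longleftrightarrow>
     distribution_of_rank 2 M D \<and>
     distribution_of_rank 3 M (dist_bracket M D D) \<and>
     (\<forall>v\<in>M. dist_bracket M (dist_bracket M D D) D v = UNIV)"


section \<open>Lie algebras and germs of infinitesimal symmetries\<close>

record 'a lie_alg =
  lie_carrier :: "'a set"
  lie_add :: "'a \<Rightarrow> 'a \<Rightarrow> 'a"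
  lie_scale :: "real \<Rightarrow> 'a \<Rightarrow> 'a"
  lie_bracket :: "'a \<Rightarrow> 'a \<Rightarrow> 'a"

definition lie_isomorphic :: "'a lie_alg \<Rightarrow> 'b lie_alg \<Rightarrow> bool" where
  "lie_isomorphic L K \<longleftrightarrow>
     (\<exists>h. bij_betw h (lie_carrier L) (lie_carrier K) \<and>
        (\<forall>x\<in>lie_carrier L. \<forall>y\<in>lie_carrier L.
           h (lie_add L x y) = lie_add K (h x) (h y) \<and>
           h (lie_bracket L x y) = lie_bracket K (h x) (h y)) \<and>
        (\<forall>c. \<forall>x\<in>lie_carrier L. h (lie_scale L c x) = lie_scale K c (h x)))"

(* The germ of X at a, as the class of all fields that agree with X near a. *)
definition vf_germ :: "real^'n::finite \<Rightarrow> 'n vfield \<Rightarrow> 'n vfield set" where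
  "vf_germ a X = {Y. \<forall>\<^sub>F v in nhds a. Y v = X v}"

(* The operations are computed on representatives; the unions are over equal germs. *)
definition symmetry_algebra_at ::
    "(real^'n::finite) set \<Rightarrow> 'n dist \<Rightarrow> real^'n \<Rightarrow> 'n vfield set lie_alg" where
  "symmetry_algebra_at M D a =
     \<lparr> lie_carrier = vf_germ a ` {X. \<exists>U. a \<in> U \<and> U \<subseteq> M \<and> infinitesimal_symmetry_on U D X},
       lie_add = (\<lambda>A B. \<Union>X\<in>A. \<Union>Y\<in>B. vf_germ a (\<lambda>v. X v + Y v)),
       lie_scale = (\<lambda>c A. \<Union>X\<in>A. vf_germ a (\<lambda>v. c *\<^sub>R X v)),
       lie_bracket = (\<lambda>A B. \<Union>X\<in>A. \<Union>Y\<in>B. vf_germ a (vf_bracket X Y)) \<rparr>"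


section \<open>The split real form of the exceptional Lie algebra g2\<close>

(* Split octonions in Zorn's vector-matrix model: (a, u, v, b) stands for the matrix with
   rows (a, u) and (v, b).  The norm below is multiplicative, nondegenerate and of signature
   (4, 4).  The split real form of g2 is the derivation algebra. *)
type_synonym zorn = "real \<times> (real^3) \<times> (real^3) \<times> real"

definition zorn_mult :: "zorn \<Rightarrow> zorn \<Rightarrow> zorn" where
  "zorn_mult = (\<lambda>(a, u, v, b) (a', u', v', b').
     (a * a' + u \<bullet> v',
      a *\<^sub>R u' + b' *\<^sub>R u - cross3 v v',
      a' *\<^sub>R v + b *\<^sub>R v' + cross3 u u',
      b * b' + v \<bullet> u'))"

definition zorn_norm :: "zorn \<Rightarrow> real" where
  "zorn_norm = (\<lambda>(a, u, v, b). a * b - u \<bullet> v)"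

lemma zorn_norm_mult: "zorn_norm (zorn_mult x y) = zorn_norm x * zorn_norm y"
  by (cases x; cases y)
     (simp add: zorn_norm_def zorn_mult_def cross3_def inner_vec_def sum_3 algebra_simps)

definition split_g2 :: "(zorn \<Rightarrow> zorn) lie_alg" where
  "split_g2 =
     \<lparr> lie_carrier = {d. linear d \<and>
         (\<forall>x y. d (zorn_mult x y) = zorn_mult (d x) y + zorn_mult x (d y))},
       lie_add = (\<lambda>d e x. d x + e x),
       lie_scale = (\<lambda>c d x. c *\<^sub>R d x),
       lie_bracket = (\<lambda>d e x. d (e x) - e (d x)) \<rparr>"


section \<open>Curvature of a pseudo-Riemannian metric in coordinates\<close>

definition pseudo_riemannian_on :: "(real^'n::finite) set \<Rightarrow> 'n metric \<Rightarrow> bool" where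
  "pseudo_riemannian_on M g \<longleftrightarrow>
     (\<forall>u w. smooth_on M (\<lambda>v. g v u w)) \<and>
     (\<forall>v\<in>M. bilinear (g v) \<and> (\<forall>u w. g v u w = g v w u) \<and>
        (\<forall>u. (\<forall>w. g v u w = 0) \<longrightarrow> u = 0))"

definition partial :: "'n::finite \<Rightarrow> (real^'n \<Rightarrow> real) \<Rightarrow> real^'n \<Rightarrow> real" where
  "partial i f v = frechet_derivative f (at v) (axis i 1)"

definition lower_metric :: "('n::finite) metric \<Rightarrow> 'n \<Rightarrow> 'n \<Rightarrow> real^'n \<Rightarrow> real" where
  "lower_metric g i j v = g v (axis i 1) (axis j 1)"

definition upper_metric :: "('n::finite) metric \<Rightarrow> 'n \<Rightarrow> 'n \<Rightarrow> real^'n \<Rightarrow> real" where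
  "upper_metric g i j v = matrix_inv (\<chi> k l. lower_metric g k l v) $ i $ j"

(* christoffel g k i j has upper index k *)
definition christoffel :: "('n::finite) metric \<Rightarrow> 'n \<Rightarrow> 'n \<Rightarrow> 'n \<Rightarrow> real^'n \<Rightarrow> real" where
  "christoffel g k i j v =
     (\<Sum>l\<in>UNIV. upper_metric g k l v *
        (partial i (lower_metric g j l) v + partial j (lower_metric g i l) v
         - partial l (lower_metric g i j) v)) / 2"

(* riemann g l k i j is the l-th component of R(e_i, e_j) e_k,
   where R(X, Y) = nabla_X nabla_Y - nabla_Y nabla_X - nabla_[X,Y] *)
definition riemann :: "('n::finite) metric \<Rightarrow> 'n \<Rightarrow> 'n \<Rightarrow> 'n \<Rightarrow> 'n \<Rightarrow> real^'n \<Rightarrow> real" where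
  "riemann g l k i j v =
     partial i (christoffel g l j k) v - partial j (christoffel g l i k) v
     + (\<Sum>m\<in>UNIV. christoffel g l i m v * christoffel g m j k v
                - christoffel g l j m v * christoffel g m i k v)"

definition riemann_lower :: "('n::finite) metric \<Rightarrow> 'n \<Rightarrow> 'n \<Rightarrow> 'n \<Rightarrow> 'n \<Rightarrow> real^'n \<Rightarrow> real" where
  "riemann_lower g a b c d v = (\<Sum>l\<in>UNIV. lower_metric g a l v * riemann g l b c d v)"

definition ricci :: "('n::finite) metric \<Rightarrow> 'n \<Rightarrow> 'n \<Rightarrow> real^'n \<Rightarrow> real" where
  "ricci g k j v = (\<Sum>l\<in>UNIV. riemann g l k l j v)"

definition scalar_curvature :: "('n::finite) metric \<Rightarrow> real^'n \<Rightarrow> real" where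
  "scalar_curvature g v = (\<Sum>i\<in>UNIV. \<Sum>j\<in>UNIV. upper_metric g i j v * ricci g i j v)"

definition weyl :: "('n::finite) metric \<Rightarrow> 'n \<Rightarrow> 'n \<Rightarrow> 'n \<Rightarrow> 'n \<Rightarrow> real^'n \<Rightarrow> real" where
  "weyl g a b c d v =
     (let n = real CARD('n); G = (\<lambda>i j. lower_metric g i j v); R = (\<lambda>i j. ricci g i j v) in
       riemann_lower g a b c d v
       - (G a c * R b d - G a d * R b c - G b c * R a d + G b d * R a c) / (n - 2)
       + scalar_curvature g v * (G a c * G b d - G a d * G b c) / ((n - 1) * (n - 2)))"

definition flat_on :: "(real^'n::finite) set \<Rightarrow> 'n metric \<Rightarrow> bool" where
  "flat_on U g \<longleftrightarrow> (\<forall>v\<in>U. \<forall>l k i j. riemann g l k i j v = 0)"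

definition conformally_flat_on :: "(real^'n::finite) set \<Rightarrow> 'n metric \<Rightarrow> bool" where
  "conformally_flat_on M g \<longleftrightarrow>
     (\<forall>a\<in>M. \<exists>U f. open U \<and> a \<in> U \<and> U \<subseteq> M \<and> smooth_on U f \<and>
        flat_on U (\<lambda>v u w. exp (2 * f v) * g v u w))"


section \<open>The differential equation for s and the function F\<close>

definition schwarzian :: "(real \<Rightarrow> real) \<Rightarrow> real \<Rightarrow> real" where
  "schwarzian s q =
     deriv (\<lambda>r. deriv (deriv s) r / deriv s r) q - (deriv (deriv s) q / deriv s q)^2 / 2"

definition potential :: "real \<Rightarrow> real \<Rightarrow> real \<Rightarrow> real \<Rightarrow> real" where
  "potential \<alpha> \<beta> \<gamma> s =
     (1 - \<beta>^2) / s^2 + (1 - \<gamma>^2) / (s - 1)^2 + (\<beta>^2 + \<gamma>^2 - \<alpha>^2 - 1) / (s * (s - 1))"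

definition iterated_antiderivative_on :: "real set \<Rightarrow> (real \<Rightarrow> real) \<Rightarrow> (real \<Rightarrow> real) \<Rightarrow> bool" where
  "iterated_antiderivative_on I f F \<longleftrightarrow>
     (\<exists>G. \<forall>q\<in>I. (G has_real_derivative f q) (at q) \<and> (F has_real_derivative G q) (at q))"


section \<open>The distribution and Nurowski's metric\<close>

(* Coordinates (x, y, z, p, q) are the components 1, ..., 5 of real^5; in the index type 5
   the numeral 5 equals 0, so these are five distinct indices. *)
definition M_xyzpq :: "real set \<Rightarrow> (real^5) set" where
  "M_xyzpq I = {v. v $ 5 \<in> I}"

definition \<omega>1 :: "5 one_form" where "\<omega>1 v w = w $ 2 - v $ 4 * w $ 1"
definition \<omega>2 :: "5 one_form" where "\<omega>2 v w = w $ 4 - v $ 5 * w $ 1"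
definition \<omega>3 :: "(real \<Rightarrow> real) \<Rightarrow> 5 one_form" where "\<omega>3 F v w = w $ 3 - F (v $ 5) * w $ 1"
definition \<omega>4 :: "5 one_form" where "\<omega>4 v w = w $ 5"
definition \<omega>5 :: "5 one_form" where "\<omega>5 v w = w $ 1"

definition distribution_F :: "(real \<Rightarrow> real) \<Rightarrow> 5 dist" where
  "distribution_F F v = {w. \<omega>1 v w = 0 \<and> \<omega>2 v w = 0 \<and> \<omega>3 F v w = 0}"

definition sym_prod :: "('n::finite) one_form \<Rightarrow> 'n one_form \<Rightarrow> 'n metric" where
  "sym_prod \<theta> \<eta> v u w = (\<theta> v u * \<eta> v w + \<eta> v u * \<theta> v w) / 2"

definition Dq :: "(real \<Rightarrow> real) \<Rightarrow> nat \<Rightarrow> real^5 \<Rightarrow> real" where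
  "Dq F k v = (deriv ^^ k) F (v $ 5)"

definition \<theta>1 :: "(real \<Rightarrow> real) \<Rightarrow> 5 one_form" where
  "\<theta>1 F v w = \<omega>1 v w - 1 / Dq F 2 v * (Dq F 1 v * \<omega>2 v w - \<omega>3 F v w)"

definition \<theta>2 :: "(real \<Rightarrow> real) \<Rightarrow> 5 one_form" where
  "\<theta>2 F v w = 1 / Dq F 2 v * (Dq F 1 v * \<omega>2 v w - \<omega>3 F v w)"

definition \<theta>3 :: "(real \<Rightarrow> real) \<Rightarrow> 5 one_form" where
  "\<theta>3 F v w = (1 - Dq F 1 v * Dq F 3 v / (4 * (Dq F 2 v)^2)) * \<omega>2 v w
     + Dq F 3 v / (4 * (Dq F 2 v)^2) * \<omega>3 F v w"

definition \<theta>4 :: "(real \<Rightarrow> real) \<Rightarrow> 5 one_form" where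
  "\<theta>4 F v w = (7 * (Dq F 3 v)^2 - 4 * Dq F 2 v * Dq F 4 v) / (40 * (Dq F 2 v)^3)
       * (Dq F 1 v * \<omega>2 v w - \<omega>3 F v w)
     + \<omega>4 v w - \<omega>5 v w"

definition \<theta>5 :: "5 one_form" where "\<theta>5 v w = - \<omega>4 v w"

definition nurowski_metric :: "(real \<Rightarrow> real) \<Rightarrow> 5 metric" where
  "nurowski_metric F v u w =
     2 * sym_prod (\<theta>1 F) \<theta>5 v u w - 2 * sym_prod (\<theta>2 F) (\<theta>4 F) v u w
     + 4/3 * sym_prod (\<theta>3 F) (\<theta>3 F) v u w"

end

theory Submission
  imports Defs
begin

text \<open>The flat (2,3,5)-distribution is the canonical distribution on the projective quadric of null imaginary
  split octonions: a curve is tangent to it iff the product of the point with its derivative vanishes.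
  In an affine chart of the quadric its symmetries are computed by integrating the overdetermined
  linear system for their components, which leaves 14 constants; these are matched by the derivations
  of the split octonions.  The conformal class induced by the octonion norm is flat.

  It remains to find a local diffeomorphism \<open>\<Phi>\<close> onto an open subset of this chart that carries the given
  distribution and Nurowski's conformal class to the flat ones.  Put \<open>t = s\<close> for the parameters \<open>(3, 3, 3)\<close> and
  \<open>t\<^sup>3 = s / (s - 1)\<close>, \<open>1 - s\<close> or \<open>s\<close> in the other three cases.  The Schwarzian equation becomes the one
  of a second order linear equation in \<open>t\<close> with explicit algebraic solutions, and \<open>F'\<close> and \<open>q F' - F\<close> are quotients
  of cubic polynomials in \<open>t\<close> by one cubic polynomial \<open>C\<close>.  The chart \<open>\<Phi>\<close> is built from these three binary cubics and
  the invariant symplectic form on the space of binary cubics.\<close>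

section \<open>Calculus of smooth maps\<close>

text \<open>All four triples come from one equation. In terms of \<open>t\<close> it is y'' = - W y
  with W = (3 C C'' - 2 C'^2) / C^2, where \<open>C\<close> is a binary cubic vanishing at the three
  singular points: x^2 - x for (3, 3, 3), whose third root is infinity, and x^3 - 1 otherwise. The
  exponent difference at each of them is 3. A parameter 1/3 is an exponent difference 1/3, which the
  cube root makes regular, while the point with parameter 3 splits into the three cube roots of
  unity. For every cubic g apolar to \<open>C\<close> the function C (g / C)' solves the equation,
  which is where the cubics come from: solutions divided by the square root of t' span 1 and q, and
  g / C is an antiderivative that turns this into formulas for F' and q F' - F.

  Two obstacles shape the rest. The claim on symmetries concerns all germs of fields, not only a
  14-dimensional family, hence the integration of the full linear system. The behaviour of the Weyl
  tensor under rescaling is bypassed: a metric conformal to a flat one is induced by a map into a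
  light cone, where the Gauss formula yields its curvature.\<close>

lemma Ck_on_subset: "Ck_on k S f \<Longrightarrow> T \<subseteq> S \<Longrightarrow> Ck_on k T f"
  by (induction k arbitrary: f) (auto intro: continuous_on_subset differentiable_on_subset)

lemma frechet_derivative_cong_open:
  assumes "open S" "x \<in> S" "\<And>y. y \<in> S \<Longrightarrow> f y = g y"
  shows "frechet_derivative f (at x) = frechet_derivative g (at x)"
proof -
  have "(f has_derivative D) (at x) \<longleftrightarrow> (g has_derivative D) (at x)" for D
    using assms has_derivative_transform_within_open[of f D x UNIV S g]
      has_derivative_transform_within_open[of g D x UNIV S f] by (auto simp: eq_commute)
  then show ?thesis
    by (simp add: frechet_derivative_def)
qed

lemma differentiable_on_cong_open:
  assumes "open S" "\<And>y. y \<in> S \<Longrightarrow> f y = g y" "f differentiable_on S"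
  shows "g differentiable_on S"
proof -
  have "g differentiable (at x)" if x: "x \<in> S" for x
  proof -
    obtain D where "(f has_derivative D) (at x)"
      using assms(1,3) x by (auto simp: differentiable_on_eq_differentiable_at differentiable_def)
    then have "(g has_derivative D) (at x)"
      by (rule has_derivative_transform_within_open) (use assms x in auto)
    then show ?thesis by (auto simp: differentiable_def)
  qed
  then show ?thesis by (simp add: differentiable_on_def differentiable_at_withinI)
qed

lemma Ck_on_cong:
  assumes "open S" "\<And>y. y \<in> S \<Longrightarrow> f y = g y" "Ck_on k S f"
  shows "Ck_on k S g"
  using assms(2,3)
proof (induction k arbitrary: f g)
  case 0
  then show ?case by (auto cong: continuous_on_cong)
next
  case (Suc k)
  have "frechet_derivative f (at y) = frechet_derivative g (at y)" if "y \<in> S" for y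
    using frechet_derivative_cong_open[OF assms(1) that] Suc.prems by auto
  then have "Ck_on k S (\<lambda>x. frechet_derivative g (at x) v)" for v
    using Suc.IH[of "\<lambda>x. frechet_derivative f (at x) v" "\<lambda>x. frechet_derivative g (at x) v"] Suc.prems
    by auto
  then show ?case
    using Suc.prems differentiable_on_cong_open[OF assms(1), of f g] by simp
qed

text \<open>Derivatives at points of an open set are unique, so any explicit candidate
  \<open>f'\<close> may replace \<open>frechet_derivative\<close> in the recursion.\<close>

lemma Ck_onI:
  assumes "open S" "\<And>x. x \<in> S \<Longrightarrow> (f has_derivative f' x) (at x)"
    and "\<And>v. Ck_on k S (\<lambda>x. f' x v)"
  shows "Ck_on (Suc k) S f"
proof -
  have "f' x v = frechet_derivative f (at x) v" if "x \<in> S" for x v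
    using frechet_derivative_at[OF assms(2)[OF that]] by simp
  then have "Ck_on k S (\<lambda>x. frechet_derivative f (at x) v)" for v
    by (intro Ck_on_cong[OF assms(1) _ assms(3)[of v]]) auto
  moreover have "f differentiable_on S"
    using assms(2) unfolding differentiable_on_def differentiable_def
    by (blast intro: has_derivative_at_withinI)
  ultimately show ?thesis by simp
qed

lemma Ck_on_has_derivative:
  assumes "Ck_on (Suc k) S f" "open S" "x \<in> S"
  shows "(f has_derivative frechet_derivative f (at x)) (at x)"
  using assms by (simp add: differentiable_on_eq_differentiable_at frechet_derivative_works)

lemma Ck_on_decr: "open S \<Longrightarrow> Ck_on (Suc k) S f \<Longrightarrow> Ck_on k S f"
  by (induction k arbitrary: f) (auto intro: differentiable_imp_continuous_on)

lemma Ck_on_const [simp]: "open S \<Longrightarrow> Ck_on k S (\<lambda>x. c)"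
proof (induction k arbitrary: c)
  case (Suc k)
  show ?case by (rule Ck_onI[where f'="\<lambda>x v. 0"]) (use Suc in auto)
qed auto

lemma Ck_on_bounded_linear:
  assumes "bounded_linear L" "open S" shows "Ck_on k S L"
proof (cases k)
  case 0
  then show ?thesis using assms linear_continuous_on by auto
next
  case (Suc k')
  show ?thesis unfolding Suc
    by (rule Ck_onI[where f'="\<lambda>x. L"]) (use assms in \<open>auto intro: bounded_linear_imp_has_derivative\<close>)
qed

lemma Ck_on_bounded_linear_comp:
  assumes "bounded_linear L" "open S" "Ck_on k S f" shows "Ck_on k S (\<lambda>x. L (f x))"
  using assms(3)
proof (induction k arbitrary: f)
  case 0
  then show ?case using bounded_linear.continuous_on[OF assms(1)] by auto
next
  case (Suc k)
  show ?case
    by (rule Ck_onI[where f'="\<lambda>x v. L (frechet_derivative f (at x) v)"])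
      (use Suc assms in \<open>auto intro!: bounded_linear.has_derivative[OF assms(1)] Ck_on_has_derivative\<close>)
qed

lemma Ck_on_add:
  assumes "open S" "Ck_on k S f" "Ck_on k S g" shows "Ck_on k S (\<lambda>x. f x + g x)"
  using assms(2,3)
proof (induction k arbitrary: f g)
  case 0
  then show ?case by (auto intro: continuous_intros)
next
  case (Suc k)
  show ?case
    by (rule Ck_onI[where f'="\<lambda>x v. frechet_derivative f (at x) v + frechet_derivative g (at x) v"])
      (use Suc assms in \<open>auto intro!: has_derivative_add Ck_on_has_derivative\<close>)
qed

lemma Ck_on_bilinear:
  assumes "bounded_bilinear p" "open S" "Ck_on k S f" "Ck_on k S g"
  shows "Ck_on k S (\<lambda>x. p (f x) (g x))"
  using assms(3,4)
proof (induction k arbitrary: f g)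
  case 0
  then show ?case using bounded_bilinear.continuous_on[OF assms(1)] by auto
next
  case (Suc k)
  have "Ck_on k S f" "Ck_on k S g"
    using Suc.prems by (auto intro!: Ck_on_decr[OF assms(2)] simp del: Ck_on.simps)
  then have "Ck_on k S (\<lambda>x. p (f x) (frechet_derivative g (at x) v) + p (frechet_derivative f (at x) v) (g x))" for v
    using Suc by (intro Ck_on_add assms Suc.IH) auto
  then show ?case
    by (intro Ck_onI[where f'="\<lambda>x v. p (f x) (frechet_derivative g (at x) v) + p (frechet_derivative f (at x) v) (g x)"])
      (use Suc assms in \<open>auto intro!: bounded_bilinear.FDERIV[OF assms(1)] Ck_on_has_derivative\<close>)
qed

lemma Ck_on_sum:
  assumes "open S" "\<And>i. i \<in> A \<Longrightarrow> Ck_on k S (f i)" shows "Ck_on k S (\<lambda>x. \<Sum>i\<in>A. f i x)"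
proof (cases "finite A")
  case True
  then show ?thesis using assms(2)
    by (induction A) (auto intro: Ck_on_add simp: assms(1))
qed (use assms in auto)

text \<open>\<open>Ck_on\<close> speaks of derivatives in a fixed direction \<open>v\<close>, while
  the chain rule differentiates \<open>g\<close> in a direction that varies with \<open>x\<close>.
  Expanding that direction in \<open>Basis\<close> gives \<open>?f'\<close>, a finite sum of
  products to which the induction hypothesis applies; this is why the middle space is
  Euclidean.\<close>

lemma Ck_on_compose:
  fixes f :: "'a::real_normed_vector \<Rightarrow> 'b::euclidean_space" and g :: "'b \<Rightarrow> 'c::real_normed_vector"
  assumes "open S" "open T" "Ck_on k S f" "Ck_on k T g" "f ` S \<subseteq> T"
  shows "Ck_on k S (\<lambda>x. g (f x))"
  using assms(3,4)
proof (induction k arbitrary: g)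
  case 0
  then show ?case using assms(5) by (auto intro: continuous_on_compose2)
next
  case (Suc k)
  let ?f' = "\<lambda>x v. \<Sum>b\<in>Basis. (frechet_derivative f (at x) v \<bullet> b) *\<^sub>R frechet_derivative g (at (f x)) b"
  have fk: "Ck_on k S f" using Suc.prems(1) by (rule Ck_on_decr[OF assms(1)])
  have "Ck_on k S (\<lambda>x. ?f' x v)" for v
  proof (rule Ck_on_sum[OF assms(1)], rule Ck_on_bilinear[OF bounded_bilinear_scaleR assms(1)])
    show "Ck_on k S (\<lambda>x. frechet_derivative f (at x) v \<bullet> b)" for b
      using Suc.prems by (intro Ck_on_bounded_linear_comp[OF bounded_linear_inner_left assms(1)]) simp
    show "Ck_on k S (\<lambda>x. frechet_derivative g (at (f x)) b)" for b
      using Suc.IH[OF fk, of "\<lambda>y. frechet_derivative g (at y) b"] Suc.prems by simp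
  qed
  moreover have "((\<lambda>x. g (f x)) has_derivative ?f' x) (at x)" if x: "x \<in> S" for x
  proof -
    have fx: "f x \<in> T" using x assms by auto
    have dg: "(g has_derivative frechet_derivative g (at (f x))) (at (f x))"
      by (rule Ck_on_has_derivative[OF Suc.prems(2) assms(2) fx])
    have df: "(f has_derivative frechet_derivative f (at x)) (at x)"
      by (rule Ck_on_has_derivative[OF Suc.prems(1) assms(1) x])
    have "((\<lambda>x. g (f x)) has_derivative (\<lambda>v. frechet_derivative g (at (f x)) (frechet_derivative f (at x) v))) (at x)"
      using diff_chain_at[OF df dg] by (simp add: o_def)
    moreover have "frechet_derivative g (at (f x)) (frechet_derivative f (at x) v) = ?f' x v" for v
    proof -
      have lin: "linear (frechet_derivative g (at (f x)))"
        using dg has_derivative_linear by blast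
      have "frechet_derivative g (at (f x)) (\<Sum>b\<in>Basis. (frechet_derivative f (at x) v \<bullet> b) *\<^sub>R b) = ?f' x v"
        by (simp add: linear_sum[OF lin] linear_cmul[OF lin])
      then show ?thesis by (simp add: euclidean_representation)
    qed
    ultimately show ?thesis by simp
  qed
  ultimately show ?case by (intro Ck_onI[OF assms(1)]) auto
qed

lemma Ck_on_euclidean:
  fixes f :: "'a::real_normed_vector \<Rightarrow> 'b::euclidean_space"
  assumes "open S" "\<And>b. b \<in> Basis \<Longrightarrow> Ck_on k S (\<lambda>x. f x \<bullet> b)"
  shows "Ck_on k S f"
proof -
  have "Ck_on k S (\<lambda>x. \<Sum>b\<in>Basis. (f x \<bullet> b) *\<^sub>R b)"
    by (rule Ck_on_sum[OF assms(1)], rule Ck_on_bilinear[OF bounded_bilinear_scaleR assms(1)])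
      (use assms in auto)
  then show ?thesis by (simp add: euclidean_representation)
qed

text \<open>If f' = h(f) with \<open>h\<close> smooth, then \<open>f\<close> of class C^k makes its
  derivative of class C^k, so \<open>f\<close> gains one order at a time. The inverse solves y' = -
  y^2 and the cube root solves y' = 1 / (3 y^2).\<close>

lemma Ck_on_real_bootstrap:
  fixes f :: "real \<Rightarrow> real"
  assumes "open S" "open T" "f ` S \<subseteq> T" "\<And>k. Ck_on k T h"
    and "\<And>x. x \<in> S \<Longrightarrow> (f has_real_derivative h (f x)) (at x)"
  shows "Ck_on k S f"
proof (induction k)
  case 0
  have "isCont f x" if "x \<in> S" for x
    using assms(5)[OF that] by (rule DERIV_isCont)
  then show ?case by (simp add: continuous_at_imp_continuous_on)
next
  case (Suc k)
  have "Ck_on k S (\<lambda>x. h (f x) * v)" for v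
    using Ck_on_bilinear[OF bounded_bilinear_mult assms(1) Ck_on_compose[OF assms(1,2) Suc assms(4,3)] Ck_on_const[OF assms(1)]] .
  then show ?case
    using assms(5)[unfolded has_field_derivative_def]
    by (rule Ck_onI[OF assms(1), where f'="\<lambda>x v. h (f x) * v", rotated])
qed

lemma Ck_on_inverse_real: "Ck_on k (- {0::real}) (\<lambda>x. inverse x)"
proof (rule Ck_on_real_bootstrap[where h="\<lambda>x. - (x * x)" and T=UNIV])
  show "Ck_on k UNIV (\<lambda>x::real. - (x * x))" for k
    using Ck_on_bounded_linear_comp[OF bounded_linear_minus[OF bounded_linear_ident] open_UNIV
        Ck_on_bilinear[OF bounded_bilinear_mult open_UNIV Ck_on_bounded_linear Ck_on_bounded_linear],
        OF bounded_linear_ident open_UNIV bounded_linear_ident open_UNIV] .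
  show "(inverse has_real_derivative - (inverse x * inverse x)) (at x)" if "x \<in> - {0}" for x :: real
    using that by (auto intro!: derivative_eq_intros simp: power2_eq_square)
qed auto


section \<open>Closure properties of smooth maps\<close>

lemma smooth_on_subset: "smooth_on S f \<Longrightarrow> T \<subseteq> S \<Longrightarrow> smooth_on T f"
  by (auto simp: smooth_on_def intro: Ck_on_subset)

lemma smooth_on_cong:
  "open S \<Longrightarrow> (\<And>y. y \<in> S \<Longrightarrow> f y = g y) \<Longrightarrow> smooth_on S f \<Longrightarrow> smooth_on S g"
  unfolding smooth_on_def using Ck_on_cong[of S f g] by simp

lemma smooth_on_derivI:
  assumes "open S" "\<And>x. x \<in> S \<Longrightarrow> (f has_derivative f' x) (at x)"
    and "\<And>v. smooth_on S (\<lambda>x. f' x v)"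
  shows "smooth_on S f"
  unfolding smooth_on_def
proof
  show "Ck_on k S f" for k
    by (rule Ck_on_decr[OF assms(1) Ck_onI[OF assms(1,2)]]) (use assms(3) in \<open>simp_all add: smooth_on_def\<close>)
qed

lemma smooth_on_has_derivative:
  "smooth_on S f \<Longrightarrow> open S \<Longrightarrow> x \<in> S \<Longrightarrow> (f has_derivative frechet_derivative f (at x)) (at x)"
  unfolding smooth_on_def by (rule Ck_on_has_derivative[of 0]) auto

lemma smooth_on_differentiable:
  "smooth_on S f \<Longrightarrow> open S \<Longrightarrow> x \<in> S \<Longrightarrow> f differentiable (at x)"
  using smooth_on_has_derivative[of S f x] by (auto simp: differentiable_def)

lemma smooth_on_continuous_on: "smooth_on S f \<Longrightarrow> continuous_on S f"
  unfolding smooth_on_def by (metis Ck_on.simps(1))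

lemma smooth_on_frechet_derivative:
  "smooth_on S f \<Longrightarrow> smooth_on S (\<lambda>x. frechet_derivative f (at x) v)"
  unfolding smooth_on_def by (metis Ck_on.simps(2))

lemma smooth_on_linear_comp:
  "bounded_linear L \<Longrightarrow> open S \<Longrightarrow> smooth_on S f \<Longrightarrow> smooth_on S (\<lambda>x. L (f x))"
  by (auto simp: smooth_on_def intro: Ck_on_bounded_linear_comp)

lemma smooth_on_compose:
  fixes f :: "'a::real_normed_vector \<Rightarrow> 'b::euclidean_space" and g :: "'b \<Rightarrow> 'c::real_normed_vector"
  assumes "open S" "open T" "smooth_on S f" "smooth_on T g" "f ` S \<subseteq> T"
  shows "smooth_on S (\<lambda>x. g (f x))"
  unfolding smooth_on_def
proof
  fix k
  show "Ck_on k S (\<lambda>x. g (f x))"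
    by (rule Ck_on_compose[OF assms(1,2) _ _ assms(5)]) (use assms(3,4) in \<open>simp_all add: smooth_on_def\<close>)
qed

lemma smooth_on_euclidean:
  fixes f :: "'a::real_normed_vector \<Rightarrow> 'b::euclidean_space"
  assumes "open S" "\<And>b. b \<in> Basis \<Longrightarrow> smooth_on S (\<lambda>x. f x \<bullet> b)"
  shows "smooth_on S f"
  unfolding smooth_on_def
proof
  fix k
  show "Ck_on k S f"
    by (rule Ck_on_euclidean[OF assms(1)]) (use assms(2) in \<open>simp add: smooth_on_def\<close>)
qed

named_theorems smooth_intros

lemma smooth_on_const [smooth_intros]: "open S \<Longrightarrow> smooth_on S (\<lambda>x. c)"
  by (auto simp: smooth_on_def)

lemma smooth_on_bounded_linear: "bounded_linear L \<Longrightarrow> open S \<Longrightarrow> smooth_on S L"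
  by (auto simp: smooth_on_def intro: Ck_on_bounded_linear)

lemma smooth_on_id [smooth_intros]: "open S \<Longrightarrow> smooth_on S (\<lambda>x. x)"
  by (rule smooth_on_bounded_linear) auto

lemma smooth_on_add [smooth_intros]:
  "open S \<Longrightarrow> smooth_on S f \<Longrightarrow> smooth_on S g \<Longrightarrow> smooth_on S (\<lambda>x. f x + g x)"
  by (auto simp: smooth_on_def intro: Ck_on_add)

lemma smooth_on_bilinear:
  "bounded_bilinear p \<Longrightarrow> open S \<Longrightarrow> smooth_on S f \<Longrightarrow> smooth_on S g \<Longrightarrow> smooth_on S (\<lambda>x. p (f x) (g x))"
  by (auto simp: smooth_on_def intro: Ck_on_bilinear)

lemmas smooth_on_scaleR [smooth_intros] = smooth_on_bilinear[OF bounded_bilinear_scaleR]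
lemmas smooth_on_inner [smooth_intros] = smooth_on_bilinear[OF bounded_bilinear_inner]

lemma smooth_on_mult [smooth_intros]:
  fixes f g :: "'a::real_normed_vector \<Rightarrow> real"
  shows "open S \<Longrightarrow> smooth_on S f \<Longrightarrow> smooth_on S g \<Longrightarrow> smooth_on S (\<lambda>x. f x * g x)"
  by (rule smooth_on_bilinear[OF bounded_bilinear_mult])

lemma smooth_on_minus [smooth_intros]: "open S \<Longrightarrow> smooth_on S f \<Longrightarrow> smooth_on S (\<lambda>x. - f x)"
  by (rule smooth_on_linear_comp[OF bounded_linear_minus[OF bounded_linear_ident]])

lemma smooth_on_diff [smooth_intros]:
  "open S \<Longrightarrow> smooth_on S f \<Longrightarrow> smooth_on S g \<Longrightarrow> smooth_on S (\<lambda>x. f x - g x)"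
  using smooth_on_add[OF _ _ smooth_on_minus, of S f g] by simp

lemma smooth_on_power [smooth_intros]:
  fixes f :: "'a::real_normed_vector \<Rightarrow> real"
  shows "open S \<Longrightarrow> smooth_on S f \<Longrightarrow> smooth_on S (\<lambda>x. f x ^ n)"
  by (induction n) (auto intro: smooth_intros)

lemma smooth_on_sum [smooth_intros]:
  "open S \<Longrightarrow> (\<And>i. i \<in> A \<Longrightarrow> smooth_on S (f i)) \<Longrightarrow> smooth_on S (\<lambda>x. \<Sum>i\<in>A. f i x)"
  by (auto simp: smooth_on_def intro: Ck_on_sum)

lemma smooth_on_inverse [smooth_intros]:
  fixes f :: "'a::real_normed_vector \<Rightarrow> real"
  assumes "open S" "smooth_on S f" "\<And>x. x \<in> S \<Longrightarrow> f x \<noteq> 0"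
  shows "smooth_on S (\<lambda>x. inverse (f x))"
  by (rule smooth_on_compose[OF assms(1) _ assms(2), of "- {0}"])
    (use assms Ck_on_inverse_real in \<open>auto simp: smooth_on_def\<close>)

lemma smooth_on_divide [smooth_intros]:
  fixes f g :: "'a::real_normed_vector \<Rightarrow> real"
  assumes "open S" "smooth_on S f" "smooth_on S g" "\<And>x. x \<in> S \<Longrightarrow> g x \<noteq> 0"
  shows "smooth_on S (\<lambda>x. f x / g x)"
  unfolding divide_inverse by (intro smooth_intros assms)

lemma smooth_on_vec_nth [smooth_intros]:
  "open S \<Longrightarrow> smooth_on S f \<Longrightarrow> smooth_on S (\<lambda>x. f x $ i)"
  by (rule smooth_on_linear_comp[OF bounded_linear_vec_nth])

lemma smooth_on_vecI:
  fixes f :: "'a::real_normed_vector \<Rightarrow> real^'n::finite"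
  assumes "open S" "\<And>i. smooth_on S (\<lambda>x. f x $ i)"
  shows "smooth_on S f"
  by (rule smooth_on_euclidean) (use assms in \<open>auto simp: Basis_vec_def inner_axis\<close>)

lemma smooth_on_Pair [smooth_intros]:
  fixes f :: "'a::real_normed_vector \<Rightarrow> 'b::real_normed_vector" and g :: "'a \<Rightarrow> 'c::real_normed_vector"
  assumes "open S" "smooth_on S f" "smooth_on S g"
  shows "smooth_on S (\<lambda>x. (f x, g x))"
proof -
  have "bounded_linear (\<lambda>x. (x, 0::'c))" "bounded_linear (\<lambda>x. (0::'b, x))"
    by (auto intro!: bounded_linear_Pair bounded_linear_ident bounded_linear_zero)
  then have "smooth_on S (\<lambda>x. (f x, 0) + (0, g x))"
    by (intro smooth_on_add smooth_on_linear_comp[of "\<lambda>x. (x, 0::'c)"] smooth_on_linear_comp[of "\<lambda>x. (0::'b, x)"] assms) auto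
  then show ?thesis by simp
qed

lemma smooth_on_fst [smooth_intros]: "open S \<Longrightarrow> smooth_on S f \<Longrightarrow> smooth_on S (\<lambda>x. fst (f x))"
  by (rule smooth_on_linear_comp[OF bounded_linear_fst])

lemma smooth_on_snd [smooth_intros]: "open S \<Longrightarrow> smooth_on S f \<Longrightarrow> smooth_on S (\<lambda>x. snd (f x))"
  by (rule smooth_on_linear_comp[OF bounded_linear_snd])

lemma smooth_on_real_bootstrap:
  fixes f :: "real \<Rightarrow> real"
  assumes "open S" "open T" "f ` S \<subseteq> T" "smooth_on T h"
    and "\<And>x. x \<in> S \<Longrightarrow> (f has_real_derivative h (f x)) (at x)"
  shows "smooth_on S f"
  using Ck_on_real_bootstrap[OF assms(1-3) _ assms(5)] assms(4) by (simp add: smooth_on_def)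

lemma smooth_on_ln: "smooth_on {0<..} (ln :: real \<Rightarrow> real)"
  by (rule smooth_on_derivI[where f'="\<lambda>x v. inverse x * v"])
    (auto intro!: smooth_intros DERIV_ln[unfolded has_field_derivative_def])

lemma smooth_on_root3: "smooth_on (- {0}) (root 3)"
proof (rule smooth_on_real_bootstrap[where h="\<lambda>y. inverse (3 * y^2)" and T="- {0}"])
  show "smooth_on (- {0}) (\<lambda>y::real. inverse (3 * y\<^sup>2))"
    by (intro smooth_intros) auto
  show "(root 3 has_real_derivative inverse (3 * (root 3 x)\<^sup>2)) (at x)" if "x \<in> - {0}" for x
    using DERIV_odd_real_root[of 3 x] that by (simp add: power2_eq_square)
qed auto

lemma smooth_on_deriv:
  fixes f :: "real \<Rightarrow> real"
  assumes "open S" "smooth_on S f"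
  shows "smooth_on S (deriv f)"
    and "x \<in> S \<Longrightarrow> (f has_real_derivative deriv f x) (at x)"
proof -
  have D: "(f has_real_derivative deriv f x) (at x)" if "x \<in> S" for x
    using smooth_on_differentiable[OF assms(2,1) that]
    by (simp add: DERIV_deriv_iff_real_differentiable)
  then show "x \<in> S \<Longrightarrow> (f has_real_derivative deriv f x) (at x)" .
  have "frechet_derivative f (at x) 1 = deriv f x" if "x \<in> S" for x
    using frechet_derivative_at[OF D[OF that, unfolded has_field_derivative_def]]
    by (metis mult.right_neutral)
  then show "smooth_on S (deriv f)"
    using smooth_on_cong[OF assms(1) _ smooth_on_frechet_derivative[OF assms(2), of 1]] by auto
qed

lemma Ck_on_locally:
  assumes "\<And>x. x \<in> S \<Longrightarrow> \<exists>U. open U \<and> x \<in> U \<and> Ck_on k U f"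
  shows "Ck_on k S f"
  using assms
proof (induction k arbitrary: f)
  case 0
  show ?case unfolding Ck_on.simps
  proof (rule continuous_at_imp_continuous_on, rule ballI)
    fix x assume "x \<in> S"
    then obtain U where "open U" "x \<in> U" "continuous_on U f" using 0 by auto
    then show "isCont f x" by (simp add: continuous_on_eq_continuous_at)
  qed
next
  case (Suc k)
  have "f differentiable (at x)" if x: "x \<in> S" for x
  proof -
    obtain U where "open U" "x \<in> U" "f differentiable_on U" using Suc.prems[OF x] by auto
    then show ?thesis by (simp add: differentiable_on_eq_differentiable_at)
  qed
  moreover have "Ck_on k S (\<lambda>x. frechet_derivative f (at x) v)" for v
    by (rule Suc.IH) (use Suc.prems in fastforce)
  ultimately show ?case by (auto simp: differentiable_on_def differentiable_at_withinI)
qed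

lemma smooth_on_locally:
  assumes "\<And>x. x \<in> S \<Longrightarrow> \<exists>U. open U \<and> x \<in> U \<and> smooth_on U f"
  shows "smooth_on S f"
  unfolding smooth_on_def using assms
  by (intro allI Ck_on_locally) (auto simp: smooth_on_def)

section \<open>Symmetry of second derivatives\<close>

lemma second_difference_MVT:
  fixes f :: "'a::real_normed_vector \<Rightarrow> real"
  assumes conv: "\<And>a b. 0 \<le> a \<Longrightarrow> a \<le> h \<Longrightarrow> 0 \<le> b \<Longrightarrow> b \<le> h \<Longrightarrow> x + a *\<^sub>R v + b *\<^sub>R w \<in> S"
    and S: "open S" "Ck_on 2 S f" and h: "h > 0"
  shows "\<exists>a b. 0 < a \<and> a < h \<and> 0 < b \<and> b < h \<and>
    f (x + h *\<^sub>R v + h *\<^sub>R w) - f (x + h *\<^sub>R v) - f (x + h *\<^sub>R w) + f x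
      = h^2 * frechet_derivative (\<lambda>y. frechet_derivative f (at y) v) (at (x + a *\<^sub>R v + b *\<^sub>R w)) w"
proof -
  let ?D = "\<lambda>y. frechet_derivative f (at y) v"
  have S2: "Ck_on (Suc 1) S f" "Ck_on (Suc 0) S ?D"
    using S(2) by (simp_all add: numeral_2_eq_2)
  have D1: "((\<lambda>r. f (x + r *\<^sub>R v + b *\<^sub>R w)) has_real_derivative ?D (x + r *\<^sub>R v + b *\<^sub>R w)) (at r)"
    if "0 \<le> r" "r \<le> h" "0 \<le> b" "b \<le> h" for r b
  proof -
    have d: "(f has_derivative frechet_derivative f (at (x + r *\<^sub>R v + b *\<^sub>R w))) (at (x + r *\<^sub>R v + b *\<^sub>R w))"
      by (rule Ck_on_has_derivative[OF S2(1) S(1) conv[OF that]])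
    have l: "((\<lambda>r. x + r *\<^sub>R v + b *\<^sub>R w) has_derivative (\<lambda>s. s *\<^sub>R v)) (at r)"
      by (auto intro!: derivative_eq_intros)
    show ?thesis
      using diff_chain_at[OF l d] linear_cmul[OF has_derivative_linear[OF d]]
      by (simp add: o_def has_field_derivative_def mult.commute[of _ "?D _"])
  qed
  have D2: "((\<lambda>r. ?D (x + a *\<^sub>R v + r *\<^sub>R w)) has_real_derivative
      frechet_derivative ?D (at (x + a *\<^sub>R v + r *\<^sub>R w)) w) (at r)"
    if "0 \<le> r" "r \<le> h" "0 \<le> a" "a \<le> h" for r a
  proof -
    have d: "(?D has_derivative frechet_derivative ?D (at (x + a *\<^sub>R v + r *\<^sub>R w))) (at (x + a *\<^sub>R v + r *\<^sub>R w))"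
      by (rule Ck_on_has_derivative[OF S2(2) S(1) conv[OF that(3,4,1,2)]])
    have l: "((\<lambda>r. x + a *\<^sub>R v + r *\<^sub>R w) has_derivative (\<lambda>s. s *\<^sub>R w)) (at r)"
      by (auto intro!: derivative_eq_intros)
    show ?thesis
      using diff_chain_at[OF l d] linear_cmul[OF has_derivative_linear[OF d]]
      by (simp add: o_def has_field_derivative_def mult.commute[of _ "frechet_derivative ?D _ w"])
  qed
  \<comment> \<open>The first mean value step runs along \<open>v\<close>, for the function f(x + r
    v + h w) - f(x + r v) of \<open>r\<close>; the second one below runs along
    \<open>w\<close>.\<close>
  have "\<exists>a. 0 < a \<and> a < h \<and>
      (f (x + h *\<^sub>R v + h *\<^sub>R w) - f (x + h *\<^sub>R v + 0 *\<^sub>R w)) - (f (x + 0 *\<^sub>R v + h *\<^sub>R w) - f (x + 0 *\<^sub>R v + 0 *\<^sub>R w))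
      = (h - 0) * (?D (x + a *\<^sub>R v + h *\<^sub>R w) - ?D (x + a *\<^sub>R v + 0 *\<^sub>R w))"
    by (rule MVT2[OF h], rule DERIV_diff; rule D1) (use h in auto)
  then obtain a where a: "0 < a" "a < h" and
    eq1: "f (x + h *\<^sub>R v + h *\<^sub>R w) - f (x + h *\<^sub>R v) - f (x + h *\<^sub>R w) + f x
      = h * (?D (x + a *\<^sub>R v + h *\<^sub>R w) - ?D (x + a *\<^sub>R v + 0 *\<^sub>R w))" by auto
  have "\<exists>b. 0 < b \<and> b < h \<and> ?D (x + a *\<^sub>R v + h *\<^sub>R w) - ?D (x + a *\<^sub>R v + 0 *\<^sub>R w)
      = (h - 0) * frechet_derivative ?D (at (x + a *\<^sub>R v + b *\<^sub>R w)) w"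
    by (rule MVT2[OF h]) (use a in \<open>auto intro!: D2\<close>)
  then show ?thesis using a eq1 by (auto simp: power2_eq_square)
qed

lemma second_difference_limit:
  fixes f :: "'a::real_normed_vector \<Rightarrow> real"
  assumes S: "open S" "x \<in> S" "Ck_on 2 S f"
  shows "((\<lambda>h. (f (x + h *\<^sub>R v + h *\<^sub>R w) - f (x + h *\<^sub>R v) - f (x + h *\<^sub>R w) + f x) / h^2)
    \<longlongrightarrow> frechet_derivative (\<lambda>y. frechet_derivative f (at y) v) (at x) w) (at_right 0)"
proof (rule tendstoI)
  let ?DD = "\<lambda>y. frechet_derivative (\<lambda>y. frechet_derivative f (at y) v) (at y) w"
  fix e :: real assume e: "e > 0"
  have "continuous_on S ?DD" using S(3) by (auto simp: numeral_2_eq_2)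
  then have "isCont ?DD x" using S by (simp add: continuous_on_eq_continuous_at)
  then obtain d1 where d1: "d1 > 0" "\<And>y. dist y x < d1 \<Longrightarrow> dist (?DD y) (?DD x) < e"
    using e unfolding continuous_at_eps_delta by blast
  obtain d2 where d2: "d2 > 0" "ball x d2 \<subseteq> S" using S openE by blast
  define d where "d = min d1 d2"
  have d: "d > 0" using d1 d2 by (simp add: d_def)
  \<comment> \<open>\<open>near\<close> needs h (norm v + norm w) < d; the summand 1 keeps the
    denominator positive when both vectors vanish.\<close>
  define \<delta> where "\<delta> = d / (norm v + norm w + 1)"
  have \<delta>: "\<delta> > 0" using d by (simp add: \<delta>_def add_nonneg_pos)
  have near: "dist (x + a *\<^sub>R v + b *\<^sub>R w) x < d" if "0 \<le> a" "a \<le> h" "0 \<le> b" "b \<le> h" "h < \<delta>" for a b h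
  proof -
    have "norm (a *\<^sub>R v + b *\<^sub>R w) \<le> a * norm v + b * norm w"
      using norm_triangle_ineq[of "a *\<^sub>R v" "b *\<^sub>R w"] that by simp
    also have "\<dots> \<le> h * norm v + h * norm w"
      using that by (intro add_mono mult_right_mono) auto
    also have "\<dots> \<le> h * (norm v + norm w + 1)" using that by (simp add: algebra_simps)
    also have "\<dots> < d"
    proof -
      have "norm v + norm w + 1 > 0" by (simp add: add_nonneg_pos)
      then show ?thesis using that(5) by (simp add: \<delta>_def pos_less_divide_eq)
    qed
    finally show ?thesis by (simp add: dist_norm add.assoc)
  qed
  have "dist ((f (x + h *\<^sub>R v + h *\<^sub>R w) - f (x + h *\<^sub>R v) - f (x + h *\<^sub>R w) + f x) / h^2) (?DD x) < e"
    if h: "0 < h" "h < \<delta>" for h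
  proof -
    have "\<exists>a b. 0 < a \<and> a < h \<and> 0 < b \<and> b < h \<and>
      f (x + h *\<^sub>R v + h *\<^sub>R w) - f (x + h *\<^sub>R v) - f (x + h *\<^sub>R w) + f x = h^2 * ?DD (x + a *\<^sub>R v + b *\<^sub>R w)"
    proof (rule second_difference_MVT[OF _ S(1,3) h(1)])
      fix a b assume "0 \<le> a" "a \<le> h" "0 \<le> b" "b \<le> h"
      from near[OF this h(2)] have "x + a *\<^sub>R v + b *\<^sub>R w \<in> ball x d2"
        by (simp add: d_def dist_commute)
      then show "x + a *\<^sub>R v + b *\<^sub>R w \<in> S" using d2 by auto
    qed
    then obtain a b where ab: "0 < a" "a < h" "0 < b" "b < h" and
      eq: "f (x + h *\<^sub>R v + h *\<^sub>R w) - f (x + h *\<^sub>R v) - f (x + h *\<^sub>R w) + f x = h^2 * ?DD (x + a *\<^sub>R v + b *\<^sub>R w)"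
      by blast
    have "dist (x + a *\<^sub>R v + b *\<^sub>R w) x < d1" using near[of a h b] ab h by (simp add: d_def)
    then show ?thesis using d1(2) eq h(1) by simp
  qed
  then show "\<forall>\<^sub>F h in at_right 0. dist ((f (x + h *\<^sub>R v + h *\<^sub>R w) - f (x + h *\<^sub>R v) - f (x + h *\<^sub>R w) + f x) / h^2) (?DD x) < e"
    using \<delta> by (auto simp: eventually_at_right_field)
qed

text \<open>Both mixed derivatives are limits of the same second difference quotient, which does not
  change when \<open>v\<close> and \<open>w\<close> are exchanged.\<close>

lemma second_derivative_symmetric_real:
  fixes f :: "'a::real_normed_vector \<Rightarrow> real"
  assumes "open S" "x \<in> S" "Ck_on 2 S f"
  shows "frechet_derivative (\<lambda>y. frechet_derivative f (at y) v) (at x) w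
       = frechet_derivative (\<lambda>y. frechet_derivative f (at y) w) (at x) v"
proof -
  have "(\<lambda>h. (f (x + h *\<^sub>R w + h *\<^sub>R v) - f (x + h *\<^sub>R w) - f (x + h *\<^sub>R v) + f x) / h^2)
    = (\<lambda>h. (f (x + h *\<^sub>R v + h *\<^sub>R w) - f (x + h *\<^sub>R v) - f (x + h *\<^sub>R w) + f x) / h^2)"
    by (rule ext) (simp add: add.assoc add.commute[of "_ *\<^sub>R v"])
  with second_difference_limit[OF assms, of w v]
  have "((\<lambda>h. (f (x + h *\<^sub>R v + h *\<^sub>R w) - f (x + h *\<^sub>R v) - f (x + h *\<^sub>R w) + f x) / h^2)
    \<longlongrightarrow> frechet_derivative (\<lambda>y. frechet_derivative f (at y) w) (at x) v) (at_right 0)"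
    by (simp only:)
  with second_difference_limit[OF assms, of v w] show ?thesis
    by (rule tendsto_unique[OF trivial_limit_at_right_real])
qed

lemma frechet_derivative_linear_comp:
  assumes "bounded_linear L" "f differentiable (at x)"
  shows "frechet_derivative (\<lambda>y. L (f y)) (at x) = (\<lambda>v. L (frechet_derivative f (at x) v))"
  using frechet_derivative_at[OF bounded_linear.has_derivative[OF assms(1) assms(2)[unfolded frechet_derivative_works]]]
  by simp

lemma second_derivative_symmetric:
  fixes f :: "'a::real_normed_vector \<Rightarrow> 'b::real_inner"
  assumes S: "open S" "x \<in> S" "smooth_on S f"
  shows "frechet_derivative (\<lambda>y. frechet_derivative f (at y) v) (at x) w
       = frechet_derivative (\<lambda>y. frechet_derivative f (at y) w) (at x) v"
proof -
  have eq: "frechet_derivative (\<lambda>y. frechet_derivative f (at y) v) (at x) w \<bullet> b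
      = frechet_derivative (\<lambda>y. frechet_derivative (\<lambda>y. f y \<bullet> b) (at y) v) (at x) w" for b v w
  proof -
    have L: "bounded_linear (\<lambda>z. z \<bullet> b)" by (rule bounded_linear_inner_left)
    have "frechet_derivative (\<lambda>y. frechet_derivative (\<lambda>y. f y \<bullet> b) (at y) v) (at x)
        = frechet_derivative (\<lambda>y. frechet_derivative f (at y) v \<bullet> b) (at x)"
      using S smooth_on_differentiable[OF S(3,1)]
      by (intro frechet_derivative_cong_open[OF S(1,2)]) (simp add: frechet_derivative_linear_comp[OF L])
    then have "frechet_derivative (\<lambda>y. frechet_derivative (\<lambda>y. f y \<bullet> b) (at y) v) (at x) w
        = frechet_derivative (\<lambda>y. frechet_derivative f (at y) v) (at x) w \<bullet> b"
      using smooth_on_differentiable[OF smooth_on_frechet_derivative[OF S(3)] S(1,2)]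
      by (simp add: frechet_derivative_linear_comp[OF L])
    then show ?thesis by simp
  qed
  have "Ck_on 2 S (\<lambda>y. f y \<bullet> b)" for b
    using smooth_on_inner[OF S(1,3) smooth_on_const[OF S(1)]] by (simp add: smooth_on_def)
  then have "(frechet_derivative (\<lambda>y. frechet_derivative f (at y) v) (at x) w
       - frechet_derivative (\<lambda>y. frechet_derivative f (at y) w) (at x) v) \<bullet> b = 0" for b
    by (simp add: inner_diff_left eq second_derivative_symmetric_real[OF S(1,2)])
  then show ?thesis by (metis inner_eq_zero_iff right_minus_eq)
qed

section \<open>Coordinates on five-space\<close>

lemma exhaust_5: "i = 1 \<or> i = 2 \<or> i = 3 \<or> i = 4 \<or> i = (5 :: 5)"
proof (induct i)
  case (of_int z)
  then have "0 \<le> z" and "z < 5" by simp_all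
  \<comment> \<open>The case z = 0 becomes the alternative i = 5, since 5 = 0 in this type.\<close>
  then have "z = 0 \<or> z = 1 \<or> z = 2 \<or> z = 3 \<or> z = 4" by arith
  then show ?case by auto
qed

lemma forall_5: "(\<forall>i::5. P i) \<longleftrightarrow> P 1 \<and> P 2 \<and> P 3 \<and> P 4 \<and> P 5"
  by (metis exhaust_5)

lemma UNIV_5: "UNIV = {1, 2, 3, 4, 5 :: 5}"
  using exhaust_5 by auto

lemma vec5_eq_iff: "v = w \<longleftrightarrow> v$1 = w$1 \<and> v$2 = w$2 \<and> v$3 = w$3 \<and> v$4 = w$4 \<and> v$5 = w$5"
  for v w :: "'a^5"
  by (simp add: vec_eq_iff forall_5)

definition vec5 :: "'a \<Rightarrow> 'a \<Rightarrow> 'a \<Rightarrow> 'a \<Rightarrow> 'a \<Rightarrow> 'a^5" where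
  "vec5 a b c d e = (\<chi> i. if i = 1 then a else if i = 2 then b else if i = 3 then c
     else if i = 4 then d else e)"

lemma vec5_nth [simp]:
  "vec5 a b c d e $ 1 = a" "vec5 a b c d e $ 2 = b" "vec5 a b c d e $ 3 = c"
  "vec5 a b c d e $ 4 = d" "vec5 a b c d e $ 5 = e"
  by (simp_all add: vec5_def)

lemma smooth_on_vec5 [smooth_intros]:
  fixes a b c d e :: "'a::real_normed_vector \<Rightarrow> real"
  assumes "open S" "smooth_on S a" "smooth_on S b" "smooth_on S c" "smooth_on S d" "smooth_on S e"
  shows "smooth_on S (\<lambda>x. vec5 (a x) (b x) (c x) (d x) (e x))"
proof (rule smooth_on_vecI[OF assms(1)])
  show "smooth_on S (\<lambda>x. vec5 (a x) (b x) (c x) (d x) (e x) $ i)" for i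
    using exhaust_5[of i] assms by auto
qed

lemma has_derivative_vec_nth_iff:
  fixes f :: "'a::real_normed_vector \<Rightarrow> real^'n::finite"
  shows "(f has_derivative f') (at x) \<longleftrightarrow> (\<forall>i. ((\<lambda>x. f x $ i) has_derivative (\<lambda>h. f' h $ i)) (at x))"
  using has_derivative_componentwise_within[of f f' x UNIV]
  by (auto simp: Basis_vec_def inner_axis)

lemma has_derivative_vec5:
  fixes a b c d e :: "'a::real_normed_vector \<Rightarrow> real"
  assumes "(a has_derivative a') (at x)" "(b has_derivative b') (at x)" "(c has_derivative c') (at x)"
    "(d has_derivative d') (at x)" "(e has_derivative e') (at x)"
  shows "((\<lambda>x. vec5 (a x) (b x) (c x) (d x) (e x)) has_derivative
    (\<lambda>h. vec5 (a' h) (b' h) (c' h) (d' h) (e' h))) (at x)"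
  unfolding has_derivative_vec_nth_iff forall_5 using assms by simp

lemma has_derivative_vec_nth [derivative_intros]:
  "(f has_derivative f') F \<Longrightarrow> ((\<lambda>x. f x $ i) has_derivative (\<lambda>h. f' h $ i)) F"
  by (rule bounded_linear.has_derivative[OF bounded_linear_vec_nth])


section \<open>Lie derivatives of functions\<close>

definition lie_deriv :: "('n::finite) vfield \<Rightarrow> (real^'n \<Rightarrow> real) \<Rightarrow> real^'n \<Rightarrow> real" where
  "lie_deriv A f v = frechet_derivative f (at v) (A v)"

lemma lie_deriv_eq:
  assumes "(f has_derivative f') (at v)" shows "lie_deriv A f v = f' (A v)"
  using frechet_derivative_at[OF assms] by (simp add: lie_deriv_def)

lemma frechet_derivative_sum_basis:
  fixes f :: "real^'n::finite \<Rightarrow> real"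
  assumes "f differentiable (at v)"
  shows "frechet_derivative f (at v) w = (\<Sum>i\<in>UNIV. w $ i * frechet_derivative f (at v) (axis i 1))"
proof -
  have lin: "linear (frechet_derivative f (at v))"
    using assms by (simp add: linear_frechet_derivative)
  have "w = (\<Sum>i\<in>UNIV. w $ i *\<^sub>R axis i 1)"
    using basis_expansion[of w] by (simp add: scalar_mult_eq_scaleR)
  then have "frechet_derivative f (at v) w = frechet_derivative f (at v) (\<Sum>i\<in>UNIV. w $ i *\<^sub>R axis i 1)"
    by simp
  then show ?thesis by (simp add: linear_sum[OF lin] linear_cmul[OF lin])
qed

lemma smooth_on_lie_deriv:
  assumes U: "open U" and A: "smooth_on U A" and f: "smooth_on U f"
  shows "smooth_on U (lie_deriv A f)"
proof -
  have "smooth_on U (\<lambda>v. \<Sum>i\<in>UNIV. A v $ i * frechet_derivative f (at v) (axis i 1))"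
    by (intro smooth_intros U A smooth_on_frechet_derivative f)
  then show ?thesis
    by (rule smooth_on_cong[OF U, rotated])
      (simp add: lie_deriv_def frechet_derivative_sum_basis[OF smooth_on_differentiable[OF f U], symmetric])
qed

text \<open>The first term is the second derivative of \<open>f\<close> with the direction
  \<open>A v\<close> frozen at the point, the second comes from the variation of \<open>A\<close>.
  In coordinates \<open>lie_deriv A f\<close> is a sum of products, which the product rule
  differentiates.\<close>

lemma has_derivative_lie_deriv:
  assumes U: "open U" "v \<in> U" and A: "smooth_on U A" and f: "smooth_on U f"
  shows "(lie_deriv A f has_derivative (\<lambda>w. frechet_derivative (\<lambda>x. frechet_derivative f (at x) (A v)) (at v) w
    + frechet_derivative f (at v) (frechet_derivative A (at v) w))) (at v)"
proof -
  let ?D = "\<lambda>i x. frechet_derivative f (at x) (axis i 1)"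
  note df = smooth_on_differentiable[OF f U(1)]
  have dA: "(A has_derivative frechet_derivative A (at v)) (at v)"
    by (rule smooth_on_has_derivative[OF A U])
  have dD: "(?D i has_derivative frechet_derivative (?D i) (at v)) (at v)" for i
    by (rule smooth_on_has_derivative[OF smooth_on_frechet_derivative[OF f] U])
  have eq: "frechet_derivative (\<lambda>x. frechet_derivative f (at x) (A v)) (at v) w
      = (\<Sum>i\<in>UNIV. A v $ i * frechet_derivative (?D i) (at v) w)" for w
  proof -
    have "frechet_derivative (\<lambda>x. frechet_derivative f (at x) (A v)) (at v)
        = frechet_derivative (\<lambda>x. \<Sum>i\<in>UNIV. A v $ i * ?D i x) (at v)"
      by (rule frechet_derivative_cong_open[OF U]) (simp add: frechet_derivative_sum_basis[OF df, symmetric])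
    moreover have "((\<lambda>x. \<Sum>i\<in>UNIV. A v $ i * ?D i x) has_derivative
        (\<lambda>w. \<Sum>i\<in>UNIV. A v $ i * frechet_derivative (?D i) (at v) w)) (at v)"
      by (intro has_derivative_sum has_derivative_mult_right dD)
    ultimately show ?thesis by (simp add: frechet_derivative_at[symmetric])
  qed
  have "((\<lambda>x. \<Sum>i\<in>UNIV. A x $ i * ?D i x) has_derivative
      (\<lambda>w. \<Sum>i\<in>UNIV. A v $ i * frechet_derivative (?D i) (at v) w
         + frechet_derivative A (at v) w $ i * ?D i v)) (at v)"
    by (intro has_derivative_sum has_derivative_mult dD has_derivative_vec_nth dA)
  then have "((\<lambda>x. \<Sum>i\<in>UNIV. A x $ i * ?D i x) has_derivative
      (\<lambda>w. frechet_derivative (\<lambda>x. frechet_derivative f (at x) (A v)) (at v) w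
    + frechet_derivative f (at v) (frechet_derivative A (at v) w))) (at v)"
    by (simp add: sum.distrib eq frechet_derivative_sum_basis[OF df[OF U(2)], of "frechet_derivative A (at v) _", symmetric])
  then show ?thesis
    by (rule has_derivative_transform_within_open[OF _ U])
      (simp add: lie_deriv_def frechet_derivative_sum_basis[OF df, symmetric])
qed

text \<open>The terms with second derivatives of \<open>f\<close> cancel by symmetry; the terms with
  derivatives of the fields form the bracket.\<close>

lemma lie_deriv_commutator:
  assumes U: "open U" "v \<in> U" and A: "smooth_on U A" "smooth_on U B" and f: "smooth_on U f"
  shows "lie_deriv A (lie_deriv B f) v - lie_deriv B (lie_deriv A f) v
    = frechet_derivative f (at v) (vf_bracket A B v)"
proof -
  have "linear (frechet_derivative f (at v))"
    using smooth_on_differentiable[OF f U] by (simp add: linear_frechet_derivative)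
  then show ?thesis
    using lie_deriv_eq[OF has_derivative_lie_deriv[OF U A(2) f], of A]
      lie_deriv_eq[OF has_derivative_lie_deriv[OF U A(1) f], of B]
      second_derivative_symmetric[OF U f, of "A v" "B v"]
    by (simp add: vf_bracket_def linear_diff)
qed

lemma lie_deriv_lincomb:
  assumes U: "open U" "v \<in> U" and "smooth_on U f" "smooth_on U h"
    and eq: "\<And>v. v \<in> U \<Longrightarrow> k v = a * f v + b * h v"
  shows "lie_deriv A k v = a * lie_deriv A f v + b * lie_deriv A h v"
proof -
  have d: "((\<lambda>v. a * f v + b * h v) has_derivative
      (\<lambda>w. a * frechet_derivative f (at v) w + b * frechet_derivative h (at v) w)) (at v)"
    by (intro has_derivative_add has_derivative_mult_right smooth_on_has_derivative[OF _ U] assms)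
  have "frechet_derivative k (at v) = frechet_derivative (\<lambda>v. a * f v + b * h v) (at v)"
    by (rule frechet_derivative_cong_open[OF U eq])
  then show ?thesis by (simp add: lie_deriv_def frechet_derivative_at[OF d, symmetric])
qed


section \<open>The flat model and its infinitesimal symmetries\<close>

text \<open>In the chart \<open>null_pt\<close> of the null quadric defined below, \<open>w\<close> lies in \<open>flat_dist v\<close> iff the
  octonion product of \<open>null_pt v\<close> with its derivative along \<open>w\<close> vanishes.  The frame starts with two
  sections of the distribution and is closed under brackets up to constant factors.\<close>

definition flat_dist :: "5 dist" where
  "flat_dist v = {w. w$3 = v$2 * w$1 - v$1 * w$2 \<and> w$4 = v$3 * w$2 - v$2 * w$3
     \<and> w$5 = v$1 * w$3 - v$3 * w$1}"

definition e1 :: "5 vfield" where "e1 v = vec5 1 0 (v$2) (- ((v$2)^2)) (v$1 * v$2 - v$3)"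
definition e2 :: "5 vfield" where "e2 v = vec5 0 1 (- v$1) (v$3 + v$1 * v$2) (- ((v$1)^2))"
definition e3 :: "5 vfield" where "e3 v = vec5 0 0 1 (- 2 * v$2) (2 * v$1)"
definition e4 :: "5 vfield" where "e4 v = vec5 0 0 0 1 0"
definition e5 :: "5 vfield" where "e5 v = vec5 0 0 0 0 1"

lemma smooth_frame: "open U \<Longrightarrow> smooth_on U e1" "open U \<Longrightarrow> smooth_on U e2" "open U \<Longrightarrow> smooth_on U e3"
  "open U \<Longrightarrow> smooth_on U e4" "open U \<Longrightarrow> smooth_on U e5"
  unfolding e1_def e2_def e3_def e4_def e5_def by (intro smooth_intros; assumption)+

lemma has_derivative_frame:
  "(e1 has_derivative (\<lambda>h. vec5 0 0 (h$2) (- 2 * v$2 * h$2) (v$1 * h$2 + h$1 * v$2 - h$3))) (at v)"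
  "(e2 has_derivative (\<lambda>h. vec5 0 0 (- h$1) (h$3 + v$1 * h$2 + h$1 * v$2) (- 2 * v$1 * h$1))) (at v)"
  "(e3 has_derivative (\<lambda>h. vec5 0 0 0 (- 2 * h$2) (2 * h$1))) (at v)"
  "(e4 has_derivative (\<lambda>h. 0)) (at v)"
  "(e5 has_derivative (\<lambda>h. 0)) (at v)"
  unfolding e1_def e2_def e3_def e4_def e5_def
  by (rule has_derivative_eq_rhs, rule has_derivative_vec5, (rule derivative_intros)+, force simp: fun_eq_iff vec5_eq_iff)+

lemmas frame_derivative = has_derivative_frame[THEN frechet_derivative_at, symmetric]

lemma frame_brackets:
  "vf_bracket e1 e2 v = -2 *\<^sub>R e3 v" "vf_bracket e1 e3 v = 3 *\<^sub>R e5 v" "vf_bracket e2 e3 v = -3 *\<^sub>R e4 v"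
  "vf_bracket e4 e1 v = 0" "vf_bracket e4 e2 v = 0" "vf_bracket e5 e1 v = 0" "vf_bracket e5 e2 v = 0"
  unfolding vf_bracket_def frame_derivative
  by (simp_all add: vec5_eq_iff e1_def e2_def e3_def e4_def e5_def power2_eq_square)

lemma flat_commutators:
  assumes U: "open U" "v \<in> U" and f: "smooth_on U f"
  shows "lie_deriv e1 (lie_deriv e2 f) v - lie_deriv e2 (lie_deriv e1 f) v = -2 * lie_deriv e3 f v"
    "lie_deriv e1 (lie_deriv e3 f) v - lie_deriv e3 (lie_deriv e1 f) v = 3 * lie_deriv e5 f v"
    "lie_deriv e2 (lie_deriv e3 f) v - lie_deriv e3 (lie_deriv e2 f) v = -3 * lie_deriv e4 f v"
    "lie_deriv e4 (lie_deriv e1 f) v = lie_deriv e1 (lie_deriv e4 f) v"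
    "lie_deriv e4 (lie_deriv e2 f) v = lie_deriv e2 (lie_deriv e4 f) v"
    "lie_deriv e5 (lie_deriv e1 f) v = lie_deriv e1 (lie_deriv e5 f) v"
    "lie_deriv e5 (lie_deriv e2 f) v = lie_deriv e2 (lie_deriv e5 f) v"
proof -
  have lin: "linear (frechet_derivative f (at v))"
    using smooth_on_differentiable[OF f U] by (simp add: linear_frechet_derivative)
  note c = lie_deriv_commutator[OF U _ _ f] and s = smooth_frame[OF U(1)]
  show "lie_deriv e1 (lie_deriv e2 f) v - lie_deriv e2 (lie_deriv e1 f) v = -2 * lie_deriv e3 f v"
    using c[OF s(1,2)] by (simp only: frame_brackets linear_cmul[OF lin]) (simp add: lie_deriv_def)
  show "lie_deriv e1 (lie_deriv e3 f) v - lie_deriv e3 (lie_deriv e1 f) v = 3 * lie_deriv e5 f v"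
    using c[OF s(1,3)] by (simp only: frame_brackets linear_cmul[OF lin]) (simp add: lie_deriv_def)
  show "lie_deriv e2 (lie_deriv e3 f) v - lie_deriv e3 (lie_deriv e2 f) v = -3 * lie_deriv e4 f v"
    using c[OF s(2,3)] by (simp only: frame_brackets linear_cmul[OF lin]) (simp add: lie_deriv_def)
  show "lie_deriv e4 (lie_deriv e1 f) v = lie_deriv e1 (lie_deriv e4 f) v"
    "lie_deriv e4 (lie_deriv e2 f) v = lie_deriv e2 (lie_deriv e4 f) v"
    "lie_deriv e5 (lie_deriv e1 f) v = lie_deriv e1 (lie_deriv e5 f) v"
    "lie_deriv e5 (lie_deriv e2 f) v = lie_deriv e2 (lie_deriv e5 f) v"
    using c[OF s(4,1)] c[OF s(4,2)] c[OF s(5,1)] c[OF s(5,2)]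
    by (simp_all add: frame_brackets linear_0[OF lin])
qed

text \<open>The fields \<open>e1\<close> and \<open>e2\<close> generate all directions by brackets:
  the commutators show that \<open>e3\<close>, and then \<open>e4\<close> and \<open>e5\<close>,
  annihilate \<open>f\<close> as well.\<close>

lemma flat_constant:
  assumes U: "open U" "connected U" and f: "smooth_on U f"
    and L: "\<And>v. v \<in> U \<Longrightarrow> lie_deriv e1 f v = 0" "\<And>v. v \<in> U \<Longrightarrow> lie_deriv e2 f v = 0"
  shows "\<exists>c. \<forall>v\<in>U. f v = c"
proof -
  note s = smooth_frame[OF U(1)]
  have zero: "lie_deriv A h v = 0" if "v \<in> U" "\<And>v. v \<in> U \<Longrightarrow> h v = 0" for A h v
    using lie_deriv_lincomb[OF U(1) that(1) f f, of h 0 0 A] that(2) by simp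
  have L3: "lie_deriv e3 f v = 0" if "v \<in> U" for v
    using flat_commutators(1)[OF U(1) that f] zero[OF that] L by simp
  have L45: "lie_deriv e4 f v = 0" "lie_deriv e5 f v = 0" if "v \<in> U" for v
    using flat_commutators(2,3)[OF U(1) that f] zero[OF that] L L3 by simp_all
  have "(f has_derivative (\<lambda>h. 0)) (at v)" if v: "v \<in> U" for v
  proof -
    have d: "(f has_derivative frechet_derivative f (at v)) (at v)"
      by (rule smooth_on_has_derivative[OF f U(1) v])
    have lin: "linear (frechet_derivative f (at v))" using d has_derivative_linear by blast
    have "frechet_derivative f (at v) w = 0" for w
    proof -
      \<comment> \<open>The \<open>e3\<close> coefficient of \<open>w\<close>: what is left of its
        third coordinate after the \<open>e1\<close> and \<open>e2\<close> parts. The coefficients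
        of \<open>e4\<close> and \<open>e5\<close> arise in the same way.\<close>
      define c where "c = w$3 - v$2 * w$1 + v$1 * w$2"
      have "w = w$1 *\<^sub>R e1 v + w$2 *\<^sub>R e2 v + c *\<^sub>R e3 v
        + (w$4 + (v$2)^2 * w$1 - (v$3 + v$1 * v$2) * w$2 + 2 * v$2 * c) *\<^sub>R e4 v
        + (w$5 - (v$1 * v$2 - v$3) * w$1 + (v$1)^2 * w$2 - 2 * v$1 * c) *\<^sub>R e5 v"
        by (simp add: vec5_eq_iff e1_def e2_def e3_def e4_def e5_def c_def algebra_simps)
      then have "frechet_derivative f (at v) w = frechet_derivative f (at v) (w$1 *\<^sub>R e1 v + w$2 *\<^sub>R e2 v + c *\<^sub>R e3 v
        + (w$4 + (v$2)^2 * w$1 - (v$3 + v$1 * v$2) * w$2 + 2 * v$2 * c) *\<^sub>R e4 v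
        + (w$5 - (v$1 * v$2 - v$3) * w$1 + (v$1)^2 * w$2 - 2 * v$1 * c) *\<^sub>R e5 v)" by simp
      also have "\<dots> = 0"
        unfolding linear_add[OF lin] linear_cmul[OF lin]
        using L[OF v] L3[OF v] L45[OF v] by (simp add: lie_deriv_def)
      finally show ?thesis .
    qed
    then have "frechet_derivative f (at v) = (\<lambda>h. 0)" by auto
    then show ?thesis using d by simp
  qed
  then have "f v = f w" if "v \<in> U" "w \<in> U" for v w
    using has_derivative_zero_unique_connected[OF U _ that] by blast
  then show ?thesis by (metis (no_types))
qed

text \<open>By \<open>flat_constant\<close>, \<open>h\<close> is known up to a constant from its
  derivatives along \<open>e1\<close> and \<open>e2\<close>, so a guess \<open>p\<close> only has to
  be differentiated. The premise \<open>that\<close> precedes those on \<open>p\<close> so that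
  resolving it first instantiates \<open>p\<close> and \<open>k\<close>.\<close>

lemma flat_integrate:
  assumes U: "open U" "connected U" and h: "smooth_on U h"
    and that: "\<And>c. \<forall>v\<in>U. h v = p v + k * c \<Longrightarrow> thesis"
    and p: "smooth_on U p" "\<And>v. (p has_derivative p' v) (at v)"
      "\<And>v. v \<in> U \<Longrightarrow> p' v (e1 v) = lie_deriv e1 h v" "\<And>v. v \<in> U \<Longrightarrow> p' v (e2 v) = lie_deriv e2 h v"
    and k: "k \<noteq> 0"
  shows thesis
proof -
  have "lie_deriv A (\<lambda>v. h v - p v) v = lie_deriv A h v - p' v (A v)" if "v \<in> U" for A v
    using lie_deriv_lincomb[OF U(1) that h p(1), of "\<lambda>v. h v - p v" 1 "-1" A] lie_deriv_eq[OF p(2)] by simp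
  then have "\<exists>c. \<forall>v\<in>U. h v - p v = c"
    by (intro flat_constant[OF U] smooth_on_diff U h p) (simp_all add: p)
  then obtain c where c: "\<forall>v\<in>U. h v - p v = c" by blast
  show thesis by (rule that[of "c / k"]) (use c k in \<open>auto simp: algebra_simps\<close>)
qed

text \<open>For an infinitesimal symmetry \<open>f1 e1 + f2 e2 + g e3 + phi e4 + psi e5\<close> of the flat model the
  equations below say that its brackets with \<open>e1\<close> and \<open>e2\<close> lie in the distribution.\<close>

locale flat_system =
  fixes U :: "(real^5) set" and phi psi g f1 f2 :: "real^5 \<Rightarrow> real"
  assumes U: "open U"
    and smooth_phi: "smooth_on U phi" and smooth_psi: "smooth_on U psi" and smooth_g: "smooth_on U g"
    and smooth_f1: "smooth_on U f1" and smooth_f2: "smooth_on U f2"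
    and L1phi: "v \<in> U \<Longrightarrow> lie_deriv e1 phi v = 0" and L2phi: "v \<in> U \<Longrightarrow> lie_deriv e2 phi v = 3 * g v"
    and L1psi: "v \<in> U \<Longrightarrow> lie_deriv e1 psi v = -3 * g v" and L2psi: "v \<in> U \<Longrightarrow> lie_deriv e2 psi v = 0"
    and L1g: "v \<in> U \<Longrightarrow> lie_deriv e1 g v = 2 * f2 v" and L2g: "v \<in> U \<Longrightarrow> lie_deriv e2 g v = -2 * f1 v"
begin

text \<open>Prolongation: derivatives of the unknowns become new unknowns, and the commutators of
  the frame express the \<open>e1\<close> and \<open>e2\<close> derivatives of each by later ones,
  until those of \<open>oc\<close> turn out to be constant. The stages phi and psi, g, f, m, n, oc
  and the derivatives of \<open>oc\<close> have 2, 1, 2, 4, 2, 1 and 2 members, the dimensions of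
  the grading of g2 that belongs to (2,3,5)-distributions.\<close>

definition "m11 = lie_deriv e1 f1"
definition "m12 = lie_deriv e2 f1"
definition "m21 = lie_deriv e1 f2"
definition "m22 = lie_deriv e2 f2"
definition "n1 = lie_deriv e5 g"
definition "n2 = lie_deriv e4 g"
definition "oc = lie_deriv e2 n1"

lemmas smooth_L =
  smooth_on_lie_deriv[OF U smooth_frame(1)[OF U]] smooth_on_lie_deriv[OF U smooth_frame(2)[OF U]]
  smooth_on_lie_deriv[OF U smooth_frame(3)[OF U]] smooth_on_lie_deriv[OF U smooth_frame(4)[OF U]]
  smooth_on_lie_deriv[OF U smooth_frame(5)[OF U]]

lemma smooth_m11: "smooth_on U m11" and smooth_m12: "smooth_on U m12"
  and smooth_m21: "smooth_on U m21" and smooth_m22: "smooth_on U m22"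
  and smooth_n1: "smooth_on U n1" and smooth_n2: "smooth_on U n2" and smooth_oc: "smooth_on U oc"
  by (simp_all add: m11_def m12_def m21_def m22_def n1_def n2_def oc_def smooth_L
      smooth_f1 smooth_f2 smooth_g)

lemma L_lin:
  assumes "\<And>v. v \<in> U \<Longrightarrow> k v = a * f v + b * h v" "smooth_on U f" "smooth_on U h" "v \<in> U"
  shows "lie_deriv A k v = a * lie_deriv A f v + b * lie_deriv A h v"
  using lie_deriv_lincomb[OF U assms(4,2,3,1)] .

lemma L_mult:
  assumes "\<And>v. v \<in> U \<Longrightarrow> k v = a * f v" "smooth_on U f" "v \<in> U"
  shows "lie_deriv A k v = a * lie_deriv A f v"
  using L_lin[of k a f 0 f] assms by simp

lemma L_zero:
  assumes "\<And>v. v \<in> U \<Longrightarrow> k v = 0" "v \<in> U"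
  shows "lie_deriv A k v = 0"
  using L_mult[of k 0 g] assms smooth_g by simp

context fixes v assumes v: "v \<in> U" begin

lemmas comm = flat_commutators[OF U v]

lemma L3g: "lie_deriv e3 g v = m11 v + m22 v"
  using comm(1)[OF smooth_g] L_mult[OF L2g smooth_f1 v] L_mult[OF L1g smooth_f2 v]
  by (simp add: m11_def m22_def)

lemma L3phi: "lie_deriv e3 phi v = -3 * f2 v"
  using comm(1)[OF smooth_phi] L_mult[OF L2phi smooth_g v] L_zero[OF L1phi v] L1g[OF v] by simp

lemma L3psi: "lie_deriv e3 psi v = 3 * f1 v"
  using comm(1)[OF smooth_psi] L_mult[OF L1psi smooth_g v] L_zero[OF L2psi v] L2g[OF v] by simp

end

text \<open>Commutators with \<open>e3\<close> applied to \<open>phi\<close> and \<open>psi\<close>.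
  The factors 1 give the right-hand sides the shape expected by \<open>L_lin\<close>.\<close>

lemma L45:
  assumes v: "v \<in> U"
  shows L5phi: "lie_deriv e5 phi v = - m21 v" and L4phi: "lie_deriv e4 phi v = 1 * m11 v + 2 * m22 v"
    and L5psi: "lie_deriv e5 psi v = 2 * m11 v + 1 * m22 v" and L4psi: "lie_deriv e4 psi v = - m12 v"
  using comm(2,3)[OF v smooth_phi] comm(2,3)[OF v smooth_psi]
    L_mult[OF L3phi smooth_f2 v] L_mult[OF L3psi smooth_f1 v]
    L_zero[OF L1phi v] L_zero[OF L2psi v] L_mult[OF L2phi smooth_g v] L_mult[OF L1psi smooth_g v] L3g[OF v]
  by (simp_all add: m11_def m12_def m21_def m22_def)

text \<open>Since \<open>e4\<close> and \<open>e5\<close> commute with \<open>e1\<close> and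
  \<open>e2\<close>, differentiating the formulas of \<open>L45\<close> yields eight linear
  equations, which determine the eight derivatives.\<close>

lemma L_m:
  assumes v: "v \<in> U"
  shows L1m11: "lie_deriv e1 m11 v = -2 * n1 v" and L1m12: "lie_deriv e1 m12 v = 3 * n2 v"
    and L1m21: "lie_deriv e1 m21 v = 0" and L1m22: "lie_deriv e1 m22 v = n1 v"
    and L2m11: "lie_deriv e2 m11 v = - n2 v" and L2m12: "lie_deriv e2 m12 v = 0"
    and L2m21: "lie_deriv e2 m21 v = -3 * n1 v" and L2m22: "lie_deriv e2 m22 v = 2 * n2 v"
proof -
  have k: "lie_deriv e5 phi v = -1 * m21 v" "lie_deriv e4 psi v = -1 * m12 v" if "v \<in> U" for v
    using L5phi[OF that] L4psi[OF that] by simp_all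
  note a = L_mult[OF k(1) smooth_m21 v] L_mult[OF k(2) smooth_m12 v]
    L_lin[OF L4phi smooth_m11 smooth_m22 v] L_lin[OF L5psi smooth_m11 smooth_m22 v]
  show "lie_deriv e1 m11 v = -2 * n1 v" "lie_deriv e1 m12 v = 3 * n2 v"
    "lie_deriv e1 m21 v = 0" "lie_deriv e1 m22 v = n1 v"
    "lie_deriv e2 m11 v = - n2 v" "lie_deriv e2 m12 v = 0"
    "lie_deriv e2 m21 v = -3 * n1 v" "lie_deriv e2 m22 v = 2 * n2 v"
    using comm(4-7)[OF v smooth_phi] comm(4-7)[OF v smooth_psi] a
      L_zero[OF L1phi v] L_zero[OF L2psi v] L_mult[OF L2phi smooth_g v] L_mult[OF L1psi smooth_g v]
    by (simp_all add: n1_def n2_def)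
qed

lemma L3f:
  assumes v: "v \<in> U"
  shows L3f1: "lie_deriv e3 f1 v = -2 * n2 v" and L3f2: "lie_deriv e3 f2 v = -2 * n1 v"
  using comm(1)[OF v smooth_f1] comm(1)[OF v smooth_f2] L_m[OF v]
  by (simp_all add: m11_def m12_def m21_def m22_def)

lemma L45f:
  assumes v: "v \<in> U"
  shows "-2 * lie_deriv e5 f1 v = lie_deriv e2 n1 v" "2 * lie_deriv e5 f2 v = lie_deriv e1 n1 v"
    "-2 * lie_deriv e4 f1 v = lie_deriv e2 n2 v" "2 * lie_deriv e4 f2 v = lie_deriv e1 n2 v"
  using comm(4-7)[OF v smooth_g] L_mult[OF L2g smooth_f1 v] L_mult[OF L1g smooth_f2 v]
  by (simp_all add: n1_def n2_def)

text \<open>The derivatives of \<open>f1\<close> and \<open>f2\<close> along \<open>e4\<close> and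
  \<open>e5\<close> are available in two ways: from the commutators with \<open>e3\<close> and
  \<open>L3f\<close>, and from \<open>L45f\<close>. Comparing them leaves a single free quantity,
  \<open>oc\<close>.\<close>

lemma L_n:
  assumes v: "v \<in> U"
  shows L1n1: "lie_deriv e1 n1 v = 0" and L2n1: "lie_deriv e2 n1 v = oc v"
    and L1n2: "lie_deriv e1 n2 v = oc v" and L2n2: "lie_deriv e2 n2 v = 0"
proof -
  have k: "lie_deriv e2 m11 v = -1 * n2 v" if "v \<in> U" for v using L2m11[OF that] by simp
  note c = comm(2,3)[OF v smooth_f1] comm(2,3)[OF v smooth_f2]
    L_mult[OF L3f1 smooth_n2 v] L_mult[OF L3f2 smooth_n1 v]
    comm(1)[OF v smooth_m11] comm(1)[OF v smooth_m21] comm(1)[OF v smooth_m12]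
    L_mult[OF L1m11 smooth_n1 v] L_mult[OF k smooth_n2 v] L_mult[OF L2m21 smooth_n1 v]
    L_zero[OF L1m21 v] L_zero[OF L2m12 v] L_mult[OF L1m12 smooth_n2 v] L45f[OF v]
  show "lie_deriv e1 n1 v = 0" "lie_deriv e2 n1 v = oc v" "lie_deriv e1 n2 v = oc v" "lie_deriv e2 n2 v = 0"
    using c by (simp_all add: m11_def[symmetric] m12_def[symmetric] m21_def[symmetric] m22_def[symmetric] oc_def)
qed

lemma L45f':
  assumes v: "v \<in> U"
  shows "lie_deriv e5 f1 v = -1/2 * oc v" "lie_deriv e5 f2 v = 0" "lie_deriv e4 f1 v = 0" "lie_deriv e4 f2 v = 1/2 * oc v"
  using L45f[OF v] L_n[OF v] by simp_all

lemma L45m: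
  assumes v: "v \<in> U"
  shows "lie_deriv e5 m22 v = 0" "lie_deriv e5 m11 v = -1/2 * lie_deriv e1 oc v"
    "lie_deriv e4 m22 v = 1/2 * lie_deriv e2 oc v" "lie_deriv e4 m11 v = 0"
  using comm(4-7)[OF v smooth_f1] comm(4-7)[OF v smooth_f2]
    L_mult[OF L45f'(1) smooth_oc v] L_zero[OF L45f'(2) v] L_zero[OF L45f'(3) v] L_mult[OF L45f'(4) smooth_oc v]
  by (simp_all add: m11_def m22_def)

text \<open>Closing the prolongation: the commutators on \<open>m11\<close>, \<open>m22\<close>,
  \<open>n1\<close>, \<open>n2\<close> and \<open>oc\<close> give a homogeneous linear system that
  forces the second derivatives of \<open>oc\<close> to vanish.\<close>

lemma L_oc:
  assumes v: "v \<in> U"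
  shows "lie_deriv e1 (lie_deriv e1 oc) v = 0" "lie_deriv e2 (lie_deriv e1 oc) v = 0"
    "lie_deriv e1 (lie_deriv e2 oc) v = 0" "lie_deriv e2 (lie_deriv e2 oc) v = 0"
proof -
  have k: "lie_deriv e2 m11 v = -1 * n2 v" "lie_deriv e1 m22 v = 1 * n1 v"
    "lie_deriv e2 n1 v = 1 * oc v" "lie_deriv e1 n2 v = 1 * oc v" if "v \<in> U" for v
    using L2m11[OF that] L1m22[OF that] L_n[OF that] by simp_all
  have L3n: "lie_deriv e3 n1 v = -1/2 * lie_deriv e1 oc v" "lie_deriv e3 n2 v = 1/2 * lie_deriv e2 oc v"
    if v: "v \<in> U" for v
    using comm(1)[OF v smooth_n1] comm(1)[OF v smooth_n2]
      L_zero[OF L1n1 v] L_zero[OF L2n2 v] L_mult[OF k(3) smooth_oc v] L_mult[OF k(4) smooth_oc v] by simp_all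
  note s1 = smooth_L(1)[OF smooth_oc] and s2 = smooth_L(2)[OF smooth_oc]
  note c = comm(4-7)[OF v smooth_m11] comm(4-7)[OF v smooth_m22]
    comm(2,3)[OF v smooth_n1] comm(2,3)[OF v smooth_n2] comm(1)[OF v smooth_oc]
    L_zero[OF L45m(1) v] L_mult[OF L45m(2) s1 v] L_mult[OF L45m(3) s2 v] L_zero[OF L45m(4) v]
    L_mult[OF L1m11 smooth_n1 v] L_mult[OF k(2) smooth_n1 v] L_mult[OF k(1) smooth_n2 v] L_mult[OF L2m22 smooth_n2 v]
    L_mult[OF L3n(1) s1 v] L_mult[OF L3n(2) s2 v] L_zero[OF L1n1 v] L_zero[OF L2n2 v]
    L_mult[OF k(3) smooth_oc v] L_mult[OF k(4) smooth_oc v]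
  show "lie_deriv e1 (lie_deriv e1 oc) v = 0" "lie_deriv e2 (lie_deriv e1 oc) v = 0"
    "lie_deriv e1 (lie_deriv e2 oc) v = 0" "lie_deriv e2 (lie_deriv e2 oc) v = 0"
    using c by (simp_all)
qed

text \<open>Integrates the prolonged chain backwards, from \<open>oc\<close> to \<open>phi\<close>
  and \<open>psi\<close>; the stages contribute 2 + 1 + 2 + 4 + 2 + 1 + 2 constants. Names, factors
  and signs anticipate \<open>zorn_der\<close>: \<open>p1\<close> to \<open>p3\<close> and
  \<open>r1\<close> to \<open>r3\<close> are its two vectors, \<open>a12\<close> to
  \<open>a33\<close> its matrix entries.\<close>

lemma solution:
  assumes conn: "connected U"
  obtains p1 p2 p3 r1 r2 r3 a12 a13 a21 a22 a23 a31 a32 a33 :: real where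
    "\<And>v. v \<in> U \<Longrightarrow> f1 v = -1 * v$1 * v$2 * r2 - 2 * v$1 * v$3 * p1 - v$1 * a13 * v$5 + v$1 * a33 + (v$1)^2 * r3 + v$2 * a12 * v$5 - v$2 * a32 + 2 * v$3 * r2 + (v$3)^2 * a12 - p1 * v$5 + p3"
    "\<And>v. v \<in> U \<Longrightarrow> f2 v = v$1 * v$2 * r3 + v$1 * a13 * v$4 - v$1 * a23 - 2 * v$2 * v$3 * p1 - v$2 * a12 * v$4 + v$2 * a22 - (v$2)^2 * r2 + 2 * v$3 * r3 + (v$3)^2 * a13 + p1 * v$4 - p2"
    "\<And>v. v \<in> U \<Longrightarrow> g v = -1 * v$1 * v$2 * a12 * v$4 + v$1 * v$2 * a13 * v$5 + v$1 * v$2 * a22 - v$1 * v$2 * a33 + 3 * v$1 * v$3 * r3 + v$1 * (v$3)^2 * a13 + 2 * v$1 * p1 * v$4 - 2 * v$1 * p2 + (v$1)^2 * a13 * v$4 - (v$1)^2 * a23 - 3 * v$2 * v$3 * r2 - v$2 * (v$3)^2 * a12 + 2 * v$2 * p1 * v$5 - 2 * v$2 * p3 - (v$2)^2 * a12 * v$5 + (v$2)^2 * a32 - v$3 * a12 * v$4 - v$3 * a13 * v$5 + v$3 * a22 + v$3 * a33 - (v$3)^2 * p1 - r1 - r2 * v$4 - r3 * v$5"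
    "\<And>v. v \<in> U \<Longrightarrow> phi v = 3 * v$1 * v$2 * v$3 * r3 + v$1 * v$2 * (v$3)^2 * a13 + 3 * v$1 * v$2 * p1 * v$4 - 3 * v$1 * v$2 * p2 - v$1 * (v$2)^2 * a12 * v$4 + v$1 * (v$2)^2 * a13 * v$5 + v$1 * (v$2)^2 * a22 - v$1 * (v$2)^2 * a33 - v$1 * v$3 * a13 * v$4 + v$1 * v$3 * a23 + (v$1)^2 * v$2 * a13 * v$4 - (v$1)^2 * v$2 * a23 - v$2 * v$3 * a12 * v$4 - 2 * v$2 * v$3 * a13 * v$5 + v$2 * v$3 * a22 + 2 * v$2 * v$3 * a33 - 3 * v$2 * r1 - 3 * v$2 * r2 * v$4 - 3 * v$2 * r3 * v$5 - 3 * (v$2)^2 * v$3 * r2 - (v$2)^2 * (v$3)^2 * a12 + 3 * (v$2)^2 * p1 * v$5 - 3 * (v$2)^2 * p3 - (v$2)^3 * a12 * v$5 + (v$2)^3 * a32 - 3 * v$3 * p1 * v$4 + 3 * v$3 * p2 - 3 * (v$3)^2 * r3 - (v$3)^3 * a13 - a12 * (v$4)^2 - a13 * v$4 * v$5 + a21 + 2 * a22 * v$4 + a23 * v$5 + a33 * v$4"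
    "\<And>v. v \<in> U \<Longrightarrow> psi v = 3 * v$1 * v$2 * v$3 * r2 + v$1 * v$2 * (v$3)^2 * a12 - 3 * v$1 * v$2 * p1 * v$5 + 3 * v$1 * v$2 * p3 + v$1 * (v$2)^2 * a12 * v$5 - v$1 * (v$2)^2 * a32 + 2 * v$1 * v$3 * a12 * v$4 + v$1 * v$3 * a13 * v$5 - 2 * v$1 * v$3 * a22 - v$1 * v$3 * a33 + 3 * v$1 * r1 + 3 * v$1 * r2 * v$4 + 3 * v$1 * r3 * v$5 + (v$1)^2 * v$2 * a12 * v$4 - (v$1)^2 * v$2 * a13 * v$5 - (v$1)^2 * v$2 * a22 + (v$1)^2 * v$2 * a33 - 3 * (v$1)^2 * v$3 * r3 - (v$1)^2 * (v$3)^2 * a13 - 3 * (v$1)^2 * p1 * v$4 + 3 * (v$1)^2 * p2 - (v$1)^3 * a13 * v$4 + (v$1)^3 * a23 + v$2 * v$3 * a12 * v$5 - v$2 * v$3 * a32 - 3 * v$3 * p1 * v$5 + 3 * v$3 * p3 + 3 * (v$3)^2 * r2 + (v$3)^3 * a12 - a12 * v$4 * v$5 - a13 * (v$5)^2 + a22 * v$5 + a31 + a32 * v$4 + 2 * a33 * v$5"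
proof -
  obtain c1 where "\<forall>v\<in>U. lie_deriv e1 oc v = c1"
    using flat_constant[OF U conn smooth_L(1)[OF smooth_oc] L_oc(1,2)] by blast
  then obtain a13 where R1: "\<And>v. v \<in> U \<Longrightarrow> lie_deriv e1 oc v = 2 * a13"
    using that by (metis field_sum_of_halves mult_2)
  obtain c2 where "\<forall>v\<in>U. lie_deriv e2 oc v = c2"
    using flat_constant[OF U conn smooth_L(2)[OF smooth_oc] L_oc(3,4)] by blast
  then have "\<And>v. v \<in> U \<Longrightarrow> lie_deriv e2 oc v = -2 * (- c2/2)" by simp
  then obtain a12 where R2: "\<And>v. v \<in> U \<Longrightarrow> lie_deriv e2 oc v = -2 * a12" by blast
  \<comment> \<open>The new constant stands last with an explicit factor, because
    \<open>erule that\<close> reads \<open>p\<close> and \<open>k\<close> of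
    \<open>flat_integrate\<close> off this formula.\<close>
  obtain p1 where Poc: "\<forall>v\<in>U. oc v = 2 * v$1 * a13 - 2 * v$2 * a12 + 2 * p1"
    by (rule flat_integrate[OF U conn smooth_oc], erule that, intro smooth_intros U, (rule derivative_eq_intros refl)+)
      (simp_all add:  R1 R2 e1_def e2_def algebra_simps power2_eq_square power3_eq_cube)
  obtain r3 where Pn1: "\<forall>v\<in>U. n1 v = v$1 * v$2 * a13 + 2 * v$2 * p1 - (v$2)^2 * a12 - v$3 * a13 + (-1) * r3"
    by (rule flat_integrate[OF U conn smooth_n1], erule that, intro smooth_intros U, (rule derivative_eq_intros refl)+)
      (simp_all add: L1n1 L2n1 Poc e1_def e2_def algebra_simps power2_eq_square power3_eq_cube)
  obtain r2 where Pn2: "\<forall>v\<in>U. n2 v = -1 * v$1 * v$2 * a12 + 2 * v$1 * p1 + (v$1)^2 * a13 - v$3 * a12 + (-1) * r2"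
    by (rule flat_integrate[OF U conn smooth_n2], erule that, intro smooth_intros U, (rule derivative_eq_intros refl)+)
      (simp_all add: L1n2 L2n2 Poc e1_def e2_def algebra_simps power2_eq_square power3_eq_cube)
  obtain a33 where Pm11: "\<forall>v\<in>U. m11 v = -3 * v$1 * v$2 * p1 + v$1 * (v$2)^2 * a12 + v$1 * v$3 * a13 + 2 * v$1 * r3 - (v$1)^2 * v$2 * a13 + v$2 * v$3 * a12 + v$2 * r2 - v$3 * p1 - a13 * v$5 + 1 * a33"
    by (rule flat_integrate[OF U conn smooth_m11], erule that, intro smooth_intros U, (rule derivative_eq_intros refl)+)
      (simp_all add: L1m11 L2m11 Pn1 Pn2 e1_def e2_def algebra_simps power2_eq_square power3_eq_cube)
  obtain a32 where Pm12: "\<forall>v\<in>U. m12 v = -2 * v$1 * v$3 * a12 - 3 * v$1 * r2 - (v$1)^2 * v$2 * a12 + 3 * (v$1)^2 * p1 + (v$1)^3 * a13 + a12 * v$5 + (-1) * a32"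
    by (rule flat_integrate[OF U conn smooth_m12], erule that, intro smooth_intros U, (rule derivative_eq_intros refl)+)
      (simp_all add: L1m12 L2m12 Pn1 Pn2 e1_def e2_def algebra_simps power2_eq_square power3_eq_cube)
  obtain a23 where Pm21: "\<forall>v\<in>U. m21 v = -1 * v$1 * (v$2)^2 * a13 + 2 * v$2 * v$3 * a13 + 3 * v$2 * r3 - 3 * (v$2)^2 * p1 + (v$2)^3 * a12 + a13 * v$4 + (-1) * a23"
    by (rule flat_integrate[OF U conn smooth_m21], erule that, intro smooth_intros U, (rule derivative_eq_intros refl)+)
      (simp_all add: L1m21 L2m21 Pn1 Pn2 e1_def e2_def algebra_simps power2_eq_square power3_eq_cube)
  obtain a22 where Pm22: "\<forall>v\<in>U. m22 v = 3 * v$1 * v$2 * p1 - v$1 * (v$2)^2 * a12 - v$1 * v$3 * a13 - v$1 * r3 + (v$1)^2 * v$2 * a13 - v$2 * v$3 * a12 - 2 * v$2 * r2 - v$3 * p1 - a12 * v$4 + 1 * a22"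
    by (rule flat_integrate[OF U conn smooth_m22], erule that, intro smooth_intros U, (rule derivative_eq_intros refl)+)
      (simp_all add: L1m22 L2m22 Pn1 Pn2 e1_def e2_def algebra_simps power2_eq_square power3_eq_cube)
  obtain p3 where Pf1: "\<forall>v\<in>U. f1 v = -1 * v$1 * v$2 * r2 - 2 * v$1 * v$3 * p1 - v$1 * a13 * v$5 + v$1 * a33 + (v$1)^2 * r3 + v$2 * a12 * v$5 - v$2 * a32 + 2 * v$3 * r2 + (v$3)^2 * a12 - p1 * v$5 + 1 * p3"
    by (rule flat_integrate[OF U conn smooth_f1], erule that, intro smooth_intros U, (rule derivative_eq_intros refl)+)
      (simp_all add: m11_def[symmetric] m12_def[symmetric] Pm11 Pm12 e1_def e2_def algebra_simps power2_eq_square power3_eq_cube)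
  obtain p2 where Pf2: "\<forall>v\<in>U. f2 v = v$1 * v$2 * r3 + v$1 * a13 * v$4 - v$1 * a23 - 2 * v$2 * v$3 * p1 - v$2 * a12 * v$4 + v$2 * a22 - (v$2)^2 * r2 + 2 * v$3 * r3 + (v$3)^2 * a13 + p1 * v$4 + (-1) * p2"
    by (rule flat_integrate[OF U conn smooth_f2], erule that, intro smooth_intros U, (rule derivative_eq_intros refl)+)
      (simp_all add: m21_def[symmetric] m22_def[symmetric] Pm21 Pm22 e1_def e2_def algebra_simps power2_eq_square power3_eq_cube)
  obtain r1 where Pg: "\<forall>v\<in>U. g v = -1 * v$1 * v$2 * a12 * v$4 + v$1 * v$2 * a13 * v$5 + v$1 * v$2 * a22 - v$1 * v$2 * a33 + 3 * v$1 * v$3 * r3 + v$1 * (v$3)^2 * a13 + 2 * v$1 * p1 * v$4 - 2 * v$1 * p2 + (v$1)^2 * a13 * v$4 - (v$1)^2 * a23 - 3 * v$2 * v$3 * r2 - v$2 * (v$3)^2 * a12 + 2 * v$2 * p1 * v$5 - 2 * v$2 * p3 - (v$2)^2 * a12 * v$5 + (v$2)^2 * a32 - v$3 * a12 * v$4 - v$3 * a13 * v$5 + v$3 * a22 + v$3 * a33 - (v$3)^2 * p1 - r2 * v$4 - r3 * v$5 + (-1) * r1"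
    by (rule flat_integrate[OF U conn smooth_g], erule that, intro smooth_intros U, (rule derivative_eq_intros refl)+)
      (simp_all add: L1g L2g Pf1 Pf2 e1_def e2_def algebra_simps power2_eq_square power3_eq_cube)
  obtain a21 where Pphi: "\<forall>v\<in>U. phi v = 3 * v$1 * v$2 * v$3 * r3 + v$1 * v$2 * (v$3)^2 * a13 + 3 * v$1 * v$2 * p1 * v$4 - 3 * v$1 * v$2 * p2 - v$1 * (v$2)^2 * a12 * v$4 + v$1 * (v$2)^2 * a13 * v$5 + v$1 * (v$2)^2 * a22 - v$1 * (v$2)^2 * a33 - v$1 * v$3 * a13 * v$4 + v$1 * v$3 * a23 + (v$1)^2 * v$2 * a13 * v$4 - (v$1)^2 * v$2 * a23 - v$2 * v$3 * a12 * v$4 - 2 * v$2 * v$3 * a13 * v$5 + v$2 * v$3 * a22 + 2 * v$2 * v$3 * a33 - 3 * v$2 * r1 - 3 * v$2 * r2 * v$4 - 3 * v$2 * r3 * v$5 - 3 * (v$2)^2 * v$3 * r2 - (v$2)^2 * (v$3)^2 * a12 + 3 * (v$2)^2 * p1 * v$5 - 3 * (v$2)^2 * p3 - (v$2)^3 * a12 * v$5 + (v$2)^3 * a32 - 3 * v$3 * p1 * v$4 + 3 * v$3 * p2 - 3 * (v$3)^2 * r3 - (v$3)^3 * a13 - a12 * (v$4)^2 - a13 * v$4 * v$5 + 2 * a22 * v$4 + a23 * v$5 + a33 * v$4 + 1 * a21"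
    by (rule flat_integrate[OF U conn smooth_phi], erule that, intro smooth_intros U, (rule derivative_eq_intros refl)+)
      (simp_all add: L1phi L2phi Pg e1_def e2_def algebra_simps power2_eq_square power3_eq_cube)
  obtain a31 where Ppsi: "\<forall>v\<in>U. psi v = 3 * v$1 * v$2 * v$3 * r2 + v$1 * v$2 * (v$3)^2 * a12 - 3 * v$1 * v$2 * p1 * v$5 + 3 * v$1 * v$2 * p3 + v$1 * (v$2)^2 * a12 * v$5 - v$1 * (v$2)^2 * a32 + 2 * v$1 * v$3 * a12 * v$4 + v$1 * v$3 * a13 * v$5 - 2 * v$1 * v$3 * a22 - v$1 * v$3 * a33 + 3 * v$1 * r1 + 3 * v$1 * r2 * v$4 + 3 * v$1 * r3 * v$5 + (v$1)^2 * v$2 * a12 * v$4 - (v$1)^2 * v$2 * a13 * v$5 - (v$1)^2 * v$2 * a22 + (v$1)^2 * v$2 * a33 - 3 * (v$1)^2 * v$3 * r3 - (v$1)^2 * (v$3)^2 * a13 - 3 * (v$1)^2 * p1 * v$4 + 3 * (v$1)^2 * p2 - (v$1)^3 * a13 * v$4 + (v$1)^3 * a23 + v$2 * v$3 * a12 * v$5 - v$2 * v$3 * a32 - 3 * v$3 * p1 * v$5 + 3 * v$3 * p3 + 3 * (v$3)^2 * r2 + (v$3)^3 * a12 - a12 * v$4 * v$5 - a13 * (v$5)^2 + a22 * v$5 + a32 * v$4 + 2 * a33 * v$5 + 1 * a31"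
    by (rule flat_integrate[OF U conn smooth_psi], erule that, intro smooth_intros U, (rule derivative_eq_intros refl)+)
      (simp_all add: L1psi L2psi Pg e1_def e2_def algebra_simps power2_eq_square power3_eq_cube)
  show thesis by (rule that) (simp_all add: Pf1 Pf2 Pg Pphi Ppsi algebra_simps)
qed

end

section \<open>Exponentials of linear maps\<close>

definition exp_lin :: "('a::euclidean_space \<Rightarrow> 'a) \<Rightarrow> real \<Rightarrow> 'a \<Rightarrow> 'a" where
  "exp_lin d t z = (\<Sum>n. (t ^ n / fact n) *\<^sub>R (d ^^ n) z)"

context
  fixes d :: "'a::euclidean_space \<Rightarrow> 'a"
  assumes lin: "linear d"
begin

lemma bounded_linear_d: "bounded_linear d"
  using lin linear_conv_bounded_linear by blast

lemma linear_funpow: "linear (d ^^ n)"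
proof (induction n)
  case (Suc n)
  then show ?case using linear_compose[OF Suc lin] by (simp add: o_def)
qed (simp add: linear_id[unfolded id_def] id_def)

lemma summable_exp_lin: "summable (\<lambda>n. (t ^ n / fact n) *\<^sub>R (d ^^ n) z)"
proof -
  obtain K where K: "K > 0" "\<And>x. norm (d x) \<le> norm x * K"
    using bounded_linear.pos_bounded[OF bounded_linear_d] by blast
  have n: "norm ((d ^^ n) z) \<le> norm z * K ^ n" for n
  proof (induction n)
    case (Suc n)
    have "norm ((d ^^ Suc n) z) \<le> norm ((d ^^ n) z) * K" using K(2) by simp
    also have "\<dots> \<le> norm z * K ^ n * K" using Suc K(1) by (intro mult_right_mono) auto
    finally show ?case by (simp add: mult_ac)
  qed simp
  show ?thesis
  proof (rule summable_comparison_test')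
    show "summable (\<lambda>n. norm z * (inverse (fact n) * (\<bar>t\<bar> * K) ^ n))"
      by (intro summable_mult summable_exp)
    show "norm ((t ^ n / fact n) *\<^sub>R (d ^^ n) z) \<le> norm z * (inverse (fact n) * (\<bar>t\<bar> * K) ^ n)" for n
      using mult_left_mono[OF n[of n], of "\<bar>t\<bar> ^ n / fact n"]
      by (simp add: power_abs abs_mult power_mult_distrib divide_inverse mult_ac)
  qed
qed

lemma exp_lin_0: "exp_lin d 0 z = z"
proof -
  have "(\<lambda>n. (0 ^ n / fact n) *\<^sub>R (d ^^ n) z) sums (\<Sum>n\<in>{0}. (0 ^ n / fact n) *\<^sub>R (d ^^ n) z)"
    by (rule sums_finite) auto
  then show ?thesis unfolding exp_lin_def by (auto simp: sums_iff)
qed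

lemma linear_exp_lin: "linear (exp_lin d t)"
proof (rule linearI)
  show "exp_lin d t (x + y) = exp_lin d t x + exp_lin d t y" for x y
    unfolding exp_lin_def using suminf_add[OF summable_exp_lin[of t x] summable_exp_lin[of t y]]
    by (simp add: linear_add[OF linear_funpow] scaleR_add_right)
  show "exp_lin d t (c *\<^sub>R x) = c *\<^sub>R exp_lin d t x" for c x
    unfolding exp_lin_def using suminf_scaleR_right[OF summable_exp_lin[of t x], of c]
    by (simp add: linear_cmul[OF linear_funpow] mult.commute)
qed

lemma exp_lin_commute: "exp_lin d t (d z) = d (exp_lin d t z)"
  unfolding exp_lin_def bounded_linear.suminf[OF bounded_linear_d summable_exp_lin]
  by (simp add: linear_cmul[OF lin] funpow_swap1)

lemma exp_lin_inner: "exp_lin d t z \<bullet> b = (\<Sum>n. ((d ^^ n) z \<bullet> b / fact n) * t ^ n)"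
  unfolding exp_lin_def bounded_linear.suminf[OF bounded_linear_inner_left summable_exp_lin]
  by (simp add: mult.commute)

text \<open>Each component is a real power series in \<open>t\<close>; differentiating it termwise
  shifts the coefficients to those of the series at \<open>d z\<close>.\<close>

lemma exp_lin_derivative: "((\<lambda>t. exp_lin d t z) has_vector_derivative exp_lin d t (d z)) (at t)"
proof -
  have D: "((\<lambda>t. exp_lin d t z \<bullet> b) has_real_derivative exp_lin d t (d z) \<bullet> b) (at t)" for b
  proof -
    let ?c = "\<lambda>n. (d ^^ n) z \<bullet> b / fact n"
    have "summable (\<lambda>n. ?c n * y ^ n)" for y
      using bounded_linear.summable[OF bounded_linear_inner_left summable_exp_lin[of y z], of b]
      by (simp add: mult.commute)
    then have "((\<lambda>t. \<Sum>n. ?c n * t ^ n) has_real_derivative (\<Sum>n. diffs ?c n * t ^ n)) (at t)"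
      by (rule termdiffs_strong_converges_everywhere)
    moreover have "diffs ?c n = (d ^^ n) (d z) \<bullet> b / fact n" for n
      by (simp add: diffs_def funpow_swap1 del: of_nat_Suc)
    ultimately show ?thesis by (simp add: exp_lin_inner)
  qed
  show ?thesis
    unfolding has_vector_derivative_def
    by (subst has_derivative_componentwise_within)
      (use D in \<open>auto simp: has_field_derivative_def inner_scaleR_left mult_commute_abs\<close>)
qed

text \<open>In \<open>t\<close> the derivative has the same form with \<open>d z\<close> in place of
  \<open>z\<close>, which gives all orders; joint smoothness follows because the map is linear in
  \<open>z\<close>.\<close>

lemma smooth_on_exp_lin: "smooth_on UNIV (\<lambda>(t, z). exp_lin d t z)"
proof -
  have C: "Ck_on k UNIV (\<lambda>t. exp_lin d t z)" for k z
  proof (induction k arbitrary: z)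
    case 0
    then show ?case
      by (auto intro!: continuous_at_imp_continuous_on has_vector_derivative_continuous exp_lin_derivative)
  next
    case (Suc k)
    have "((\<lambda>t. exp_lin d t z) has_derivative (\<lambda>h. h *\<^sub>R exp_lin d t (d z))) (at t)" for t
      using exp_lin_derivative unfolding has_vector_derivative_def .
    then show ?case
      by (rule Ck_onI[OF open_UNIV]) (intro Ck_on_bilinear[OF bounded_bilinear_scaleR open_UNIV Ck_on_const] open_UNIV Suc)
  qed
  have "smooth_on UNIV (\<lambda>p. \<Sum>b\<in>Basis. (snd p \<bullet> b) *\<^sub>R exp_lin d (fst p) b)"
    by (intro smooth_on_sum smooth_on_scaleR smooth_on_inner smooth_on_snd smooth_on_id smooth_on_const open_UNIV
        smooth_on_compose[OF open_UNIV open_UNIV smooth_on_fst[OF open_UNIV smooth_on_id[OF open_UNIV]], of "\<lambda>t. exp_lin d t _"])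
      (auto simp: smooth_on_def C)
  moreover have "(\<Sum>b\<in>Basis. (z \<bullet> b) *\<^sub>R exp_lin d t b) = exp_lin d t z" for t z
    using linear_sum[OF linear_exp_lin, of t "\<lambda>b. (z \<bullet> b) *\<^sub>R b" Basis]
    by (simp add: linear_cmul[OF linear_exp_lin] euclidean_representation)
  ultimately show ?thesis by (simp add: case_prod_unfold)
qed

text \<open>The two terms in the derivative of exp(- t d) (g t) cancel. Expanding \<open>g t\<close>
  in \<open>Basis\<close> reduces the product rule for an operator applied to a curve to that for
  scalars times curves.\<close>

lemma exp_lin_unique:
  assumes g: "\<And>t. (g has_vector_derivative d (g t)) (at t)"
  shows "exp_lin d (- t) (g t) = g 0"
proof -
  have eq: "exp_lin d s z = (\<Sum>b\<in>Basis. (z \<bullet> b) *\<^sub>R exp_lin d s b)" for s z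
    using linear_sum[OF linear_exp_lin, of s "\<lambda>b. (z \<bullet> b) *\<^sub>R b" Basis]
    by (simp add: linear_cmul[OF linear_exp_lin] euclidean_representation)
  have E: "((\<lambda>t. exp_lin d (- t) z) has_vector_derivative - exp_lin d (- t) (d z)) (at t)" for t z
  proof -
    have "(uminus has_real_derivative - 1) (at t)" by (auto intro!: derivative_eq_intros)
    from vector_diff_chain_at[OF this[unfolded has_real_derivative_iff_has_vector_derivative] exp_lin_derivative]
    show ?thesis by (simp add: o_def)
  qed
  have "((\<lambda>t. \<Sum>b\<in>Basis. (g t \<bullet> b) *\<^sub>R exp_lin d (- t) b) has_vector_derivative
      (\<Sum>b\<in>Basis. (g t \<bullet> b) *\<^sub>R (- exp_lin d (- t) (d b)) + (d (g t) \<bullet> b) *\<^sub>R exp_lin d (- t) b)) (at t)" for t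
  proof (intro has_vector_derivative_sum)
    fix b :: 'a
    have "((\<lambda>t. g t \<bullet> b) has_vector_derivative d (g t) \<bullet> b) (at t)"
      by (rule bounded_linear.has_vector_derivative[OF bounded_linear_inner_left g])
    then have "((\<lambda>t. g t \<bullet> b) has_real_derivative d (g t) \<bullet> b) (at t)"
      by (simp add: has_real_derivative_iff_has_vector_derivative)
    then show "((\<lambda>t. (g t \<bullet> b) *\<^sub>R exp_lin d (- t) b) has_vector_derivative
        (g t \<bullet> b) *\<^sub>R (- exp_lin d (- t) (d b)) + (d (g t) \<bullet> b) *\<^sub>R exp_lin d (- t) b) (at t)"
      by (rule has_vector_derivative_scaleR[OF _ E])
  qed
  moreover have "(\<Sum>b\<in>Basis. (g t \<bullet> b) *\<^sub>R (- exp_lin d (- t) (d b)) + (d (g t) \<bullet> b) *\<^sub>R exp_lin d (- t) b) = 0" for t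
  proof -
    have "(\<Sum>b\<in>Basis. (g t \<bullet> b) *\<^sub>R exp_lin d (- t) (d b)) = exp_lin d (- t) (d (g t))"
    proof -
      have "d (g t) = (\<Sum>b\<in>Basis. (g t \<bullet> b) *\<^sub>R d b)"
        using linear_sum[OF lin, of "\<lambda>b. (g t \<bullet> b) *\<^sub>R b" Basis]
        by (simp add: linear_cmul[OF lin] euclidean_representation)
      then show ?thesis
        by (simp add: linear_sum[OF linear_exp_lin] linear_cmul[OF linear_exp_lin])
    qed
    then show ?thesis
      by (simp add: sum.distrib sum_subtractf eq[of _ "d (g t)", symmetric])
  qed
  ultimately have "((\<lambda>t. exp_lin d (- t) (g t)) has_vector_derivative 0) (at t)" for t
    by (subst eq) simp
  then have "((\<lambda>t. exp_lin d (- t) (g t)) has_derivative (\<lambda>h. 0)) (at t within UNIV)" for t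
    by (simp add: has_vector_derivative_def)
  from has_derivative_zero_constant[OF convex_UNIV this]
  obtain c where "\<forall>t. exp_lin d (- t) (g t) = c" by auto
  then show ?thesis by (metis exp_lin_0 minus_zero)
qed

lemma exp_lin_minus: "exp_lin d (- t) (exp_lin d t z) = z" "exp_lin d t (exp_lin d (- t) z) = z"
proof -
  have "exp_lin d (- t) (exp_lin d t z) = z" for t
    using exp_lin_unique[of "\<lambda>t. exp_lin d t z" t] exp_lin_derivative by (simp add: exp_lin_commute exp_lin_0)
  from this[of t] this[of "- t"]
  show "exp_lin d (- t) (exp_lin d t z) = z" "exp_lin d t (exp_lin d (- t) z) = z" by simp_all
qed

end


section \<open>Derivations of the split octonions\<close>

abbreviation zorn_derivation :: "(zorn \<Rightarrow> zorn) \<Rightarrow> bool" where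
  "zorn_derivation d \<equiv> d \<in> lie_carrier split_g2"

lemma zorn_derivation_iff:
  "zorn_derivation d \<longleftrightarrow> linear d \<and> (\<forall>x y. d (zorn_mult x y) = zorn_mult (d x) y + zorn_mult x (d y))"
  by (simp add: split_g2_def)

lemma zorn_derivation_linear: "zorn_derivation d \<Longrightarrow> linear d"
  by (simp add: zorn_derivation_iff)

lemma zorn_derivation_mult:
  "zorn_derivation d \<Longrightarrow> d (zorn_mult x y) = zorn_mult (d x) y + zorn_mult x (d y)"
  unfolding zorn_derivation_iff by blast

lemma bounded_bilinear_zorn_mult: "bounded_bilinear zorn_mult"
proof -
  have "bilinear zorn_mult"
    unfolding bilinear_def linear_iff
    by (auto simp: zorn_mult_def inner_add_left inner_add_right algebra_simps cross_add_left cross_add_right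
        cross_mult_left cross_mult_right)
  then show ?thesis using bilinear_conv_bounded_bilinear by blast
qed

text \<open>By the Leibniz rule the product of the two exponentials solves the same linear equation
  as the exponential of the product, with the same initial value.\<close>

lemma exp_lin_mult:
  assumes d: "zorn_derivation d"
  shows "zorn_mult (exp_lin d t x) (exp_lin d t y) = exp_lin d t (zorn_mult x y)"
proof -
  note lin = zorn_derivation_linear[OF d]
  have "((\<lambda>t. zorn_mult (exp_lin d t x) (exp_lin d t y)) has_vector_derivative
      d (zorn_mult (exp_lin d t x) (exp_lin d t y))) (at t)" for t
    using bounded_bilinear.has_vector_derivative[OF bounded_bilinear_zorn_mult
        exp_lin_derivative[OF lin, of x t] exp_lin_derivative[OF lin, of y t]]
    by (simp add: zorn_derivation_mult[OF d] exp_lin_commute[OF lin] add.commute)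
  from exp_lin_unique[OF lin this, of t]
  have "exp_lin d (- t) (zorn_mult (exp_lin d t x) (exp_lin d t y)) = zorn_mult x y"
    by (simp add: exp_lin_0[OF lin])
  then show ?thesis by (metis exp_lin_minus(2)[OF lin])
qed

abbreviation zorn_a :: "zorn \<Rightarrow> real" where "zorn_a z \<equiv> fst z"
abbreviation zorn_u :: "zorn \<Rightarrow> real^3" where "zorn_u z \<equiv> fst (snd z)"
abbreviation zorn_v :: "zorn \<Rightarrow> real^3" where "zorn_v z \<equiv> fst (snd (snd z))"
abbreviation zorn_b :: "zorn \<Rightarrow> real" where "zorn_b z \<equiv> snd (snd (snd z))"

text \<open>Comes from differentiating the relations that make (1, 0, 0, 0) and (0, 0, 0, 1)
  idempotents with product zero in both orders.\<close>

lemma zorn_derivation_idempotent: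
  assumes d: "zorn_derivation d"
  obtains p r where "d (1, 0, 0, 0) = (0, p, r, 0)" "d (0, 0, 0, 1) = (0, - p, - r, 0)"
proof -
  note lin = zorn_derivation_linear[OF d]
  obtain A U V B where e: "d (1, 0, 0, 0) = (A, U, V, B)" by (metis surj_pair)
  obtain A' U' V' B' where f: "d (0, 0, 0, 1) = (A', U', V', B')" by (metis surj_pair)
  have "zorn_mult (1, 0, 0, 0) (1, 0, 0, 0) = (1, 0, 0, 0)" "zorn_mult (0, 0, 0, 1) (0, 0, 0, 1) = (0, 0, 0, 1)"
    "zorn_mult (1, 0, 0, 0) (0, 0, 0, 1) = 0"
    by (simp_all add: zorn_mult_def zero_prod_def)
  then have "(A, U, V, B) = zorn_mult (A, U, V, B) (1, 0, 0, 0) + zorn_mult (1, 0, 0, 0) (A, U, V, B)"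
    "(A', U', V', B') = zorn_mult (A', U', V', B') (0, 0, 0, 1) + zorn_mult (0, 0, 0, 1) (A', U', V', B')"
    "0 = zorn_mult (A, U, V, B) (0, 0, 0, 1) + zorn_mult (1, 0, 0, 0) (A', U', V', B')"
    using zorn_derivation_mult[OF d, of "(1, 0, 0, 0)" "(1, 0, 0, 0)"]
      zorn_derivation_mult[OF d, of "(0, 0, 0, 1)" "(0, 0, 0, 1)"]
      zorn_derivation_mult[OF d, of "(1, 0, 0, 0)" "(0, 0, 0, 1)"] linear_0[OF lin]
    by (simp_all add: e f)
  moreover have "zorn_mult (0, 0, 0, 1) (1, 0, 0, 0) = 0"
    by (simp add: zorn_mult_def zero_prod_def)
  then have "0 = zorn_mult (A', U', V', B') (1, 0, 0, 0) + zorn_mult (0, 0, 0, 1) (A, U, V, B)"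
    using zorn_derivation_mult[OF d, of "(0, 0, 0, 1)" "(1, 0, 0, 0)"] linear_0[OF lin] by (simp add: e f)
  ultimately have "A = 0" "B = 0" "A' = 0" "B' = 0" "U' = - U" "V' = - V"
    by (auto simp: zorn_mult_def zero_prod_def eq_neg_iff_add_eq_0 add.commute)
  then show thesis using that[of U V] e f by simp
qed

text \<open>With e = (1, 0, 0, 0), differentiating e u = u and u e = 0 determines both diagonal
  entries of the image of a pure \<open>u\<close>; for a pure \<open>v\<close> the relations are v e
  = v and e v = 0. It follows that derivations and their exponentials preserve the imaginary
  octonions.\<close>

lemma zorn_derivation_trace:
  assumes d: "zorn_derivation d"
  shows "zorn_a (d z) + zorn_b (d z) = 0"
proof -
  note lin = zorn_derivation_linear[OF d]
  obtain p r where e: "d (1, 0, 0, 0) = (0, p, r, 0)" and f: "d (0, 0, 0, 1) = (0, - p, - r, 0)"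
    using zorn_derivation_idempotent[OF d] .
  have u: "zorn_a (d (0, u, 0, 0)) + zorn_b (d (0, u, 0, 0)) = 0" for u
  proof -
    obtain A U V B where z: "d (0, u, 0, 0) = (A, U, V, B)" by (metis surj_pair)
    have "zorn_mult (1, 0, 0, 0) (0, u, 0, 0) = (0, u, 0, 0)" "zorn_mult (0, u, 0, 0) (1, 0, 0, 0) = 0"
      by (simp_all add: zorn_mult_def zero_prod_def)
    then have "(A, U, V, B) = zorn_mult (0, p, r, 0) (0, u, 0, 0) + zorn_mult (1, 0, 0, 0) (A, U, V, B)"
      "0 = zorn_mult (A, U, V, B) (1, 0, 0, 0) + zorn_mult (0, u, 0, 0) (0, p, r, 0)"
      using zorn_derivation_mult[OF d, of "(1, 0, 0, 0)" "(0, u, 0, 0)"]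
        zorn_derivation_mult[OF d, of "(0, u, 0, 0)" "(1, 0, 0, 0)"] linear_0[OF lin] by (simp_all add: e z)
    then show ?thesis by (simp add: z zorn_mult_def zero_prod_def inner_commute)
  qed
  have v: "zorn_a (d (0, 0, v, 0)) + zorn_b (d (0, 0, v, 0)) = 0" for v
  proof -
    obtain A U V B where z: "d (0, 0, v, 0) = (A, U, V, B)" by (metis surj_pair)
    have "zorn_mult (0, 0, v, 0) (1, 0, 0, 0) = (0, 0, v, 0)" "zorn_mult (1, 0, 0, 0) (0, 0, v, 0) = 0"
      by (simp_all add: zorn_mult_def zero_prod_def)
    then have "(A, U, V, B) = zorn_mult (A, U, V, B) (1, 0, 0, 0) + zorn_mult (0, 0, v, 0) (0, p, r, 0)"
      "0 = zorn_mult (0, p, r, 0) (0, 0, v, 0) + zorn_mult (1, 0, 0, 0) (A, U, V, B)"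
      using zorn_derivation_mult[OF d, of "(0, 0, v, 0)" "(1, 0, 0, 0)"]
        zorn_derivation_mult[OF d, of "(1, 0, 0, 0)" "(0, 0, v, 0)"] linear_0[OF lin] by (simp_all add: e z)
    then show ?thesis by (simp add: z zorn_mult_def zero_prod_def inner_commute)
  qed
  obtain a x y b where z: "z = (a, x, y, b)" by (metis surj_pair)
  have "d z = a *\<^sub>R d (1, 0, 0, 0) + d (0, x, 0, 0) + d (0, 0, y, 0) + b *\<^sub>R d (0, 0, 0, 1)"
    by (simp add: z linear_add[OF lin, symmetric] linear_cmul[OF lin, symmetric])
  then show ?thesis using u[of x] v[of y] by (simp add: e f)
qed

lemma exp_lin_trace:
  assumes d: "zorn_derivation d"
  shows "zorn_a (exp_lin d t z) + zorn_b (exp_lin d t z) = zorn_a z + zorn_b z"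
proof -
  note lin = zorn_derivation_linear[OF d]
  have L: "bounded_linear (\<lambda>z::zorn. zorn_a z + zorn_b z)"
    by (intro bounded_linear_add bounded_linear_fst bounded_linear_compose[OF bounded_linear_snd, unfolded o_def] bounded_linear_snd)
  have "((\<lambda>t. zorn_a (exp_lin d t z) + zorn_b (exp_lin d t z)) has_vector_derivative 0) (at t)" for t
    using bounded_linear.has_vector_derivative[OF L exp_lin_derivative[OF lin, of z t]]
      zorn_derivation_trace[OF d, of "exp_lin d t z"] by (simp add: exp_lin_commute[OF lin])
  then have "((\<lambda>t. zorn_a (exp_lin d t z) + zorn_b (exp_lin d t z)) has_derivative (\<lambda>h. 0)) (at t within UNIV)" for t
    by (simp add: has_vector_derivative_def)
  from has_derivative_zero_constant[OF convex_UNIV this]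
  obtain c where "\<forall>t. zorn_a (exp_lin d t z) + zorn_b (exp_lin d t z) = c" by auto
  then show ?thesis using exp_lin_0[OF lin, of z] by metis
qed

section \<open>The null quadric of imaginary split octonions in an affine chart\<close>

text \<open>The imaginary octonions of norm zero whose coordinate \<open>lead\<close> equals 1.\<close>

definition null_pt :: "real^5 \<Rightarrow> zorn" where
  "null_pt v = (v$3, vector [1, v$4, v$5], vector [- ((v$3)^2) - v$4 * v$1 - v$5 * v$2, v$1, v$2], - v$3)"

definition null_deriv :: "real^5 \<Rightarrow> real^5 \<Rightarrow> zorn" where
  "null_deriv v w = (w$3, vector [0, w$4, w$5],
     vector [- (2 * v$3 * w$3) - (v$4 * w$1 + w$4 * v$1) - (v$5 * w$2 + w$5 * v$2), w$1, w$2], - w$3)"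

definition chart :: "zorn \<Rightarrow> real^5" where
  "chart z = vec5 (zorn_v z $ 2) (zorn_v z $ 3) (zorn_a z) (zorn_u z $ 2) (zorn_u z $ 3)"

definition lead :: "zorn \<Rightarrow> real" where "lead z = zorn_u z $ 1"

lemma vec3_eq_iff: "v = w \<longleftrightarrow> v$1 = w$1 \<and> v$2 = w$2 \<and> v$3 = w$3" for v w :: "'a^3"
  by (simp add: vec_eq_iff forall_3)

lemma zorn_eq_iff: "z = w \<longleftrightarrow> zorn_a z = zorn_a w \<and> (zorn_u z $ 1 = zorn_u w $ 1 \<and> zorn_u z $ 2 = zorn_u w $ 2
    \<and> zorn_u z $ 3 = zorn_u w $ 3) \<and> (zorn_v z $ 1 = zorn_v w $ 1 \<and> zorn_v z $ 2 = zorn_v w $ 2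
    \<and> zorn_v z $ 3 = zorn_v w $ 3) \<and> zorn_b z = zorn_b w"
  by (auto simp: prod_eq_iff vec3_eq_iff)

lemma linear_chart: "linear chart" and linear_lead: "linear lead"
  by (auto simp: linear_iff chart_def lead_def vec5_eq_iff)

lemma bounded_linear_chart: "bounded_linear chart" and bounded_linear_lead: "bounded_linear lead"
  using linear_chart linear_lead linear_conv_bounded_linear by auto

lemma chart_null_pt [simp]: "chart (null_pt v) = v" and lead_null_pt [simp]: "lead (null_pt v) = 1"
  and chart_null_deriv [simp]: "chart (null_deriv v w) = w" and lead_null_deriv [simp]: "lead (null_deriv v w) = 0"
  by (simp_all add: chart_def lead_def null_pt_def null_deriv_def vec5_eq_iff vector_3)

lemma has_derivative_null_pt: "(null_pt has_derivative null_deriv v) (at v)"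
  unfolding null_pt_def null_deriv_def
  by (intro has_derivative_Pair)
    (auto intro!: derivative_eq_intros
      simp: has_derivative_vec_nth_iff forall_3 vector_3 power2_eq_square algebra_simps)

lemma smooth_on_vector_3 [smooth_intros]:
  fixes a b c :: "'a::real_normed_vector \<Rightarrow> real"
  assumes "open S" "smooth_on S a" "smooth_on S b" "smooth_on S c"
  shows "smooth_on S (\<lambda>x. vector [a x, b x, c x] :: real^3)"
proof (rule smooth_on_vecI[OF assms(1)])
  show "smooth_on S (\<lambda>x. (vector [a x, b x, c x] :: real^3) $ i)" for i
    using exhaust_3[of i] assms by (auto simp: vector_3)
qed

lemma smooth_null_pt: "open U \<Longrightarrow> smooth_on U null_pt"
  unfolding null_pt_def by (intro smooth_intros; assumption)

lemma null_pt_imaginary: "zorn_a (null_pt v) + zorn_b (null_pt v) = 0"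
  by (simp add: null_pt_def)

lemma null_pt_square: "zorn_mult (null_pt v) (null_pt v) = 0"
  by (simp add: zorn_eq_iff null_pt_def zorn_mult_def inner_vec_def sum_3 vector_3 cross3_def zero_prod_def
      power2_eq_square algebra_simps)

lemma flat_dist_iff_mult: "w \<in> flat_dist v \<longleftrightarrow> zorn_mult (null_pt v) (null_deriv v w) = 0"
proof
  assume "w \<in> flat_dist v"
  then have w: "w$3 = v$2 * w$1 - v$1 * w$2" "w$4 = v$3 * w$2 - v$2 * w$3" "w$5 = v$1 * w$3 - v$3 * w$1"
    by (auto simp: flat_dist_def)
  show "zorn_mult (null_pt v) (null_deriv v w) = 0"
    by (simp add: zorn_eq_iff null_pt_def null_deriv_def zorn_mult_def inner_vec_def sum_3 vector_3 cross3_def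
        zero_prod_def w power2_eq_square algebra_simps)
next
  assume *: "zorn_mult (null_pt v) (null_deriv v w) = 0"
  show "w \<in> flat_dist v"
    using * unfolding flat_dist_def
    by (simp add: zorn_eq_iff null_pt_def null_deriv_def zorn_mult_def inner_vec_def sum_3 vector_3 cross3_def
        zero_prod_def) argo?
qed

text \<open>For imaginary \<open>z\<close> the condition z z = 0 says that the norm vanishes. Solved
  for the first entry of \<open>zorn_v z\<close>, this is the formula in
  \<open>null_pt\<close>.\<close>

lemma chart_projection:
  assumes "zorn_a z + zorn_b z = 0" "zorn_mult z z = 0" "lead z \<noteq> 0"
  shows "null_pt ((1 / lead z) *\<^sub>R chart z) = (1 / lead z) *\<^sub>R z"
proof -
  have b: "zorn_b z = - zorn_a z" using assms(1) by simp
  have "zorn_a z * zorn_a z + zorn_u z \<bullet> zorn_v z = 0"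
    using assms(2) by (simp add: zorn_mult_def case_prod_unfold zero_prod_def)
  then have "zorn_u z $ 1 * zorn_v z $ 1 = - zorn_a z * zorn_a z - zorn_u z $ 2 * zorn_v z $ 2 - zorn_u z $ 3 * zorn_v z $ 3"
    by (simp add: inner_vec_def sum_3)
  then have "zorn_v z $ 1 / zorn_u z $ 1 = (- zorn_a z * zorn_a z - zorn_u z $ 2 * zorn_v z $ 2 - zorn_u z $ 3 * zorn_v z $ 3) / (zorn_u z $ 1)^2"
    using assms(3) by (simp add: lead_def field_simps power2_eq_square)
  then show ?thesis
    using assms(3)
    by (simp add: zorn_eq_iff null_pt_def chart_def vector_3 b lead_def power2_eq_square diff_divide_distrib)
qed


section \<open>The fields on the chart induced by derivations\<close>

text \<open>Minus the derivative of chart z / lead z at z = \<open>null_pt v\<close> in the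
  direction d z. The minus sign makes the passage from derivations to fields preserve brackets
  instead of reversing them.\<close>

definition sym_field :: "(zorn \<Rightarrow> zorn) \<Rightarrow> 5 vfield" where
  "sym_field d v = lead (d (null_pt v)) *\<^sub>R v - chart (d (null_pt v))"

lemma smooth_sym_field:
  assumes "linear d" "open U" shows "smooth_on U (sym_field d)"
proof -
  have d: "bounded_linear d" using assms linear_conv_bounded_linear by blast
  show ?thesis
    unfolding sym_field_def
    by (intro smooth_on_diff smooth_on_scaleR smooth_on_id assms(2) smooth_on_linear_comp[OF bounded_linear_lead]
        smooth_on_linear_comp[OF bounded_linear_chart] smooth_on_linear_comp[OF d] smooth_null_pt)
qed

text \<open>On the cone over the quadric the field is - d up to a multiple of the point. The first
  entry of \<open>zorn_v\<close> is not a coordinate of the chart; it is controlled by the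
  derivative of the relation z z = 0.\<close>

lemma null_deriv_sym_field:
  assumes d: "zorn_derivation d"
  shows "null_deriv v (sym_field d v) = lead (d (null_pt v)) *\<^sub>R null_pt v - d (null_pt v)"
proof -
  define z where "z = d (null_pt v)"
  have b: "zorn_b z = - zorn_a z" using zorn_derivation_trace[OF d, of "null_pt v"] by (simp add: z_def)
  have "zorn_mult z (null_pt v) + zorn_mult (null_pt v) z = 0"
    using zorn_derivation_mult[OF d, of "null_pt v" "null_pt v"] null_pt_square[of v]
      linear_0[OF zorn_derivation_linear[OF d]] by (simp add: z_def)
  then have "zorn_v z $ 1 = - 2 * v$3 * zorn_a z - zorn_u z $ 1 * (- ((v$3)^2) - v$4 * v$1 - v$5 * v$2)
      - v$4 * zorn_v z $ 2 - zorn_u z $ 2 * v$1 - v$5 * zorn_v z $ 3 - zorn_u z $ 3 * v$2"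
    by (cases z) (simp add: zorn_eq_iff null_pt_def zorn_mult_def inner_vec_def sum_3 vector_3 zero_prod_def, argo)
  then show ?thesis
    unfolding sym_field_def z_def[symmetric]
    by (simp add: zorn_eq_iff null_pt_def null_deriv_def chart_def lead_def vector_3 b)
      (simp add: algebra_simps power2_eq_square)
qed

lemma has_derivative_sym_field:
  assumes "linear d"
  shows "(sym_field d has_derivative (\<lambda>w. lead (d (null_deriv v w)) *\<^sub>R v + lead (d (null_pt v)) *\<^sub>R w
    - chart (d (null_deriv v w)))) (at v)"
proof -
  have d: "bounded_linear d" using assms linear_conv_bounded_linear by blast
  note D = bounded_linear.has_derivative[OF d has_derivative_null_pt]
  show ?thesis
    unfolding sym_field_def[abs_def]
    by (rule has_derivative_eq_rhs)
      (rule has_derivative_diff has_derivative_scaleR has_derivative_ident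
        bounded_linear.has_derivative[OF bounded_linear_lead D] bounded_linear.has_derivative[OF bounded_linear_chart D]
        | simp add: add.commute)+
qed

lemma vf_bracket_sym_field:
  assumes d: "zorn_derivation d" and e: "zorn_derivation e"
  shows "vf_bracket (sym_field d) (sym_field e) v = sym_field (\<lambda>z. d (e z) - e (d z)) v"
proof -
  note ld = zorn_derivation_linear[OF d] and le = zorn_derivation_linear[OF e]
  define z where "z = null_pt v"
  have D: "frechet_derivative (sym_field c) (at v) = (\<lambda>w. lead (c (null_deriv v w)) *\<^sub>R v + lead (c z) *\<^sub>R w
    - chart (c (null_deriv v w)))" if "linear c" for c
    using frechet_derivative_at[OF has_derivative_sym_field[OF that]] by (simp add: z_def)
  note n = null_deriv_sym_field[of _ v, folded z_def]
  note l = linear_diff linear_cmul linear_add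
  show ?thesis
    unfolding vf_bracket_def D[OF ld] D[OF le] n[OF d] n[OF e]
    by (simp add: l[OF ld] l[OF le] l[OF linear_lead] l[OF linear_chart] sym_field_def z_def[symmetric])
      (simp add: algebra_simps)
qed

text \<open>Where the field vanishes, every point of the cone is an eigenvector of \<open>d\<close>.
  Along a line in the chart this is a polynomial identity, and its coefficients show that
  \<open>d\<close> is a scalar \<open>c\<close> on the imaginary octonions. A derivation sends (1,
  0, 0, -1) to an element with zero diagonal, so c = 0, and it annihilates the unit.\<close>

lemma sym_field_eq_0_imp:
  assumes d: "zorn_derivation d" and U: "open U" "v \<in> U" and z: "\<And>v. v \<in> U \<Longrightarrow> sym_field d v = 0"
  shows "d = (\<lambda>z. 0)"
proof -
  note lin = zorn_derivation_linear[OF d]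
  define n :: zorn where "n = (0, 0, vector [1, 0, 0], 0)"
  have eig: "d (null_pt u) = lead (d (null_pt u)) *\<^sub>R null_pt u" if "u \<in> U" for u
    using null_deriv_sym_field[OF d, of u] z[OF that] by (simp add: null_deriv_def zorn_eq_iff vector_3)
  define c where "c = lead (d (null_pt v))"
  have *: "lead (d (null_deriv v w)) = 0 \<and> d (null_deriv v w) = c *\<^sub>R null_deriv v w
      \<and> q w *\<^sub>R d n = (c * q w) *\<^sub>R n" if q: "\<And>w. q w = - ((w$3)^2) - w$4 * w$1 - w$5 * w$2" for w q
  proof (cases "w = 0")
    case True
    moreover have "null_deriv v 0 = 0" by (simp add: null_deriv_def zorn_eq_iff vector_3)
    ultimately show ?thesis using q[of w] linear_0[OF lin] linear_0[OF linear_lead] by simp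
  next
    case False
    obtain r where r: "r > 0" "ball v r \<subseteq> U" using U openE by blast
    \<comment> \<open>Exact, since \<open>null_pt\<close> is quadratic; its quadratic part only
      affects the entry spanned by \<open>n\<close>.\<close>
    have line: "null_pt (v + t *\<^sub>R w) = null_pt v + t *\<^sub>R null_deriv v w + (t^2 * q w) *\<^sub>R n" for t
      by (simp add: zorn_eq_iff null_pt_def null_deriv_def vector_3 n_def q) (simp add: algebra_simps power2_eq_square)
    let ?z0 = "null_pt v" and ?z1 = "null_deriv v w"
    define c1 where "c1 = lead (d ?z1)"
    define c2 where "c2 = q w * lead (d n)"
    \<comment> \<open>Small enough that the four parameters \<open>s\<close>, - \<open>s\<close>, 2
      \<open>s\<close> and - 2 \<open>s\<close> used in \<open>coef\<close> keep the line inside the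
      ball.\<close>
    define s where "s = r / (3 * norm w)"
    have s: "s > 0" using r False by (simp add: s_def)
    have E: "d ?z0 + t *\<^sub>R d ?z1 + (t^2 * q w) *\<^sub>R d n
        = (c + t * c1 + t^2 * c2) *\<^sub>R (?z0 + t *\<^sub>R ?z1 + (t^2 * q w) *\<^sub>R n)" if "\<bar>t\<bar> \<le> 2 * s" for t
    proof -
      have "norm (t *\<^sub>R w) < r" using that r False by (simp add: s_def field_simps) 
      then have "v + t *\<^sub>R w \<in> U" using r(2) by (auto simp: dist_norm)
      from eig[OF this] show ?thesis
        unfolding line by (simp add: linear_add[OF lin] linear_cmul[OF lin] linear_add[OF linear_lead]
            linear_cmul[OF linear_lead] c_def c1_def c2_def)
    qed
    have z0: "d ?z0 = c *\<^sub>R ?z0" using eig[OF U(2)] by (simp add: c_def)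
    \<comment> \<open>The coefficients of t, t^2, t^3 and t^4 in \<open>E\<close>; the constant term
      is \<open>z0\<close>.\<close>
    define A where "A = d ?z1 - c *\<^sub>R ?z1 - c1 *\<^sub>R ?z0"
    define B where "B = q w *\<^sub>R d n - (c * q w) *\<^sub>R n - c1 *\<^sub>R ?z1 - c2 *\<^sub>R ?z0"
    define C where "C = - (c1 * q w) *\<^sub>R n - c2 *\<^sub>R ?z1"
    define D where "D = - (c2 * q w) *\<^sub>R n"
    have P: "A + t *\<^sub>R B + t^2 *\<^sub>R C + t^3 *\<^sub>R D = 0" if "\<bar>t\<bar> \<le> 2 * s" "t \<noteq> 0" for t
    proof -
      have "t *\<^sub>R (A + t *\<^sub>R B + t^2 *\<^sub>R C + t^3 *\<^sub>R D) = 0"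
        using E[OF that(1)] unfolding A_def B_def C_def D_def z0
        by (simp add: algebra_simps power2_eq_square power3_eq_cube)
      then show ?thesis using that(2) by simp
    qed
    have coef: "a = 0 \<and> b = 0 \<and> e = 0 \<and> f = 0"
      if "\<And>t. \<bar>t\<bar> \<le> 2 * s \<Longrightarrow> t \<noteq> 0 \<Longrightarrow> a + t * b + t^2 * e + t^3 * f = 0" for a b e f :: real
    proof -
      note h = that[of s] that[of "-s"] that[of "2 * s"] that[of "- 2 * s"]
      have 1: "a + s * b + s^2 * e + s^3 * f = 0" "a - s * b + s^2 * e - s^3 * f = 0"
        "a + 2 * s * b + 4 * s^2 * e + 8 * s^3 * f = 0" "a - 2 * s * b + 4 * s^2 * e - 8 * s^3 * f = 0"
        using h s by (simp_all add: power2_eq_square power3_eq_cube algebra_simps)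
      then have "a = 0" "s * b = 0" "s^2 * e = 0" "s^3 * f = 0" by linarith+
      then show ?thesis using s by simp
    qed
    have ABCD: "A \<bullet> b = 0 \<and> B \<bullet> b = 0 \<and> C \<bullet> b = 0 \<and> D \<bullet> b = 0" for b
    proof (rule coef)
      fix t assume "\<bar>t\<bar> \<le> 2 * s" "t \<noteq> 0"
      from arg_cong[OF P[OF this], of "\<lambda>z. z \<bullet> b"]
      show "A \<bullet> b + t * (B \<bullet> b) + t\<^sup>2 * (C \<bullet> b) + t ^ 3 * (D \<bullet> b) = 0"
        by (simp add: inner_add_left)
    qed
    then have zero: "A = 0" "B = 0" "C = 0" "D = 0" by (metis inner_eq_zero_iff)+
    have "chart C = - c2 *\<^sub>R w"
      unfolding C_def by (simp add: linear_diff[OF linear_chart] linear_cmul[OF linear_chart])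
        (simp add: n_def chart_def vec5_eq_iff vector_3)
    then have c2: "c2 = 0" using zero False linear_0[OF linear_chart] by simp
    then have "c1 * q w = 0" using zero(3) by (simp add: C_def n_def zorn_eq_iff vector_3 zero_prod_def)
    have "chart B = q w *\<^sub>R chart (d n) - c1 *\<^sub>R w"
      unfolding B_def c2 by (simp add: linear_diff[OF linear_chart] linear_cmul[OF linear_chart])
        (simp add: n_def chart_def vec5_eq_iff vector_3)
    then have c1: "c1 = 0" using zero(2) \<open>c1 * q w = 0\<close> False linear_0[OF linear_chart] by (cases "q w = 0") auto
    show ?thesis using zero(1,2) c1 c2 by (simp add: A_def B_def c1_def)
  qed
  define q where "q = (\<lambda>w::real^5. - ((w$3)^2) - w$4 * w$1 - w$5 * w$2)"
  note st = *[of q, unfolded q_def, OF refl]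
  \<comment> \<open>For this direction the quadratic term is -1, so its factor can be
    cancelled.\<close>
  have dn: "d n = c *\<^sub>R n"
    using st[of "vec5 0 0 1 0 0"] by simp
  have d1: "d (null_deriv v w) = c *\<^sub>R null_deriv v w" for w using st[of w] by simp
  have d0: "d (null_pt v) = c *\<^sub>R null_pt v" using eig[OF U(2)] by (simp add: c_def)
  \<comment> \<open>The point, its derivatives and \<open>n\<close> together span the imaginary
    octonions.\<close>
  have im: "d z = c *\<^sub>R z" if "zorn_b z = - zorn_a z" for z
  proof -
    let ?w = "chart z - lead z *\<^sub>R v"
    have "\<exists>k. z = lead z *\<^sub>R null_pt v + null_deriv v ?w + k *\<^sub>R n"
      using that
      by (intro exI[of _ "zorn_v z $ 1 - lead z * zorn_v (null_pt v) $ 1 - zorn_v (null_deriv v ?w) $ 1"])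
        (simp add: zorn_eq_iff n_def null_pt_def null_deriv_def chart_def lead_def vector_3)
    then obtain k where k: "z = lead z *\<^sub>R null_pt v + null_deriv v ?w + k *\<^sub>R n" ..
    have "d z = c *\<^sub>R (lead z *\<^sub>R null_pt v + null_deriv v ?w + k *\<^sub>R n)"
      by (subst k) (simp add: linear_add[OF lin] linear_cmul[OF lin] d0 d1 dn scaleR_add_right mult.commute)
    then show ?thesis using k by simp
  qed
  obtain p r where e: "d (1, 0, 0, 0) = (0, p, r, 0)" and f: "d (0, 0, 0, 1) = (0, - p, - r, 0)"
    using zorn_derivation_idempotent[OF d] .
  have one: "d (1, 0, 0, 1) = 0"
    using linear_add[OF lin, of "(1, 0, 0, 0)" "(0, 0, 0, 1)"] by (simp add: e f zero_prod_def)
  have "d ((1, 0, 0, -1) :: zorn) = c *\<^sub>R (1, 0, 0, -1)" by (rule im) simp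
  moreover have "d ((1, 0, 0, -1) :: zorn) = d (1, 0, 0, 0) - d (0, 0, 0, 1)"
    using linear_diff[OF lin, of "(1, 0, 0, 0)" "(0, 0, 0, 1)"] by simp
  ultimately have "c = 0" by (simp add: e f)
  have "d z = 0" for z
  proof -
    define x where "x = (zorn_a z - zorn_b z) / 2"
    have "z = ((zorn_a z + zorn_b z) / 2) *\<^sub>R (1, 0, 0, 1) + (x, zorn_u z, zorn_v z, - x)"
      by (simp add: prod_eq_iff field_simps x_def)
    then have "d z = ((zorn_a z + zorn_b z) / 2) *\<^sub>R d (1, 0, 0, 1) + d (x, zorn_u z, zorn_v z, - x)"
      by (metis linear_add[OF lin] linear_cmul[OF lin])
    also have "\<dots> = 0" using one \<open>c = 0\<close> im[of "(x, zorn_u z, zorn_v z, - x)"] by (simp add: zero_prod_def)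
    finally show ?thesis .
  qed
  then show ?thesis by auto
qed

lemma sym_field_linear:
  "sym_field (\<lambda>z. d z + e z) v = sym_field d v + sym_field e v"
  "sym_field (\<lambda>z. c *\<^sub>R d z) v = c *\<^sub>R sym_field d v"
  "sym_field (\<lambda>z. d z - e z) v = sym_field d v - sym_field e v"
  by (simp_all add: sym_field_def linear_add[OF linear_lead] linear_add[OF linear_chart]
      linear_cmul[OF linear_lead] linear_cmul[OF linear_chart] linear_diff[OF linear_lead] linear_diff[OF linear_chart]
      algebra_simps)

lemma zorn_derivation_closed:
  assumes "zorn_derivation d" "zorn_derivation e"
  shows "zorn_derivation (\<lambda>z. d z + e z)" "zorn_derivation (\<lambda>z. c *\<^sub>R d z)"
    "zorn_derivation (\<lambda>z. d z - e z)" "zorn_derivation (\<lambda>z. d (e z) - e (d z))"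
proof -
  note l = assms[THEN zorn_derivation_linear] and m = assms[THEN zorn_derivation_mult]
  interpret bounded_bilinear zorn_mult by (rule bounded_bilinear_zorn_mult)
  show "zorn_derivation (\<lambda>z. d z + e z)" "zorn_derivation (\<lambda>z. c *\<^sub>R d z)"
    "zorn_derivation (\<lambda>z. d z - e z)"
    unfolding zorn_derivation_iff
    by (auto intro!: linear_compose_add linear_compose_sub linear_compose_scale_right l
        simp: m add_left add_right diff_left diff_right scaleR_left scaleR_right algebra_simps)
  show "zorn_derivation (\<lambda>z. d (e z) - e (d z))"
    unfolding zorn_derivation_iff
    using linear_compose_sub[OF linear_compose[OF l(2,1)] linear_compose[OF l(1,2)]]
    by (auto simp: o_def m linear_add[OF l(1)] linear_add[OF l(2)] diff_left diff_right)
qed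

section \<open>Flows of the induced fields\<close>

lemma open_box_in_time_space:
  fixes O' :: "(real \<times> 'a::topological_space) set"
  assumes "open O'" "(0, a) \<in> O'"
  obtains \<epsilon> W where "\<epsilon> > 0" "open W" "a \<in> W" "{-\<epsilon><..<\<epsilon>} \<times> W \<subseteq> O'"
proof -
  obtain A W where A: "open A" "open W" "(0, a) \<in> A \<times> W" "A \<times> W \<subseteq> O'"
    by (rule open_prod_elim[OF assms])
  obtain \<epsilon> where "\<epsilon> > 0" "ball 0 \<epsilon> \<subseteq> A" using A openE by blast
  moreover have "{-\<epsilon><..<\<epsilon>} = ball (0::real) \<epsilon>" by (auto simp: dist_real_def)
  ultimately show thesis using that[of \<epsilon> W] A by blast
qed

text \<open>The linear flow exp(- t d) in projective coordinates, with the sign of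
  \<open>sym_field\<close>.\<close>

definition sym_flow :: "(zorn \<Rightarrow> zorn) \<Rightarrow> real \<Rightarrow> real^5 \<Rightarrow> real^5" where
  "sym_flow d t v = (1 / lead (exp_lin d (- t) (null_pt v))) *\<^sub>R chart (exp_lin d (- t) (null_pt v))"

lemma null_pt_sym_flow:
  assumes d: "zorn_derivation d" and "lead (exp_lin d (- t) (null_pt v)) \<noteq> 0"
  shows "null_pt (sym_flow d t v)
    = (1 / lead (exp_lin d (- t) (null_pt v))) *\<^sub>R exp_lin d (- t) (null_pt v)"
  unfolding sym_flow_def
  by (rule chart_projection)
    (use assms(2) in \<open>simp_all add: exp_lin_trace[OF d] null_pt_imaginary exp_lin_mult[OF d] null_pt_square
      linear_0[OF linear_exp_lin[OF zorn_derivation_linear[OF d]]]\<close>)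

lemma has_vector_derivative_sym_flow:
  assumes d: "zorn_derivation d" and l: "lead (exp_lin d (- t) (null_pt v)) \<noteq> 0"
  shows "((\<lambda>t. sym_flow d t v) has_vector_derivative sym_field d (sym_flow d t v)) (at t)"
proof -
  note lin = zorn_derivation_linear[OF d]
  let ?z = "\<lambda>t. exp_lin d (- t) (null_pt v)"
  have z: "(?z has_vector_derivative - d (?z t)) (at t)"
  proof -
    have "(uminus has_real_derivative - 1) (at t)" by (auto intro!: derivative_eq_intros)
    from vector_diff_chain_at[OF this[unfolded has_real_derivative_iff_has_vector_derivative] exp_lin_derivative[OF lin]]
    show ?thesis by (simp add: o_def exp_lin_commute[OF lin])
  qed
  have 1: "((\<lambda>t. lead (?z t)) has_real_derivative - lead (d (?z t))) (at t)"
    using bounded_linear.has_vector_derivative[OF bounded_linear_lead z]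
    by (simp add: has_real_derivative_iff_has_vector_derivative linear_neg[OF linear_lead])
  have 2: "((\<lambda>t. chart (?z t)) has_vector_derivative - chart (d (?z t))) (at t)"
    using bounded_linear.has_vector_derivative[OF bounded_linear_chart z]
    by (simp add: linear_neg[OF linear_chart])
  have 3: "((\<lambda>t. 1 / lead (?z t)) has_real_derivative lead (d (?z t)) / (lead (?z t))^2) (at t)"
    using l by (auto intro!: derivative_eq_intros 1 simp: power2_eq_square)
  have "((\<lambda>t. (1 / lead (?z t)) *\<^sub>R chart (?z t)) has_vector_derivative
     ((1 / lead (?z t)) *\<^sub>R (- chart (d (?z t))) + (lead (d (?z t)) / (lead (?z t))^2) *\<^sub>R chart (?z t))) (at t)"
    by (rule has_vector_derivative_scaleR[OF 3 2])
  moreover have "sym_field d (sym_flow d t v)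
    = (1 / lead (?z t)) *\<^sub>R (- chart (d (?z t))) + (lead (d (?z t)) / (lead (?z t))^2) *\<^sub>R chart (?z t)"
    unfolding sym_field_def null_pt_sym_flow[OF d l]
    by (simp add: linear_cmul[OF lin] linear_cmul[OF linear_lead] linear_cmul[OF linear_chart]
        sym_flow_def power2_eq_square)
  ultimately show ?thesis by (simp add: sym_flow_def[abs_def])
qed

text \<open>On the cone the flow is the automorphism \<open>?E\<close> followed by a rescaling. The
  derivative of the scale factor adds only a multiple of the point, whose square is zero, so
  \<open>?E\<close> carries the product criterion \<open>flat_dist_iff_mult\<close> from
  \<open>v\<close> to its image.\<close>

lemma sym_flow_preserves_flat_dist:
  assumes d: "zorn_derivation d" and W: "open W" "v \<in> W"
    and l: "\<And>v. v \<in> W \<Longrightarrow> lead (exp_lin d (- t) (null_pt v)) \<noteq> 0"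
    and D: "(sym_flow d t has_derivative f) (at v)"
  shows "f ` flat_dist v = flat_dist (sym_flow d t v)"
proof -
  note lin = zorn_derivation_linear[OF d] and linE = linear_exp_lin[OF zorn_derivation_linear[OF d]]
  let ?E = "exp_lin d (- t)"
  let ?r = "\<lambda>v. 1 / lead (?E (null_pt v))"
  have bE: "bounded_linear ?E" using linE linear_conv_bounded_linear by blast
  have E: "((\<lambda>v. ?E (null_pt v)) has_derivative (\<lambda>w. ?E (null_deriv v w))) (at v)"
    by (rule bounded_linear.has_derivative[OF bE has_derivative_null_pt])
  obtain r' where r': "(?r has_derivative r') (at v)"
    using has_derivative_divide[OF has_derivative_const[of 1] bounded_linear.has_derivative[OF bounded_linear_lead E] l[OF W(2)]]
    by blast
  have 1: "((\<lambda>v. null_pt (sym_flow d t v)) has_derivative (\<lambda>w. null_deriv (sym_flow d t v) (f w))) (at v)"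
    using diff_chain_at[OF D has_derivative_null_pt] by (simp add: o_def)
  have "((\<lambda>v. ?r v *\<^sub>R ?E (null_pt v)) has_derivative
      (\<lambda>w. ?r v *\<^sub>R ?E (null_deriv v w) + r' w *\<^sub>R ?E (null_pt v))) (at v)"
    by (rule has_derivative_scaleR[OF r' E])
  then have "((\<lambda>v. null_pt (sym_flow d t v)) has_derivative
      (\<lambda>w. ?r v *\<^sub>R ?E (null_deriv v w) + r' w *\<^sub>R ?E (null_pt v))) (at v)"
    by (rule has_derivative_transform_within_open[OF _ W]) (simp add: null_pt_sym_flow[OF d l])
  then have "(\<lambda>w. null_deriv (sym_flow d t v) (f w)) = (\<lambda>w. ?r v *\<^sub>R ?E (null_deriv v w) + r' w *\<^sub>R ?E (null_pt v))"
    using 1 by (rule has_derivative_unique[rotated])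
  from fun_cong[OF this] have eq: "null_deriv (sym_flow d t v) (f w) = ?r v *\<^sub>R ?E (null_deriv v w) + r' w *\<^sub>R ?E (null_pt v)" for w
    by simp
  interpret zm: bounded_bilinear zorn_mult by (rule bounded_bilinear_zorn_mult)
  have E0: "z = 0" if "?E z = 0" for z
    using exp_lin_minus(2)[OF lin, of t z] that linear_0[OF linear_exp_lin[OF lin, of t]] by simp
  have iff: "f w \<in> flat_dist (sym_flow d t v) \<longleftrightarrow> w \<in> flat_dist v" for w
  proof -
    have "zorn_mult (null_pt (sym_flow d t v)) (null_deriv (sym_flow d t v) (f w))
      = (?r v * ?r v) *\<^sub>R ?E (zorn_mult (null_pt v) (null_deriv v w))"
      unfolding null_pt_sym_flow[OF d l[OF W(2)]] eq
      by (simp add: zm.add_right zm.scaleR_left zm.scaleR_right exp_lin_mult[OF d] null_pt_square linear_0[OF linE])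
    moreover have "?E z = 0 \<longleftrightarrow> z = 0" for z
      using E0[of z] linear_0[OF linE] by auto
    ultimately show ?thesis
      using l[OF W(2)] by (simp add: flat_dist_iff_mult)
  qed
  have linf: "linear f" using D has_derivative_linear by blast
  \<comment> \<open>Bijectivity turns the equivalence \<open>iff\<close> into an equality of
    subspaces.\<close>
  have "inj f"
    unfolding linear_injective_0[OF linf]
  proof (intro allI impI)
    fix w assume "f w = 0"
    moreover have "null_deriv u 0 = 0" for u by (simp add: null_deriv_def zorn_eq_iff vector_3)
    ultimately have "?E (?r v *\<^sub>R null_deriv v w + r' w *\<^sub>R null_pt v) = 0"
      using eq[of w] by (simp add: linear_add[OF linE] linear_cmul[OF linE])
    then have *: "?r v *\<^sub>R null_deriv v w + r' w *\<^sub>R null_pt v = 0"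
      by (rule E0)
    from arg_cong[OF *, of lead] have "r' w = 0"
      by (simp add: linear_add[OF linear_lead] linear_cmul[OF linear_lead] linear_0[OF linear_lead])
    with arg_cong[OF *, of chart] l[OF W(2)] show "w = 0"
      by (simp add: linear_add[OF linear_chart] linear_cmul[OF linear_chart] linear_0[OF linear_chart])
  qed
  then have "surj f" using linear_injective_imp_surjective[OF linf] by blast
  show ?thesis
  proof
    show "f ` flat_dist v \<subseteq> flat_dist (sym_flow d t v)" using iff by auto
    show "flat_dist (sym_flow d t v) \<subseteq> f ` flat_dist v"
    proof
      fix y assume y: "y \<in> flat_dist (sym_flow d t v)"
      obtain w where "y = f w" using surjD[OF \<open>surj f\<close>, of y] by blast
      then show "y \<in> f ` flat_dist v" using y iff[of w] by simp
    qed
  qed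
qed

lemma infinitesimal_symmetry_sym_field:
  assumes d: "zorn_derivation d" and U: "open U"
  shows "infinitesimal_symmetry_on U flat_dist (sym_field d)"
  unfolding infinitesimal_symmetry_on_def
proof (intro conjI ballI U)
  note lin = zorn_derivation_linear[OF d]
  show "smooth_on U (sym_field d)" by (rule smooth_sym_field[OF lin U])
  fix a assume a: "a \<in> U"
  let ?z = "\<lambda>p. exp_lin d (- fst p) (null_pt (snd p))"
  have sz: "smooth_on UNIV ?z"
  proof -
    have "smooth_on UNIV (\<lambda>p::real \<times> (real^5). null_pt (snd p))"
      by (rule smooth_on_compose[OF open_UNIV open_UNIV _ smooth_null_pt[OF open_UNIV]])
        (simp_all add: smooth_on_bounded_linear[OF bounded_linear_snd])
    then have "smooth_on UNIV (\<lambda>p::real \<times> (real^5). (- fst p, null_pt (snd p)))"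
      by (intro smooth_on_Pair smooth_on_minus smooth_on_fst smooth_on_id open_UNIV)
    from smooth_on_compose[OF open_UNIV open_UNIV this smooth_on_exp_lin[OF lin]]
    show ?thesis by simp
  qed
  define O1 where "O1 = {p. lead (?z p) \<noteq> 0}"
  have "continuous_on UNIV (\<lambda>p. lead (?z p))"
    by (rule smooth_on_continuous_on[OF smooth_on_linear_comp[OF bounded_linear_lead open_UNIV sz]])
  from open_vimage[OF _ this, of "- {0}"]
  have O1: "open O1" by (simp add: O1_def vimage_def open_Compl)
  let ?\<phi> = "\<lambda>p. sym_flow d (fst p) (snd p)"
  have s\<phi>: "smooth_on O1 ?\<phi>"
    unfolding sym_flow_def
    by (intro smooth_on_scaleR smooth_on_divide smooth_on_const smooth_on_linear_comp[OF bounded_linear_lead]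
        smooth_on_linear_comp[OF bounded_linear_chart] smooth_on_subset[OF sz] O1) (auto simp: O1_def)
  define O2 where "O2 = O1 \<inter> ?\<phi> -` U"
  have O2: "open O2"
    unfolding O2_def using continuous_open_preimage[OF smooth_on_continuous_on[OF s\<phi>] O1 U] .
  have "(0, a) \<in> O2"
    using a by (simp add: O2_def O1_def sym_flow_def exp_lin_0[OF lin])
  from open_box_in_time_space[OF O2 this] obtain \<epsilon> W0 where
    \<epsilon>: "\<epsilon> > 0" "open W0" "a \<in> W0" "{-\<epsilon><..<\<epsilon>} \<times> W0 \<subseteq> O2" by blast
  define W where "W = W0 \<inter> U"
  have W: "open W" "a \<in> W" "W \<subseteq> U" and box: "{-\<epsilon><..<\<epsilon>} \<times> W \<subseteq> O2"
    using \<epsilon> U a by (auto simp: W_def)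
  have l: "lead (exp_lin d (- t) (null_pt v)) \<noteq> 0" "sym_flow d t v \<in> U" if "t \<in> {-\<epsilon><..<\<epsilon>}" "v \<in> W" for t v
  proof -
    have "(t, v) \<in> O2" using box that by blast
    then show "lead (exp_lin d (- t) (null_pt v)) \<noteq> 0" "sym_flow d t v \<in> U"
      by (auto simp: O2_def O1_def)
  qed
  have sbox: "smooth_on ({-\<epsilon><..<\<epsilon>} \<times> W) ?\<phi>"
    by (rule smooth_on_subset[OF s\<phi>]) (use box in \<open>auto simp: O2_def\<close>)
  have "local_flow U (sym_field d) \<epsilon> W (sym_flow d)"
    unfolding local_flow_def
    using sbox has_vector_derivative_sym_flow[OF d l(1)] l(2)
    by (auto simp: case_prod_unfold sym_flow_def exp_lin_0[OF lin])
  moreover have "frechet_derivative (sym_flow d t) (at v) ` flat_dist v = flat_dist (sym_flow d t v)"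
    if t: "t \<in> {-\<epsilon><..<\<epsilon>}" and v: "v \<in> W" for t v
  proof (rule sym_flow_preserves_flat_dist[OF d W(1) v l(1)[OF t]])
    have "smooth_on W (\<lambda>v. sym_flow d t v)"
    proof -
      have "smooth_on W (\<lambda>v. (t, v))" by (intro smooth_intros W(1))
      moreover have "(\<lambda>v. (t, v)) ` W \<subseteq> {-\<epsilon><..<\<epsilon>} \<times> W" using t by auto
      ultimately have "smooth_on W (\<lambda>v. ?\<phi> (t, v))"
        by (rule smooth_on_compose[OF W(1) open_Times[OF open_greaterThanLessThan W(1)] _ sbox])
      then show ?thesis by simp
    qed
    then show "(sym_flow d t has_derivative frechet_derivative (sym_flow d t) (at v)) (at v)"
      using smooth_on_has_derivative[OF _ W(1) v] by blast
  qed
  ultimately show "\<exists>\<epsilon> W \<phi>. \<epsilon> > 0 \<and> open W \<and> a \<in> W \<and> W \<subseteq> U \<and> local_flow U (sym_field d) \<epsilon> W \<phi> \<and>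
      (\<forall>v\<in>W. \<forall>t\<in>{-\<epsilon><..<\<epsilon>}. frechet_derivative (\<phi> t) (at v) ` flat_dist v = flat_dist (\<phi> t v))"
    using \<epsilon>(1) W by blast
qed

section \<open>Symmetries of the flat model come from derivations\<close>

text \<open>The derivative at time zero of the statement that the flow preserves the distribution; \<open>A\<close> is a
  field of linear forms annihilating it.\<close>

lemma symmetry_linearization:
  fixes X :: "('n::finite) vfield" and A :: "real^'n \<Rightarrow> real^'n \<Rightarrow> real"
  assumes sym: "infinitesimal_symmetry_on U D X" and a: "a \<in> U" and w: "w \<in> D a"
    and A: "\<And>v y. v \<in> U \<Longrightarrow> y \<in> D v \<Longrightarrow> A v y = 0"
    and A': "((\<lambda>p. A (fst p) (snd p)) has_derivative A') (at (a, w))"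
  shows "A' (X a, frechet_derivative X (at a) w) = 0"
proof -
  have U: "open U" and sX: "smooth_on U X" using sym by (auto simp: infinitesimal_symmetry_on_def)
  obtain \<epsilon> W \<phi> where \<epsilon>: "\<epsilon> > 0" and W: "open W" "a \<in> W" "W \<subseteq> U" and fl: "local_flow U X \<epsilon> W \<phi>"
    and pres: "\<And>v t. v \<in> W \<Longrightarrow> t \<in> {-\<epsilon><..<\<epsilon>} \<Longrightarrow> frechet_derivative (\<phi> t) (at v) ` D v = D (\<phi> t v)"
    using sym a unfolding infinitesimal_symmetry_on_def by meson
  define S where "S = {-\<epsilon><..<\<epsilon>} \<times> W"
  define G where "G = (\<lambda>p. \<phi> (fst p) (snd p))"
  have S: "open S" and S0: "(0, a) \<in> S" unfolding S_def using W \<epsilon> by (auto intro: open_Times)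
  have G: "smooth_on S G"
    using fl by (simp add: local_flow_def S_def G_def case_prod_unfold)
  have G0: "G (0, v) = v" if "v \<in> W" for v using fl that by (simp add: local_flow_def G_def)
  have inU: "G p \<in> U" and vd: "((\<lambda>\<tau>. \<phi> \<tau> (snd p)) has_vector_derivative X (G p)) (at (fst p))" if "p \<in> S" for p
    using fl that by (auto simp: local_flow_def G_def S_def)
  note dG = smooth_on_has_derivative[OF G S]
  have part1: "frechet_derivative G (at p) (1, 0) = X (G p)" if p: "p \<in> S" for p
  proof -
    have "((\<lambda>\<tau>. (\<tau>, snd p)) has_derivative (\<lambda>h. (h, 0))) (at (fst p))"
      by (auto intro!: derivative_eq_intros)
    from diff_chain_at[OF this, of G] dG[OF p]
    have "((\<lambda>\<tau>. \<phi> \<tau> (snd p)) has_derivative (\<lambda>h. frechet_derivative G (at p) (h, 0))) (at (fst p))"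
      by (simp add: o_def G_def)
    then have "(\<lambda>h. frechet_derivative G (at p) (h, 0)) = (\<lambda>h. h *\<^sub>R X (G p))"
      using vd[OF p] unfolding has_vector_derivative_def by (rule has_derivative_unique)
    from fun_cong[OF this, of 1] show ?thesis by simp
  qed
  have part2: "(\<phi> t has_derivative (\<lambda>y. frechet_derivative G (at (t, v)) (0, y))) (at v)" if "(t, v) \<in> S" for t v
  proof -
    have "((\<lambda>v. (t, v)) has_derivative (\<lambda>h. (0, h))) (at v)"
      by (auto intro!: derivative_eq_intros)
    from diff_chain_at[OF this dG[OF that]] show ?thesis by (simp add: o_def G_def)
  qed
  have id: "frechet_derivative G (at (0, a)) (0, y) = y" for y
  proof -
    have "((\<lambda>v. v) has_derivative (\<lambda>y. frechet_derivative G (at (0, a)) (0, y))) (at a)"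
      by (rule has_derivative_transform_within_open[OF part2[OF S0] W(1,2)])
        (use G0 in \<open>simp add: G_def\<close>)
    from has_derivative_unique[OF this has_derivative_ident] show ?thesis by (rule fun_cong)
  qed
  define H where "H = (\<lambda>p. frechet_derivative G (at p) (0, w))"
  have sH: "smooth_on S H" unfolding H_def by (rule smooth_on_frechet_derivative[OF G])
  \<comment> \<open>Exchanging the derivatives in time and space shows that the time derivative of
    the differential of the flow is the differential of \<open>X\<close>.\<close>
  have "frechet_derivative H (at (0, a)) (1, 0)
      = frechet_derivative (\<lambda>p. frechet_derivative G (at p) (1, 0)) (at (0, a)) (0, w)"
    unfolding H_def by (rule second_derivative_symmetric[OF S S0 G])
  also have "\<dots> = frechet_derivative (\<lambda>p. X (G p)) (at (0, a)) (0, w)"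
    using frechet_derivative_cong_open[OF S S0 part1] by simp
  also have "\<dots> = frechet_derivative X (at a) w"
  proof -
    have "(X has_derivative frechet_derivative X (at a)) (at (G (0, a)))"
      using smooth_on_has_derivative[OF sX U a] G0[OF W(2)] by simp
    from fun_cong[OF frechet_derivative_at[OF diff_chain_at[OF dG[OF S0] this]], of "(0, w)"] id show ?thesis
      by (simp add: o_def)
  qed
  finally have H': "frechet_derivative H (at (0, a)) (1, 0) = frechet_derivative X (at a) w" .
  have c: "((\<lambda>t. (t, a)) has_derivative (\<lambda>h. (h, 0))) (at 0)"
    by (auto intro!: derivative_eq_intros)
  have pa: "((\<lambda>t. G (t, a)) has_derivative (\<lambda>h. frechet_derivative G (at (0, a)) (h, 0))) (at 0)"
    using diff_chain_at[OF c dG[OF S0]] by (simp add: o_def)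
  have pb: "((\<lambda>t. H (t, a)) has_derivative (\<lambda>h. frechet_derivative H (at (0, a)) (h, 0))) (at 0)"
    using diff_chain_at[OF c smooth_on_has_derivative[OF sH S S0]] by (simp add: o_def)
  have "((\<lambda>p. A (fst p) (snd p)) has_derivative A') (at (G (0, a), H (0, a)))"
    using A' id[of w] G0[OF W(2)] by (simp add: H_def)
  from diff_chain_at[OF has_derivative_Pair[OF pa pb] this]
  have "((\<lambda>t. A (G (t, a)) (H (t, a))) has_derivative
      (\<lambda>h. A' (frechet_derivative G (at (0, a)) (h, 0), frechet_derivative H (at (0, a)) (h, 0)))) (at 0)"
    by (simp add: o_def)
  moreover have "A (G (t, a)) (H (t, a)) = 0" if t: "t \<in> {-\<epsilon><..<\<epsilon>}" for t
  proof (rule A)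
    have ta: "(t, a) \<in> S" using t W by (simp add: S_def)
    show "G (t, a) \<in> U" by (rule inU[OF ta])
    have "H (t, a) = frechet_derivative (\<phi> t) (at a) w"
      using frechet_derivative_at[OF part2[OF ta]] by (simp add: H_def fun_eq_iff)
    then show "H (t, a) \<in> D (G (t, a))"
      using pres[OF W(2) t] w by (auto simp: G_def)
  qed
  then have "((\<lambda>t. A (G (t, a)) (H (t, a))) has_derivative (\<lambda>h. 0)) (at 0)"
    using has_derivative_transform_within_open[OF has_derivative_const[of 0 "at 0"], of "{-\<epsilon><..<\<epsilon>}" "\<lambda>t. A (G (t, a)) (H (t, a))"] \<epsilon>
    by simp
  ultimately have "(\<lambda>h. A' (frechet_derivative G (at (0, a)) (h, 0), frechet_derivative H (at (0, a)) (h, 0))) = (\<lambda>h. 0)"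
    by (rule has_derivative_unique)
  from fun_cong[OF this, of 1] show ?thesis
    using part1[OF S0] G0[OF W(2)] by (simp add: H')
qed

lemma flat_symmetry_linearization:
  assumes sym: "infinitesimal_symmetry_on U flat_dist X" and v: "v \<in> U" and w: "w \<in> flat_dist v"
    and y: "y = frechet_derivative X (at v) w"
  shows "y$3 = X v$2 * w$1 + v$2 * y$1 - X v$1 * w$2 - v$1 * y$2"
    and "y$4 = X v$3 * w$2 + v$3 * y$2 - X v$2 * w$3 - v$2 * y$3"
    and "y$5 = X v$1 * w$3 + v$1 * y$3 - X v$3 * w$1 - v$3 * y$1"
proof -
  note s = symmetry_linearization[OF sym v w, folded y]
  have "((\<lambda>p. (snd p)$3 - (fst p)$2 * (snd p)$1 + (fst p)$1 * (snd p)$2) has_derivative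
      (\<lambda>p. (snd p)$3 - ((fst p)$2 * w$1 + v$2 * (snd p)$1) + ((fst p)$1 * w$2 + v$1 * (snd p)$2))) (at (v, w))"
    by (auto intro!: derivative_eq_intros simp: algebra_simps)
  from s[OF _ this] show "y$3 = X v$2 * w$1 + v$2 * y$1 - X v$1 * w$2 - v$1 * y$2"
    by (simp add: flat_dist_def)
  have "((\<lambda>p. (snd p)$4 - (fst p)$3 * (snd p)$2 + (fst p)$2 * (snd p)$3) has_derivative
      (\<lambda>p. (snd p)$4 - ((fst p)$3 * w$2 + v$3 * (snd p)$2) + ((fst p)$2 * w$3 + v$2 * (snd p)$3))) (at (v, w))"
    by (auto intro!: derivative_eq_intros simp: algebra_simps)
  from s[OF _ this] show "y$4 = X v$3 * w$2 + v$3 * y$2 - X v$2 * w$3 - v$2 * y$3"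
    by (simp add: flat_dist_def)
  have "((\<lambda>p. (snd p)$5 - (fst p)$1 * (snd p)$3 + (fst p)$3 * (snd p)$1) has_derivative
      (\<lambda>p. (snd p)$5 - ((fst p)$1 * w$3 + v$1 * (snd p)$3) + ((fst p)$3 * w$1 + v$3 * (snd p)$1))) (at (v, w))"
    by (auto intro!: derivative_eq_intros simp: algebra_simps)
  from s[OF _ this] show "y$5 = X v$1 * w$3 + v$1 * y$3 - X v$3 * w$1 - v$3 * y$1"
    by (simp add: flat_dist_def)
qed

text \<open>\<open>g\<close>, \<open>phi\<close> and \<open>psi\<close> are the coefficients of
  \<open>X\<close> at \<open>e3\<close>, \<open>e4\<close> and \<open>e5\<close>; those at
  \<open>e1\<close> and \<open>e2\<close> are its first two coordinates. The six equations are the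
  linearised invariance evaluated on \<open>e1\<close> and \<open>e2\<close>.\<close>

lemma symmetry_flat_system:
  assumes sym: "infinitesimal_symmetry_on U flat_dist X"
  defines "g \<equiv> \<lambda>v. X v$3 - v$2 * X v$1 + v$1 * X v$2"
  defines "phi \<equiv> \<lambda>v. X v$4 + v$2 * X v$3 - v$3 * X v$2 + v$2 * g v"
  defines "psi \<equiv> \<lambda>v. X v$5 - v$1 * X v$3 + v$3 * X v$1 - v$1 * g v"
  shows "flat_system U phi psi g (\<lambda>v. X v$1) (\<lambda>v. X v$2)"
proof -
  have U: "open U" and sX: "smooth_on U X" using sym by (auto simp: infinitesimal_symmetry_on_def)
  have D: "L = lie_deriv A h v \<Longrightarrow> lie_deriv A h v = L" for L A h and v :: "real^5" by simp
  have main: "lie_deriv e1 phi v = 0" "lie_deriv e2 phi v = 3 * g v"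
      "lie_deriv e1 psi v = -3 * g v" "lie_deriv e2 psi v = 0"
      "lie_deriv e1 g v = 2 * X v$2" "lie_deriv e2 g v = -2 * X v$1" if v: "v \<in> U" for v
  proof -
    let ?D = "frechet_derivative X (at v)"
    note dX = smooth_on_has_derivative[OF sX U v]
    have dg: "(g has_derivative (\<lambda>h. ?D h$3 - (h$2 * X v$1 + v$2 * ?D h$1) + (h$1 * X v$2 + v$1 * ?D h$2))) (at v)"
      unfolding g_def by (auto intro!: derivative_eq_intros dX simp: algebra_simps)
    have dphi: "(phi has_derivative (\<lambda>h. ?D h$4 + (h$2 * X v$3 + v$2 * ?D h$3) - (h$3 * X v$2 + v$3 * ?D h$2)
        + (h$2 * g v + v$2 * (?D h$3 - (h$2 * X v$1 + v$2 * ?D h$1) + (h$1 * X v$2 + v$1 * ?D h$2))))) (at v)"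
      unfolding phi_def by (auto intro!: derivative_eq_intros dX dg simp: algebra_simps)
    have dpsi: "(psi has_derivative (\<lambda>h. ?D h$5 - (h$1 * X v$3 + v$1 * ?D h$3) + (h$3 * X v$1 + v$3 * ?D h$1)
        - (h$1 * g v + v$1 * (?D h$3 - (h$2 * X v$1 + v$2 * ?D h$1) + (h$1 * X v$2 + v$1 * ?D h$2))))) (at v)"
      unfolding psi_def by (auto intro!: derivative_eq_intros dX dg simp: algebra_simps)
    have e: "e1 v \<in> flat_dist v" "e2 v \<in> flat_dist v"
      by (simp_all add: flat_dist_def e1_def e2_def power2_eq_square algebra_simps)
    note c1 = flat_symmetry_linearization[OF sym v e(1) refl] and c2 = flat_symmetry_linearization[OF sym v e(2) refl]
    have n: "e1 v$1 = 1" "e1 v$2 = 0" "e1 v$3 = v$2" "e2 v$1 = 0" "e2 v$2 = 1" "e2 v$3 = - v$1"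
      by (simp_all add: e1_def e2_def)
    show "lie_deriv e1 phi v = 0" "lie_deriv e2 phi v = 3 * g v"
      "lie_deriv e1 psi v = -3 * g v" "lie_deriv e2 psi v = 0"
      "lie_deriv e1 g v = 2 * X v$2" "lie_deriv e2 g v = -2 * X v$1"
      unfolding lie_deriv_eq[OF dg] lie_deriv_eq[OF dphi] lie_deriv_eq[OF dpsi] c1(2,3) c2(2,3)
      unfolding c1(1) c2(1) n g_def
      by (simp_all add: algebra_simps)
  qed
  show ?thesis
    by unfold_locales
      (use main in \<open>auto intro!: smooth_intros U sX simp: g_def phi_def psi_def\<close>)
qed

text \<open>The decomposition of g2 under sl(3): \<open>m\<close> acts on \<open>u\<close> and
  dually on \<open>v\<close>, while \<open>p\<close> and \<open>r\<close> form the image of (1, 0,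
  0, 0). With \<open>m\<close> of trace zero there are 8 + 3 + 3 parameters.\<close>

definition zorn_der :: "real^3 \<Rightarrow> real^3 \<Rightarrow> real^3^3 \<Rightarrow> zorn \<Rightarrow> zorn" where
  "zorn_der p r m = (\<lambda>(a, u, v, b). (- (r \<bullet> u) - p \<bullet> v, (a - b) *\<^sub>R p + m *v u - cross3 v r,
     (a - b) *\<^sub>R r + cross3 p u - transpose m *v v, r \<bullet> u + p \<bullet> v))"

lemma zorn_derivation_zorn_der:
  assumes "m$1$1 = - m$2$2 - m$3$3"
  shows "zorn_derivation (zorn_der p r m)"
  unfolding zorn_derivation_iff
proof (intro conjI allI)
  show "linear (zorn_der p r m)"
    by (rule linearI)
      (auto simp: zorn_der_def zorn_eq_iff inner_vec_def sum_3 cross3_def vector_3 matrix_vector_mult_def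
        transpose_def algebra_simps)
  fix x y :: zorn
  obtain a u v b where x: "x = (a, u, v, b)" by (rule prod_cases4)
  obtain a' u' v' b' where y: "y = (a', u', v', b')" by (rule prod_cases4)
  show "zorn_der p r m (zorn_mult x y) = zorn_mult (zorn_der p r m x) y + zorn_mult x (zorn_der p r m y)"
    unfolding x y zorn_eq_iff
    by (simp add: zorn_der_def zorn_mult_def inner_vec_def sum_3 cross3_def vector_3
        matrix_vector_mult_def transpose_def assms algebra_simps)
qed

lemma flat_symmetry_from_derivation:
  assumes sym: "infinitesimal_symmetry_on U flat_dist X" and b: "b \<in> U"
  obtains d where "zorn_derivation d" "\<forall>\<^sub>F v in nhds b. X v = sym_field d v"
proof -
  have U: "open U" and sX: "smooth_on U X" using sym by (auto simp: infinitesimal_symmetry_on_def)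
  obtain \<delta> where \<delta>: "\<delta> > 0" "ball b \<delta> \<subseteq> U" using U b openE by blast
  define g where "g = (\<lambda>v. X v$3 - v$2 * X v$1 + v$1 * X v$2)"
  define phi where "phi = (\<lambda>v. X v$4 + v$2 * X v$3 - v$3 * X v$2 + v$2 * g v)"
  define psi where "psi = (\<lambda>v. X v$5 - v$1 * X v$3 + v$3 * X v$1 - v$1 * g v)"
  have fs: "flat_system U phi psi g (\<lambda>v. X v$1) (\<lambda>v. X v$2)"
    unfolding phi_def psi_def g_def by (rule symmetry_flat_system[OF sym])
  then interpret B: flat_system U phi psi g "\<lambda>v. X v$1" "\<lambda>v. X v$2" .
  \<comment> \<open>\<open>solution\<close> needs a connected domain, hence the restriction to a
    ball.\<close>
  interpret flat_system "ball b \<delta>" phi psi g "\<lambda>v. X v$1" "\<lambda>v. X v$2"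
    by (rule flat_system.intro[OF open_ball B.smooth_phi[THEN smooth_on_subset] B.smooth_psi[THEN smooth_on_subset]
          B.smooth_g[THEN smooth_on_subset] B.smooth_f1[THEN smooth_on_subset] B.smooth_f2[THEN smooth_on_subset]
          B.L1phi B.L2phi B.L1psi B.L2psi B.L1g B.L2g])
      (use \<delta>(2) in \<open>simp_all add: subset_eq\<close>)
  obtain p1 p2 p3 r1 r2 r3 a12 a13 a21 a22 a23 a31 a32 a33 where sol:
    "\<And>v. v \<in> ball b \<delta> \<Longrightarrow> X v$1 = -1 * v$1 * v$2 * r2 - 2 * v$1 * v$3 * p1 - v$1 * a13 * v$5 + v$1 * a33 + (v$1)^2 * r3 + v$2 * a12 * v$5 - v$2 * a32 + 2 * v$3 * r2 + (v$3)^2 * a12 - p1 * v$5 + p3"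
    "\<And>v. v \<in> ball b \<delta> \<Longrightarrow> X v$2 = v$1 * v$2 * r3 + v$1 * a13 * v$4 - v$1 * a23 - 2 * v$2 * v$3 * p1 - v$2 * a12 * v$4 + v$2 * a22 - (v$2)^2 * r2 + 2 * v$3 * r3 + (v$3)^2 * a13 + p1 * v$4 - p2"
    "\<And>v. v \<in> ball b \<delta> \<Longrightarrow> g v = -1 * v$1 * v$2 * a12 * v$4 + v$1 * v$2 * a13 * v$5 + v$1 * v$2 * a22 - v$1 * v$2 * a33 + 3 * v$1 * v$3 * r3 + v$1 * (v$3)^2 * a13 + 2 * v$1 * p1 * v$4 - 2 * v$1 * p2 + (v$1)^2 * a13 * v$4 - (v$1)^2 * a23 - 3 * v$2 * v$3 * r2 - v$2 * (v$3)^2 * a12 + 2 * v$2 * p1 * v$5 - 2 * v$2 * p3 - (v$2)^2 * a12 * v$5 + (v$2)^2 * a32 - v$3 * a12 * v$4 - v$3 * a13 * v$5 + v$3 * a22 + v$3 * a33 - (v$3)^2 * p1 - r1 - r2 * v$4 - r3 * v$5"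
    "\<And>v. v \<in> ball b \<delta> \<Longrightarrow> phi v = 3 * v$1 * v$2 * v$3 * r3 + v$1 * v$2 * (v$3)^2 * a13 + 3 * v$1 * v$2 * p1 * v$4 - 3 * v$1 * v$2 * p2 - v$1 * (v$2)^2 * a12 * v$4 + v$1 * (v$2)^2 * a13 * v$5 + v$1 * (v$2)^2 * a22 - v$1 * (v$2)^2 * a33 - v$1 * v$3 * a13 * v$4 + v$1 * v$3 * a23 + (v$1)^2 * v$2 * a13 * v$4 - (v$1)^2 * v$2 * a23 - v$2 * v$3 * a12 * v$4 - 2 * v$2 * v$3 * a13 * v$5 + v$2 * v$3 * a22 + 2 * v$2 * v$3 * a33 - 3 * v$2 * r1 - 3 * v$2 * r2 * v$4 - 3 * v$2 * r3 * v$5 - 3 * (v$2)^2 * v$3 * r2 - (v$2)^2 * (v$3)^2 * a12 + 3 * (v$2)^2 * p1 * v$5 - 3 * (v$2)^2 * p3 - (v$2)^3 * a12 * v$5 + (v$2)^3 * a32 - 3 * v$3 * p1 * v$4 + 3 * v$3 * p2 - 3 * (v$3)^2 * r3 - (v$3)^3 * a13 - a12 * (v$4)^2 - a13 * v$4 * v$5 + a21 + 2 * a22 * v$4 + a23 * v$5 + a33 * v$4"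
    "\<And>v. v \<in> ball b \<delta> \<Longrightarrow> psi v = 3 * v$1 * v$2 * v$3 * r2 + v$1 * v$2 * (v$3)^2 * a12 - 3 * v$1 * v$2 * p1 * v$5 + 3 * v$1 * v$2 * p3 + v$1 * (v$2)^2 * a12 * v$5 - v$1 * (v$2)^2 * a32 + 2 * v$1 * v$3 * a12 * v$4 + v$1 * v$3 * a13 * v$5 - 2 * v$1 * v$3 * a22 - v$1 * v$3 * a33 + 3 * v$1 * r1 + 3 * v$1 * r2 * v$4 + 3 * v$1 * r3 * v$5 + (v$1)^2 * v$2 * a12 * v$4 - (v$1)^2 * v$2 * a13 * v$5 - (v$1)^2 * v$2 * a22 + (v$1)^2 * v$2 * a33 - 3 * (v$1)^2 * v$3 * r3 - (v$1)^2 * (v$3)^2 * a13 - 3 * (v$1)^2 * p1 * v$4 + 3 * (v$1)^2 * p2 - (v$1)^3 * a13 * v$4 + (v$1)^3 * a23 + v$2 * v$3 * a12 * v$5 - v$2 * v$3 * a32 - 3 * v$3 * p1 * v$5 + 3 * v$3 * p3 + 3 * (v$3)^2 * r2 + (v$3)^3 * a12 - a12 * v$4 * v$5 - a13 * (v$5)^2 + a22 * v$5 + a31 + a32 * v$4 + 2 * a33 * v$5"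
    by (rule solution[OF connected_ball]) (rule that; simp)
  define d where "d = zorn_der (vector [p1, p2, p3]) (vector [r1, r2, r3])
    (vector [vector [- a22 - a33, a12, a13], vector [a21, a22, a23], vector [a31, a32, a33]])"
  have d: "zorn_derivation d" unfolding d_def by (rule zorn_derivation_zorn_der) (simp add: vector_3)
  \<comment> \<open>\<open>X\<close> is the field that \<open>d\<close> itself induces in the chart;
    \<open>sym_field\<close> has the opposite sign.\<close>
  have "X v = sym_field (\<lambda>z. (- 1) *\<^sub>R d z) v" if v: "v \<in> ball b \<delta>" for v
  proof -
    have X: "X v$3 = g v + v$2 * X v$1 - v$1 * X v$2"
      "X v$4 = phi v - v$2 * g v - v$2 * X v$3 + v$3 * X v$2"
      "X v$5 = psi v + v$1 * g v + v$1 * X v$3 - v$3 * X v$1"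
      by (simp_all add: phi_def psi_def g_def)
    show ?thesis
      unfolding sym_field_linear(2) vec5_eq_iff X(2,3) unfolding X(1) sol[OF v]
      by (simp add: sym_field_def d_def zorn_der_def lead_def chart_def null_pt_def inner_vec_def sum_3
          cross3_def vector_3 matrix_vector_mult_def transpose_def)
        (simp add: algebra_simps power2_eq_square power3_eq_cube)
  qed
  then have "\<forall>\<^sub>F v in nhds b. X v = sym_field (\<lambda>z. (- 1) *\<^sub>R d z) v"
    using \<delta>(1) by (auto simp: eventually_nhds intro!: exI[of _ "ball b \<delta>"])
  then show thesis using that[OF zorn_derivation_closed(2)[OF d d]] by blast
qed

section \<open>Transport of symmetries along diffeomorphisms\<close>

definition diffeo :: "(real^'n::finite) set \<Rightarrow> (real^'n) set \<Rightarrow> (real^'n \<Rightarrow> real^'n) \<Rightarrow> (real^'n \<Rightarrow> real^'n) \<Rightarrow> bool" where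
  "diffeo U V \<Phi> \<Psi> \<longleftrightarrow> open U \<and> open V \<and> smooth_on U \<Phi> \<and> smooth_on V \<Psi> \<and> \<Phi> ` U \<subseteq> V \<and> \<Psi> ` V \<subseteq> U
     \<and> (\<forall>v\<in>U. \<Psi> (\<Phi> v) = v) \<and> (\<forall>w\<in>V. \<Phi> (\<Psi> w) = w)"

definition push :: "(real^'n::finite \<Rightarrow> real^'n) \<Rightarrow> (real^'n \<Rightarrow> real^'n) \<Rightarrow> 'n vfield \<Rightarrow> 'n vfield" where
  "push \<Phi> \<Psi> X w = frechet_derivative \<Phi> (at (\<Psi> w)) (X (\<Psi> w))"

lemma diffeo_sym: "diffeo U V \<Phi> \<Psi> \<Longrightarrow> diffeo V U \<Psi> \<Phi>"
  by (auto simp: diffeo_def)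

context
  fixes U V :: "(real^'n::finite) set" and \<Phi> \<Psi> :: "real^'n \<Rightarrow> real^'n"
  assumes diffeo: "diffeo U V \<Phi> \<Psi>"
begin

lemma diffeoD:
  "open U" "open V" "smooth_on U \<Phi>" "smooth_on V \<Psi>"
  "v \<in> U \<Longrightarrow> \<Phi> v \<in> V" "w \<in> V \<Longrightarrow> \<Psi> w \<in> U" "v \<in> U \<Longrightarrow> \<Psi> (\<Phi> v) = v" "w \<in> V \<Longrightarrow> \<Phi> (\<Psi> w) = w"
  using diffeo by (auto simp: diffeo_def)

lemma diffeo_preimage_open: "open W \<Longrightarrow> open (V \<inter> \<Psi> -` W)"
  using continuous_open_preimage[OF smooth_on_continuous_on[OF diffeoD(4)] diffeoD(2)] .

lemma diffeo_derivative_inverse: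
  assumes v: "v \<in> U"
  shows "frechet_derivative \<Psi> (at (\<Phi> v)) (frechet_derivative \<Phi> (at v) h) = h"
proof -
  have "((\<lambda>v. \<Psi> (\<Phi> v)) has_derivative (\<lambda>h. frechet_derivative \<Psi> (at (\<Phi> v)) (frechet_derivative \<Phi> (at v) h))) (at v)"
    using diff_chain_at[OF smooth_on_has_derivative[OF diffeoD(3,1) v]
        smooth_on_has_derivative[OF diffeoD(4,2) diffeoD(5)[OF v]]] by (simp add: o_def)
  then have "((\<lambda>v. v) has_derivative (\<lambda>h. frechet_derivative \<Psi> (at (\<Phi> v)) (frechet_derivative \<Phi> (at v) h))) (at v)"
    by (rule has_derivative_transform_within_open[OF _ diffeoD(1) v]) (simp add: diffeoD)
  from has_derivative_unique[OF this has_derivative_ident] show ?thesis by (rule fun_cong)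
qed

text \<open>Reduces push-forwards to Lie derivatives of functions, so that smoothness and
  compatibility with brackets follow from the results on those.\<close>

lemma push_nth:
  assumes w: "w \<in> V"
  shows "push \<Phi> \<Psi> X w $ i = lie_deriv X (\<lambda>v. \<Phi> v $ i) (\<Psi> w)"
  using fun_cong[OF frechet_derivative_linear_comp[OF bounded_linear_vec_nth
      smooth_on_differentiable[OF diffeoD(3,1) diffeoD(6)[OF w]]], of i "X (\<Psi> w)"]
  by (simp add: push_def lie_deriv_def)

lemma smooth_push:
  assumes W: "open W" "W \<subseteq> U" and X: "smooth_on W X"
  shows "smooth_on (V \<inter> \<Psi> -` W) (push \<Phi> \<Psi> X)"
proof (rule smooth_on_vecI[OF diffeo_preimage_open[OF W(1)]])
  fix i
  have "smooth_on W (lie_deriv X (\<lambda>v. \<Phi> v $ i))"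
    by (intro smooth_on_lie_deriv W X smooth_on_vec_nth smooth_on_subset[OF diffeoD(3) W(2)])
  then have "smooth_on (V \<inter> \<Psi> -` W) (\<lambda>w. lie_deriv X (\<lambda>v. \<Phi> v $ i) (\<Psi> w))"
    by (rule smooth_on_compose[OF diffeo_preimage_open[OF W(1)] W(1) smooth_on_subset[OF diffeoD(4) Int_lower1]]) auto
  then show "smooth_on (V \<inter> \<Psi> -` W) (\<lambda>w. push \<Phi> \<Psi> X w $ i)"
    by (rule smooth_on_cong[OF diffeo_preimage_open[OF W(1)], rotated]) (simp add: push_nth)
qed

lemma vf_bracket_push:
  assumes W: "open W" "W \<subseteq> U" and X: "smooth_on W X" "smooth_on W Y" and w: "w \<in> V" "\<Psi> w \<in> W"
  shows "vf_bracket (push \<Phi> \<Psi> X) (push \<Phi> \<Psi> Y) w = push \<Phi> \<Psi> (vf_bracket X Y) w"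
proof (rule vec_eq_iff[THEN iffD2], rule allI)
  fix i
  let ?W = "V \<inter> \<Psi> -` W" and ?f = "\<lambda>v. \<Phi> v $ i"
  have oW: "open ?W" and wW: "w \<in> ?W" using diffeo_preimage_open[OF W(1)] w by auto
  have sf: "smooth_on W ?f" by (intro smooth_on_vec_nth W smooth_on_subset[OF diffeoD(3) W(2)])
  have *: "frechet_derivative (push \<Phi> \<Psi> Y) (at w) (push \<Phi> \<Psi> X w) $ i = lie_deriv X (lie_deriv Y ?f) (\<Psi> w)"
    if X: "smooth_on W X" and Y: "smooth_on W Y" for X Y
  proof -
    have dY: "push \<Phi> \<Psi> Y differentiable (at w)"
      by (rule smooth_on_differentiable[OF smooth_push[OF W Y] oW wW])
    have "frechet_derivative (push \<Phi> \<Psi> Y) (at w) (push \<Phi> \<Psi> X w) $ i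
        = frechet_derivative (\<lambda>w. push \<Phi> \<Psi> Y w $ i) (at w) (push \<Phi> \<Psi> X w)"
      using frechet_derivative_linear_comp[OF bounded_linear_vec_nth dY] by simp
    also have "\<dots> = frechet_derivative (\<lambda>w. lie_deriv Y ?f (\<Psi> w)) (at w) (push \<Phi> \<Psi> X w)"
      by (subst frechet_derivative_cong_open[OF oW wW, of "\<lambda>w. push \<Phi> \<Psi> Y w $ i" "\<lambda>w. lie_deriv Y ?f (\<Psi> w)"])
        (simp_all add: push_nth)
    also have "((\<lambda>w. lie_deriv Y ?f (\<Psi> w)) has_derivative
        (\<lambda>h. frechet_derivative (lie_deriv Y ?f) (at (\<Psi> w)) (frechet_derivative \<Psi> (at w) h))) (at w)"
      using diff_chain_at[OF smooth_on_has_derivative[OF diffeoD(4,2) w(1)]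
          smooth_on_has_derivative[OF smooth_on_lie_deriv[OF W(1) Y sf] W(1) w(2)]] by (simp add: o_def)
    from fun_cong[OF frechet_derivative_at[OF this], of "push \<Phi> \<Psi> X w"]
    have "frechet_derivative (\<lambda>w. lie_deriv Y ?f (\<Psi> w)) (at w) (push \<Phi> \<Psi> X w)
      = frechet_derivative (lie_deriv Y ?f) (at (\<Psi> w)) (X (\<Psi> w))"
      using diffeo_derivative_inverse[OF diffeoD(6)[OF w(1)]] diffeoD(8)[OF w(1)] by (simp add: push_def)
    finally show ?thesis by (simp add: lie_deriv_def)
  qed
  have "vf_bracket (push \<Phi> \<Psi> X) (push \<Phi> \<Psi> Y) w $ i
      = lie_deriv X (lie_deriv Y ?f) (\<Psi> w) - lie_deriv Y (lie_deriv X ?f) (\<Psi> w)"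
    unfolding vf_bracket_def using *[OF X] *[OF X(2,1)] by simp
  also have "\<dots> = push \<Phi> \<Psi> (vf_bracket X Y) w $ i"
    using lie_deriv_commutator[OF W(1) w(2) X sf] push_nth[OF w(1), of "vf_bracket X Y" i]
    by (simp add: lie_deriv_def)
  finally show "vf_bracket (push \<Phi> \<Psi> X) (push \<Phi> \<Psi> Y) w $ i = push \<Phi> \<Psi> (vf_bracket X Y) w $ i" .
qed

text \<open>The flow of the pushed field is the original flow conjugated by \<Phi>.\<close>

lemma infinitesimal_symmetry_push:
  assumes sym: "infinitesimal_symmetry_on W D X" and WU: "W \<subseteq> U"
    and DE: "\<And>v. v \<in> U \<Longrightarrow> frechet_derivative \<Phi> (at v) ` D v = E (\<Phi> v)"
  shows "infinitesimal_symmetry_on (V \<inter> \<Psi> -` W) E (push \<Phi> \<Psi> X)"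
  unfolding infinitesimal_symmetry_on_def
proof (intro conjI ballI)
  have W: "open W" and sX: "smooth_on W X" using sym by (auto simp: infinitesimal_symmetry_on_def)
  show "open (V \<inter> \<Psi> -` W)" by (rule diffeo_preimage_open[OF W])
  show "smooth_on (V \<inter> \<Psi> -` W) (push \<Phi> \<Psi> X)" by (rule smooth_push[OF W WU sX])
  fix b assume b: "b \<in> V \<inter> \<Psi> -` W"
  then have "\<Psi> b \<in> W" by simp
  then obtain \<epsilon> Wa \<phi> where \<epsilon>: "\<epsilon> > 0" and Wa: "open Wa" "\<Psi> b \<in> Wa" "Wa \<subseteq> W" and fl: "local_flow W X \<epsilon> Wa \<phi>"
    and pres: "\<And>v t. v \<in> Wa \<Longrightarrow> t \<in> {-\<epsilon><..<\<epsilon>} \<Longrightarrow> frechet_derivative (\<phi> t) (at v) ` D v = D (\<phi> t v)"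
    using sym unfolding infinitesimal_symmetry_on_def by meson
  let ?I = "{-\<epsilon><..<\<epsilon>}"
  define Wb where "Wb = V \<inter> \<Psi> -` Wa"
  define \<theta> where "\<theta> = (\<lambda>t w. \<Phi> (\<phi> t (\<Psi> w)))"
  have Wb: "open Wb" "b \<in> Wb" "Wb \<subseteq> V \<inter> \<Psi> -` W"
    unfolding Wb_def using diffeo_preimage_open[OF Wa(1)] b Wa by auto
  have \<Psi>Wb: "\<Psi> w \<in> Wa" "w \<in> V" if "w \<in> Wb" for w using that by (auto simp: Wb_def)
  have G: "smooth_on (?I \<times> Wa) (\<lambda>p. \<phi> (fst p) (snd p))"
    and \<phi>0: "\<And>v. v \<in> Wa \<Longrightarrow> \<phi> 0 v = v"
    and \<phi>W: "\<And>v t. v \<in> Wa \<Longrightarrow> t \<in> ?I \<Longrightarrow> \<phi> t v \<in> W"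
    and \<phi>': "\<And>v t. v \<in> Wa \<Longrightarrow> t \<in> ?I \<Longrightarrow> ((\<lambda>\<tau>. \<phi> \<tau> v) has_vector_derivative X (\<phi> t v)) (at t)"
    using fl by (auto simp: local_flow_def case_prod_unfold)
  have oI: "open (?I \<times> Wb)" "open (?I \<times> Wa)" by (intro open_Times open_greaterThanLessThan Wb Wa)+
  have "smooth_on (?I \<times> Wb) (\<lambda>p. \<phi> (fst (fst p, \<Psi> (snd p))) (snd (fst p, \<Psi> (snd p))))"
  proof (rule smooth_on_compose[OF oI _ G])
    have "smooth_on (?I \<times> Wb) (\<lambda>p. \<Psi> (snd p))"
      by (rule smooth_on_compose[OF oI(1) diffeoD(2) smooth_on_bounded_linear[OF bounded_linear_snd oI(1)] diffeoD(4)])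
        (auto simp: Wb_def)
    then show "smooth_on (?I \<times> Wb) (\<lambda>p. (fst p, \<Psi> (snd p)))"
      by (intro smooth_on_Pair smooth_on_fst smooth_on_id oI(1))
  qed (auto simp: Wb_def)
  then have "smooth_on (?I \<times> Wb) (\<lambda>p. \<Phi> (\<phi> (fst p) (\<Psi> (snd p))))"
    using smooth_on_compose[OF oI(1) diffeoD(1) _ diffeoD(3)] \<phi>W WU \<Psi>Wb by fastforce
  then have s\<theta>: "smooth_on (?I \<times> Wb) (\<lambda>(t, w). \<theta> t w)"
    by (simp add: \<theta>_def case_prod_unfold)
  have \<Psi>\<theta>: "\<Psi> (\<theta> t w) = \<phi> t (\<Psi> w)" "\<theta> t w \<in> V" "\<phi> t (\<Psi> w) \<in> W" "\<phi> t (\<Psi> w) \<in> U" if "t \<in> ?I" "w \<in> Wb" for t w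
    using \<phi>W[OF \<Psi>Wb(1)[OF that(2)] that(1)] WU diffeoD(5,7) by (auto simp: \<theta>_def)
  have "local_flow (V \<inter> \<Psi> -` W) (push \<Phi> \<Psi> X) \<epsilon> Wb \<theta>"
    unfolding local_flow_def
  proof (intro conjI ballI s\<theta>)
    show "\<theta> 0 w = w" if "w \<in> Wb" for w using \<phi>0[OF \<Psi>Wb(1)[OF that]] \<Psi>Wb(2)[OF that] diffeoD(8) by (simp add: \<theta>_def)
    fix w t assume wt: "w \<in> Wb" "t \<in> ?I"
    show "\<theta> t w \<in> V \<inter> \<Psi> -` W" using \<Psi>\<theta>[OF wt(2,1)] by auto
    have "((\<lambda>\<tau>. \<phi> \<tau> (\<Psi> w)) has_derivative (\<lambda>h. h *\<^sub>R X (\<phi> t (\<Psi> w)))) (at t)"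
      using \<phi>'[OF \<Psi>Wb(1)[OF wt(1)] wt(2)] by (simp add: has_vector_derivative_def)
    moreover have d: "(\<Phi> has_derivative frechet_derivative \<Phi> (at (\<phi> t (\<Psi> w)))) (at (\<phi> t (\<Psi> w)))"
      by (rule smooth_on_has_derivative[OF diffeoD(3,1) \<Psi>\<theta>(4)[OF wt(2,1)]])
    ultimately have "((\<lambda>\<tau>. \<theta> \<tau> w) has_derivative
        (\<lambda>h. frechet_derivative \<Phi> (at (\<phi> t (\<Psi> w))) (h *\<^sub>R X (\<phi> t (\<Psi> w))))) (at t)"
      using diff_chain_at by (fastforce simp: \<theta>_def o_def)
    then show "((\<lambda>\<tau>. \<theta> \<tau> w) has_vector_derivative push \<Phi> \<Psi> X (\<theta> t w)) (at t)"
      unfolding has_vector_derivative_def push_def \<Psi>\<theta>(1)[OF wt(2,1)]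
      by (simp add: linear_cmul[OF has_derivative_linear[OF d]])
  qed
  moreover have "frechet_derivative (\<theta> t) (at w) ` E w = E (\<theta> t w)" if wt: "w \<in> Wb" "t \<in> ?I" for w t
  proof -
    have "smooth_on Wa (\<lambda>v. \<phi> (fst (t, v)) (snd (t, v)))"
      by (rule smooth_on_compose[OF Wa(1) oI(2) _ G]) (use wt Wa(1) in \<open>auto intro!: smooth_intros\<close>)
    then have "((\<lambda>v. \<phi> t v) has_derivative frechet_derivative (\<phi> t) (at (\<Psi> w))) (at (\<Psi> w))"
      using smooth_on_has_derivative[OF _ Wa(1) \<Psi>Wb(1)[OF wt(1)]] by simp
    from diff_chain_at[OF diff_chain_at[OF smooth_on_has_derivative[OF diffeoD(4,2) \<Psi>Wb(2)[OF wt(1)]] this]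
        smooth_on_has_derivative[OF diffeoD(3,1), of "((\<lambda>v. \<phi> t v) \<circ> \<Psi>) w"]]
    have "(\<theta> t has_derivative (\<lambda>h. frechet_derivative \<Phi> (at (\<phi> t (\<Psi> w))) (frechet_derivative (\<phi> t) (at (\<Psi> w)) (frechet_derivative \<Psi> (at w) h)))) (at w)"
      using \<Psi>\<theta>(4)[OF wt(2,1)] by (simp add: \<theta>_def o_def)
    from frechet_derivative_at[OF this, symmetric]
    have "frechet_derivative (\<theta> t) (at w) ` E w = frechet_derivative \<Phi> (at (\<phi> t (\<Psi> w))) `
        frechet_derivative (\<phi> t) (at (\<Psi> w)) ` frechet_derivative \<Psi> (at w) ` E w"
      by (simp add: image_image)
    also have "frechet_derivative \<Psi> (at w) ` E w = D (\<Psi> w)"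
    proof -
      have u: "\<Psi> w \<in> U" "\<Phi> (\<Psi> w) = w" using \<Psi>Wb(2)[OF wt(1)] diffeoD by auto
      from DE[OF u(1)] diffeo_derivative_inverse[OF u(1)] show ?thesis
        unfolding u(2) by (metis (no_types, lifting) image_cong image_ident image_image)
    qed
    also have "frechet_derivative (\<phi> t) (at (\<Psi> w)) ` D (\<Psi> w) = D (\<phi> t (\<Psi> w))"
      by (rule pres[OF \<Psi>Wb(1)[OF wt(1)] wt(2)])
    also have "frechet_derivative \<Phi> (at (\<phi> t (\<Psi> w))) ` D (\<phi> t (\<Psi> w)) = E (\<theta> t w)"
      using DE[OF \<Psi>\<theta>(4)[OF wt(2,1)]] by (simp add: \<theta>_def)
    finally show ?thesis .
  qed
  ultimately show "\<exists>\<epsilon> Wb \<theta>. \<epsilon> > 0 \<and> open Wb \<and> b \<in> Wb \<and> Wb \<subseteq> V \<inter> \<Psi> -` W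
      \<and> local_flow (V \<inter> \<Psi> -` W) (push \<Phi> \<Psi> X) \<epsilon> Wb \<theta>
      \<and> (\<forall>w\<in>Wb. \<forall>t\<in>{-\<epsilon><..<\<epsilon>}. frechet_derivative (\<theta> t) (at w) ` E w = E (\<theta> t w))"
    using \<epsilon> Wb by blast
qed

end

lemma push_push:
  assumes d: "diffeo U V \<Phi> \<Psi>" and v: "v \<in> U"
  shows "push \<Psi> \<Phi> (push \<Phi> \<Psi> X) v = X v"
  using diffeo_derivative_inverse[OF d v] diffeoD(7)[OF d v] by (simp add: push_def)


section \<open>The algebra of germs of symmetries\<close>

lemma vf_germ_eq_iff: "vf_germ a X = vf_germ a Y \<longleftrightarrow> (\<forall>\<^sub>F v in nhds a. X v = Y v)"
proof
  assume "vf_germ a X = vf_germ a Y"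
  moreover have "X \<in> vf_germ a X" by (simp add: vf_germ_def)
  ultimately show "\<forall>\<^sub>F v in nhds a. X v = Y v" by (simp add: vf_germ_def)
next
  assume *: "\<forall>\<^sub>F v in nhds a. X v = Y v"
  have "(\<forall>\<^sub>F v in nhds a. Z v = X v) \<longleftrightarrow> (\<forall>\<^sub>F v in nhds a. Z v = Y v)" for Z
    by (rule eventually_subst) (use * in \<open>auto elim: eventually_mono\<close>)
  then show "vf_germ a X = vf_germ a Y" by (simp add: vf_germ_def)
qed

text \<open>An operation that respects equality near \<open>a\<close> makes all sets in the union
  equal, so the operations of \<open>symmetry_algebra_at\<close> can be computed on any
  representatives.\<close>

lemma vf_germ_lift1:
  assumes "\<And>X'. \<forall>\<^sub>F v in nhds a. X' v = X v \<Longrightarrow> \<forall>\<^sub>F v in nhds a. f X' v = f X v"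
  shows "(\<Union>X'\<in>vf_germ a X. vf_germ a (f X')) = vf_germ a (f X)"
proof -
  have "vf_germ a (f X') = vf_germ a (f X)" if "X' \<in> vf_germ a X" for X'
    using assms that by (simp add: vf_germ_eq_iff) (simp add: vf_germ_def)
  moreover have "X \<in> vf_germ a X" by (simp add: vf_germ_def)
  ultimately show ?thesis by blast
qed

lemma vf_germ_lift2:
  assumes "\<And>X' Y'. \<forall>\<^sub>F v in nhds a. X' v = X v \<Longrightarrow> \<forall>\<^sub>F v in nhds a. Y' v = Y v \<Longrightarrow> \<forall>\<^sub>F v in nhds a. f X' Y' v = f X Y v"
  shows "(\<Union>X'\<in>vf_germ a X. \<Union>Y'\<in>vf_germ a Y. vf_germ a (f X' Y')) = vf_germ a (f X Y)"
proof -
  have "vf_germ a (f X' Y') = vf_germ a (f X Y)" if "X' \<in> vf_germ a X" "Y' \<in> vf_germ a Y" for X' Y'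
    using assms that by (simp add: vf_germ_eq_iff) (simp add: vf_germ_def)
  moreover have "X \<in> vf_germ a X" "Y \<in> vf_germ a Y" by (simp_all add: vf_germ_def)
  ultimately show ?thesis by blast
qed

lemma eventually_vf_bracket_cong:
  assumes "\<forall>\<^sub>F v in nhds a. X' v = X v" "\<forall>\<^sub>F v in nhds a. Y' v = Y v"
  shows "\<forall>\<^sub>F v in nhds a. vf_bracket X' Y' v = vf_bracket X Y v"
proof -
  from eventually_conj[OF assms] obtain S where S: "open S" "a \<in> S" "\<And>v. v \<in> S \<Longrightarrow> X' v = X v \<and> Y' v = Y v"
    by (auto simp: eventually_nhds)
  have "vf_bracket X' Y' v = vf_bracket X Y v" if v: "v \<in> S" for v
  proof -
    have "frechet_derivative X' (at v) = frechet_derivative X (at v)" "frechet_derivative Y' (at v) = frechet_derivative Y (at v)"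
      by (rule frechet_derivative_cong_open[OF S(1) v]; use S(3) in simp)+
    then show ?thesis using S(3)[OF v] by (simp add: vf_bracket_def)
  qed
  then show ?thesis using S(1,2) by (auto simp: eventually_nhds)
qed

lemma symmetry_algebra_germ_operations:
  "lie_add (symmetry_algebra_at M D a) (vf_germ a X) (vf_germ a Y) = vf_germ a (\<lambda>v. X v + Y v)"
  "lie_scale (symmetry_algebra_at M D a) c (vf_germ a X) = vf_germ a (\<lambda>v. c *\<^sub>R X v)"
  "lie_bracket (symmetry_algebra_at M D a) (vf_germ a X) (vf_germ a Y) = vf_germ a (vf_bracket X Y)"
proof -
  have "(\<Union>X'\<in>vf_germ a X. \<Union>Y'\<in>vf_germ a Y. vf_germ a (\<lambda>v. X' v + Y' v)) = vf_germ a (\<lambda>v. X v + Y v)"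
    by (rule vf_germ_lift2[where f="\<lambda>X Y v. X v + Y v"]) (auto elim: eventually_elim2)
  then show "lie_add (symmetry_algebra_at M D a) (vf_germ a X) (vf_germ a Y) = vf_germ a (\<lambda>v. X v + Y v)"
    by (simp add: symmetry_algebra_at_def)
  have "(\<Union>X'\<in>vf_germ a X. vf_germ a (\<lambda>v. c *\<^sub>R X' v)) = vf_germ a (\<lambda>v. c *\<^sub>R X v)"
    by (rule vf_germ_lift1[where f="\<lambda>X v. c *\<^sub>R X v"]) (auto elim: eventually_mono)
  then show "lie_scale (symmetry_algebra_at M D a) c (vf_germ a X) = vf_germ a (\<lambda>v. c *\<^sub>R X v)"
    by (simp add: symmetry_algebra_at_def)
  have "(\<Union>X'\<in>vf_germ a X. \<Union>Y'\<in>vf_germ a Y. vf_germ a (vf_bracket X' Y')) = vf_germ a (vf_bracket X Y)"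
    by (rule vf_germ_lift2[where f=vf_bracket]) (rule eventually_vf_bracket_cong)
  then show "lie_bracket (symmetry_algebra_at M D a) (vf_germ a X) (vf_germ a Y) = vf_germ a (vf_bracket X Y)"
    by (simp add: symmetry_algebra_at_def)
qed

text \<open>The isomorphism is easier to define on \<open>K\<close>, whose elements are maps, than
  on germs. Closure of \<open>K\<close> under its operations lets the inverse respect them.\<close>

lemma lie_isomorphic_inverseI:
  assumes bij: "bij_betw k (lie_carrier K) (lie_carrier L)"
    and closed: "\<And>x y c. x \<in> lie_carrier K \<Longrightarrow> y \<in> lie_carrier K \<Longrightarrow> lie_add K x y \<in> lie_carrier K
      \<and> lie_bracket K x y \<in> lie_carrier K \<and> lie_scale K c x \<in> lie_carrier K"
    and hom: "\<And>x y c. x \<in> lie_carrier K \<Longrightarrow> y \<in> lie_carrier K \<Longrightarrow> k (lie_add K x y) = lie_add L (k x) (k y)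
      \<and> k (lie_bracket K x y) = lie_bracket L (k x) (k y) \<and> k (lie_scale K c x) = lie_scale L c (k x)"
  shows "lie_isomorphic L K"
  unfolding lie_isomorphic_def
proof (intro exI conjI ballI allI)
  let ?h = "inv_into (lie_carrier K) k"
  have inj: "inj_on k (lie_carrier K)" and im: "k ` lie_carrier K = lie_carrier L"
    using bij by (auto simp: bij_betw_def)
  show "bij_betw ?h (lie_carrier L) (lie_carrier K)" by (rule bij_betw_inv_into[OF bij])
  have h: "?h (k x) = x" if "x \<in> lie_carrier K" for x by (rule inv_into_f_f[OF inj that])
  fix x assume "x \<in> lie_carrier L"
  then obtain x' where x: "x' \<in> lie_carrier K" "x = k x'" using im by auto
  show "?h (lie_scale L c x) = lie_scale K c (?h x)" for c
    using hom[OF x(1) x(1), of c] closed[OF x(1) x(1), of c] h x by metis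
  fix y assume "y \<in> lie_carrier L"
  then obtain y' where y: "y' \<in> lie_carrier K" "y = k y'" using im by auto
  show "?h (lie_add L x y) = lie_add K (?h x) (?h y)" "?h (lie_bracket L x y) = lie_bracket K (?h x) (?h y)"
    using hom[OF x(1) y(1)] closed[OF x(1) y(1)] h x y by metis+
qed

text \<open>A derivation is sent to the germ of its induced field, carried back to \<open>M\<close>
  by \<Psi>. Injectivity is \<open>sym_field_eq_0_imp\<close> and surjectivity is
  \<open>flat_symmetry_from_derivation\<close>, both applied near the image of
  \<open>a\<close>.\<close>

theorem symmetry_algebra_isomorphic_split_g2:
  assumes d: "diffeo M V \<Phi> \<Psi>" and a: "a \<in> M"
    and DE: "\<And>v. v \<in> M \<Longrightarrow> frechet_derivative \<Phi> (at v) ` D v = flat_dist (\<Phi> v)"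
  shows "lie_isomorphic (symmetry_algebra_at M D a) split_g2"
proof (rule lie_isomorphic_inverseI)
  note dD = diffeoD[OF d] and d' = diffeo_sym[OF d]
  define k where "k = (\<lambda>c. vf_germ a (push \<Psi> \<Phi> (sym_field c)))"
  have ED: "frechet_derivative \<Psi> (at w) ` flat_dist w = D (\<Psi> w)" if w: "w \<in> V" for w
    using DE[OF dD(6)[OF w]] diffeo_derivative_inverse[OF d dD(6)[OF w]]
    unfolding dD(8)[OF w] by (metis (no_types, lifting) image_cong image_ident image_image)
  have pre: "M \<inter> \<Phi> -` V = M" using dD(5) by auto
  have ka: "k c \<in> lie_carrier (symmetry_algebra_at M D a)" if c: "zorn_derivation c" for c
  proof -
    have "infinitesimal_symmetry_on M D (push \<Psi> \<Phi> (sym_field c))"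
      using infinitesimal_symmetry_push[OF d' infinitesimal_symmetry_sym_field[OF c dD(2)] order_refl ED]
      by (simp add: pre)
    then show ?thesis using a by (auto simp: k_def symmetry_algebra_at_def)
  qed
  show "bij_betw k (lie_carrier split_g2) (lie_carrier (symmetry_algebra_at M D a))"
    unfolding bij_betw_def
  proof (intro conjI inj_onI equalityI subsetI)
    fix c e assume c: "zorn_derivation c" and e: "zorn_derivation e" and "k c = k e"
    then have "\<forall>\<^sub>F v in nhds a. push \<Psi> \<Phi> (sym_field c) v = push \<Psi> \<Phi> (sym_field e) v"
      by (simp add: k_def vf_germ_eq_iff)
    then obtain S where S: "open S" "a \<in> S" "\<And>v. v \<in> S \<Longrightarrow> push \<Psi> \<Phi> (sym_field c) v = push \<Psi> \<Phi> (sym_field e) v"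
      by (auto simp: eventually_nhds)
    have "sym_field c w = sym_field e w" if w: "w \<in> V \<inter> \<Psi> -` S" for w
    proof -
      have "push \<Phi> \<Psi> (push \<Psi> \<Phi> (sym_field c)) w = push \<Phi> \<Psi> (push \<Psi> \<Phi> (sym_field e)) w"
        using S(3)[of "\<Psi> w"] w by (simp add: push_def[of \<Phi>])
      then show ?thesis using push_push[OF d'] w by simp
    qed
    then have "sym_field (\<lambda>z. c z - e z) w = 0" if "w \<in> V \<inter> \<Psi> -` S" for w
      using that by (simp add: sym_field_linear(3))
    moreover have "\<Phi> a \<in> V \<inter> \<Psi> -` S" using a S dD(5,7) by simp
    ultimately have "(\<lambda>z. c z - e z) = (\<lambda>z. 0)"
      using sym_field_eq_0_imp[OF zorn_derivation_closed(3)[OF c e] diffeo_preimage_open[OF d S(1)]] by blast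
    then show "c = e" by (metis eq_iff_diff_eq_0 ext)
  next
    show "A \<in> lie_carrier (symmetry_algebra_at M D a)" if "A \<in> k ` lie_carrier split_g2" for A using ka that by auto
  next
    fix A assume "A \<in> lie_carrier (symmetry_algebra_at M D a)"
    then obtain X W where A: "A = vf_germ a X" and W: "a \<in> W" "W \<subseteq> M" and sym: "infinitesimal_symmetry_on W D X"
      by (auto simp: symmetry_algebra_at_def)
    have "infinitesimal_symmetry_on (V \<inter> \<Psi> -` W) flat_dist (push \<Phi> \<Psi> X)"
      by (rule infinitesimal_symmetry_push[OF d sym W(2) DE])
    moreover have "\<Phi> a \<in> V \<inter> \<Psi> -` W" using a W dD(5,7) by simp
    ultimately obtain c where c: "zorn_derivation c" and "\<forall>\<^sub>F w in nhds (\<Phi> a). push \<Phi> \<Psi> X w = sym_field c w"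
      by (rule flat_symmetry_from_derivation)
    then obtain S where S: "open S" "\<Phi> a \<in> S" "\<And>w. w \<in> S \<Longrightarrow> push \<Phi> \<Psi> X w = sym_field c w"
      by (auto simp: eventually_nhds)
    have "X v = push \<Psi> \<Phi> (sym_field c) v" if v: "v \<in> M \<inter> \<Phi> -` S" for v
    proof -
      have "push \<Psi> \<Phi> (sym_field c) v = push \<Psi> \<Phi> (push \<Phi> \<Psi> X) v"
        using v S(3) by (simp add: push_def[of \<Psi>])
      then show ?thesis using push_push[OF d] v by simp
    qed
    then have "\<forall>\<^sub>F v in nhds a. X v = push \<Psi> \<Phi> (sym_field c) v"
      unfolding eventually_nhds
      using diffeo_preimage_open[OF d' S(1)] a S(2) by (intro exI[of _ "M \<inter> \<Phi> -` S"]) auto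
    then have "A = k c" by (simp add: A k_def vf_germ_eq_iff)
    then show "A \<in> k ` lie_carrier split_g2" using c by blast
  qed
  fix x y c assume x: "zorn_derivation x" and y: "zorn_derivation y"
  note cl = zorn_derivation_closed[OF x y]
  show "lie_add split_g2 x y \<in> lie_carrier split_g2 \<and> lie_bracket split_g2 x y \<in> lie_carrier split_g2
      \<and> lie_scale split_g2 c x \<in> lie_carrier split_g2"
    using cl by (simp add: split_g2_def)
  have sf: "smooth_on V (sym_field x)" "smooth_on V (sym_field y)"
    by (intro smooth_sym_field zorn_derivation_linear x y dD(2))+
  have lin: "linear (frechet_derivative \<Psi> (at w))" if "w \<in> V" for w
    using smooth_on_differentiable[OF dD(4,2) that] by (simp add: linear_frechet_derivative)
  have ev: "\<forall>\<^sub>F v in nhds a. P v" if "\<And>v. v \<in> M \<Longrightarrow> P v" for P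
    using dD(1) a that by (auto simp: eventually_nhds)
  show "k (lie_add split_g2 x y) = lie_add (symmetry_algebra_at M D a) (k x) (k y)
      \<and> k (lie_bracket split_g2 x y) = lie_bracket (symmetry_algebra_at M D a) (k x) (k y)
      \<and> k (lie_scale split_g2 c x) = lie_scale (symmetry_algebra_at M D a) c (k x)"
    unfolding k_def symmetry_algebra_germ_operations vf_germ_eq_iff
  proof (intro conjI ev)
    fix v assume v: "v \<in> M"
    note l = lin[OF dD(5)[OF v]]
    show "push \<Psi> \<Phi> (sym_field (lie_add split_g2 x y)) v = push \<Psi> \<Phi> (sym_field x) v + push \<Psi> \<Phi> (sym_field y) v"
      by (simp add: split_g2_def push_def sym_field_linear linear_add[OF l])
    show "push \<Psi> \<Phi> (sym_field (lie_scale split_g2 c x)) v = c *\<^sub>R push \<Psi> \<Phi> (sym_field x) v"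
      by (simp add: split_g2_def push_def sym_field_linear linear_cmul[OF l])
    show "push \<Psi> \<Phi> (sym_field (lie_bracket split_g2 x y)) v
        = vf_bracket (push \<Psi> \<Phi> (sym_field x)) (push \<Psi> \<Phi> (sym_field y)) v"
      unfolding vf_bracket_push[OF d' dD(2) order_refl sf v dD(5)[OF v]]
      by (simp add: push_def vf_bracket_sym_field[OF x y] split_g2_def)
  qed
qed

section \<open>Curvature of induced metrics\<close>

lemma smooth_on_prod:
  fixes f :: "'i \<Rightarrow> 'a::real_normed_vector \<Rightarrow> real"
  assumes "open S" "\<And>i. i \<in> A \<Longrightarrow> smooth_on S (f i)"
  shows "smooth_on S (\<lambda>x. \<Prod>i\<in>A. f i x)"
proof (cases "finite A")
  case True
  then show ?thesis using assms(2)
    by (induction A) (simp_all add: smooth_on_mult smooth_on_const assms(1))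
qed (simp add: smooth_on_const assms(1))

lemma smooth_on_det:
  fixes A :: "'a::real_normed_vector \<Rightarrow> real^'n^'n"
  assumes "open S" "\<And>i j. smooth_on S (\<lambda>x. A x $ i $ j)"
  shows "smooth_on S (\<lambda>x. det (A x))"
  unfolding det_def
  by (intro smooth_on_sum smooth_on_mult smooth_on_const smooth_on_prod assms)

lemma matrix_inv_inverse:
  assumes "invertible A" shows "A ** matrix_inv A = mat 1" "matrix_inv A ** A = mat 1"
proof -
  have "A ** matrix_inv A = mat 1 \<and> matrix_inv A ** A = mat 1"
    unfolding matrix_inv_def by (rule someI_ex) (use assms in \<open>simp add: invertible_def\<close>)
  then show "A ** matrix_inv A = mat 1" "matrix_inv A ** A = mat 1" by auto
qed

text \<open>Entries of the inverse as quotients of determinants, from which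
  \<open>upper_metric\<close> is seen to be smooth.\<close>

lemma matrix_inv_cramer:
  fixes A :: "real^'n^'n"
  assumes "invertible A"
  shows "matrix_inv A $ i $ j = det (\<chi> r c. if c = i then axis j 1 $ r else A $ r $ c) / det A"
proof -
  have "A *v (matrix_inv A *v axis j 1) = axis j 1"
    by (simp add: matrix_vector_mul_assoc matrix_inv_inverse(1)[OF assms])
  then have "matrix_inv A *v axis j 1 = (\<chi> k. det (\<chi> r c. if c = k then axis j 1 $ r else A $ r $ c) / det A)"
    using cramer[of A] assms by (simp add: invertible_det_nz)
  then have "(matrix_inv A *v axis j 1) $ i = det (\<chi> r c. if c = i then axis j 1 $ r else A $ r $ c) / det A"
    by simp
  then show ?thesis by (simp add: matrix_vector_mul_component inner_axis' inner_axis)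
qed

locale coord_metric =
  fixes M :: "(real^'n::finite) set" and g :: "'n metric"
  assumes M: "open M"
    and smooth_lower: "smooth_on M (lower_metric g i j)"
    and lower_sym: "v \<in> M \<Longrightarrow> lower_metric g i j v = lower_metric g j i v"
    and lower_inv: "v \<in> M \<Longrightarrow> invertible (\<chi> i j. lower_metric g i j v)"
begin

abbreviation "G \<equiv> lower_metric g"
abbreviation "\<Gamma> \<equiv> christoffel g"

lemma upper_lower:
  assumes "v \<in> M"
  shows "(\<Sum>k\<in>UNIV. upper_metric g i k v * G k j v) = (if i = j then 1 else 0)"
    and "(\<Sum>k\<in>UNIV. G i k v * upper_metric g k j v) = (if i = j then 1 else 0)"
proof -
  let ?A = "\<chi> i j. G i j v"
  have "(matrix_inv ?A ** ?A) $ i $ j = mat 1 $ i $ j" "(?A ** matrix_inv ?A) $ i $ j = mat 1 $ i $ j"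
    using matrix_inv_inverse(2)[OF lower_inv[OF assms]] matrix_inv_inverse(1)[OF lower_inv[OF assms]] by simp_all
  then show "(\<Sum>k\<in>UNIV. upper_metric g i k v * G k j v) = (if i = j then 1 else 0)"
    "(\<Sum>k\<in>UNIV. G i k v * upper_metric g k j v) = (if i = j then 1 else 0)"
    by (simp_all add: matrix_matrix_mult_def upper_metric_def mat_def)
qed

lemma smooth_upper: "smooth_on M (upper_metric g i j)"
proof -
  have "smooth_on M (\<lambda>v. det (\<chi> r c. if c = i then axis j 1 $ r else G r c v) / det (\<chi> k l. G k l v))"
  proof (intro smooth_on_divide smooth_on_det M)
    show "smooth_on M (\<lambda>v. (\<chi> r c. if c = i then axis j 1 $ r else G r c v) $ k $ l)" for k l
      by (cases "l = i") (simp_all add: smooth_on_const M smooth_lower)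
    show "det (\<chi> k l. G k l v) \<noteq> 0" if "v \<in> M" for v
      using lower_inv[OF that] by (simp add: invertible_det_nz)
  qed (simp add: smooth_lower)
  then show ?thesis
    by (rule smooth_on_cong[OF M, rotated]) (simp add: upper_metric_def matrix_inv_cramer[OF lower_inv] cong: if_cong)
qed

lemma smooth_partial: "smooth_on M f \<Longrightarrow> smooth_on M (partial i f)"
  unfolding partial_def[abs_def] by (rule smooth_on_frechet_derivative)

lemma smooth_christoffel: "smooth_on M (\<Gamma> k i j)"
  unfolding christoffel_def[abs_def]
  by (intro smooth_on_divide smooth_on_sum smooth_on_mult smooth_on_add smooth_on_diff smooth_on_const
      smooth_upper smooth_partial smooth_lower M) auto

text \<open>The Christoffel symbols of the first kind, in which no inverse matrix occurs.\<close>

definition "chr1 l i j v = (partial i (G j l) v + partial j (G i l) v - partial l (G i j) v) / 2"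

lemma lower_christoffel:
  assumes v: "v \<in> M" shows "(\<Sum>k\<in>UNIV. G l k v * \<Gamma> k i j v) = chr1 l i j v"
proof -
  have c: "\<Gamma> k i j v = (\<Sum>m\<in>UNIV. upper_metric g k m v * chr1 m i j v)" for k
    by (simp add: christoffel_def chr1_def sum_divide_distrib)
  have "(\<Sum>k\<in>UNIV. G l k v * \<Gamma> k i j v) = (\<Sum>k\<in>UNIV. \<Sum>m\<in>UNIV. (G l k v * upper_metric g k m v) * chr1 m i j v)"
    by (simp add: c sum_distrib_left mult.assoc)
  also have "\<dots> = (\<Sum>m\<in>UNIV. (\<Sum>k\<in>UNIV. G l k v * upper_metric g k m v) * chr1 m i j v)"
    by (subst sum.swap) (simp add: sum_distrib_right)
  also have "\<dots> = chr1 l i j v"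
    by (simp add: upper_lower(2)[OF v] if_distrib[of "\<lambda>x. x * _"] cong: if_cong)
  finally show ?thesis .
qed

lemma partial_sum_mult:
  assumes v: "v \<in> M" and "\<And>k. smooth_on M (a k)" "\<And>k. smooth_on M (b k)"
  shows "partial i (\<lambda>v. \<Sum>k\<in>(UNIV::'n set). a k v * b k v) v = (\<Sum>k\<in>UNIV. partial i (a k) v * b k v + a k v * partial i (b k) v)"
proof -
  have "((\<lambda>v. \<Sum>k\<in>(UNIV::'n set). a k v * b k v) has_derivative
      (\<lambda>h. \<Sum>k\<in>UNIV. a k v * frechet_derivative (b k) (at v) h + frechet_derivative (a k) (at v) h * b k v)) (at v)"
    by (intro has_derivative_sum has_derivative_mult smooth_on_has_derivative[OF _ M v] assms)
  from frechet_derivative_at[OF this, symmetric] show ?thesis by (simp add: partial_def add.commute)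
qed

lemma partial_cong:
  assumes v: "v \<in> M" and "\<And>v. v \<in> M \<Longrightarrow> a v = b v"
  shows "partial i a v = partial i b v"
  using frechet_derivative_cong_open[OF M v assms(2)] by (simp add: partial_def)

text \<open>The compatibility of the connection with the metric.\<close>

lemma partial_lower:
  assumes v: "v \<in> M" shows "partial c (G a l) v = chr1 a c l v + chr1 l c a v"
proof -
  have "partial i (G j k) v = partial i (G k j) v" for i j k
    by (rule partial_cong[OF v]) (rule lower_sym)
  from this[of c a l] this[of l c a] this[of a c l] show ?thesis by (simp add: chr1_def field_simps)
qed

text \<open>Derivatives of the inverse metric are avoided: by \<open>lower_christoffel\<close>,
  lowering a derivative of \<Gamma> gives the derivative of \<open>chr1\<close> minus a term with
  first derivatives of \<open>G\<close>.\<close>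

lemma riemann_lower_chr1:
  assumes v: "v \<in> M"
  shows "riemann_lower g a b c d v = partial c (chr1 a d b) v - partial d (chr1 a c b) v
    - (\<Sum>l\<in>UNIV. chr1 l c a v * \<Gamma> l d b v) + (\<Sum>l\<in>UNIV. chr1 l d a v * \<Gamma> l c b v)"
proof -
  have p: "(\<Sum>l\<in>UNIV. G a l v * partial c (\<Gamma> l d b) v)
      = partial c (chr1 a d b) v - (\<Sum>l\<in>UNIV. (chr1 a c l v + chr1 l c a v) * \<Gamma> l d b v)" for c d
  proof -
    have "partial c (chr1 a d b) v = partial c (\<lambda>v. \<Sum>l\<in>UNIV. G a l v * \<Gamma> l d b v) v"
      by (rule partial_cong[OF v]) (simp add: lower_christoffel)
    also have "\<dots> = (\<Sum>l\<in>UNIV. partial c (G a l) v * \<Gamma> l d b v + G a l v * partial c (\<Gamma> l d b) v)"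
      by (rule partial_sum_mult[OF v smooth_lower smooth_christoffel])
    finally show ?thesis by (simp add: sum.distrib partial_lower[OF v])
  qed
  have q: "(\<Sum>l\<in>UNIV. G a l v * (\<Sum>m\<in>UNIV. \<Gamma> l c m v * \<Gamma> m d b v)) = (\<Sum>m\<in>UNIV. chr1 a c m v * \<Gamma> m d b v)" for c d
  proof -
    have "(\<Sum>l\<in>UNIV. G a l v * (\<Sum>m\<in>UNIV. \<Gamma> l c m v * \<Gamma> m d b v))
        = (\<Sum>m\<in>UNIV. (\<Sum>l\<in>UNIV. G a l v * \<Gamma> l c m v) * \<Gamma> m d b v)"
      by (simp add: sum_distrib_left sum_distrib_right mult.assoc) (rule sum.swap)
    then show ?thesis by (simp add: lower_christoffel[OF v])
  qed
  have "riemann_lower g a b c d v = (\<Sum>l\<in>UNIV. G a l v * partial c (\<Gamma> l d b) v) - (\<Sum>l\<in>UNIV. G a l v * partial d (\<Gamma> l c b) v)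
      + (\<Sum>l\<in>UNIV. G a l v * (\<Sum>m\<in>UNIV. \<Gamma> l c m v * \<Gamma> m d b v)) - (\<Sum>l\<in>UNIV. G a l v * (\<Sum>m\<in>UNIV. \<Gamma> l d m v * \<Gamma> m c b v))"
    by (simp add: riemann_lower_def riemann_def sum_subtractf sum.distrib algebra_simps)
  then show ?thesis unfolding p q by (simp add: sum.distrib algebra_simps)
qed

lemma riemann_eq_upper:
  assumes v: "v \<in> M"
  shows "riemann g l b c d v = (\<Sum>a\<in>UNIV. upper_metric g l a v * riemann_lower g a b c d v)"
proof -
  have "(\<Sum>a\<in>UNIV. upper_metric g l a v * riemann_lower g a b c d v)
      = (\<Sum>k\<in>UNIV. (\<Sum>a\<in>UNIV. upper_metric g l a v * G a k v) * riemann g k b c d v)"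
    by (simp add: riemann_lower_def sum_distrib_left sum_distrib_right mult.assoc) (rule sum.swap)
  then show ?thesis
    by (simp add: upper_lower(1)[OF v] if_distrib[of "\<lambda>x. x * _"] cong: if_cong)
qed

text \<open>The right-hand side is minus the Kulkarni-Nomizu product of \<open>T\<close> and the
  metric. Contraction gives the Ricci tensor (2 - n) T - t G and scalar curvature (2 - 2 n) t with
  \<open>t\<close> the trace of \<open>T\<close>, so that \<open>T\<close> is minus the Schouten
  tensor and the correction terms of \<open>weyl\<close> cancel the product.\<close>

lemma weyl_eq_0_if_Kulkarni_Nomizu:
  fixes T :: "'n \<Rightarrow> 'n \<Rightarrow> real"
  assumes v: "v \<in> M" and n: "CARD('n) > 2" and T: "\<And>i j. T i j = T j i"
    and R: "\<And>a b c d. riemann_lower g a b c d v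
      = - T d b * G c a v - G d b v * T c a + T c b * G d a v + G c b v * T d a"
  shows "weyl g a b c d v = 0"
proof -
  let ?U = "\<lambda>i j. upper_metric g i j v" and ?G = "\<lambda>i j. G i j v"
  define t where "t = (\<Sum>l\<in>UNIV. \<Sum>a\<in>UNIV. ?U l a * T l a)"
  define n where "n = real CARD('n)"
  have tr: "(\<Sum>l\<in>UNIV. \<Sum>a\<in>UNIV. ?U l a * ?G l a) = n"
  proof -
    have "(\<Sum>l\<in>UNIV. \<Sum>a\<in>UNIV. ?U l a * ?G l a) = (\<Sum>l\<in>UNIV. \<Sum>a\<in>UNIV. ?U l a * ?G a l)"
      by (intro sum.cong refl arg_cong2[where f="(*)"] lower_sym v)
    then show ?thesis by (simp add: upper_lower(1)[OF v] n_def)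
  qed
  have c1: "(\<Sum>l\<in>UNIV. \<Sum>a\<in>UNIV. ?U l a * (T l k * ?G j a)) = T j k" for j k
  proof -
    have "(\<Sum>l\<in>UNIV. \<Sum>a\<in>UNIV. ?U l a * (T l k * ?G j a)) = (\<Sum>l\<in>UNIV. T l k * (\<Sum>a\<in>UNIV. ?U l a * ?G a j))"
      by (simp add: sum_distrib_left lower_sym[OF v, of j] mult_ac)
    then show ?thesis by (simp add: upper_lower(1)[OF v] if_distrib cong: if_cong)
  qed
  have c2: "(\<Sum>l\<in>UNIV. \<Sum>a\<in>UNIV. ?U l a * (?G l k * T j a)) = T j k" for j k
  proof -
    have "(\<Sum>l\<in>UNIV. \<Sum>a\<in>UNIV. ?U l a * (?G l k * T j a)) = (\<Sum>a\<in>UNIV. T j a * (\<Sum>l\<in>UNIV. ?G k l * ?U l a))"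
      by (subst sum.swap) (simp add: sum_distrib_left lower_sym[OF v, of _ k] mult_ac)
    then show ?thesis by (simp add: upper_lower(2)[OF v] if_distrib cong: if_cong)
  qed
  have ric: "ricci g k j v = (2 - n) * T j k - t * ?G j k" for k j
  proof -
    have "ricci g k j v = (\<Sum>l\<in>UNIV. \<Sum>a\<in>UNIV. ?U l a * (- T j k * ?G l a - ?G j k * T l a + T l k * ?G j a + ?G l k * T j a))"
      unfolding ricci_def riemann_eq_upper[OF v] R ..
    also have "\<dots> = - T j k * (\<Sum>l\<in>UNIV. \<Sum>a\<in>UNIV. ?U l a * ?G l a) - ?G j k * t
        + (\<Sum>l\<in>UNIV. \<Sum>a\<in>UNIV. ?U l a * (T l k * ?G j a)) + (\<Sum>l\<in>UNIV. \<Sum>a\<in>UNIV. ?U l a * (?G l k * T j a))"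
      by (simp add: t_def sum_distrib_left sum.distrib sum_subtractf sum_negf algebra_simps)
    finally show ?thesis unfolding tr c1 c2 by (simp add: algebra_simps)
  qed
  have "scalar_curvature g v = (\<Sum>i\<in>UNIV. \<Sum>j\<in>UNIV. ?U i j * ((2 - n) * T i j - t * ?G i j))"
    unfolding scalar_curvature_def ric
    by (intro sum.cong refl arg_cong2[where f="(*)"] arg_cong2[where f="(-)"] T lower_sym v)
  also have "\<dots> = (\<Sum>i\<in>UNIV. \<Sum>j\<in>UNIV. (2 - n) * (?U i j * T i j) - t * (?U i j * ?G i j))"
    by (intro sum.cong refl) (simp add: algebra_simps)
  also have "\<dots> = (2 - n) * (\<Sum>i\<in>UNIV. \<Sum>j\<in>UNIV. ?U i j * T i j) - t * (\<Sum>i\<in>UNIV. \<Sum>j\<in>UNIV. ?U i j * ?G i j)"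
    by (simp only: sum_subtractf sum_distrib_left)
  also have "\<dots> = (2 - n) * t - t * (\<Sum>i\<in>UNIV. \<Sum>j\<in>UNIV. ?U i j * ?G i j)"
    by (simp only: t_def)
  finally have sc: "scalar_curvature g v = (2 - 2 * n) * t" unfolding tr by (simp add: algebra_simps)
  have n: "n - 2 \<noteq> 0" "n - 1 \<noteq> 0" using n by (simp_all add: n_def)
  have s: "?G c b = ?G b c" "?G d b = ?G b d" "?G c a = ?G a c" "?G d a = ?G a d" "T d b = T b d" "T c b = T b c"
    by (rule lower_sym[OF v] T)+
  have h: "((2 - 2 * n) * t) * (?G a c * ?G b d - ?G a d * ?G b c) / ((n - 1) * (n - 2))
      = - 2 * t * (?G a c * ?G b d - ?G a d * ?G b c) / (n - 2)"
  proof -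
    have "(2 - 2 * n) * t * (?G a c * ?G b d - ?G a d * ?G b c) = (n - 1) * (- 2 * t * (?G a c * ?G b d - ?G a d * ?G b c))"
      by (simp add: algebra_simps)
    then show ?thesis
      by (simp only: nonzero_mult_divide_mult_cancel_left[OF n(2)])
  qed
  show ?thesis
    unfolding weyl_def Let_def R ric sc n_def[symmetric] s h
    using n by (simp add: field_simps)
qed

end

text \<open>The Gauss formula: \<open>hess\<close> is the part of the second derivative of \<open>\<Psi>\<close> orthogonal to its image.\<close>

locale induced_metric = coord_metric M g for M :: "(real^'n::finite) set" and g +
  fixes \<Psi> :: "real^'n \<Rightarrow> 'e::euclidean_space" and \<beta> :: "'e \<Rightarrow> 'e \<Rightarrow> real"
  assumes smooth_\<Psi>: "smooth_on M \<Psi>" and \<beta>: "bounded_bilinear \<beta>" and \<beta>_sym: "\<beta> x y = \<beta> y x"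
    and lower_eq: "v \<in> M \<Longrightarrow> lower_metric g i j v
      = \<beta> (frechet_derivative \<Psi> (at v) (axis i 1)) (frechet_derivative \<Psi> (at v) (axis j 1))"
begin

definition "P i v = frechet_derivative \<Psi> (at v) (axis i 1)"
definition "PP i j v = frechet_derivative (P j) (at v) (axis i 1)"
definition "hess i j v = PP i j v - (\<Sum>k\<in>UNIV. \<Gamma> k i j v *\<^sub>R P k v)"

lemma smooth_P: "smooth_on M (P i)"
  unfolding P_def[abs_def] by (rule smooth_on_frechet_derivative[OF smooth_\<Psi>])

lemma smooth_PP: "smooth_on M (PP i j)"
  unfolding PP_def[abs_def] by (rule smooth_on_frechet_derivative[OF smooth_P])

lemma PP_sym: "v \<in> M \<Longrightarrow> PP i j v = PP j i v"
  unfolding PP_def P_def[abs_def] by (rule second_derivative_symmetric[OF M _ smooth_\<Psi>])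

lemma PPP_sym:
  assumes v: "v \<in> M"
  shows "frechet_derivative (PP d b) (at v) (axis c 1) = frechet_derivative (PP c b) (at v) (axis d 1)"
  unfolding PP_def[abs_def] by (rule second_derivative_symmetric[OF M v smooth_P])

lemma G_eq: "v \<in> M \<Longrightarrow> G i j v = \<beta> (P i v) (P j v)"
  by (simp add: lower_eq P_def)

lemma partial_\<beta>:
  assumes v: "v \<in> M" and a: "smooth_on M a" "smooth_on M b"
  shows "partial i (\<lambda>v. \<beta> (a v) (b v)) v
    = \<beta> (frechet_derivative a (at v) (axis i 1)) (b v) + \<beta> (a v) (frechet_derivative b (at v) (axis i 1))"
  using frechet_derivative_at[OF bounded_bilinear.FDERIV[OF \<beta> smooth_on_has_derivative[OF a(1) M v]
        smooth_on_has_derivative[OF a(2) M v]], symmetric]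
  by (simp add: partial_def add.commute)

text \<open>In the combination of first derivatives of \<beta>(P, P) that defines
  \<open>chr1\<close>, symmetry of second derivatives leaves one term.\<close>

lemma chr1_eq:
  assumes v: "v \<in> M" shows "chr1 l i j v = \<beta> (P l v) (PP i j v)"
proof -
  have "partial i (G j k) v = \<beta> (PP i j v) (P k v) + \<beta> (P j v) (PP i k v)" for i j k
  proof -
    have "partial i (G j k) v = partial i (\<lambda>v. \<beta> (P j v) (P k v)) v" by (rule partial_cong[OF v G_eq])
    also have "\<dots> = \<beta> (PP i j v) (P k v) + \<beta> (P j v) (PP i k v)"
      unfolding PP_def by (rule partial_\<beta>[OF v smooth_P smooth_P])
    finally show ?thesis .
  qed
  then show ?thesis
    unfolding chr1_def using PP_sym[OF v] \<beta>_sym by (simp add: field_simps)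
qed

lemma hess_orthogonal:
  assumes v: "v \<in> M" shows "\<beta> (P l v) (hess i j v) = 0"
proof -
  interpret bounded_bilinear \<beta> by (rule \<beta>)
  have "(\<Sum>k\<in>UNIV. \<Gamma> k i j v * \<beta> (P l v) (P k v)) = chr1 l i j v"
    using lower_christoffel[OF v, of l i j] by (simp add: G_eq[OF v] mult.commute)
  then show ?thesis
    by (simp add: hess_def diff_right sum_right scaleR_right chr1_eq[OF v])
qed

text \<open>The Gauss equation. The left factors may stay \<open>PP\<close> because they differ from
  \<open>hess\<close> by tangent vectors, to which \<open>hess\<close> is orthogonal. Third
  derivatives of \<Psi> cancel by \<open>PPP_sym\<close>.\<close>

lemma riemann_lower_Gauss:
  assumes v: "v \<in> M"
  shows "riemann_lower g a b c d v = \<beta> (PP c a v) (hess d b v) - \<beta> (PP d a v) (hess c b v)"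
proof -
  interpret bounded_bilinear \<beta> by (rule \<beta>)
  have p: "partial c (chr1 a d b) v = \<beta> (PP c a v) (PP d b v) + \<beta> (P a v) (frechet_derivative (PP d b) (at v) (axis c 1))" for c d
  proof -
    have "partial c (chr1 a d b) v = partial c (\<lambda>v. \<beta> (P a v) (PP d b v)) v" by (rule partial_cong[OF v chr1_eq])
    also have "\<dots> = \<beta> (PP c a v) (PP d b v) + \<beta> (P a v) (frechet_derivative (PP d b) (at v) (axis c 1))"
      unfolding PP_def[of c a] by (rule partial_\<beta>[OF v smooth_P smooth_PP])
    finally show ?thesis .
  qed
  have q: "(\<Sum>l\<in>UNIV. chr1 l c a v * \<Gamma> l d b v) = \<beta> (PP c a v) (\<Sum>k\<in>UNIV. \<Gamma> k d b v *\<^sub>R P k v)" for c d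
    by (simp add: sum_right scaleR_right chr1_eq[OF v] \<beta>_sym[of "P _ v"] mult.commute)
  show ?thesis
    unfolding riemann_lower_chr1[OF v] p q PPP_sym[OF v, of d b c]
    by (simp add: hess_def diff_right)
qed

lemma riemann_eq_0_if_nondegenerate:
  assumes v: "v \<in> M" and nd: "\<And>e. (\<And>l. \<beta> (P l v) e = 0) \<Longrightarrow> e = 0"
  shows "riemann g l k i j v = 0"
proof -
  interpret bounded_bilinear \<beta> by (rule \<beta>)
  have "hess i j v = 0" for i j by (rule nd) (rule hess_orthogonal[OF v])
  then have "riemann_lower g a b c d v = 0" for a b c d by (simp add: riemann_lower_Gauss[OF v] zero_right)
  then show ?thesis by (simp add: riemann_eq_upper[OF v])
qed

text \<open>For a map into the light cone, differentiating \<open>null\<close> twice shows that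
  \<open>hess\<close> pairs with \<Psi> to - G. Hence it equals T \<Psi> - G N, and the Gauss
  equation becomes a Kulkarni-Nomizu product of \<open>T\<close> with the metric.\<close>

lemma weyl_eq_0_if_null_cone:
  assumes v: "v \<in> M" and n: "CARD('n) > 2"
    and null: "\<And>v. v \<in> M \<Longrightarrow> \<beta> (\<Psi> v) (\<Psi> v) = 0"
    and N: "\<And>l. \<beta> (P l v) N = 0"
    and split: "\<And>e. (\<And>l. \<beta> (P l v) e = 0) \<Longrightarrow> e = \<beta> e N *\<^sub>R \<Psi> v + \<beta> e (\<Psi> v) *\<^sub>R N"
  shows "weyl g a b c d v = 0"
proof -
  interpret bounded_bilinear \<beta> by (rule \<beta>)
  have \<Psi>P: "\<beta> (\<Psi> w) (P i w) = 0" if w: "w \<in> M" for i w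
  proof -
    have "partial i (\<lambda>w. \<beta> (\<Psi> w) (\<Psi> w)) w = partial i (\<lambda>w. 0) w"
      by (rule partial_cong[OF w null])
    also have "\<dots> = 0" by (simp add: partial_def)
    also have "partial i (\<lambda>w. \<beta> (\<Psi> w) (\<Psi> w)) w = \<beta> (P i w) (\<Psi> w) + \<beta> (\<Psi> w) (P i w)"
      unfolding P_def by (rule partial_\<beta>[OF w smooth_\<Psi> smooth_\<Psi>])
    finally show ?thesis using \<beta>_sym[of "\<Psi> w" "P i w"] by simp
  qed
  have \<Psi>PP: "\<beta> (\<Psi> v) (PP i j v) = - G i j v" for i j
  proof -
    have "partial i (\<lambda>w. \<beta> (\<Psi> w) (P j w)) v = partial i (\<lambda>w. 0) v"
      by (rule partial_cong[OF v \<Psi>P])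
    also have "\<dots> = 0" by (simp add: partial_def)
    also have "partial i (\<lambda>w. \<beta> (\<Psi> w) (P j w)) v = \<beta> (P i v) (P j v) + \<beta> (\<Psi> v) (PP i j v)"
      unfolding PP_def P_def[of i] by (rule partial_\<beta>[OF v smooth_\<Psi> smooth_P])
    finally show ?thesis by (simp add: G_eq[OF v])
  qed
  define T where "T i j = \<beta> (PP i j v) N" for i j
  have h: "\<beta> (hess i j v) N = T i j" "\<beta> (hess i j v) (\<Psi> v) = - G i j v" for i j
    using \<Psi>PP[of i j] \<beta>_sym[of "P _ v" "\<Psi> v"] \<beta>_sym[of "PP i j v" "\<Psi> v"]
    by (simp_all add: hess_def diff_left sum_left scaleR_left N T_def \<Psi>P[OF v])
  have hess: "hess i j v = T i j *\<^sub>R \<Psi> v - G i j v *\<^sub>R N" for i j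
    using split[OF hess_orthogonal[OF v], of i j] by (simp add: h)
  show ?thesis
  proof (rule weyl_eq_0_if_Kulkarni_Nomizu[OF v n, of T])
    show "T i j = T j i" for i j using PP_sym[OF v] by (simp add: T_def)
    show "riemann_lower g a b c d v = - T d b * G c a v - G d b v * T c a + T c b * G d a v + G c b v * T d a" for a b c d
      unfolding riemann_lower_Gauss[OF v] hess
      using \<Psi>PP \<beta>_sym[of "PP _ _ v" "\<Psi> v"]
      by (simp add: diff_right scaleR_right T_def)
  qed
qed

end

section \<open>Metrics conformal to a pulled back constant form\<close>

lemma coord_metricI:
  assumes "open M" "pseudo_riemannian_on M g"
  shows "coord_metric M g"
proof
  show "open M" by fact
  show "smooth_on M (lower_metric g i j)" for i j
    using assms(2) by (simp add: pseudo_riemannian_on_def lower_metric_def[abs_def])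
  fix v i j assume v: "v \<in> M"
  then have bil: "bilinear (g v)" and sym: "\<And>u w. g v u w = g v w u" and nd: "\<And>u. (\<And>w. g v u w = 0) \<Longrightarrow> u = 0"
    using assms(2) by (auto simp: pseudo_riemannian_on_def)
  show "lower_metric g i j v = lower_metric g j i v" for i j by (simp add: lower_metric_def sym)
  let ?A = "\<chi> i j. lower_metric g i j v"
  have "x = 0" if x: "?A *v x = 0" for x
  proof (rule nd)
    fix w
    have e: "u = (\<Sum>i\<in>UNIV. u $ i *\<^sub>R axis i 1)" for u :: "real^'n"
      using basis_expansion[of u] by (simp add: scalar_mult_eq_scaleR)
    have row: "(\<Sum>j\<in>UNIV. g v (axis i 1) (axis j 1) * x $ j) = 0" for i
      using x by (simp add: vec_eq_iff matrix_vector_mult_def lower_metric_def)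
    have "g v x w = g v (\<Sum>j\<in>UNIV. x $ j *\<^sub>R axis j 1) (\<Sum>i\<in>UNIV. w $ i *\<^sub>R axis i 1)"
      using e[of x] e[of w] by simp
    also have "\<dots> = (\<Sum>j\<in>UNIV. \<Sum>i\<in>UNIV. g v (x $ j *\<^sub>R axis j 1) (w $ i *\<^sub>R axis i 1))"
      by (simp add: bilinear_sum[OF bil] sum.cartesian_product)
    also have "\<dots> = (\<Sum>i\<in>UNIV. w $ i * (\<Sum>j\<in>UNIV. g v (axis j 1) (axis i 1) * x $ j))"
      by (subst sum.swap) (simp add: bilinear_lmul[OF bil] bilinear_rmul[OF bil] sum_distrib_left mult_ac)
    also have "\<dots> = (\<Sum>i\<in>UNIV. w $ i * (\<Sum>j\<in>UNIV. g v (axis i 1) (axis j 1) * x $ j))"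
      by (intro sum.cong refl arg_cong2[where f="(*)"] sym)
    finally show "g v x w = 0" by (simp add: row)
  qed
  then show "invertible ?A"
    by (simp add: invertible_left_inverse matrix_left_invertible_ker)
qed

text \<open>For the Weyl tensor, \<Phi> is lifted to \<mu> (1, \<Phi>, - h(\<Phi>, \<Phi>)) in the
  light cone of \<open>h\<close> plus a hyperbolic plane. The conformal factor becomes the choice of
  a section of this cone, and the induced metric is \<open>g\<close> itself. For conformal flatness,
  dividing by \<mu>^2 leaves a metric induced by \<Phi> into a space of equal dimension, where
  \<open>hess\<close> vanishes.\<close>

theorem
  fixes M :: "(real^'n::finite) set" and g :: "'n metric" and \<Phi> :: "real^'n \<Rightarrow> real^'n"
  assumes M: "open M" and pr: "pseudo_riemannian_on M g" and n: "CARD('n) > 2"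
    and \<Phi>: "smooth_on M \<Phi>" and \<mu>: "smooth_on M \<mu>" "\<And>v. v \<in> M \<Longrightarrow> \<mu> v \<noteq> 0"
    and h: "bounded_bilinear h" "\<And>x y. h x y = h y x"
    and g: "\<And>v u w. v \<in> M \<Longrightarrow> g v u w
      = (\<mu> v)^2 * h (frechet_derivative \<Phi> (at v) u) (frechet_derivative \<Phi> (at v) w)"
  shows weyl_conformal_pullback: "v \<in> M \<Longrightarrow> weyl g a b c d v = 0"
    and conformally_flat_conformal_pullback: "conformally_flat_on M g"
proof -
  interpret coord_metric M g by (rule coord_metricI[OF M pr])
  interpret h: bounded_bilinear h by (rule h(1))
  let ?D = "\<lambda>v. frechet_derivative \<Phi> (at v)"
  have lin: "linear (?D v)" if "v \<in> M" for v
    using smooth_on_differentiable[OF \<Phi> M that] by (simp add: linear_frechet_derivative)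
  have nd: "x = 0" if v: "v \<in> M" and x: "\<And>l. h (?D v (axis l 1)) x = 0" for v x
  proof -
    have "u = 0" if u: "?D v u = 0" for u
    proof -
      have "g v u w = 0" for w using u by (simp add: g[OF v] h.zero_left)
      then show ?thesis using pr v by (auto simp: pseudo_riemannian_on_def)
    qed
    then have "inj (?D v)" by (simp add: linear_injective_0[OF lin[OF v]])
    then have "surj (?D v)" using linear_injective_imp_surjective[OF lin[OF v]] by blast
    then obtain u where u: "x = ?D v u" by (metis surjD)
    have "h (?D v w) x = 0" for w
    proof -
      have "?D v w = (\<Sum>i\<in>UNIV. w $ i *\<^sub>R ?D v (axis i 1))"
        using basis_expansion[of w] linear_sum[OF lin[OF v], of "\<lambda>i. w $ i *\<^sub>R axis i 1" UNIV]
        by (simp add: scalar_mult_eq_scaleR linear_cmul[OF lin[OF v]])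
      then show ?thesis by (simp add: h.sum_left h.scaleR_left x)
    qed
    then have "g v u w = 0" for w by (simp add: g[OF v] u h(2)[of "?D v u"])
    then have "u = 0" using pr v by (auto simp: pseudo_riemannian_on_def)
    then show ?thesis by (simp add: u linear_0[OF lin[OF v]])
  qed
  show "conformally_flat_on M g"
    unfolding conformally_flat_on_def
  proof (intro ballI exI conjI)
    \<comment> \<open>Chosen so that exp (2 f) = 1 / \<mu>^2; the square under the logarithm allows
      either sign of \<mu>.\<close>
    let ?f = "\<lambda>v. - (ln ((\<mu> v)^2) / 2)"
    show "smooth_on M ?f"
    proof -
      have "smooth_on M (\<lambda>v. ln ((\<mu> v)^2))"
        by (rule smooth_on_compose[OF M open_greaterThan smooth_on_power[OF M \<mu>(1)] smooth_on_ln]) (use \<mu>(2) in auto)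
      then show ?thesis by (intro smooth_intros M) auto
    qed
    let ?g = "\<lambda>v u w. exp (2 * ?f v) * g v u w"
    have e: "exp (2 * ?f v) = 1 / (\<mu> v)^2" if "v \<in> M" for v
      using \<mu>(2)[OF that] by (simp add: exp_minus inverse_eq_divide)
    have ge: "?g v u w = h (?D v u) (?D v w)" if v: "v \<in> M" for v u w
      using \<mu>(2)[OF v] by (simp only: e[OF v] g[OF v]) simp
    have "pseudo_riemannian_on M ?g"
    proof -
      have "smooth_on M (\<lambda>v. ?g v u w)" for u w
      proof -
        have "smooth_on M (\<lambda>v. h (?D v u) (?D v w))"
          by (intro smooth_on_bilinear[OF h(1)] M smooth_on_frechet_derivative \<Phi>)
        then show ?thesis by (rule smooth_on_cong[OF M, rotated]) (simp only: ge)
      qed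
      moreover have "bilinear (?g v)" if "v \<in> M" for v
        using pr that unfolding pseudo_riemannian_on_def bilinear_def linear_iff
        by (auto simp: algebra_simps)
      ultimately show ?thesis using pr by (simp add: pseudo_riemannian_on_def)
    qed
    then interpret I: coord_metric M ?g by (rule coord_metricI[OF M])
    interpret I: induced_metric M ?g \<Phi> h
    proof unfold_locales
      show "lower_metric ?g i j v = h (?D v (axis i 1)) (?D v (axis j 1))" if "v \<in> M" for i j v
        unfolding lower_metric_def by (rule ge[OF that])
      show "h x y = h y x" for x y by (rule h(2))
    qed (use \<Phi> h(1) in auto)
    show "flat_on M ?g"
      unfolding flat_on_def
      by (intro ballI allI I.riemann_eq_0_if_nondegenerate) (use nd in \<open>auto simp: I.P_def\<close>)
  qed (use M in auto)
  define \<beta> :: "real \<times> (real^'n) \<times> real \<Rightarrow> real \<times> (real^'n) \<times> real \<Rightarrow> real"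
    where "\<beta> = (\<lambda>(r, x, s) (r', x', s'). h x x' + (r * s' + r' * s) / 2)"
  define \<Psi> :: "real^'n \<Rightarrow> real \<times> (real^'n) \<times> real" where "\<Psi> v = (\<mu> v, \<mu> v *\<^sub>R \<Phi> v, - (\<mu> v * h (\<Phi> v) (\<Phi> v)))" for v
  have \<beta>bil: "bounded_bilinear \<beta>"
  proof -
    have "bilinear \<beta>"
      unfolding bilinear_def linear_iff
      by (auto simp: \<beta>_def h.add_left h.add_right h.scaleR_left h.scaleR_right field_simps)
    then show ?thesis by (simp add: bilinear_conv_bounded_bilinear)
  qed
  have \<beta>sym: "\<beta> x y = \<beta> y x" for x y
    by (cases x; cases y) (simp add: \<beta>_def h(2) field_simps)
  have s\<Psi>: "smooth_on M \<Psi>"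
    unfolding \<Psi>_def[abs_def]
    by (intro smooth_on_Pair smooth_on_scaleR smooth_on_minus smooth_on_mult smooth_on_bilinear[OF h(1)] M \<mu>(1) \<Phi>)
  have D\<Psi>: "frechet_derivative \<Psi> (at v) w = (frechet_derivative \<mu> (at v) w,
      frechet_derivative \<mu> (at v) w *\<^sub>R \<Phi> v + \<mu> v *\<^sub>R ?D v w,
      - (frechet_derivative \<mu> (at v) w * h (\<Phi> v) (\<Phi> v) + 2 * \<mu> v * h (\<Phi> v) (?D v w)))" if v: "v \<in> M" for v w
  proof -
    note d = smooth_on_has_derivative[OF \<mu>(1) M v] smooth_on_has_derivative[OF \<Phi> M v]
    have "(\<Psi> has_derivative (\<lambda>w. (frechet_derivative \<mu> (at v) w,
        \<mu> v *\<^sub>R ?D v w + frechet_derivative \<mu> (at v) w *\<^sub>R \<Phi> v,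
        - (\<mu> v * (h (\<Phi> v) (?D v w) + h (?D v w) (\<Phi> v)) + frechet_derivative \<mu> (at v) w * h (\<Phi> v) (\<Phi> v))))) (at v)"
      unfolding \<Psi>_def[abs_def]
      by (intro has_derivative_Pair has_derivative_scaleR has_derivative_minus has_derivative_mult h.FDERIV d)
    from fun_cong[OF frechet_derivative_at[OF this, symmetric], of w] show ?thesis
      by (simp add: h(2)[of "?D v w"] algebra_simps)
  qed
  interpret B: bounded_bilinear \<beta> by (rule \<beta>bil)
  interpret induced_metric M g \<Psi> \<beta>
  proof unfold_locales
    fix v i j assume v: "v \<in> M"
    show "G i j v = \<beta> (frechet_derivative \<Psi> (at v) (axis i 1)) (frechet_derivative \<Psi> (at v) (axis j 1))"
      unfolding D\<Psi>[OF v] lower_metric_def g[OF v]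
      by (simp add: \<beta>_def h.add_left h.add_right h.scaleR_left h.scaleR_right h(2)[of "?D v (axis i 1)" "\<Phi> v"] power2_eq_square field_simps)
  next
    show "\<beta> x y = \<beta> y x" for x y by (rule \<beta>sym)
  qed (rule s\<Psi>)
  have null: "\<beta> (\<Psi> v) (\<Psi> v) = 0" for v
    by (simp add: \<beta>_def \<Psi>_def h.scaleR_left h.scaleR_right)
  show "weyl g a b c d v = 0" if v: "v \<in> M" for a b c d v
  proof -
    let ?\<mu>' = "\<lambda>i. frechet_derivative \<mu> (at v) (axis i 1)"
    \<comment> \<open>Construction of the second null normal \<open>N\<close>: \<open>e\<close> /
      \<mu> pairs to 1 with \<Psi>, \<open>S\<close> cancels the pairings with tangent vectors, and
      a multiple of \<Psi> makes the sum null.\<close>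
    define e where "e = (0::real, 0::real^'n, 2::real)"
    define k where "k i = - (\<Sum>j\<in>UNIV. upper_metric g i j v * ?\<mu>' j) / \<mu> v" for i
    define S where "S = (\<Sum>i\<in>UNIV. k i *\<^sub>R P i v)"
    define N0 where "N0 = (1 / \<mu> v) *\<^sub>R e + S"
    define N where "N = N0 - (\<beta> N0 N0 / 2) *\<^sub>R \<Psi> v"
    have e: "\<beta> e (\<Psi> v) = \<mu> v" "\<beta> (P i v) e = ?\<mu>' i" for i
      by (simp_all add: e_def \<beta>_def \<Psi>_def P_def D\<Psi>[OF v] h.zero_left h.zero_right)
    have P\<Psi>: "\<beta> (P i v) (\<Psi> v) = 0" for i
      by (simp add: \<beta>_def \<Psi>_def P_def D\<Psi>[OF v] h.add_left h.scaleR_left h.scaleR_right h(2)[of "?D v (axis i 1)" "\<Phi> v"] field_simps)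
    have PS: "\<beta> (P l v) S = - ?\<mu>' l / \<mu> v" for l
    proof -
      have "\<beta> (P l v) S = (\<Sum>i\<in>UNIV. k i * G l i v)"
        by (simp add: S_def B.sum_right B.scaleR_right G_eq[OF v])
      also have "\<dots> = - (\<Sum>i\<in>UNIV. \<Sum>j\<in>UNIV. G l i v * upper_metric g i j v * ?\<mu>' j) / \<mu> v"
        by (simp add: k_def sum_distrib_left sum_distrib_right sum_divide_distrib sum_negf mult_ac)
      also have "(\<Sum>i\<in>UNIV. \<Sum>j\<in>UNIV. G l i v * upper_metric g i j v * ?\<mu>' j) = (\<Sum>j\<in>UNIV. (\<Sum>i\<in>UNIV. G l i v * upper_metric g i j v) * ?\<mu>' j)"
        by (subst sum.swap) (simp add: sum_distrib_right)
      also have "\<dots> = ?\<mu>' l"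
        by (simp add: upper_lower(2)[OF v] if_distrib[of "\<lambda>x. x * _"] cong: if_cong)
      finally show ?thesis .
    qed
    have S\<Psi>: "\<beta> S (\<Psi> v) = 0" by (simp add: S_def B.sum_left B.scaleR_left P\<Psi>)
    have N0: "\<beta> N0 (\<Psi> v) = 1" "\<beta> (P l v) N0 = 0" for l
      using \<mu>(2)[OF v] by (simp_all add: N0_def B.add_left B.add_right B.scaleR_left B.scaleR_right e S\<Psi> PS)
    have N: "\<beta> N (\<Psi> v) = 1" "\<beta> (P l v) N = 0" "\<beta> N N = 0" for l
      by (simp_all add: N_def B.diff_left B.diff_right B.scaleR_left B.scaleR_right N0 null P\<Psi> \<beta>sym[of "\<Psi> v" N0])
    show ?thesis
    proof (rule weyl_eq_0_if_null_cone[OF v n null N(2)])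
      fix y assume y: "\<And>l. \<beta> (P l v) y = 0"
      \<comment> \<open>The remainder is orthogonal to the tangent vectors, to \<Psi> and to
        \<open>N\<close>, hence also to \<open>e\<close>, which lies in their span. Orthogonality to
        \<open>e\<close> removes the first component; the others then vanish by
        \<open>nd\<close>.\<close>
      define y' where "y' = y - (\<beta> y N *\<^sub>R \<Psi> v + \<beta> y (\<Psi> v) *\<^sub>R N)"
      have y'P: "\<beta> (P l v) y' = 0" for l
        by (simp add: y'_def B.diff_right B.add_right B.scaleR_right y P\<Psi> N)
      have y'\<Psi>: "\<beta> (\<Psi> v) y' = 0" and y'N: "\<beta> N y' = 0"
        by (simp_all add: y'_def B.diff_right B.add_right B.scaleR_right N null \<beta>sym[of "\<Psi> v" N] \<beta>sym[of "\<Psi> v" y] \<beta>sym[of N y])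
      have "\<beta> S y' = 0" by (simp add: S_def B.sum_left B.scaleR_left y'P)
      moreover have "e = \<mu> v *\<^sub>R (N + (\<beta> N0 N0 / 2) *\<^sub>R \<Psi> v - S)"
        using \<mu>(2)[OF v] by (simp add: N_def N0_def)
      ultimately have ey: "\<beta> e y' = 0"
        using y'N y'\<Psi> by (simp add: B.scaleR_left B.diff_left B.add_left)
      obtain r x s where y3: "y' = (r, x, s)" by (metis surj_pair)
      have r: "r = 0" using ey by (simp add: e_def y3 \<beta>_def h.zero_left)
      have "\<mu> v * (h (\<Phi> v) x + s / 2) = 0"
        using y'\<Psi> by (simp add: y3 r \<beta>_def \<Psi>_def h.scaleR_left algebra_simps)
      then have "h (\<Phi> v) x + s / 2 = 0" using \<mu>(2)[OF v] by simp
      then have s: "s = - 2 * h (\<Phi> v) x" by (simp add: field_simps)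
      have "\<mu> v * h (?D v (axis l 1)) x = 0" for l
        using y'P[of l] by (simp add: y3 r s \<beta>_def P_def D\<Psi>[OF v] h.add_left h.scaleR_left algebra_simps)
      then have "x = 0" using nd[OF v, of x] \<mu>(2)[OF v] by simp
      then have "y' = 0" using s by (simp add: y3 r h.zero_right zero_prod_def)
      then show "y = \<beta> y N *\<^sub>R \<Psi> v + \<beta> y (\<Psi> v) *\<^sub>R N" by (simp add: y'_def)
    qed
  qed
qed

section \<open>The chart adapted to a solution\<close>

text \<open>\<open>apolar\<close> is the invariant symplectic form on binary cubics.\<close>

definition cubic :: "real \<Rightarrow> real \<Rightarrow> real \<Rightarrow> real \<Rightarrow> real \<Rightarrow> real" where
  "cubic c0 c1 c2 c3 s = c0 + c1 * s + c2 * s^2 + c3 * s^3"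

definition dcubic :: "real \<Rightarrow> real \<Rightarrow> real \<Rightarrow> real \<Rightarrow> real" where
  "dcubic c1 c2 c3 s = c1 + 2 * c2 * s + 3 * c3 * s^2"

definition ddcubic :: "real \<Rightarrow> real \<Rightarrow> real \<Rightarrow> real" where
  "ddcubic c2 c3 s = 2 * c2 + 6 * c3 * s"

definition apolar :: "real \<Rightarrow> real \<Rightarrow> real \<Rightarrow> real \<Rightarrow> real \<Rightarrow> real \<Rightarrow> real \<Rightarrow> real \<Rightarrow> real" where
  "apolar a0 a1 a2 a3 b0 b1 b2 b3 = (a1 * b2 - a2 * b1) / 3 + a3 * b0 - a0 * b3"

text \<open>The pairing is invariant under translation of the variable. Apolarity thereby becomes a
  relation between values and derivatives at every point \<open>s\<close>.\<close>

lemma apolar_Taylor: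
  "apolar a0 a1 a2 a3 b0 b1 b2 b3 = apolar (cubic a0 a1 a2 a3 s) (dcubic a1 a2 a3 s) (ddcubic a2 a3 s / 2) a3
    (cubic b0 b1 b2 b3 s) (dcubic b1 b2 b3 s) (ddcubic b2 b3 s / 2) b3"
  by (simp add: apolar_def cubic_def dcubic_def ddcubic_def field_simps power2_eq_square power3_eq_cube)

text \<open>In terms of \<open>t\<close>, both \<open>F' = G1 / C\<close> and \<open>q F' - F = G2 / C\<close> are rational with the same
  denominator.  The equation for \<open>q\<close> is the quotient of the derivatives of these two, and the equation
  for \<open>F\<close> results by eliminating \<open>F'\<close>.\<close>

locale solution_chart =
  fixes I :: "real set" and F t :: "real \<Rightarrow> real"
    and c0 c1 c2 c3 a0 a1 a2 a3 b0 b1 b2 b3 :: real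
  fixes C dC ddC G1 dG1 ddG1 G2 dG2 ddG2 A dA B dB ddB :: "real \<Rightarrow> real" and \<omega> :: real
  defines "C \<equiv> cubic c0 c1 c2 c3" and "dC \<equiv> dcubic c1 c2 c3" and "ddC \<equiv> ddcubic c2 c3"
    and "G1 \<equiv> cubic a0 a1 a2 a3" and "dG1 \<equiv> dcubic a1 a2 a3" and "ddG1 \<equiv> ddcubic a2 a3"
    and "G2 \<equiv> cubic b0 b1 b2 b3" and "dG2 \<equiv> dcubic b1 b2 b3" and "ddG2 \<equiv> ddcubic b2 b3"
    and "A \<equiv> \<lambda>s. C s * dG2 s - dC s * G2 s" and "dA \<equiv> \<lambda>s. C s * ddG2 s - ddC s * G2 s"
    and "B \<equiv> \<lambda>s. C s * dG1 s - dC s * G1 s" and "dB \<equiv> \<lambda>s. C s * ddG1 s - ddC s * G1 s"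
    and "ddB \<equiv> \<lambda>s. C s * (6 * a3) + dC s * ddG1 s - ddC s * dG1 s - (6 * c3) * G1 s"
    and "\<omega> \<equiv> apolar a0 a1 a2 a3 b0 b1 b2 b3"
  assumes I: "open I" and smooth_t: "smooth_on I t"
    and C: "q \<in> I \<Longrightarrow> C (t q) \<noteq> 0" and B: "q \<in> I \<Longrightarrow> B (t q) \<noteq> 0"
    and qB: "q \<in> I \<Longrightarrow> q * B (t q) = A (t q)"
    and FC: "q \<in> I \<Longrightarrow> F q * C (t q) = q * G1 (t q) - G2 (t q)"
    and apolar_a: "apolar a0 a1 a2 a3 c0 c1 c2 c3 = 0" and apolar_b: "apolar b0 b1 b2 b3 c0 c1 c2 c3 = 0"
    and \<omega>: "\<omega> \<noteq> 0"
begin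

lemma poly_derivatives:
  "(C has_real_derivative dC s) (at s)" "(dC has_real_derivative ddC s) (at s)"
  "(G1 has_real_derivative dG1 s) (at s)" "(dG1 has_real_derivative ddG1 s) (at s)"
  "(G2 has_real_derivative dG2 s) (at s)" "(dG2 has_real_derivative ddG2 s) (at s)"
  "(ddC has_real_derivative 6 * c3) (at s)" "(ddG1 has_real_derivative 6 * a3) (at s)"
  unfolding C_def dC_def ddC_def G1_def dG1_def ddG1_def G2_def dG2_def ddG2_def
    cubic_def dcubic_def ddcubic_def
  by (auto intro!: derivative_eq_intros simp: algebra_simps power2_eq_square)

lemma AB_derivatives:
  "(A has_real_derivative dA s) (at s)" "(B has_real_derivative dB s) (at s)" "(dB has_real_derivative ddB s) (at s)"
  unfolding A_def dA_def B_def dB_def ddB_def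
  by (auto intro!: derivative_eq_intros poly_derivatives simp: algebra_simps)

text \<open>The identity \<open>id\<close> expresses the difference of both sides through the
  apolarity relations \<open>h1\<close> and \<open>h2\<close>. Since q = A / B along a solution,
  this computes the derivative of q with respect to t.\<close>

lemma Jacobian: "dA s * B s - A s * dB s = 6 * \<omega> * (C s)^2"
proof -
  have h1: "(dG1 s * (ddC s / 2) - ddG1 s / 2 * dC s) / 3 + a3 * C s - G1 s * c3 = 0"
    and h2: "(dG2 s * (ddC s / 2) - ddG2 s / 2 * dC s) / 3 + b3 * C s - G2 s * c3 = 0"
    using apolar_a apolar_b
    by (simp_all add: apolar_Taylor[where s=s and ?b0.0=c0] C_def dC_def ddC_def G1_def dG1_def ddG1_def G2_def dG2_def ddG2_def)
      (simp_all add: apolar_def)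
  have h3: "\<omega> = (dG1 s * (ddG2 s / 2) - ddG1 s / 2 * dG2 s) / 3 + a3 * G2 s - G1 s * b3"
    unfolding \<omega>_def
    by (subst apolar_Taylor[where s=s]) (simp add: apolar_def G1_def dG1_def ddG1_def G2_def dG2_def ddG2_def)
  have id: "6 * ((dG1 s * (ddG2 s / 2) - ddG1 s / 2 * dG2 s) / 3 + a3 * G2 s - G1 s * b3) * (C s)^2
      = (C s * ddG2 s - ddC s * G2 s) * (C s * dG1 s - dC s * G1 s) - (C s * dG2 s - dC s * G2 s) * (C s * ddG1 s - ddC s * G1 s)
        + 6 * C s * (G2 s * ((dG1 s * (ddC s / 2) - ddG1 s / 2 * dC s) / 3 + a3 * C s - G1 s * c3)
          - G1 s * ((dG2 s * (ddC s / 2) - ddG2 s / 2 * dC s) / 3 + b3 * C s - G2 s * c3))"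
    by (simp add: field_simps power2_eq_square)
  show ?thesis
    unfolding h3 id h1 h2 A_def dA_def B_def dB_def by simp
qed

text \<open>Up to a constant factor this is the second transvectant of \<open>C\<close> and the
  quartic \<open>B\<close>; it equals 6 C times the apolar pairing of \<open>G1\<close> and
  \<open>C\<close>. It serves to eliminate \<open>ddB\<close> from the fourth derivative of
  F.\<close>

lemma transvectant: "C s * ddB s - 2 * dC s * dB s + 2 * ddC s * B s = 0"
proof -
  have "(dG1 s * (ddC s / 2) - ddG1 s / 2 * dC s) / 3 + a3 * C s - G1 s * c3 = 0"
    using apolar_a
    by (simp add: apolar_Taylor[where s=s and ?b0.0=c0] C_def dC_def ddC_def G1_def dG1_def ddG1_def)
      (simp add: apolar_def)
  moreover have "C s * ddB s - 2 * dC s * dB s + 2 * ddC s * B s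
      = 6 * C s * ((dG1 s * (ddC s / 2) - ddG1 s / 2 * dC s) / 3 + a3 * C s - G1 s * c3)"
    by (simp add: ddB_def dB_def B_def field_simps)
  ultimately show ?thesis by simp
qed

text \<open>By \<open>Jacobian\<close>, the reciprocal of the derivative of A / B, hence t' as a
  function of t.\<close>

definition "\<tau> s = (B s)^2 / (6 * \<omega> * (C s)^2)"

lemma t_derivative:
  assumes q: "q \<in> I" shows "(t has_real_derivative \<tau> (t q)) (at q)"
proof -
  have t: "(t has_real_derivative deriv t q) (at q)" by (rule smooth_on_deriv(2)[OF I smooth_t q])
  have "((\<lambda>q. q * B (t q)) has_real_derivative B (t q) + q * (dB (t q) * deriv t q)) (at q)"
    by (auto intro!: derivative_eq_intros DERIV_chain2[OF AB_derivatives(2) t])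
  moreover have "((\<lambda>q. q * B (t q)) has_real_derivative dA (t q) * deriv t q) (at q)"
    by (rule has_field_derivative_transform_within_open[OF DERIV_chain2[OF AB_derivatives(1) t] I q])
      (simp add: qB)
  ultimately have "B (t q) + q * (dB (t q) * deriv t q) = dA (t q) * deriv t q"
    by (rule DERIV_unique)
  then have "B (t q) * (B (t q) + q * (dB (t q) * deriv t q)) = B (t q) * (dA (t q) * deriv t q)"
    by simp
  then have "(B (t q))^2 = (dA (t q) * B (t q) - (q * B (t q)) * dB (t q)) * deriv t q"
    by (simp add: algebra_simps power2_eq_square)
  then have "(B (t q))^2 = 6 * \<omega> * (C (t q))^2 * deriv t q"
    unfolding qB[OF q] Jacobian .
  then have "deriv t q = \<tau> (t q)" using C[OF q] \<omega> by (simp add: \<tau>_def field_simps)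
  then show ?thesis using t by simp
qed

lemma \<tau>_nonzero: "q \<in> I \<Longrightarrow> \<tau> (t q) \<noteq> 0"
  using B C \<omega> by (simp add: \<tau>_def)

lemma F_eq: "q \<in> I \<Longrightarrow> F q = (q * G1 (t q) - G2 (t q)) / C (t q)"
  using FC C by (simp add: field_simps)

lemma smooth_poly_t:
  "smooth_on I (\<lambda>q. C (t q))" "smooth_on I (\<lambda>q. dC (t q))" "smooth_on I (\<lambda>q. G1 (t q))" "smooth_on I (\<lambda>q. G2 (t q))"
  "smooth_on I (\<lambda>q. B (t q))"
  unfolding B_def C_def dC_def G1_def dG1_def G2_def cubic_def dcubic_def
  by (intro smooth_intros I smooth_t)+

lemma smooth_F: "smooth_on I F"
proof -
  have "smooth_on I (\<lambda>q. (q * G1 (t q) - G2 (t q)) / C (t q))"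
    by (intro smooth_intros I smooth_poly_t C)
  then show ?thesis by (rule smooth_on_cong[OF I, rotated]) (simp add: F_eq)
qed

section \<open>Derivatives of F as functions of t\<close>

definition "F2 s = (B s)^3 / (6 * \<omega> * (C s)^4)"
definition "F3 s = (3 * (B s)^4 * dB s * C s - 4 * (B s)^5 * dC s) / ((6 * \<omega>)^2 * (C s)^7)"
definition "F4 s = \<tau> s * ((12 * (B s)^3 * (dB s)^2 * (C s)^2 + 3 * (B s)^4 * ddB s * (C s)^2
    - 38 * (B s)^4 * dB s * dC s * C s - 4 * (B s)^5 * ddC s * C s + 28 * (B s)^5 * (dC s)^2)
  / ((6 * \<omega>)^2 * (C s)^8))"

text \<open>As for a Legendre transform, the terms containing t' cancel: their coefficient is q B -
  A.\<close>

lemma F_derivative: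
  assumes q: "q \<in> I" shows "(F has_real_derivative G1 (t q) / C (t q)) (at q)"
proof -
  note t = t_derivative[OF q]
  have "((\<lambda>q. (q * G1 (t q) - G2 (t q)) / C (t q)) has_real_derivative
     ((G1 (t q) + q * (dG1 (t q) * \<tau> (t q)) - dG2 (t q) * \<tau> (t q)) * C (t q)
       - (q * G1 (t q) - G2 (t q)) * (dC (t q) * \<tau> (t q))) / (C (t q) * C (t q))) (at q)"
    by (auto intro!: derivative_eq_intros DERIV_chain2[OF poly_derivatives(1) t] DERIV_chain2[OF poly_derivatives(3) t]
        DERIV_chain2[OF poly_derivatives(5) t] simp: C[OF q])
  moreover have "((G1 (t q) + q * (dG1 (t q) * \<tau> (t q)) - dG2 (t q) * \<tau> (t q)) * C (t q)
       - (q * G1 (t q) - G2 (t q)) * (dC (t q) * \<tau> (t q))) / (C (t q) * C (t q))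
     = (G1 (t q) * C (t q) + \<tau> (t q) * (q * B (t q) - A (t q))) / (C (t q) * C (t q))"
    by (simp add: B_def A_def algebra_simps)
  ultimately have "((\<lambda>q. (q * G1 (t q) - G2 (t q)) / C (t q)) has_real_derivative G1 (t q) / C (t q)) (at q)"
    using C[OF q] by (simp add: qB[OF q])
  then show ?thesis
    by (rule has_field_derivative_transform_within_open[OF _ I q]) (simp add: F_eq)
qed

lemma F1_derivative:
  assumes q: "q \<in> I" shows "((\<lambda>q. G1 (t q) / C (t q)) has_real_derivative F2 (t q)) (at q)"
proof -
  note t = t_derivative[OF q]
  have "((\<lambda>q. G1 (t q) / C (t q)) has_real_derivative
     (dG1 (t q) * \<tau> (t q) * C (t q) - G1 (t q) * (dC (t q) * \<tau> (t q))) / (C (t q) * C (t q))) (at q)"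
    by (auto intro!: derivative_eq_intros DERIV_chain2[OF poly_derivatives(1) t] DERIV_chain2[OF poly_derivatives(3) t]
        simp: C[OF q])
  moreover have "(dG1 (t q) * \<tau> (t q) * C (t q) - G1 (t q) * (dC (t q) * \<tau> (t q))) / (C (t q) * C (t q))
    = B (t q) * \<tau> (t q) / (C (t q))^2"
    by (simp add: B_def algebra_simps power2_eq_square)
  moreover have "B (t q) * \<tau> (t q) / (C (t q))^2 = F2 (t q)"
    using C[OF q] \<omega> by (simp add: F2_def \<tau>_def frac_eq_eq) (simp add: eval_nat_numeral algebra_simps)
  ultimately show ?thesis by simp
qed

lemma F2_derivative:
  assumes q: "q \<in> I" shows "((\<lambda>q. F2 (t q)) has_real_derivative F3 (t q)) (at q)"
proof -
  have id: "(3 * b^2 * db * (k * c^4) - b^3 * (k * (4 * c^3 * dc))) / ((k * c^4) * (k * c^4)) * (b^2 / (k * c^2))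
      = (3 * b^4 * db * c - 4 * b^5 * dc) / (k^2 * c^7)" if "c \<noteq> 0" "k \<noteq> 0" for b db c dc k :: real
    using that by (simp add: frac_eq_eq) (simp add: eval_nat_numeral algebra_simps)
  have D: "((\<lambda>s. (B s)^3) has_real_derivative 3 * (B s)^2 * dB s) (at s)"
    "((\<lambda>s. 6 * \<omega> * (C s)^4) has_real_derivative 6 * \<omega> * (4 * (C s)^3 * dC s)) (at s)" for s
    by (auto intro!: derivative_eq_intros AB_derivatives poly_derivatives)
  have "6 * \<omega> * (C (t q))^4 \<noteq> 0" using C[OF q] \<omega> by simp
  from DERIV_chain2[OF DERIV_divide[OF D this] t_derivative[OF q]] id[OF C[OF q], of "6 * \<omega>" "B (t q)" "dB (t q)" "dC (t q)"]
  show ?thesis using \<omega> by (simp add: F2_def[abs_def] F3_def \<tau>_def)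
qed

lemma F3_derivative:
  assumes q: "q \<in> I" shows "((\<lambda>q. F3 (t q)) has_real_derivative F4 (t q)) (at q)"
proof -
  have id: "((12 * b^3 * db * db * c + 3 * b^4 * (ddb * c + db * dc) - (20 * b^4 * db * dc + 4 * b^5 * ddc)) * (k * c^7)
        - (3 * b^4 * db * c - 4 * b^5 * dc) * (k * (7 * c^6 * dc))) / ((k * c^7) * (k * c^7))
      = (12 * b^3 * db^2 * c^2 + 3 * b^4 * ddb * c^2 - 38 * b^4 * db * dc * c
        - 4 * b^5 * ddc * c + 28 * b^5 * dc^2) / (k * c^8)"
    if "c \<noteq> 0" "k \<noteq> 0" for b db ddb c dc ddc k :: real
    using that by (simp add: frac_eq_eq) (simp add: eval_nat_numeral algebra_simps)
  have D: "((\<lambda>s. 3 * (B s)^4 * dB s * C s - 4 * (B s)^5 * dC s) has_real_derivative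
      12 * (B s)^3 * dB s * dB s * C s + 3 * (B s)^4 * (ddB s * C s + dB s * dC s)
         - (20 * (B s)^4 * dB s * dC s + 4 * (B s)^5 * ddC s)) (at s)"
    "((\<lambda>s. (6 * \<omega>)^2 * (C s)^7) has_real_derivative (6 * \<omega>)^2 * (7 * (C s)^6 * dC s)) (at s)" for s
    by (auto intro!: derivative_eq_intros AB_derivatives poly_derivatives simp: algebra_simps)
  have k: "(6 * \<omega>)^2 \<noteq> 0" using \<omega> by simp
  then have "(6 * \<omega>)^2 * (C (t q))^7 \<noteq> 0" using C[OF q] by simp
  from DERIV_chain2[OF DERIV_divide[OF D this] t_derivative[OF q]]
  show ?thesis
    unfolding F3_def[abs_def] F4_def id[OF C[OF q] k] by (simp only: mult.commute[of _ "\<tau> (t q)"])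
qed

end

context solution_chart
begin

text \<open>The coefficients of the cubic \<open>x G2 - p G1 + z C\<close>.\<close>

definition "n0 v = v$1 * b0 - v$4 * a0 + v$3 * c0" for v :: "real^5"
definition "n1 v = v$1 * b1 - v$4 * a1 + v$3 * c1" for v :: "real^5"
definition "n2 v = v$1 * b2 - v$4 * a2 + v$3 * c2" for v :: "real^5"
definition "n3 v = v$1 * b3 - v$4 * a3 + v$3 * c3" for v :: "real^5"
lemmas n_defs = n0_def n1_def n2_def n3_def

abbreviation "M \<equiv> M_xyzpq I"

lemma open_M: "open M"
proof -
  have "M = (\<lambda>v. v$5) -` I" by (auto simp: M_xyzpq_def)
  then show ?thesis using open_vimage[OF I, of "\<lambda>v. v$5"] by (simp add: continuous_on_component)
qed

lemma smooth_on_q: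
  assumes "smooth_on I f" shows "smooth_on M (\<lambda>v. f (v$5))"
  by (rule smooth_on_compose[OF open_M I smooth_on_vec_nth[OF open_M smooth_on_id[OF open_M]] assms])
    (auto simp: M_xyzpq_def)

lemma has_derivative_q:
  assumes "(f has_real_derivative f') (at (v$5))"
  shows "((\<lambda>v. f (v$5)) has_derivative (\<lambda>w. f' * w$5)) (at v)"
  using diff_chain_at[OF has_derivative_vec_nth[OF has_derivative_ident] assms[unfolded has_field_derivative_def]]
  by (simp add: o_def)

text \<open>The coordinates other than the last are \<open>t\<close> and the coefficients of the cubic that describe it
  modulo cubes of linear forms at \<open>t\<close>; the last one is found by integrating the equations of \<open>flat_dist\<close>.\<close>

definition \<Phi> :: "real^5 \<Rightarrow> real^5" where
  "\<Phi> v = vec5 (- (n2 v + 3 * n3 v * t (v$5))) (t (v$5)) (n1 v + n2 v * t (v$5)) (3 * n0 v + n1 v * t (v$5))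
    (9/2 * \<omega> * (v$1 * v$4 - 2 * v$2) - n1 v * n2 v / 2 + 9/2 * n0 v * n3 v + (3 * n1 v * n3 v - (n2 v)^2) * t (v$5))"

definition \<Phi>' :: "real^5 \<Rightarrow> real^5 \<Rightarrow> real^5" where
  "\<Phi>' v w = (let s = t (v$5); dt = \<tau> s * w$5 in
    vec5 (- (n2 w + 3 * n3 w * s + 3 * n3 v * dt)) dt (n1 w + n2 w * s + n2 v * dt) (3 * n0 w + n1 w * s + n1 v * dt)
      (9/2 * \<omega> * (w$1 * v$4 + v$1 * w$4 - 2 * w$2) - (n1 w * n2 v + n1 v * n2 w) / 2
        + 9/2 * (n0 w * n3 v + n0 v * n3 w) + (3 * n1 w * n3 v + 3 * n1 v * n3 w - 2 * n2 v * n2 w) * s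
        + (3 * n1 v * n3 v - (n2 v)^2) * dt))"

lemma has_derivative_n [derivative_intros]:
  "(n0 has_derivative n0) (at v)" "(n1 has_derivative n1) (at v)" "(n2 has_derivative n2) (at v)" "(n3 has_derivative n3) (at v)"
  unfolding n_defs[abs_def] by (auto intro!: derivative_eq_intros)

lemma has_derivative_\<Phi>: assumes v: "v \<in> M" shows "(\<Phi> has_derivative \<Phi>' v) (at v)"
proof -
  have tq: "((\<lambda>v. t (v$5)) has_derivative (\<lambda>w. \<tau> (t (v$5)) * w$5)) (at v)"
    by (rule has_derivative_q[OF t_derivative]) (use v in \<open>simp add: M_xyzpq_def\<close>)
  show ?thesis
    unfolding \<Phi>_def[abs_def] \<Phi>'_def[abs_def] Let_def
    by (rule has_derivative_vec5;
        ((rule tq) | (auto intro!: derivative_eq_intros tq simp: fun_eq_iff field_simps power2_eq_square))?)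
qed

lemma smooth_n: "open S \<Longrightarrow> smooth_on S n0" "open S \<Longrightarrow> smooth_on S n1" "open S \<Longrightarrow> smooth_on S n2" "open S \<Longrightarrow> smooth_on S n3"
  unfolding n_defs[abs_def] by (intro smooth_intros; assumption)+

lemma smooth_\<Phi>: "smooth_on M \<Phi>"
  unfolding \<Phi>_def[abs_def]
  by (intro smooth_intros smooth_n smooth_on_q smooth_t open_M) auto

lemma frechet_derivative_\<Phi>: "v \<in> M \<Longrightarrow> frechet_derivative \<Phi> (at v) = \<Phi>' v"
  using frechet_derivative_at[OF has_derivative_\<Phi>] by simp

text \<open>\<open>C\<close> is orthogonal to \<open>G1\<close>, \<open>G2\<close> and itself, while
  \<open>G1\<close> and \<open>G2\<close> pair to \<omega>. On the cubics x G2 - p G1 + z C the form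
  therefore recovers x and p and restricts to \<omega> times the area form in (x, p).\<close>

lemma apolar_n:
  "apolar (n0 v) (n1 v) (n2 v) (n3 v) c0 c1 c2 c3 = 0"
  "apolar (n0 v) (n1 v) (n2 v) (n3 v) a0 a1 a2 a3 = - \<omega> * v$1"
  "apolar (n0 v) (n1 v) (n2 v) (n3 v) b0 b1 b2 b3 = - \<omega> * v$4"
  "apolar (n0 v) (n1 v) (n2 v) (n3 v) (n0 w) (n1 w) (n2 w) (n3 w) = \<omega> * (v$1 * w$4 - v$4 * w$1)"
proof -
  have ac: "(a1 * c2 - a2 * c1) / 3 + a3 * c0 - a0 * c3 = 0" and bc: "(b1 * c2 - b2 * c1) / 3 + b3 * c0 - b0 * c3 = 0"
    using apolar_a apolar_b by (simp_all add: apolar_def)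
  have w: "\<omega> = (a1 * b2 - a2 * b1) / 3 + a3 * b0 - a0 * b3" by (simp add: \<omega>_def apolar_def)
  have "apolar (n0 v) (n1 v) (n2 v) (n3 v) c0 c1 c2 c3
      = v$1 * ((b1 * c2 - b2 * c1) / 3 + b3 * c0 - b0 * c3) - v$4 * ((a1 * c2 - a2 * c1) / 3 + a3 * c0 - a0 * c3)"
    by (simp add: apolar_def n_defs field_simps)
  then show "apolar (n0 v) (n1 v) (n2 v) (n3 v) c0 c1 c2 c3 = 0" unfolding ac bc by simp
  have "apolar (n0 v) (n1 v) (n2 v) (n3 v) a0 a1 a2 a3
      = - ((a1 * b2 - a2 * b1) / 3 + a3 * b0 - a0 * b3) * v$1 - v$3 * ((a1 * c2 - a2 * c1) / 3 + a3 * c0 - a0 * c3)"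
    by (simp add: apolar_def n_defs field_simps)
  then show "apolar (n0 v) (n1 v) (n2 v) (n3 v) a0 a1 a2 a3 = - \<omega> * v$1" unfolding ac w[symmetric] by simp
  have "apolar (n0 v) (n1 v) (n2 v) (n3 v) b0 b1 b2 b3
      = - ((a1 * b2 - a2 * b1) / 3 + a3 * b0 - a0 * b3) * v$4 - v$3 * ((b1 * c2 - b2 * c1) / 3 + b3 * c0 - b0 * c3)"
    by (simp add: apolar_def n_defs field_simps)
  then show "apolar (n0 v) (n1 v) (n2 v) (n3 v) b0 b1 b2 b3 = - \<omega> * v$4" unfolding bc w[symmetric] by simp
  have "apolar (n0 v) (n1 v) (n2 v) (n3 v) (n0 w) (n1 w) (n2 w) (n3 w)
      = ((a1 * b2 - a2 * b1) / 3 + a3 * b0 - a0 * b3) * (v$1 * w$4 - v$4 * w$1)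
        + (v$1 * w$3 - v$3 * w$1) * ((b1 * c2 - b2 * c1) / 3 + b3 * c0 - b0 * c3)
        - (v$4 * w$3 - v$3 * w$4) * ((a1 * c2 - a2 * c1) / 3 + a3 * c0 - a0 * c3)"
    by (simp add: apolar_def n_defs field_simps)
  then show "apolar (n0 v) (n1 v) (n2 v) (n3 v) (n0 w) (n1 w) (n2 w) (n3 w) = \<omega> * (v$1 * w$4 - v$4 * w$1)"
    unfolding ac bc w[symmetric] by simp
qed

text \<open>A cubic is determined by its contraction with a point \<open>s\<close> up to a multiple of \<open>(X - s)^3\<close>; the
  multiple is fixed by apolarity to \<open>C\<close>, since \<open>C\<close> does not vanish at \<open>s\<close>.\<close>

definition "r1 w = w$3 + w$1 * w$2" for w :: "real^5"
definition "r0 w = (w$4 - r1 w * w$2) / 3" for w :: "real^5"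
definition "r3 w = - ((r1 w * c2 + w$1 * c1) / 3 - r0 w * c3) / C (w$2)" for w :: "real^5"
definition "m0 w = r0 w - (w$2)^3 * r3 w" for w :: "real^5"
definition "m1 w = r1 w + 3 * (w$2)^2 * r3 w" for w :: "real^5"
definition "m2 w = - w$1 - 3 * w$2 * r3 w" for w :: "real^5"

text \<open>The second and third pairing of \<open>apolar_n\<close>, solved for x and p.\<close>

definition "inv_x w = - apolar (m0 w) (m1 w) (m2 w) (r3 w) a0 a1 a2 a3 / \<omega>" for w
definition "inv_p w = - apolar (m0 w) (m1 w) (m2 w) (r3 w) b0 b1 b2 b3 / \<omega>" for w

definition \<Psi> :: "real^5 \<Rightarrow> real^5" where
  "\<Psi> w = vec5 (inv_x w)
     ((inv_x w * inv_p w - 2 / (9 * \<omega>) * (w$5 + m1 w * m2 w / 2 - 9/2 * m0 w * r3 w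
        - (3 * m1 w * r3 w - (m2 w)^2) * w$2)) / 2)
     ((cubic (m0 w) (m1 w) (m2 w) (r3 w) (w$2) - inv_x w * G2 (w$2) + inv_p w * G1 (w$2)) / C (w$2))
     (inv_p w) (A (w$2) / B (w$2))"

lemma \<Psi>_\<Phi>:
  assumes v: "v \<in> M" shows "\<Psi> (\<Phi> v) = v"
proof -
  let ?s = "t (v$5)" and ?w = "\<Phi> v"
  have q: "v$5 \<in> I" using v by (simp add: M_xyzpq_def)
  have w: "?w$1 = - (n2 v + 3 * n3 v * ?s)" "?w$2 = ?s" "?w$3 = n1 v + n2 v * ?s" "?w$4 = 3 * n0 v + n1 v * ?s"
    by (simp_all add: \<Phi>_def)
  have r1: "r1 ?w = n1 v - 3 * n3 v * ?s^2" by (simp add: r1_def w algebra_simps power2_eq_square)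
  have r0: "r0 ?w = n0 v + n3 v * ?s^3" by (simp add: r0_def r1 w algebra_simps power2_eq_square power3_eq_cube)
  have "(n1 v * c2 - n2 v * c1) / 3 + n3 v * c0 - n0 v * c3 = 0" using apolar_n(1)[of v] by (simp add: apolar_def)
  then have "(r1 ?w * c2 + ?w$1 * c1) / 3 - r0 ?w * c3 = - n3 v * C ?s"
    by (simp add: r1 r0 w C_def cubic_def field_simps)
  then have r3: "r3 ?w = n3 v" using C[OF q] by (simp add: r3_def w)
  have m: "m0 ?w = n0 v" "m1 ?w = n1 v" "m2 ?w = n2 v" by (simp_all add: m0_def m1_def m2_def r0 r1 r3 w algebra_simps)
  have x: "inv_x ?w = v$1" and p: "inv_p ?w = v$4" using \<omega> by (simp_all add: inv_x_def inv_p_def m r3 apolar_n)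
  have z: "cubic (n0 v) (n1 v) (n2 v) (n3 v) ?s - v$1 * G2 ?s + v$4 * G1 ?s = v$3 * C ?s"
    by (simp add: cubic_def n_defs G2_def G1_def C_def algebra_simps)
  have y: "(v$1 * v$4 - 2 / (9 * \<omega>) * (?w$5 + n1 v * n2 v / 2 - 9/2 * n0 v * n3 v - (3 * n1 v * n3 v - (n2 v)^2) * ?s)) / 2 = v$2"
    using \<omega> by (simp add: \<Phi>_def field_simps)
  have "A ?s / B ?s = v$5" using qB[OF q] B[OF q] by (simp add: field_simps)
  then show ?thesis
    unfolding \<Psi>_def vec5_eq_iff m r3 x p w(2) using z y C[OF q] by simp
qed

text \<open>The left inverse \<Psi> makes \<Phi> injective, and invariance of domain then makes the
  image open.\<close>

lemma diffeo_\<Phi>: "diffeo M (\<Phi> ` M) \<Phi> \<Psi>"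
proof -
  have inj: "inj_on \<Phi> M" by (metis \<Psi>_\<Phi> inj_onI)
  have op: "open (\<Phi> ` M)"
    by (rule invariance_of_domain[OF smooth_on_continuous_on[OF smooth_\<Phi>] open_M inj])
  have w2: "C (w$2) \<noteq> 0 \<and> B (w$2) \<noteq> 0" if w: "w \<in> \<Phi> ` M" for w
    using w C B by (auto simp: \<Phi>_def M_xyzpq_def)
  have s2: "smooth_on (\<Phi> ` M) (\<lambda>w. w $ 2)" by (intro smooth_intros op)
  have sG: "smooth_on (\<Phi> ` M) (\<lambda>w. C (w$2))" "smooth_on (\<Phi> ` M) (\<lambda>w. dC (w$2))" "smooth_on (\<Phi> ` M) (\<lambda>w. G1 (w$2))"
    "smooth_on (\<Phi> ` M) (\<lambda>w. dG1 (w$2))" "smooth_on (\<Phi> ` M) (\<lambda>w. G2 (w$2))" "smooth_on (\<Phi> ` M) (\<lambda>w. dG2 (w$2))"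
    unfolding C_def dC_def G1_def dG1_def G2_def dG2_def cubic_def dcubic_def by (intro smooth_intros op s2)+
  have sAB: "smooth_on (\<Phi> ` M) (\<lambda>w. A (w$2))" "smooth_on (\<Phi> ` M) (\<lambda>w. B (w$2))"
    unfolding A_def B_def by (intro smooth_intros op sG)+
  have r: "smooth_on (\<Phi> ` M) r1" "smooth_on (\<Phi> ` M) r0" unfolding r1_def[abs_def] r0_def[abs_def] by (intro smooth_intros op; simp)+
  have r3: "smooth_on (\<Phi> ` M) r3" unfolding r3_def[abs_def] by (intro smooth_intros op r sG) (use w2 in auto)
  have m: "smooth_on (\<Phi> ` M) m0" "smooth_on (\<Phi> ` M) m1" "smooth_on (\<Phi> ` M) m2"
    unfolding m0_def[abs_def] m1_def[abs_def] m2_def[abs_def] by (intro smooth_intros op r r3)+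
  have xp: "smooth_on (\<Phi> ` M) inv_x" "smooth_on (\<Phi> ` M) inv_p"
    unfolding inv_x_def[abs_def] inv_p_def[abs_def] apolar_def by (intro smooth_intros op m r3; use \<omega> in simp)+
  have "smooth_on (\<Phi> ` M) \<Psi>"
    unfolding \<Psi>_def[abs_def] cubic_def by (intro smooth_intros op xp m r3 sG sAB) (use w2 \<omega> in auto)
  then show ?thesis
    using open_M op smooth_\<Phi> \<Psi>_\<Phi> by (auto simp: diffeo_def)
qed

section \<open>The chart carries the distribution to the flat one\<close>

definition "ee0 q = b0 - q * a0 + F q * c0"
definition "ee1 q = b1 - q * a1 + F q * c1"
definition "ee2 q = b2 - q * a2 + F q * c2"
definition "ee3 q = b3 - q * a3 + F q * c3"
lemmas ee_defs = ee0_def ee1_def ee2_def ee3_def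

text \<open>The cubic with these coefficients has a double root at \<open>t q\<close>.\<close>

lemma ee:
  assumes q: "q \<in> I"
  shows "ee0 q = ee2 q * (t q)^2 + 2 * ee3 q * (t q)^3" "ee1 q = - 2 * ee2 q * t q - 3 * ee3 q * (t q)^2"
    and "B (t q) * (ee2 q + 3 * ee3 q * t q) = 3 * \<omega> * C (t q)"
proof -
  let ?s = "t q"
  have e: "cubic (ee0 q) (ee1 q) (ee2 q) (ee3 q) ?s = 0"
    using FC[OF q] by (simp add: cubic_def ee_defs G1_def G2_def C_def algebra_simps)
  have de: "dcubic (ee1 q) (ee2 q) (ee3 q) ?s = dG2 ?s - q * dG1 ?s + F q * dC ?s"
    by (simp add: dcubic_def ee_defs dG1_def dG2_def dC_def algebra_simps)
  have dde: "2 * (ee2 q + 3 * ee3 q * ?s) = ddG2 ?s - q * ddG1 ?s + F q * ddC ?s"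
    by (simp add: ddcubic_def ee_defs ddG1_def ddG2_def ddC_def algebra_simps)
  have "C ?s * dcubic (ee1 q) (ee2 q) (ee3 q) ?s = A ?s - q * B ?s + dC ?s * (F q * C ?s - (q * G1 ?s - G2 ?s))"
    unfolding de A_def B_def by (simp add: algebra_simps)
  then have d: "dcubic (ee1 q) (ee2 q) (ee3 q) ?s = 0" using C[OF q] by (simp add: qB[OF q] FC[OF q])
  then show e1: "ee1 q = - 2 * ee2 q * ?s - 3 * ee3 q * ?s^2" by (simp add: dcubic_def)
  show "ee0 q = ee2 q * ?s^2 + 2 * ee3 q * ?s^3"
    using e unfolding cubic_def e1 by (simp add: algebra_simps power2_eq_square power3_eq_cube)
  \<comment> \<open>Half the second derivative at the double root: eliminating q and F by
    \<open>qB\<close> and \<open>FC\<close> leaves the expression of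
    \<open>Jacobian\<close>.\<close>
  have "C ?s * (B ?s * (2 * (ee2 q + 3 * ee3 q * ?s)))
      = B ?s * (C ?s * ddG2 ?s) - (q * B ?s) * (C ?s * ddG1 ?s) + (F q * C ?s) * (B ?s * ddC ?s)"
    unfolding dde by (simp add: algebra_simps)
  also have "\<dots> = B ?s * (C ?s * ddG2 ?s) - (q * B ?s) * (C ?s * ddG1 ?s) + ((q * B ?s) * G1 ?s - B ?s * G2 ?s) * ddC ?s"
    unfolding FC[OF q] by (simp add: algebra_simps)
  also have "\<dots> = dA ?s * B ?s - A ?s * dB ?s"
    unfolding qB[OF q] by (simp add: dA_def dB_def algebra_simps)
  also have "\<dots> = C ?s * (2 * (3 * \<omega> * C ?s))" unfolding Jacobian by (simp add: power2_eq_square)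
  finally have "C ?s * (2 * (B ?s * (ee2 q + 3 * ee3 q * ?s))) = C ?s * (2 * (3 * \<omega> * C ?s))"
    by (simp only: mult.left_commute[of "B ?s" 2])
  then show "B ?s * (ee2 q + 3 * ee3 q * ?s) = 3 * \<omega> * C ?s"
    by (simp only: mult_cancel_left) (use C[OF q] in simp)
qed

lemma n_distribution_F:
  assumes "w \<in> distribution_F F v"
  shows "n0 w = w$1 * ee0 (v$5)" "n1 w = w$1 * ee1 (v$5)" "n2 w = w$1 * ee2 (v$5)" "n3 w = w$1 * ee3 (v$5)"
    and "w$4 = v$5 * w$1" "w$2 = v$4 * w$1"
  using assms by (simp_all add: distribution_F_def \<omega>1_def \<omega>2_def \<omega>3_def n_defs ee_defs algebra_simps)

text \<open>Along the distribution the cubic changes by a multiple of the one in \<open>ee\<close>.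
  Its double root at t makes the first four coordinates satisfy the equations of
  \<open>flat_dist\<close>; the last coordinate is handled through the area form in
  \<open>apolar_n\<close>.\<close>

lemma \<Phi>'_distribution_F:
  assumes v: "v \<in> M" and w: "w \<in> distribution_F F v"
  shows "\<Phi>' v w \<in> flat_dist (\<Phi> v)"
proof -
  let ?s = "t (v$5)" and ?q = "v$5"
  have q: "?q \<in> I" using v by (simp add: M_xyzpq_def)
  note nw = n_distribution_F[OF w]
  have "w$1 * v$4 + v$1 * w$4 - 2 * w$2 = v$1 * w$4 - v$4 * w$1" using nw(6) by simp
  moreover have "\<omega> * (v$1 * w$4 - v$4 * w$1) = (n1 v * n2 w - n2 v * n1 w) / 3 + n3 v * n0 w - n0 v * n3 w"
    using apolar_n(4)[of v w] unfolding apolar_def by (rule sym)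
  ultimately have w5: "9/2 * \<omega> * (w$1 * v$4 + v$1 * w$4 - 2 * w$2)
      = 9/2 * ((n1 v * n2 w - n2 v * n1 w) / 3 + n3 v * n0 w - n0 v * n3 w)"
    by (simp only: mult.assoc)
  show ?thesis
    unfolding flat_dist_def \<Phi>'_def Let_def w5 nw(1-4) ee(1,2)[OF q]
    by (simp add: \<Phi>_def field_simps power2_eq_square power3_eq_cube)
qed

lemma \<Phi>_distribution:
  assumes v: "v \<in> M"
  shows "frechet_derivative \<Phi> (at v) ` distribution_F F v = flat_dist (\<Phi> v)"
  unfolding frechet_derivative_\<Phi>[OF v]
proof (intro equalityI subsetI)
  show "y \<in> flat_dist (\<Phi> v)" if "y \<in> \<Phi>' v ` distribution_F F v" for y using that \<Phi>'_distribution_F[OF v] by auto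
  fix y assume y: "y \<in> flat_dist (\<Phi> v)"
  let ?s = "t (v$5)" and ?q = "v$5"
  have q: "?q \<in> I" using v by (simp add: M_xyzpq_def)
  define k where "k = ee2 ?q + 3 * ee3 ?q * ?s"
  have k: "k \<noteq> 0" using ee(3)[OF q] C[OF q] \<omega> by (auto simp: k_def)
  \<comment> \<open>A vector of \<open>flat_dist\<close> is determined by its first two coordinates,
    so \<open>w\<close> is chosen to match these: \<alpha> solves for the first and the q-component
    for the second.\<close>
  define \<alpha> where "\<alpha> = - (y$1 + 3 * n3 v * y$2) / k"
  define w where "w = vec5 \<alpha> (v$4 * \<alpha>) (F ?q * \<alpha>) (?q * \<alpha>) (y$2 / \<tau> ?s)"
  have w: "w \<in> distribution_F F v"
    by (simp add: distribution_F_def \<omega>1_def \<omega>2_def \<omega>3_def w_def)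
  have "\<Phi>' v w$2 = y$2" using \<tau>_nonzero[OF q] by (simp add: \<Phi>'_def Let_def w_def)
  moreover have "\<Phi>' v w$1 = y$1"
  proof -
    have "\<Phi>' v w$1 = - (\<alpha> * k + 3 * n3 v * (\<tau> ?s * w$5))"
      unfolding \<Phi>'_def Let_def by (simp add: n_distribution_F[OF w] k_def) (simp add: w_def algebra_simps)
    then show ?thesis using k \<tau>_nonzero[OF q] by (simp add: w_def \<alpha>_def)
  qed
  ultimately have "\<Phi>' v w = y"
    using \<Phi>'_distribution_F[OF v w] y by (simp add: flat_dist_def vec5_eq_iff)
  then show "y \<in> \<Phi>' v ` distribution_F F v" using w by blast
qed

end

section \<open>Nurowski's metric in the chart\<close>

text \<open>In \<open>nurowski_eq\<close> the letters b, c, d, e, h, j stand for \<open>B\<close>,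
  \<open>C\<close>, \<open>dC\<close>, \<open>dB\<close>, \<open>ddC\<close>, \<open>ddB\<close>, w
  for \<omega>, x for dx, o' for \<open>\<omega>2\<close> and \<kappa> for F'
  \<open>\<omega>2\<close> - \<open>\<omega>3\<close>. N0, N1, N2 are Taylor coefficients at t of
  the cubic attached to the tangent vector, and N1^2 - 3 N0 N2 is its Hessian covariant there, up to
  a constant.\<close>

lemma metric_coefficient_algebra:
  fixes b c d e h j k \<kappa> o' x N0 N1 N2 m w :: real
  assumes nz: "b \<noteq> 0" "c \<noteq> 0" "w \<noteq> 0" and N0: "N0 = - c * \<kappa>" and N1: "c * N1 = - b * o' - c * d * \<kappa>"
    and N2: "2 * c * N2 = - e * o' - c * h * \<kappa> + 2 * c * k * x" and k: "b * k = 3 * w * c"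
    and j: "c * j = 2 * d * e - 2 * h * b"
  defines "F2 \<equiv> b^3 / (6 * w * c^4)" and "F3 \<equiv> (3 * b^4 * e * c - 4 * b^5 * d) / ((6 * w)^2 * c^7)"
    and "F4 \<equiv> b^2 / (6 * w * c^2) * ((12 * b^3 * e^2 * c^2 + 3 * b^4 * j * c^2 - 38 * b^4 * e * d * c
      - 4 * b^5 * h * c + 28 * b^5 * d^2) / ((6 * w)^2 * c^8))"
  shows "4 * c^2 / (3 * b^2) * (N1^2 - 3 * N0 * N2)
    = 2 * \<kappa> * x / F2 - (7 * F3^2 - 4 * F2 * F4) / (20 * F2^4) * \<kappa>^2 + 4/3 * (o' - F3 / (4 * F2^2) * \<kappa>)^2"
proof -
  define u where "u = 6 * w"
  have u: "u \<noteq> 0" using nz by (simp add: u_def)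
  \<comment> \<open>\<open>p\<close> and \<open>r\<close> are the factors that remain in
    \<open>F3\<close> and \<open>F4\<close> once powers of b, c and u are taken out.\<close>
  define p where "p = 3 * e * c - 4 * b * d"
  define r where "r = 12 * e^2 * c^2 + 3 * b * (c * j) * c - 38 * b * e * d * c - 4 * b^2 * h * c + 28 * b^2 * d^2"
  have F2: "F2 = b^3 / (u * c^4)" by (simp add: F2_def u_def)
  have F3: "F3 = b^4 * p / (u^2 * c^7)" by (simp add: F3_def u_def p_def eval_nat_numeral algebra_simps)
  have F4: "F4 = b^5 * r / (u^3 * c^10)"
    by (simp add: F4_def u_def[symmetric] r_def, (simp add: eval_nat_numeral algebra_simps)?)
  have q1: "F3 / (4 * F2^2) = c * p / (4 * b^2)"
    using nz u by (simp add: F2 F3 field_simps, (simp add: eval_nat_numeral algebra_simps)?)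
  have q2: "F3^2 / F2^4 = c^2 * p^2 / b^4"
    using nz u by (simp add: F2 F3 field_simps, (simp add: eval_nat_numeral algebra_simps)?)
  have q3: "F4 / F2^3 = c^2 * r / b^4"
    using nz u by (simp add: F2 F4 field_simps, (simp add: eval_nat_numeral algebra_simps)?)
  have F2nz: "F2 \<noteq> 0" using nz u by (simp add: F2)
  have "(7 * F3^2 - 4 * F2 * F4) / (20 * F2^4) = 7/20 * (F3^2 / F2^4) - 1/5 * (F4 / F2^3)"
    using F2nz by (simp add: field_simps power_numeral_reduce)
  also have "\<dots> = c^2 / b^4 * (7/20 * p^2 - 1/5 * r)"
    unfolding q2 q3 using nz by (simp add: field_simps)
  finally have q4: "(7 * F3^2 - 4 * F2 * F4) / (20 * F2^4) = c^2 / b^4 * (7/20 * p^2 - 1/5 * r)" .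
  have q5: "2 * \<kappa> * x / F2 = 12 * w * c^4 / b^3 * \<kappa> * x"
    using nz by (simp add: F2_def field_simps)
  have rr: "r = 12 * e^2 * c^2 - 32 * b * c * e * d - 10 * b^2 * h * c + 28 * b^2 * d^2"
    unfolding r_def j by (simp add: algebra_simps power2_eq_square)
  have K: "k = 3 * w * c / b" using k nz by (simp add: field_simps)
  have n1: "N1 = - (b * o' / c + d * \<kappa>)" using N1 nz by (simp add: field_simps)
  have n2: "N2 = (- e * o' / c - h * \<kappa>) / 2 + 3 * w * c / b * x" using N2 nz unfolding K by (simp add: field_simps)
  have L: "4 * c^2 / (3 * b^2) * (N1^2 - 3 * N0 * N2) = 4/3 * o'^2 + (8/3 * d * c / b - 2 * c^2 * e / b^2) * o' * \<kappa>
      + (4/3 * c^2 * d^2 / b^2 - 2 * c^3 * h / b^2) * \<kappa>^2 + 12 * w * c^4 / b^3 * \<kappa> * x"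
    unfolding n1 n2 N0 using nz by (simp add: field_simps, (simp add: eval_nat_numeral algebra_simps)?)
  have R: "- (c^2 / b^4 * (7/20 * p^2 - 1/5 * r)) * \<kappa>^2 + 4/3 * (o' - c * p / (4 * b^2) * \<kappa>)^2
      = 4/3 * o'^2 + (8/3 * d * c / b - 2 * c^2 * e / b^2) * o' * \<kappa> + (4/3 * c^2 * d^2 / b^2 - 2 * c^3 * h / b^2) * \<kappa>^2"
    unfolding rr p_def using nz by (simp add: field_simps, (simp add: eval_nat_numeral algebra_simps)?)
  show ?thesis unfolding q1 q4 q5 L using R by simp
qed

text \<open>The polar form of the norm on imaginary octonions, up to sign and evaluated on the vectors \<open>null_deriv v x\<close>,
  does not depend on \<open>v\<close>: it is this form.\<close>

definition chart_form :: "real^5 \<Rightarrow> real^5 \<Rightarrow> real" where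
  "chart_form x y = x$3 * y$3 + (x$4 * y$1 + x$1 * y$4) / 2 + (x$5 * y$2 + x$2 * y$5) / 2"

lemma bilinear_chart_form: "bilinear chart_form"
  unfolding bilinear_def linear_iff by (auto simp: chart_form_def field_simps)

lemma chart_form_sym: "chart_form x y = chart_form y x"
  by (simp add: chart_form_def field_simps)

lemma chart_form_nondegenerate:
  assumes "\<And>y. chart_form x y = 0" shows "x = 0"
  using assms[of "vec5 1 0 0 0 0"] assms[of "vec5 0 1 0 0 0"] assms[of "vec5 0 0 1 0 0"]
    assms[of "vec5 0 0 0 1 0"] assms[of "vec5 0 0 0 0 1"]
  by (simp add: chart_form_def vec5_eq_iff)

lemma symmetric_bilinear_eqI:
  fixes f g :: "'a::real_vector \<Rightarrow> 'a \<Rightarrow> real"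
  assumes "bilinear f" "bilinear g" "\<And>x y. f x y = f y x" "\<And>x y. g x y = g y x" and eq: "\<And>x. f x x = g x x"
  shows "f x y = g x y"
proof -
  have "h x y = (h (x + y) (x + y) - h x x - h y y) / 2" if "bilinear h" "\<And>x y. h x y = h y x" for h :: "'a \<Rightarrow> 'a \<Rightarrow> real"
    using that(2)[of x y] by (simp add: bilinear_ladd[OF that(1)] bilinear_radd[OF that(1)])
  from this[OF assms(1,3)] this[OF assms(2,4)] show ?thesis by (simp add: eq)
qed

lemma bilinear_nurowski: "bilinear (nurowski_metric F v)"
  unfolding bilinear_def linear_iff nurowski_metric_def sym_prod_def \<theta>1_def \<theta>2_def \<theta>3_def \<theta>4_def \<theta>5_def
    \<omega>1_def \<omega>2_def \<omega>3_def \<omega>4_def \<omega>5_def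
  by (simp add: algebra_simps add_divide_distrib diff_divide_distrib)

lemma nurowski_sym: "nurowski_metric F v u w = nurowski_metric F v w u"
  by (simp add: nurowski_metric_def sym_prod_def algebra_simps)

context solution_chart
begin

lemma Dq_F:
  assumes v: "v \<in> M"
  shows "Dq F 1 v = G1 (t (v$5)) / C (t (v$5))" "Dq F 2 v = F2 (t (v$5))" "Dq F 3 v = F3 (t (v$5))" "Dq F 4 v = F4 (t (v$5))"
proof -
  have q: "v$5 \<in> I" using v by (simp add: M_xyzpq_def)
  have step: "(deriv ^^ Suc k) F q = g' q" if "\<And>q. q \<in> I \<Longrightarrow> (deriv ^^ k) F q = g q" "\<And>q. q \<in> I \<Longrightarrow> (g has_real_derivative g' q) (at q)" "q \<in> I"
    for k g g' q
  proof -
    have "((deriv ^^ k) F has_real_derivative g' q) (at q)"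
      by (rule has_field_derivative_transform_within_open[OF that(2)[OF that(3)] I that(3)]) (simp add: that(1))
    then show ?thesis by (simp add: DERIV_imp_deriv)
  qed
  have 1: "(deriv ^^ Suc 0) F q = G1 (t q) / C (t q)" if "q \<in> I" for q
    by (rule step[of 0 F, OF _ F_derivative that]) auto
  have 2: "(deriv ^^ Suc (Suc 0)) F q = F2 (t q)" if "q \<in> I" for q
    by (rule step[OF 1 F1_derivative that])
  have 3: "(deriv ^^ Suc (Suc (Suc 0))) F q = F3 (t q)" if "q \<in> I" for q
    by (rule step[OF 2 F2_derivative that])
  have 4: "(deriv ^^ Suc (Suc (Suc (Suc 0)))) F q = F4 (t q)" if "q \<in> I" for q
    by (rule step[OF 3 F3_derivative that])
  show "Dq F 1 v = G1 (t (v$5)) / C (t (v$5))" "Dq F 2 v = F2 (t (v$5))" "Dq F 3 v = F3 (t (v$5))" "Dq F 4 v = F4 (t (v$5))"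
    using 1[OF q] 2[OF q] 3[OF q] 4[OF q] by (simp_all add: Dq_def numeral_eq_Suc)
qed

lemma F2_nonzero: "q \<in> I \<Longrightarrow> F2 (t q) \<noteq> 0"
  using C B \<omega> by (simp add: F2_def)

text \<open>All coefficients of the cubic at the base point cancel. What remains is the Hessian
  covariant of the cubic of \<open>w\<close> and the product of \<open>\<omega>1\<close> with
  dt.\<close>

lemma chart_form_\<Phi>':
  fixes w :: "real^5"
  assumes v: "v \<in> M"
  defines "s \<equiv> t (v$5)"
  shows "chart_form (\<Phi>' v w) (\<Phi>' v w) = (dcubic (n1 w) (n2 w) (n3 w) s)^2
    - 3 * cubic (n0 w) (n1 w) (n2 w) (n3 w) s * (n2 w + 3 * n3 w * s) - 9 * \<omega> * \<tau> s * (w$2 - v$4 * w$1) * w$5"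
proof -
  have a: "\<omega> * (v$1 * w$4 - v$4 * w$1) = (n1 v * n2 w - n2 v * n1 w) / 3 + n3 v * n0 w - n0 v * n3 w"
    using apolar_n(4)[of v w] unfolding apolar_def by (rule sym)
  have "9/2 * \<omega> * (w$1 * v$4 + v$1 * w$4 - 2 * w$2) = 9/2 * (\<omega> * (v$1 * w$4 - v$4 * w$1)) + 9 * \<omega> * (v$4 * w$1 - w$2)"
    by (simp add: algebra_simps)
  then have w5: "9/2 * \<omega> * (w$1 * v$4 + v$1 * w$4 - 2 * w$2)
     = 9/2 * ((n1 v * n2 w - n2 v * n1 w) / 3 + n3 v * n0 w - n0 v * n3 w) + 9 * \<omega> * (v$4 * w$1 - w$2)"
    unfolding a .
  show ?thesis
    unfolding chart_form_def \<Phi>'_def Let_def w5 s_def[symmetric] vec5_nth dcubic_def cubic_def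
    by (simp add: field_simps power2_eq_square power3_eq_cube)
qed

text \<open>Both sides are symmetric and bilinear, so it suffices to compare them on the diagonal.
  The factor is written as a square to fit \<open>weyl_conformal_pullback\<close>.\<close>

lemma nurowski_eq:
  assumes v: "v \<in> M"
  shows "nurowski_metric F v u w = (2 / sqrt 3 * C (t (v$5)) / B (t (v$5)))^2 * chart_form (\<Phi>' v u) (\<Phi>' v w)"
proof (rule symmetric_bilinear_eqI[of "nurowski_metric F v" "\<lambda>u w. (2 / sqrt 3 * C (t (v$5)) / B (t (v$5)))^2 * chart_form (\<Phi>' v u) (\<Phi>' v w)"])
  have lin: "linear (\<Phi>' v)" using has_derivative_\<Phi>[OF v] has_derivative_linear by blast
  show "bilinear (\<lambda>u w. (2 / sqrt 3 * C (t (v$5)) / B (t (v$5)))^2 * chart_form (\<Phi>' v u) (\<Phi>' v w))"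
    unfolding bilinear_def linear_iff
    by (simp add: linear_add[OF lin] linear_cmul[OF lin] bilinear_ladd[OF bilinear_chart_form] bilinear_radd[OF bilinear_chart_form]
        bilinear_lmul[OF bilinear_chart_form] bilinear_rmul[OF bilinear_chart_form] distrib_left mult_ac)
  show "bilinear (nurowski_metric F v)" by (rule bilinear_nurowski)
  show "nurowski_metric F v x y = nurowski_metric F v y x" for x y by (rule nurowski_sym)
  show "(2 / sqrt 3 * C (t (v$5)) / B (t (v$5)))^2 * chart_form (\<Phi>' v x) (\<Phi>' v y)
      = (2 / sqrt 3 * C (t (v$5)) / B (t (v$5)))^2 * chart_form (\<Phi>' v y) (\<Phi>' v x)" for x y
    by (simp add: chart_form_sym[of "\<Phi>' v x"])
  fix w :: "real^5"
  define q where "q = v$5"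
  have q: "q \<in> I" using v by (simp add: M_xyzpq_def q_def)
  define s where "s = t q"
  define o2 where "o2 = w$4 - q * w$1"
  define o3 where "o3 = w$3 - F q * w$1"
  define \<kappa> where "\<kappa> = G1 s / C s * o2 - o3"
  define N0 where "N0 = cubic (n0 w) (n1 w) (n2 w) (n3 w) s"
  define N1 where "N1 = dcubic (n1 w) (n2 w) (n3 w) s"
  define N2 where "N2 = n2 w + 3 * n3 w * s"
  define k where "k = ee2 q + 3 * ee3 q * s"
  note nz = B[OF q, folded s_def] C[OF q, folded s_def] \<omega>
  have \<kappa>: "C s * \<kappa> = G1 s * o2 - C s * o3" using nz by (simp add: \<kappa>_def field_simps)
  have e: "G2 s - q * G1 s + F q * C s = 0" using FC[OF q] by (simp add: s_def)
  have de: "dG2 s - q * dG1 s + F q * dC s = 0"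
  proof -
    have "dG2 s - q * dG1 s + F q * dC s = dcubic (ee1 q) (ee2 q) (ee3 q) s"
      by (simp add: dcubic_def ee_defs dG1_def dG2_def dC_def algebra_simps)
    also have "\<dots> = 0" by (simp add: dcubic_def ee(2)[OF q] s_def)
    finally show ?thesis .
  qed
  have "N0 = C s * o3 - G1 s * o2 + w$1 * (G2 s - q * G1 s + F q * C s)"
    by (simp add: N0_def n_defs cubic_def C_def G1_def G2_def o2_def o3_def algebra_simps)
  then have N0: "N0 = - C s * \<kappa>" unfolding e using \<kappa> by simp
  have "N1 = dC s * o3 - dG1 s * o2 + w$1 * (dG2 s - q * dG1 s + F q * dC s)"
    by (simp add: N1_def n_defs dcubic_def dC_def dG1_def dG2_def o2_def o3_def algebra_simps)
  then have N1e: "N1 = dC s * o3 - dG1 s * o2" unfolding de by simp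
  have "C s * N1 = dC s * (C s * o3) - C s * dG1 s * o2" unfolding N1e by (simp add: algebra_simps)
  also have "C s * o3 = G1 s * o2 - C s * \<kappa>" using \<kappa> by simp
  finally have N1: "C s * N1 = - B s * o2 - C s * dC s * \<kappa>" by (simp add: B_def algebra_simps)
  have N2e: "2 * N2 = ddC s * o3 - ddG1 s * o2 + 2 * k * w$1"
    by (simp add: N2_def n_defs k_def ee_defs ddC_def ddG1_def ddcubic_def o2_def o3_def algebra_simps)
  have "2 * C s * N2 = C s * (2 * N2)" by simp
  also have "\<dots> = ddC s * (C s * o3) - C s * ddG1 s * o2 + 2 * C s * k * w$1"
    unfolding N2e by (simp add: algebra_simps)
  also have "C s * o3 = G1 s * o2 - C s * \<kappa>" using \<kappa> by simp
  finally have N2: "2 * C s * N2 = - dB s * o2 - C s * ddC s * \<kappa> + 2 * C s * k * w$1"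
    by (simp add: dB_def algebra_simps)
  have k: "B s * k = 3 * \<omega> * C s" using ee(3)[OF q] by (simp add: k_def s_def)
  have j: "C s * ddB s = 2 * dC s * dB s - 2 * ddC s * B s" using transvectant[of s] by simp
  have main: "4 * (C s)^2 / (3 * (B s)^2) * (N1^2 - 3 * N0 * N2) = 2 * \<kappa> * w$1 / F2 s
      - (7 * (F3 s)^2 - 4 * F2 s * F4 s) / (20 * (F2 s)^4) * \<kappa>^2 + 4/3 * (o2 - F3 s / (4 * (F2 s)^2) * \<kappa>)^2"
    unfolding F2_def F3_def F4_def \<tau>_def by (rule metric_coefficient_algebra[OF nz N0 N1 N2 k j])
  have F2nz: "F2 s \<noteq> 0" using F2_nonzero[OF q] by (simp add: s_def)
  have D: "Dq F 1 v = G1 s / C s" "Dq F 2 v = F2 s" "Dq F 3 v = F3 s" "Dq F 4 v = F4 s"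
    using Dq_F[OF v] by (simp_all add: s_def q_def)
  have th: "\<theta>1 F v w = \<omega>1 v w - 1 / F2 s * \<kappa>" "\<theta>2 F v w = 1 / F2 s * \<kappa>" "\<theta>3 F v w = o2 - F3 s / (4 * (F2 s)^2) * \<kappa>"
    "\<theta>4 F v w = (7 * (F3 s)^2 - 4 * F2 s * F4 s) / (40 * (F2 s)^3) * \<kappa> + w$5 - w$1" "\<theta>5 v w = - w$5"
    unfolding \<theta>1_def \<theta>2_def \<theta>3_def \<theta>4_def \<theta>5_def D \<omega>2_def \<omega>3_def \<omega>4_def \<omega>5_def
    using nz F2nz by (simp_all add: \<kappa>_def o2_def o3_def q_def) (simp add: field_simps)
  have "nurowski_metric F v w w = - 2 * \<omega>1 v w * w$5 + 2 * \<kappa> * w$1 / F2 s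
      - (7 * (F3 s)^2 - 4 * F2 s * F4 s) / (20 * (F2 s)^4) * \<kappa>^2 + 4/3 * (o2 - F3 s / (4 * (F2 s)^2) * \<kappa>)^2"
    unfolding nurowski_metric_def sym_prod_def th
    using F2nz by (simp add: field_simps, (simp add: eval_nat_numeral algebra_simps)?)
  also have "\<dots> = - 2 * \<omega>1 v w * w$5 + 4 * (C s)^2 / (3 * (B s)^2) * (N1^2 - 3 * N0 * N2)"
    unfolding main by simp
  also have "\<dots> = 4 * (C s)^2 / (3 * (B s)^2) * (N1^2 - 3 * N0 * N2 - 9 * \<omega> * \<tau> s * (w$2 - v$4 * w$1) * w$5)"
    using nz by (simp add: \<tau>_def \<omega>1_def field_simps)
  also have "N1^2 - 3 * N0 * N2 - 9 * \<omega> * \<tau> s * (w$2 - v$4 * w$1) * w$5 = chart_form (\<Phi>' v w) (\<Phi>' v w)"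
    unfolding chart_form_\<Phi>'[OF v] N0_def N1_def N2_def s_def q_def ..
  also have "4 * (C s)^2 / (3 * (B s)^2) = (2 / sqrt 3 * C s / B s)^2"
    by (simp add: power_divide power_mult_distrib)
  finally show "nurowski_metric F v w w = (2 / sqrt 3 * C (t (v$5)) / B (t (v$5)))^2 * chart_form (\<Phi>' v w) (\<Phi>' v w)"
    by (simp add: s_def q_def)
qed

lemma pseudo_riemannian_nurowski: "pseudo_riemannian_on M (nurowski_metric F)"
  unfolding pseudo_riemannian_on_def
proof (intro conjI allI ballI impI)
  have h: "bounded_bilinear chart_form" using bilinear_chart_form bilinear_conv_bounded_bilinear by blast
  show "smooth_on M (\<lambda>v. nurowski_metric F v u w)" for u w
  proof (rule smooth_on_cong[OF open_M])
    have "smooth_on M (\<lambda>v. 2 / sqrt 3 * C (t (v$5)) / B (t (v$5)))"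
      by (intro smooth_intros open_M smooth_on_q[OF smooth_poly_t(1)] smooth_on_q[OF smooth_poly_t(5)] B)
        (simp add: M_xyzpq_def)
    then show "smooth_on M (\<lambda>v. (2 / sqrt 3 * C (t (v$5)) / B (t (v$5)))^2
        * chart_form (frechet_derivative \<Phi> (at v) u) (frechet_derivative \<Phi> (at v) w))"
      by (intro smooth_on_mult smooth_on_power smooth_on_bilinear[OF h] smooth_on_frechet_derivative smooth_\<Phi> open_M)
  qed (simp add: nurowski_eq frechet_derivative_\<Phi>)
  show "bilinear (nurowski_metric F v)" for v by (rule bilinear_nurowski)
  show "nurowski_metric F v u w = nurowski_metric F v w u" for v u w by (rule nurowski_sym)
  fix v u assume v: "v \<in> M" and z: "\<forall>w. nurowski_metric F v u w = 0"
  have q: "v$5 \<in> I" using v by (simp add: M_xyzpq_def)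
  have c: "chart_form (\<Phi>' v u) (\<Phi>' v w) = 0" for w
    using z C[OF q] B[OF q] by (simp add: nurowski_eq[OF v])
  note inv = diffeo_derivative_inverse[OF diffeo_\<Phi> v, unfolded frechet_derivative_\<Phi>[OF v]]
  have lin: "linear (\<Phi>' v)" using has_derivative_\<Phi>[OF v] has_derivative_linear by blast
  have "inj (\<Phi>' v)" by (metis inv injI)
  then have "surj (\<Phi>' v)" using linear_injective_imp_surjective[OF lin] by blast
  then have "chart_form (\<Phi>' v u) y = 0" for y using c by (metis surjD)
  then have "\<Phi>' v u = 0" by (rule chart_form_nondegenerate)
  then show "u = 0" using \<open>inj (\<Phi>' v)\<close> linear_injective_0[OF lin] by blast
qed

lemma
  shows weyl_nurowski: "v \<in> M \<Longrightarrow> weyl (nurowski_metric F) a b c d v = 0"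
    and conformally_flat_nurowski: "conformally_flat_on M (nurowski_metric F)"
proof -
  have h: "bounded_bilinear chart_form" using bilinear_chart_form bilinear_conv_bounded_bilinear by blast
  have s: "smooth_on M (\<lambda>v. 2 / sqrt 3 * C (t (v$5)) / B (t (v$5)))"
    by (intro smooth_intros open_M smooth_on_q[OF smooth_poly_t(1)] smooth_on_q[OF smooth_poly_t(5)] B)
      (simp add: M_xyzpq_def)
  have nz: "2 / sqrt 3 * C (t (v$5)) / B (t (v$5)) \<noteq> 0" if "v \<in> M" for v
    using that B C by (simp add: M_xyzpq_def)
  have eq: "nurowski_metric F v u w = (2 / sqrt 3 * C (t (v$5)) / B (t (v$5)))^2
      * chart_form (frechet_derivative \<Phi> (at v) u) (frechet_derivative \<Phi> (at v) w)" if "v \<in> M" for v u w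
    using nurowski_eq[OF that] by (simp add: frechet_derivative_\<Phi>[OF that])
  have n: "CARD(5) > 2" by simp
  show "v \<in> M \<Longrightarrow> weyl (nurowski_metric F) a b c d v = 0"
    by (rule weyl_conformal_pullback[OF open_M pseudo_riemannian_nurowski n smooth_\<Phi> s nz h chart_form_sym eq])
  show "conformally_flat_on M (nurowski_metric F)"
    by (rule conformally_flat_conformal_pullback[OF open_M pseudo_riemannian_nurowski n smooth_\<Phi> s nz h chart_form_sym eq])
qed

end

section \<open>The growth vector\<close>

context solution_chart
begin

definition "F1 q = G1 (t q) / C (t q)"

lemma smooth_F1: "smooth_on I F1"
  unfolding F1_def[abs_def] by (intro smooth_intros I smooth_poly_t C)

lemma has_derivative_F_q: "v$5 \<in> I \<Longrightarrow> ((\<lambda>v. F (v$5)) has_derivative (\<lambda>w. F1 (v$5) * w$5)) (at v)"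
  unfolding F1_def by (rule has_derivative_q[OF F_derivative])

lemma has_derivative_F1_q: "v$5 \<in> I \<Longrightarrow> ((\<lambda>v. F1 (v$5)) has_derivative (\<lambda>w. F2 (t (v$5)) * w$5)) (at v)"
  unfolding F1_def by (rule has_derivative_q[OF F1_derivative])

definition E1 :: "5 vfield" where "E1 v = vec5 0 0 0 0 1"
definition E2 :: "5 vfield" where "E2 v = vec5 1 (v$4) (F (v$5)) (v$5) 0"
definition E3 :: "5 vfield" where "E3 v = vec5 0 0 (F1 (v$5)) 1 0"

lemma smooth_E: "smooth_on M E1" "smooth_on M E2" "smooth_on M E3"
  unfolding E1_def[abs_def] E2_def[abs_def] E3_def[abs_def]
  by (intro smooth_intros open_M smooth_on_q[OF smooth_F] smooth_on_q[OF smooth_F1])+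

lemma frechet_derivative_E:
  assumes v: "v \<in> M"
  shows "frechet_derivative E1 (at v) h = 0"
    "frechet_derivative E2 (at v) h = vec5 0 (h$4) (F1 (v$5) * h$5) (h$5) 0"
    "frechet_derivative E3 (at v) h = vec5 0 0 (F2 (t (v$5)) * h$5) 0 0"
proof -
  have q: "v$5 \<in> I" using v by (simp add: M_xyzpq_def)
  show "frechet_derivative E1 (at v) h = 0" unfolding E1_def[abs_def] by simp
  have "(E2 has_derivative (\<lambda>h. vec5 0 (h$4) (F1 (v$5) * h$5) (h$5) 0)) (at v)"
    unfolding E2_def[abs_def]
    by (intro has_derivative_vec5 has_derivative_F_q[OF q] has_derivative_const has_derivative_vec_nth has_derivative_ident)
  from fun_cong[OF frechet_derivative_at[OF this, symmetric]]
  show "frechet_derivative E2 (at v) h = vec5 0 (h$4) (F1 (v$5) * h$5) (h$5) 0" .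
  have "(E3 has_derivative (\<lambda>h. vec5 0 0 (F2 (t (v$5)) * h$5) 0 0)) (at v)"
    unfolding E3_def[abs_def]
    by (intro has_derivative_vec5 has_derivative_F1_q[OF q] has_derivative_const)
  from fun_cong[OF frechet_derivative_at[OF this, symmetric]]
  show "frechet_derivative E3 (at v) h = vec5 0 0 (F2 (t (v$5)) * h$5) 0 0" .
qed

definition D3 :: "5 dist" where
  "D3 v = {w. w$2 = v$4 * w$1 \<and> w$3 = F (v$5) * w$1 + F1 (v$5) * (w$4 - v$5 * w$1)}"

lemma distribution_F_iff: "w \<in> distribution_F F v \<longleftrightarrow> w$2 = v$4 * w$1 \<and> w$3 = F (v$5) * w$1 \<and> w$4 = v$5 * w$1"
  by (auto simp: distribution_F_def \<omega>1_def \<omega>2_def \<omega>3_def)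

lemma distribution_F_span: "distribution_F F v = span {E1 v, E2 v}"
proof (intro equalityI subsetI)
  fix w assume "w \<in> distribution_F F v"
  then have "w = w$5 *\<^sub>R E1 v + w$1 *\<^sub>R E2 v"
    by (simp add: distribution_F_iff vec5_eq_iff E1_def E2_def)
  then show "w \<in> span {E1 v, E2 v}"
    by (metis insertI1 insertI2 span_add span_base span_scale)
next
  have "subspace (distribution_F F v)"
    by (auto simp: subspace_def distribution_F_iff algebra_simps)
  then show "w \<in> distribution_F F v" if "w \<in> span {E1 v, E2 v}" for w
    using span_minimal[of "{E1 v, E2 v}" "distribution_F F v"] that
    by (auto simp: distribution_F_iff E1_def E2_def)
qed

lemma subspace_D3: "subspace (D3 v)"
  by (auto simp: subspace_def D3_def) (simp_all add: algebra_simps)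

lemma D3_span: "D3 v = span {E1 v, E2 v, E3 v}"
proof (intro equalityI subsetI)
  fix w assume "w \<in> D3 v"
  then have "w = w$5 *\<^sub>R E1 v + w$1 *\<^sub>R E2 v + (w$4 - v$5 * w$1) *\<^sub>R E3 v"
    by (simp add: D3_def vec5_eq_iff E1_def E2_def E3_def, (simp add: algebra_simps)?)
  then show "w \<in> span {E1 v, E2 v, E3 v}"
    by (metis insertI1 insertI2 span_add span_base span_scale)
next
  show "w \<in> D3 v" if "w \<in> span {E1 v, E2 v, E3 v}" for w
    using span_minimal[OF _ subspace_D3, of "{E1 v, E2 v, E3 v}" v] that
    by (auto simp: D3_def E1_def E2_def E3_def)
qed

lemma independent_E: "independent {E1 v, E2 v}" "independent {E1 v, E2 v, E3 v}"
  "card {E1 v, E2 v} = 2" "card {E1 v, E2 v, E3 v} = 3"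
proof -
  have ne: "E1 v \<noteq> E2 v" "E1 v \<noteq> E3 v" "E2 v \<noteq> E3 v" "E2 v \<noteq> 0" "E3 v \<noteq> 0"
    by (simp_all add: E1_def E2_def E3_def vec5_eq_iff)
  have a: "E1 v \<notin> span {E2 v}" "E1 v \<notin> span {E2 v, E3 v}" "E2 v \<notin> span {E3 v}"
    by (simp_all add: span_breakdown_eq) (auto simp: E1_def E2_def E3_def vec5_eq_iff)
  show "independent {E1 v, E2 v}" "independent {E1 v, E2 v, E3 v}"
    using ne a by (simp_all add: independent_insert)
  show "card {E1 v, E2 v} = 2" "card {E1 v, E2 v, E3 v} = 3"
    using ne by simp_all
qed

lemma local_section_E: "local_section M (distribution_F F) E1" "local_section M (distribution_F F) E2"
  "local_section M D3 E1" "local_section M D3 E2" "local_section M D3 E3"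
  using smooth_E open_M by (auto simp: local_section_def distribution_F_iff D3_def E1_def E2_def E3_def)

lemma local_section_scale:
  assumes "local_section M (distribution_F F) X"
  shows "local_section M (distribution_F F) (\<lambda>v. v$i *\<^sub>R X v)"
  using assms by (auto simp: local_section_def distribution_F_iff intro!: smooth_intros)

lemma dist_bracket_bracket:
  assumes "v \<in> M" "local_section M D X" "local_section M E Y"
  shows "vf_bracket X Y v \<in> dist_bracket M D E v"
  unfolding dist_bracket_def by (rule span_base) (use assms in blast)

lemma E_brackets:
  assumes v: "v \<in> M"
  shows "vf_bracket E1 (\<lambda>v. v$5 *\<^sub>R E1 v) v = E1 v" "vf_bracket E2 (\<lambda>v. v$1 *\<^sub>R E2 v) v = E2 v"
    "vf_bracket E1 E2 v = E3 v" "vf_bracket E3 E1 v = - F2 (t (v$5)) *\<^sub>R vec5 0 0 1 0 0" "vf_bracket E3 E2 v = vec5 0 1 0 0 0"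
proof -
  have d: "frechet_derivative (\<lambda>v. v$i *\<^sub>R X v) (at v) h = v$i *\<^sub>R frechet_derivative X (at v) h + h$i *\<^sub>R X v"
    if "smooth_on M X" for i h and X :: "5 vfield"
  proof -
    have "((\<lambda>v. v$i *\<^sub>R X v) has_derivative (\<lambda>h. v$i *\<^sub>R frechet_derivative X (at v) h + h$i *\<^sub>R X v)) (at v)"
      by (intro has_derivative_scaleR has_derivative_vec_nth has_derivative_ident smooth_on_has_derivative[OF that open_M v])
    from fun_cong[OF frechet_derivative_at[OF this, symmetric]] show ?thesis .
  qed
  show "vf_bracket E1 (\<lambda>v. v$5 *\<^sub>R E1 v) v = E1 v"
    by (simp add: vf_bracket_def d[OF smooth_E(1)] frechet_derivative_E[OF v]) (simp add: E1_def)
  show "vf_bracket E2 (\<lambda>v. v$1 *\<^sub>R E2 v) v = E2 v"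
    by (simp add: vf_bracket_def d[OF smooth_E(2)]) (simp add: frechet_derivative_E[OF v] E2_def vec5_eq_iff)
  show "vf_bracket E1 E2 v = E3 v"
    by (simp add: vf_bracket_def frechet_derivative_E[OF v] E1_def E3_def vec5_eq_iff)
  show "vf_bracket E3 E1 v = - F2 (t (v$5)) *\<^sub>R vec5 0 0 1 0 0"
    by (simp add: vf_bracket_def frechet_derivative_E[OF v] E1_def vec5_eq_iff)
  show "vf_bracket E3 E2 v = vec5 0 1 0 0 0"
    by (simp add: vf_bracket_def frechet_derivative_E[OF v]) (simp add: E2_def E3_def vec5_eq_iff)
qed

text \<open>A field has zero bracket with itself, so \<open>E1\<close> and \<open>E2\<close> are
  obtained as [\<open>E1\<close>, q \<open>E1\<close>] and [\<open>E2\<close>, x \<open>E2\<close>].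
  The general \<open>D\<close> covers both the first and the second derived distribution.\<close>

lemma E_in_bracket:
  assumes v: "v \<in> M" and E: "local_section M D E1" "local_section M D E2"
  shows "E1 v \<in> dist_bracket M D (distribution_F F) v" "E2 v \<in> dist_bracket M D (distribution_F F) v"
    "E3 v \<in> dist_bracket M D (distribution_F F) v"
  using dist_bracket_bracket[OF v E(1) local_section_scale[OF local_section_E(1), of 5]]
    dist_bracket_bracket[OF v E(2) local_section_scale[OF local_section_E(2), of 1]]
    dist_bracket_bracket[OF v E(1) local_section_E(2)]
  by (simp_all add: E_brackets[OF v])

lemma bracket_in_D3:
  assumes U: "v \<in> U" "U \<subseteq> M" and X: "local_section U (distribution_F F) X" and Y: "local_section U (distribution_F F) Y"
  shows "vf_bracket X Y v \<in> D3 v"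
proof -
  have q: "v$5 \<in> I" using U by (auto simp: M_xyzpq_def)
  have oU: "open U" using X by (simp add: local_section_def)
  \<comment> \<open>The equations of the distribution, differentiated; the terms with the
    undifferentiated \<open>X v$1\<close> are those that move the bracket out of it.\<close>
  have d: "frechet_derivative X (at v) h$2 = h$4 * X v$1 + v$4 * frechet_derivative X (at v) h$1 \<and>
     frechet_derivative X (at v) h$3 = F1 (v$5) * h$5 * X v$1 + F (v$5) * frechet_derivative X (at v) h$1 \<and>
     frechet_derivative X (at v) h$4 = h$5 * X v$1 + v$5 * frechet_derivative X (at v) h$1"
    if X: "local_section U (distribution_F F) X" for X h
  proof -
    have dX: "(X has_derivative frechet_derivative X (at v)) (at v)"
      by (rule smooth_on_has_derivative[OF _ oU U(1)]) (use X in \<open>simp add: local_section_def\<close>)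
    have eq: "X u$2 = u$4 * X u$1" "X u$3 = F (u$5) * X u$1" "X u$4 = u$5 * X u$1" if "u \<in> U" for u
      using X that by (auto simp: local_section_def distribution_F_iff)
    have *: "frechet_derivative X (at v) h$i = f' h"
      if f: "(f has_derivative f') (at v)" and e: "\<And>u. u \<in> U \<Longrightarrow> f u = X u$i" for f f' i
    proof -
      have "((\<lambda>u. X u$i) has_derivative f') (at v)"
        by (rule has_derivative_transform_within_open[OF f oU U(1) e])
      from has_derivative_unique[OF has_derivative_vec_nth[OF dX] this] show ?thesis by (rule fun_cong)
    qed
    have "((\<lambda>u. u$4 * X u$1) has_derivative (\<lambda>h. v$4 * frechet_derivative X (at v) h$1 + h$4 * X v$1)) (at v)"
      "((\<lambda>u. F (u$5) * X u$1) has_derivative (\<lambda>h. F (v$5) * frechet_derivative X (at v) h$1 + F1 (v$5) * h$5 * X v$1)) (at v)"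
      "((\<lambda>u. u$5 * X u$1) has_derivative (\<lambda>h. v$5 * frechet_derivative X (at v) h$1 + h$5 * X v$1)) (at v)"
      by (intro has_derivative_mult has_derivative_vec_nth has_derivative_ident dX has_derivative_F_q[OF q])+
    from *[OF this(1), of 2] *[OF this(2), of 3] *[OF this(3), of 4] eq show ?thesis by simp
  qed
  have Xv: "X v$2 = v$4 * X v$1" "X v$4 = v$5 * X v$1" and Yv: "Y v$2 = v$4 * Y v$1" "Y v$4 = v$5 * Y v$1"
    using X Y U(1) by (auto simp: local_section_def distribution_F_iff)
  show ?thesis
    using d[OF X, of "Y v"] d[OF Y, of "X v"] by (simp add: D3_def vf_bracket_def Xv Yv) (simp add: algebra_simps)
qed

lemma dist_bracket_eq_D3:
  assumes v: "v \<in> M" shows "dist_bracket M (distribution_F F) (distribution_F F) v = D3 v"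
proof
  show "dist_bracket M (distribution_F F) (distribution_F F) v \<subseteq> D3 v"
    unfolding dist_bracket_def by (rule span_minimal[OF _ subspace_D3]) (use bracket_in_D3 in blast)
  show "D3 v \<subseteq> dist_bracket M (distribution_F F) (distribution_F F) v"
    unfolding D3_span
    by (rule span_minimal) (use E_in_bracket[OF v local_section_E(1,2)] in \<open>auto simp: dist_bracket_def\<close>)
qed

theorem distribution_235_F: "distribution_235 M (distribution_F F)"
  unfolding distribution_235_def
proof (intro conjI ballI)
  have sect: "\<exists>U X. v \<in> U \<and> U \<subseteq> M \<and> local_section U D X \<and> X v = a *\<^sub>R E1 v + b *\<^sub>R E2 v + c *\<^sub>R E3 v"
    if "v \<in> M" "\<And>u. u \<in> M \<Longrightarrow> a *\<^sub>R E1 u + b *\<^sub>R E2 u + c *\<^sub>R E3 u \<in> D u" for v a b c D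
    using that open_M smooth_E
    by (intro exI[of _ M] exI[of _ "\<lambda>u. a *\<^sub>R E1 u + b *\<^sub>R E2 u + c *\<^sub>R E3 u"])
      (auto simp: local_section_def intro!: smooth_intros)
  show "distribution_of_rank 2 M (distribution_F F)"
    unfolding distribution_of_rank_def
  proof (intro ballI conjI)
    fix v assume v: "v \<in> M"
    show "subspace (distribution_F F v)" by (simp add: distribution_F_span)
    show "dim (distribution_F F v) = 2"
      using dim_span_eq_card_independent[OF independent_E(1)] independent_E(3) by (simp add: distribution_F_span)
    fix w assume "w \<in> distribution_F F v"
    then have "w = w$5 *\<^sub>R E1 v + w$1 *\<^sub>R E2 v + 0 *\<^sub>R E3 v"
      by (simp add: distribution_F_iff vec5_eq_iff E1_def E2_def)
    moreover have "w$5 *\<^sub>R E1 u + w$1 *\<^sub>R E2 u + 0 *\<^sub>R E3 u \<in> distribution_F F u" for u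
      by (simp add: distribution_F_iff E1_def E2_def)
    ultimately show "\<exists>U X. v \<in> U \<and> U \<subseteq> M \<and> local_section U (distribution_F F) X \<and> X v = w"
      using sect[OF v, of "w$5" "w$1" 0 "distribution_F F"] by metis
  qed
  show "distribution_of_rank 3 M (dist_bracket M (distribution_F F) (distribution_F F))"
    unfolding distribution_of_rank_def
  proof (intro ballI conjI)
    fix v assume v: "v \<in> M"
    note eq = dist_bracket_eq_D3[OF v]
    show "subspace (dist_bracket M (distribution_F F) (distribution_F F) v)" by (simp add: eq subspace_D3)
    show "dim (dist_bracket M (distribution_F F) (distribution_F F) v) = 3"
      using dim_span_eq_card_independent[OF independent_E(2)] independent_E(4) by (simp add: eq D3_span)
    fix w assume "w \<in> dist_bracket M (distribution_F F) (distribution_F F) v"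
    then have w: "w = w$5 *\<^sub>R E1 v + w$1 *\<^sub>R E2 v + (w$4 - v$5 * w$1) *\<^sub>R E3 v"
      by (simp add: eq D3_def vec5_eq_iff E1_def E2_def E3_def, (simp add: algebra_simps)?)
    have "a *\<^sub>R E1 u + b *\<^sub>R E2 u + c *\<^sub>R E3 u \<in> dist_bracket M (distribution_F F) (distribution_F F) u" if "u \<in> M" for a b c u
      unfolding dist_bracket_eq_D3[OF that] D3_span
      by (intro span_add span_scale span_base) auto
    from sect[OF v this, of "w$5" "w$1" "w$4 - v$5 * w$1"] w
    show "\<exists>U X. v \<in> U \<and> U \<subseteq> M \<and> local_section U (dist_bracket M (distribution_F F) (distribution_F F)) X \<and> X v = w"
      by metis
  qed
  fix v assume v: "v \<in> M"
  let ?S = "dist_bracket M (dist_bracket M (distribution_F F) (distribution_F F)) (distribution_F F) v"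
  have q: "v$5 \<in> I" using v by (simp add: M_xyzpq_def)
  have sub: "subspace ?S" by (simp add: dist_bracket_def)
  have sec: "local_section M (dist_bracket M (distribution_F F) (distribution_F F)) X" if "local_section M D3 X" for X
    using that by (simp add: local_section_def dist_bracket_eq_D3)
  note E = E_in_bracket[OF v sec[OF local_section_E(3)] sec[OF local_section_E(4)]]
  have "- F2 (t (v$5)) *\<^sub>R vec5 0 0 1 0 0 \<in> ?S"
    using dist_bracket_bracket[OF v sec[OF local_section_E(5)] local_section_E(1)] by (simp add: E_brackets[OF v])
  \<comment> \<open>This is where F'' being nonzero enters.\<close>
  from subspace_scale[OF sub this, of "- (1 / F2 (t (v$5)))"] have z: "vec5 0 0 1 0 0 \<in> ?S"
    using F2_nonzero[OF q] by simp
  have y: "vec5 0 1 0 0 0 \<in> ?S"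
    using dist_bracket_bracket[OF v sec[OF local_section_E(5)] local_section_E(2)] by (simp add: E_brackets[OF v])
  have "w \<in> ?S" for w
  proof -
    let ?f = "F1 (v$5)"
    have "w = w$5 *\<^sub>R E1 v + w$1 *\<^sub>R E2 v + (w$4 - v$5 * w$1) *\<^sub>R E3 v
      + (w$3 - F (v$5) * w$1 - ?f * (w$4 - v$5 * w$1)) *\<^sub>R vec5 0 0 1 0 0 + (w$2 - v$4 * w$1) *\<^sub>R vec5 0 1 0 0 0"
      by (simp add: vec5_eq_iff E1_def E2_def E3_def algebra_simps)
    then show ?thesis
      using E z y by (metis (no_types, lifting) sub subspace_add subspace_scale)
  qed
  then show "?S = UNIV" by auto
qed

theorem symmetry_algebra_F:
  assumes "v \<in> M"
  shows "lie_isomorphic (symmetry_algebra_at M (distribution_F F) v) split_g2"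
  by (rule symmetry_algebra_isomorphic_split_g2[OF diffeo_\<Phi> assms \<Phi>_distribution])

end

section \<open>From the differential equation to the chart\<close>

lemma affine_if_second_derivative_0:
  fixes z \<zeta> :: "real \<Rightarrow> real"
  assumes I: "open I" "connected I" "q0 \<in> I"
    and z: "\<And>q. q \<in> I \<Longrightarrow> (z has_real_derivative \<zeta> q) (at q)" "\<And>q. q \<in> I \<Longrightarrow> (\<zeta> has_real_derivative 0) (at q)"
  obtains \<alpha> where "\<And>q. q \<in> I \<Longrightarrow> z q = \<alpha> + \<zeta> q0 * q" "\<And>q. q \<in> I \<Longrightarrow> \<zeta> q = \<zeta> q0"
proof -
  have const: "f q = f q0" if "\<And>q. q \<in> I \<Longrightarrow> (f has_real_derivative 0) (at q)" "q \<in> I" for f :: "real \<Rightarrow> real" and q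
  proof (rule has_derivative_zero_unique_connected[OF I(1,2) _ that(2) I(3)])
    show "(f has_derivative (\<lambda>x. 0)) (at x)" if "x \<in> I" for x
      using \<open>\<And>q. q \<in> I \<Longrightarrow> (f has_real_derivative 0) (at q)\<close>[OF that] by (simp add: has_field_derivative_def lambda_zero)
  qed
  have \<zeta>: "\<zeta> q = \<zeta> q0" if "q \<in> I" for q by (rule const[OF z(2) that])
  have "((\<lambda>q. z q - \<zeta> q0 * q) has_real_derivative 0) (at q)" if "q \<in> I" for q
    using z(1)[OF that] \<zeta>[OF that] by (auto intro!: derivative_eq_intros)
  then have "z q - \<zeta> q0 * q = z q0 - \<zeta> q0 * q0" if "q \<in> I" for q by (rule const[OF _ that])
  then have "z q = (z q0 - \<zeta> q0 * q0) + \<zeta> q0 * q" if "q \<in> I" for q using that by (metis diff_add_cancel)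
  then show thesis using \<zeta> by (rule that)
qed

lemma constant_difference:
  fixes f g :: "real \<Rightarrow> real"
  assumes I: "open I" "connected I" "q0 \<in> I"
    and f: "\<And>q. q \<in> I \<Longrightarrow> (f has_real_derivative f' q) (at q)" "\<And>q. q \<in> I \<Longrightarrow> (g has_real_derivative f' q) (at q)"
  obtains k where "\<And>q. q \<in> I \<Longrightarrow> f q = g q + k"
proof -
  have d: "((\<lambda>q. f q - g q) has_real_derivative 0) (at q)" if "q \<in> I" for q
    using DERIV_diff[OF f(1)[OF that] f(2)[OF that]] by simp
  show thesis
  proof (rule affine_if_second_derivative_0[OF I d])
    show "((\<lambda>q. 0) has_real_derivative 0) (at q)" for q :: real by simp
    fix \<alpha> assume "\<And>q. q \<in> I \<Longrightarrow> f q - g q = \<alpha> + 0 * q"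
    then show thesis by (intro that[of \<alpha>]) (simp add: algebra_simps)
  qed
qed

text \<open>If \<open>y'' = - W y\<close> and \<open>t\<close> has Schwarzian derivative \<open>- 2 W t'\<^sup>2\<close>, then \<open>y \<circ> t\<close> divided by a square
  root of \<open>t'\<close> is affine.\<close>

lemma solution_chart_exists:
  fixes F G R t dt u W :: "real \<Rightarrow> real" and c0 c1 c2 c3 g0 g1 g2 g3 h0 h1 h2 h3 \<kappa> \<rho> q0 :: real
  defines "C \<equiv> cubic c0 c1 c2 c3" and "dC \<equiv> dcubic c1 c2 c3"
  defines "y1 \<equiv> \<lambda>s. (C s * dcubic g1 g2 g3 s - dC s * cubic g0 g1 g2 g3 s) / C s"
    and "y2 \<equiv> \<lambda>s. (C s * dcubic h1 h2 h3 s - dC s * cubic h0 h1 h2 h3 s) / C s"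
  assumes I: "open I" "connected I" "q0 \<in> I" and smooth_t: "smooth_on I t"
    and t: "\<And>q. q \<in> I \<Longrightarrow> (t has_real_derivative dt q) (at q)"
    and dt: "\<And>q. q \<in> I \<Longrightarrow> (dt has_real_derivative dt q * u q) (at q)"
    and u: "\<And>q. q \<in> I \<Longrightarrow> (u has_real_derivative (u q)^2 / 2 - 2 * (dt q)^2 * W (t q)) (at q)"
    and dt_nz: "\<And>q. q \<in> I \<Longrightarrow> dt q \<noteq> 0" and C: "\<And>q. q \<in> I \<Longrightarrow> C (t q) \<noteq> 0"
    and R: "\<And>q. q \<in> I \<Longrightarrow> \<exists>D. (R has_real_derivative D) (at q)" "\<And>q. q \<in> I \<Longrightarrow> (R q)^2 = \<kappa> * dt q" "\<kappa> \<noteq> 0"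
    and F: "\<And>q. q \<in> I \<Longrightarrow> (F has_real_derivative G q) (at q)"
      "\<And>q. q \<in> I \<Longrightarrow> (G has_real_derivative R q * dt q / C (t q)) (at q)"
    and y1: "\<And>s. C s \<noteq> 0 \<Longrightarrow> (y1 has_real_derivative dy1 s) (at s)" "\<And>s. C s \<noteq> 0 \<Longrightarrow> (dy1 has_real_derivative - W s * y1 s) (at s)"
    and y2: "\<And>s. C s \<noteq> 0 \<Longrightarrow> (y2 has_real_derivative dy2 s) (at s)" "\<And>s. C s \<noteq> 0 \<Longrightarrow> (dy2 has_real_derivative - W s * y2 s) (at s)"
    and Wronskian: "\<And>s. C s \<noteq> 0 \<Longrightarrow> y1 s * dy2 s - y2 s * dy1 s = \<rho>" "\<rho> \<noteq> 0"
    and ap: "apolar g0 g1 g2 g3 c0 c1 c2 c3 = 0" "apolar h0 h1 h2 h3 c0 c1 c2 c3 = 0" "apolar g0 g1 g2 g3 h0 h1 h2 h3 \<noteq> 0"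
  shows "\<exists>a0 a1 a2 a3 b0 b1 b2 b3. solution_chart I F t c0 c1 c2 c3 a0 a1 a2 a3 b0 b1 b2 b3"
proof -
  have Rnz: "R q \<noteq> 0" if "q \<in> I" for q
    using R(2)[OF that] R(3) dt_nz[OF that] by auto
  \<comment> \<open>Differentiating (R q)^2 = \<kappa> t' determines the derivative of
    \<open>R\<close> from its mere existence.\<close>
  have R': "(R has_real_derivative R q * u q / 2) (at q)" if q: "q \<in> I" for q
  proof -
    obtain D where D: "(R has_real_derivative D) (at q)" using R(1)[OF q] by blast
    have "((\<lambda>q. \<kappa> * dt q) has_real_derivative 2 * R q * D) (at q)"
      by (rule has_field_derivative_transform_within_open[OF _ I(1) q, of "\<lambda>q. (R q)^2"])
        (use D R(2) in \<open>auto intro!: derivative_eq_intros\<close>)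
    moreover have "((\<lambda>q. \<kappa> * dt q) has_real_derivative \<kappa> * (dt q * u q)) (at q)"
      by (intro DERIV_cmult dt q)
    ultimately have "2 * R q * D = \<kappa> * (dt q * u q)" by (rule DERIV_unique)
    also have "\<dots> = (R q)^2 * u q" using R(2)[OF q] by simp
    finally have "D = R q * u q / 2" using Rnz[OF q] by (simp add: power2_eq_square)
    then show ?thesis using D by (simp only:)
  qed
  have aff: "((\<lambda>q. y (t q) / R q) has_real_derivative (dy (t q) * dt q - y (t q) * u q / 2) / R q) (at q)
      \<and> ((\<lambda>q. (dy (t q) * dt q - y (t q) * u q / 2) / R q) has_real_derivative 0) (at q)"
    if q: "q \<in> I" and y: "\<And>s. C s \<noteq> 0 \<Longrightarrow> (y has_real_derivative dy s) (at s)" "\<And>s. C s \<noteq> 0 \<Longrightarrow> (dy has_real_derivative - W s * y s) (at s)"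
    for y dy q
  proof
    note c = DERIV_chain2[OF y(1)[OF C[OF q]] t[OF q]] DERIV_chain2[OF y(2)[OF C[OF q]] t[OF q]]
    have "((\<lambda>q. y (t q) / R q) has_real_derivative (dy (t q) * dt q * R q - y (t q) * (R q * u q / 2)) / (R q * R q)) (at q)"
      by (rule DERIV_divide[OF c(1) R'[OF q] Rnz[OF q]])
    moreover have "dy (t q) * dt q * R q - y (t q) * (R q * u q / 2) = (dy (t q) * dt q - y (t q) * u q / 2) * R q"
      by (simp add: algebra_simps)
    ultimately show "((\<lambda>q. y (t q) / R q) has_real_derivative (dy (t q) * dt q - y (t q) * u q / 2) / R q) (at q)"
      using Rnz[OF q] by simp
    have N: "((\<lambda>q. dy (t q) * dt q - y (t q) * u q / 2) has_real_derivative
       u q / 2 * (dy (t q) * dt q - y (t q) * u q / 2)) (at q)"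
      by (auto intro!: derivative_eq_intros c dt[OF q] u[OF q] simp: field_simps power2_eq_square)
    from DERIV_divide[OF N R'[OF q] Rnz[OF q]]
    show "((\<lambda>q. (dy (t q) * dt q - y (t q) * u q / 2) / R q) has_real_derivative 0) (at q)"
      by (simp add: algebra_simps)
  qed
  define z1 where "z1 = (\<lambda>q. y1 (t q) / R q)"
  define z2 where "z2 = (\<lambda>q. y2 (t q) / R q)"
  define w1 where "w1 = (\<lambda>q. (dy1 (t q) * dt q - y1 (t q) * u q / 2) / R q)"
  define w2 where "w2 = (\<lambda>q. (dy2 (t q) * dt q - y2 (t q) * u q / 2) / R q)"
  obtain \<alpha>1 where z1: "\<And>q. q \<in> I \<Longrightarrow> z1 q = \<alpha>1 + w1 q0 * q"
  proof (rule affine_if_second_derivative_0[OF I, of z1 w1])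
    show "(z1 has_real_derivative w1 q) (at q)" "(w1 has_real_derivative 0) (at q)" if "q \<in> I" for q
      using aff[OF that y1] by (simp_all only: z1_def w1_def simp_thms)
  qed (rule that)
  obtain \<alpha>2 where z2: "\<And>q. q \<in> I \<Longrightarrow> z2 q = \<alpha>2 + w2 q0 * q"
  proof (rule affine_if_second_derivative_0[OF I, of z2 w2])
    show "(z2 has_real_derivative w2 q) (at q)" "(w2 has_real_derivative 0) (at q)" if "q \<in> I" for q
      using aff[OF that y2] by (simp_all only: z2_def w2_def simp_thms)
  qed (rule that)
  \<comment> \<open>The constant Wronskian of the affine functions \<open>z1\<close> and
    \<open>z2\<close>.\<close>
  define \<Delta> where "\<Delta> = \<alpha>1 * w2 q0 - \<alpha>2 * w1 q0"
  have "\<Delta> = z1 q0 * w2 q0 - z2 q0 * w1 q0"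
    by (simp add: \<Delta>_def z1[OF I(3)] z2[OF I(3)] algebra_simps)
  also have "\<dots> = (y1 (t q0) * dy2 (t q0) - y2 (t q0) * dy1 (t q0)) * dt q0 / (R q0)^2"
    by (simp add: z1_def z2_def w1_def w2_def diff_divide_distrib power2_eq_square algebra_simps)
  also have "\<dots> = \<rho> / \<kappa>" using Wronskian(1)[OF C[OF I(3)]] R(2)[OF I(3)] dt_nz[OF I(3)] by simp
  finally have \<Delta>: "\<Delta> \<noteq> 0" using Wronskian(2) R(3) by simp
  \<comment> \<open>Cramer's rule: these coefficients express 1 and q as combinations of
    \<open>z1\<close> and \<open>z2\<close>.\<close>
  define k1 where "k1 = w2 q0 / \<Delta>"
  define k2 where "k2 = - w1 q0 / \<Delta>"
  define l1 where "l1 = - \<alpha>2 / \<Delta>"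
  define l2 where "l2 = \<alpha>1 / \<Delta>"
  have kz: "k1 * z1 q + k2 * z2 q = 1" and lz: "l1 * z1 q + l2 * z2 q = q" if q: "q \<in> I" for q
  proof -
    have "w2 q0 * z1 q - w1 q0 * z2 q = \<Delta>" "\<alpha>1 * z2 q - \<alpha>2 * z1 q = q * \<Delta>"
      by (simp_all add: z1[OF q] z2[OF q] \<Delta>_def algebra_simps)
    moreover have "k1 * z1 q + k2 * z2 q = (w2 q0 * z1 q - w1 q0 * z2 q) / \<Delta>"
      "l1 * z1 q + l2 * z2 q = (\<alpha>1 * z2 q - \<alpha>2 * z1 q) / \<Delta>"
      by (simp_all add: k1_def k2_def l1_def l2_def diff_divide_distrib)
    ultimately show "k1 * z1 q + k2 * z2 q = 1" "l1 * z1 q + l2 * z2 q = q" using \<Delta> by simp_all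
  qed
  have kl: "k1 * l2 - k2 * l1 \<noteq> 0"
  proof -
    have "k1 * l2 - k2 * l1 = (\<alpha>1 * w2 q0 - \<alpha>2 * w1 q0) / (\<Delta> * \<Delta>)"
      by (simp add: k1_def k2_def l1_def l2_def diff_divide_distrib mult_ac)
    then show ?thesis using \<Delta> by (simp add: \<Delta>_def[symmetric])
  qed
  \<comment> \<open>The derivative of P / C is (k y1 + l y2) t' / C. With the coefficients k this is
    F'', and with the coefficients l it is q F'', the derivative of q F' - F.\<close>
  define P where "P = (\<lambda>k l s. k * cubic g0 g1 g2 g3 s + l * cubic h0 h1 h2 h3 s)"
  define dP where "dP = (\<lambda>k l s. k * dcubic g1 g2 g3 s + l * dcubic h1 h2 h3 s)"
  have dPC: "((\<lambda>q. P k l (t q) / C (t q)) has_real_derivative (k * y1 (t q) + l * y2 (t q)) * dt q / C (t q)) (at q)"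
    if q: "q \<in> I" for k l q
  proof -
    have "(C has_real_derivative dC s) (at s)" "(P k l has_real_derivative dP k l s) (at s)" for s
      unfolding P_def dP_def C_def dC_def cubic_def dcubic_def
      by (auto intro!: derivative_eq_intros simp: algebra_simps power2_eq_square)
    from DERIV_chain2[OF DERIV_divide[OF this(2,1) C[OF q]] t[OF q]]
    have "((\<lambda>q. P k l (t q) / C (t q)) has_real_derivative
      (dP k l (t q) * C (t q) - P k l (t q) * dC (t q)) / (C (t q) * C (t q)) * dt q) (at q)" .
    moreover have "(dP k l (t q) * C (t q) - P k l (t q) * dC (t q)) / (C (t q) * C (t q)) * dt q
        = (k * y1 (t q) + l * y2 (t q)) * dt q / C (t q)"
      using C[OF q] unfolding P_def dP_def y1_def y2_def by (simp add: field_simps)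
    ultimately show ?thesis by simp
  qed
  have y: "k * y1 (t q) + l * y2 (t q) = R q * (k * z1 q + l * z2 q)" if "q \<in> I" for k l q
    using Rnz[OF that] by (simp add: z1_def z2_def field_simps)
  have "((\<lambda>q. P k1 k2 (t q) / C (t q)) has_real_derivative R q * dt q / C (t q)) (at q)" if "q \<in> I" for q
    using dPC[OF that, of k1 k2] y[OF that, of k1 k2] kz[OF that] by simp
  then obtain e1 where e1: "\<And>q. q \<in> I \<Longrightarrow> G q = P k1 k2 (t q) / C (t q) + e1"
    using constant_difference[OF I F(2)] by blast
  have "((\<lambda>q. P l1 l2 (t q) / C (t q)) has_real_derivative q * (R q * dt q / C (t q))) (at q)" if "q \<in> I" for q
    using dPC[OF that, of l1 l2] y[OF that, of l1 l2] lz[OF that] by (simp add: mult_ac)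
  note d = this
  have d': "((\<lambda>q. q * G q - F q) has_real_derivative q * (R q * dt q / C (t q))) (at q)" if "q \<in> I" for q
    by (auto intro!: derivative_eq_intros F that)
  obtain e2 where e2: "\<And>q. q \<in> I \<Longrightarrow> q * G q - F q = P l1 l2 (t q) / C (t q) + e2"
  proof (rule constant_difference[OF I d' d])
  qed (assumption | rule that)+
  \<comment> \<open>The integration constants \<open>e1\<close> and \<open>e2\<close> enter the
    numerators as multiples of \<open>C\<close>.\<close>
  define a where "a = (\<lambda>g h c. k1 * g + k2 * h + e1 * c)"
  define b where "b = (\<lambda>g h c. l1 * g + l2 * h + e2 * c)"
  have pa: "cubic (a g0 h0 c0) (a g1 h1 c1) (a g2 h2 c2) (a g3 h3 c3) s = P k1 k2 s + e1 * C s"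
    "dcubic (a g1 h1 c1) (a g2 h2 c2) (a g3 h3 c3) s = dP k1 k2 s + e1 * dC s"
    "cubic (b g0 h0 c0) (b g1 h1 c1) (b g2 h2 c2) (b g3 h3 c3) s = P l1 l2 s + e2 * C s"
    "dcubic (b g1 h1 c1) (b g2 h2 c2) (b g3 h3 c3) s = dP l1 l2 s + e2 * dC s" for s
    by (simp_all add: cubic_def dcubic_def a_def b_def P_def dP_def C_def dC_def algebra_simps)
  have CB: "C s * (dP k l s + e * dC s) - dC s * (P k l s + e * C s) = C s * (k * y1 s + l * y2 s)" if "C s \<noteq> 0" for k l e s
    using that unfolding P_def dP_def y1_def y2_def by (simp add: field_simps)
  have "solution_chart I F t c0 c1 c2 c3 (a g0 h0 c0) (a g1 h1 c1) (a g2 h2 c2) (a g3 h3 c3)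
    (b g0 h0 c0) (b g1 h1 c1) (b g2 h2 c2) (b g3 h3 c3)"
  proof (rule solution_chart.intro, unfold pa C_def[symmetric] dC_def[symmetric])
    fix q assume q: "q \<in> I"
    note CB = CB[OF C[OF q]] and kz = kz[OF q] and lz = lz[OF q] and y = y[OF q]
    show "C (t q) \<noteq> 0" by (rule C[OF q])
    show "C (t q) * (dP k1 k2 (t q) + e1 * dC (t q)) - dC (t q) * (P k1 k2 (t q) + e1 * C (t q)) \<noteq> 0"
      unfolding CB y kz using C[OF q] Rnz[OF q] by simp
    show "q * (C (t q) * (dP k1 k2 (t q) + e1 * dC (t q)) - dC (t q) * (P k1 k2 (t q) + e1 * C (t q)))
        = C (t q) * (dP l1 l2 (t q) + e2 * dC (t q)) - dC (t q) * (P l1 l2 (t q) + e2 * C (t q))"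
      unfolding CB y kz lz by simp
    obtain X Y where XY: "P k1 k2 (t q) / C (t q) = X" "P l1 l2 (t q) / C (t q) = Y" by blast
    then have PC: "P k1 k2 (t q) = X * C (t q)" "P l1 l2 (t q) = Y * C (t q)"
      using C[OF q] by (simp_all add: field_simps)
    have F: "F q = q * (X + e1) - (Y + e2)"
      using e1[OF q] e2[OF q] unfolding XY by (simp add: algebra_simps)
    show "F q * C (t q) = q * (P k1 k2 (t q) + e1 * C (t q)) - (P l1 l2 (t q) + e2 * C (t q))"
      unfolding PC F by (simp add: algebra_simps)
  next
    have "apolar (a g0 h0 c0) (a g1 h1 c1) (a g2 h2 c2) (a g3 h3 c3) c0 c1 c2 c3
        = k1 * apolar g0 g1 g2 g3 c0 c1 c2 c3 + k2 * apolar h0 h1 h2 h3 c0 c1 c2 c3"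
      by (simp add: apolar_def a_def field_simps)
    then show "apolar (a g0 h0 c0) (a g1 h1 c1) (a g2 h2 c2) (a g3 h3 c3) c0 c1 c2 c3 = 0" by (simp add: ap)
    have "apolar (b g0 h0 c0) (b g1 h1 c1) (b g2 h2 c2) (b g3 h3 c3) c0 c1 c2 c3
        = l1 * apolar g0 g1 g2 g3 c0 c1 c2 c3 + l2 * apolar h0 h1 h2 h3 c0 c1 c2 c3"
      by (simp add: apolar_def b_def field_simps)
    then show "apolar (b g0 h0 c0) (b g1 h1 c1) (b g2 h2 c2) (b g3 h3 c3) c0 c1 c2 c3 = 0" by (simp add: ap)
    have "apolar (a g0 h0 c0) (a g1 h1 c1) (a g2 h2 c2) (a g3 h3 c3) (b g0 h0 c0) (b g1 h1 c1) (b g2 h2 c2) (b g3 h3 c3)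
        = (k1 * l2 - k2 * l1) * apolar g0 g1 g2 g3 h0 h1 h2 h3
          + (k1 * e2 - e1 * l1) * apolar g0 g1 g2 g3 c0 c1 c2 c3 + (k2 * e2 - e1 * l2) * apolar h0 h1 h2 h3 c0 c1 c2 c3"
      by (simp add: apolar_def a_def b_def field_simps)
    then show "apolar (a g0 h0 c0) (a g1 h1 c1) (a g2 h2 c2) (a g3 h3 c3) (b g0 h0 c0) (b g1 h1 c1) (b g2 h2 c2) (b g3 h3 c3) \<noteq> 0"
      using kl ap by simp
  qed (rule I(1) smooth_t)+
  then show ?thesis by blast
qed

text \<open>For y = N / C the last two hypotheses are y' = D / C^2 and y'' = - (w / C^2) y with
  denominators cleared, so that only polynomial identities have to be checked.\<close>

lemma quotient_second_derivative:
  fixes C N D dC dN dD w :: "real \<Rightarrow> real"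
  assumes "(C has_real_derivative dC x) (at x)" "(N has_real_derivative dN x) (at x)" "(D has_real_derivative dD x) (at x)"
    and "C x \<noteq> 0" "dN x * C x - N x * dC x = D x" "dD x * C x - 2 * D x * dC x = - w x * N x"
  shows "((\<lambda>x. N x / C x) has_real_derivative D x / (C x)^2) (at x)"
    and "((\<lambda>x. D x / (C x)^2) has_real_derivative - (w x / (C x)^2) * (N x / C x)) (at x)"
proof -
  show "((\<lambda>x. N x / C x) has_real_derivative D x / (C x)^2) (at x)"
    using DERIV_divide[OF assms(2,1,4)] assms(5) by (simp add: power2_eq_square)
  have "((\<lambda>x. (C x)^2) has_real_derivative 2 * C x * dC x) (at x)"
    using DERIV_power[OF assms(1), of 2] by (simp add: mult_ac)
  from DERIV_divide[OF assms(3) this]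
  have "((\<lambda>x. D x / (C x)^2) has_real_derivative (dD x * (C x)^2 - D x * (2 * C x * dC x)) / ((C x)^2 * (C x)^2)) (at x)"
    using assms(4) by simp
  moreover have "dD x * (C x)^2 - D x * (2 * C x * dC x) = C x * (- w x * N x)"
    unfolding assms(6)[symmetric] by (simp add: algebra_simps power2_eq_square)
  ultimately show "((\<lambda>x. D x / (C x)^2) has_real_derivative - (w x / (C x)^2) * (N x / C x)) (at x)"
    using assms(4) by (simp add: power2_eq_square mult_ac)
qed

lemma powr_three_halves:
  assumes "0 < f q" "(f has_real_derivative a) (at q)" "(w has_real_derivative b) (at q)"
  shows "\<exists>D. ((\<lambda>q. f q powr (3/2) * w q) has_real_derivative D) (at q)"
    and "(f q powr (3/2) * w q)^2 = (f q)^3 * (w q)^2"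
proof -
  show "\<exists>D. ((\<lambda>q. f q powr (3/2) * w q) has_real_derivative D) (at q)"
    using DERIV_mult[OF DERIV_chain2[OF has_real_derivative_powr[OF assms(1)] assms(2)] assms(3)] by blast
  have "(f q powr (3/2))^2 = f q powr 3"
    by (simp add: power2_eq_square powr_add[symmetric])
  then show "(f q powr (3/2) * w q)^2 = (f q)^3 * (w q)^2"
    using assms(1) by (simp add: power_mult_distrib powr_numeral)
qed

section \<open>Solutions of the Schwarzian equation\<close>

locale schwarz_solution =
  fixes s F G :: "real \<Rightarrow> real" and I :: "real set" and q0 \<alpha> \<beta> \<gamma> :: real
  assumes I: "open I" "connected I" "q0 \<in> I" and smooth_s: "smooth_on I s"
    and s: "q \<in> I \<Longrightarrow> s q \<noteq> 0" "q \<in> I \<Longrightarrow> s q \<noteq> 1" "q \<in> I \<Longrightarrow> deriv s q > 0"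
    and ode: "q \<in> I \<Longrightarrow> schwarzian s q + (deriv s q)^2 / 2 * potential \<alpha> \<beta> \<gamma> (s q) = 0"
    and F: "q \<in> I \<Longrightarrow> (F has_real_derivative G q) (at q)"
      "q \<in> I \<Longrightarrow> (G has_real_derivative deriv s q powr (3/2) / (s q * (s q - 1))) (at q)"
begin

abbreviation s' :: "real \<Rightarrow> real" where "s' \<equiv> deriv s"
definition u :: "real \<Rightarrow> real" where "u q = deriv s' q / s' q"

text \<open>For u = s'' / s' the Schwarzian equation becomes a Riccati equation.\<close>

lemma s_derivatives:
  assumes "q \<in> I"
  shows "(s has_real_derivative s' q) (at q)" "(s' has_real_derivative s' q * u q) (at q)"
    and "(u has_real_derivative (u q)^2 / 2 - (s' q)^2 / 2 * potential \<alpha> \<beta> \<gamma> (s q)) (at q)"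
proof -
  note d = smooth_on_deriv[OF I(1)]
  show "(s has_real_derivative s' q) (at q)" by (rule d(2)[OF smooth_s assms])
  show "(s' has_real_derivative s' q * u q) (at q)"
    using d(2)[OF d(1)[OF smooth_s] assms] s(3)[OF assms] by (simp add: u_def)
  have "smooth_on I (\<lambda>q. deriv s' q / s' q)"
    using s(3) by (intro smooth_intros I(1) d(1) smooth_s) (auto simp: less_imp_neq[symmetric])
  then have "smooth_on I u" by (simp add: u_def[abs_def])
  from d(2)[OF this assms] have "(u has_real_derivative deriv u q) (at q)" .
  moreover have "deriv u q = schwarzian s q + (u q)^2 / 2"
    by (simp add: schwarzian_def u_def[abs_def])
  moreover have "schwarzian s q + (u q)^2 / 2 = (u q)^2 / 2 - (s' q)^2 / 2 * potential \<alpha> \<beta> \<gamma> (s q)"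
    using ode[OF assms] by simp
  ultimately show "(u has_real_derivative (u q)^2 / 2 - (s' q)^2 / 2 * potential \<alpha> \<beta> \<gamma> (s q)) (at q)"
    by (simp only:)
qed

text \<open>The linear equation is encoded by polynomials: its potential is w / C^2 and its
  solutions are N1 / C and N2 / C. In the applications w = 3 C C'' - 2 C'^2, and the cubics g and h
  span together with \<open>C\<close> the space of cubics apolar to \<open>C\<close>.\<close>

lemma chart_exists:
  fixes c0 c1 c2 c3 g0 g1 g2 g3 h0 h1 h2 h3 \<kappa> \<rho> :: real and t dt v w D1 D2 dD1 dD2 :: "real \<Rightarrow> real"
  defines "C \<equiv> cubic c0 c1 c2 c3" and "dC \<equiv> dcubic c1 c2 c3"
  defines "N1 \<equiv> \<lambda>x. C x * dcubic g1 g2 g3 x - dC x * cubic g0 g1 g2 g3 x"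
    and "N2 \<equiv> \<lambda>x. C x * dcubic h1 h2 h3 x - dC x * cubic h0 h1 h2 h3 x"
  assumes smooth_t: "smooth_on I t"
    and t: "\<And>q. q \<in> I \<Longrightarrow> (t has_real_derivative dt q) (at q)"
    and dt: "\<And>q. q \<in> I \<Longrightarrow> (dt has_real_derivative dt q * v q) (at q)"
    and v: "\<And>q. q \<in> I \<Longrightarrow> (v has_real_derivative (v q)^2 / 2 - 2 * (dt q)^2 * (w (t q) / (C (t q))^2)) (at q)"
    and dt_nz: "\<And>q. q \<in> I \<Longrightarrow> dt q \<noteq> 0" and C: "\<And>q. q \<in> I \<Longrightarrow> C (t q) \<noteq> 0"
    and \<kappa>: "\<And>q. q \<in> I \<Longrightarrow> (s' q)^3 * (C (t q))^2 = \<kappa> * (dt q)^3 * (s q * (s q - 1))^2" "\<kappa> \<noteq> 0"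
    and D: "\<And>x. (D1 has_real_derivative dD1 x) (at x)" "\<And>x. (D2 has_real_derivative dD2 x) (at x)"
    and N1: "\<And>x. (C x * ddcubic g2 g3 x - ddcubic c2 c3 x * cubic g0 g1 g2 g3 x) * C x - N1 x * dC x = D1 x"
      "\<And>x. dD1 x * C x - 2 * D1 x * dC x = - w x * N1 x"
    and N2: "\<And>x. (C x * ddcubic h2 h3 x - ddcubic c2 c3 x * cubic h0 h1 h2 h3 x) * C x - N2 x * dC x = D2 x"
      "\<And>x. dD2 x * C x - 2 * D2 x * dC x = - w x * N2 x"
    and Wronskian: "\<And>x. N1 x * D2 x - N2 x * D1 x = \<rho> * (C x)^3" "\<rho> \<noteq> 0"
    and ap: "apolar g0 g1 g2 g3 c0 c1 c2 c3 = 0" "apolar h0 h1 h2 h3 c0 c1 c2 c3 = 0" "apolar g0 g1 g2 g3 h0 h1 h2 h3 \<noteq> 0"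
  shows "\<exists>a0 a1 a2 a3 b0 b1 b2 b3. solution_chart I F t c0 c1 c2 c3 a0 a1 a2 a3 b0 b1 b2 b3"
proof (rule solution_chart_exists[where ?c0.0=c0 and ?c1.0=c1 and ?c2.0=c2 and ?c3.0=c3 and ?g0.0=g0 and ?h0.0=h0, folded C_def dC_def])
  have C': "(C has_real_derivative dC x) (at x)" for x
    unfolding C_def dC_def cubic_def dcubic_def by (auto intro!: derivative_eq_intros simp: algebra_simps power2_eq_square)
  have N': "((\<lambda>x. C x * dcubic g1 g2 g3 x - dC x * cubic g0 g1 g2 g3 x) has_real_derivative
      C x * ddcubic g2 g3 x - ddcubic c2 c3 x * cubic g0 g1 g2 g3 x) (at x)" for g0 g1 g2 g3 x
    unfolding C_def dC_def cubic_def dcubic_def ddcubic_def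
    by (auto intro!: derivative_eq_intros simp: algebra_simps power2_eq_square)
  note N1' = N'[of g1 g2 g3 g0, folded N1_def] and N2' = N'[of h1 h2 h3 h0, folded N2_def]
  \<comment> \<open>Determined by the requirement r t' / C = F''; the condition on \<kappa> then
    says that r^2 = \<kappa> t'.\<close>
  define r where "r q = s' q powr (3/2) * (C (t q) / (s q * (s q - 1) * dt q))" for q
  show "\<exists>D. (r has_real_derivative D) (at q)" "(r q)^2 = \<kappa> * dt q" if q: "q \<in> I" for q
  proof -
    have nz: "s q * (s q - 1) * dt q \<noteq> 0" using s[OF q] dt_nz[OF q] by simp
    note d = s_derivatives[OF q] DERIV_chain2[OF C' t[OF q]] dt[OF q]
    note p = powr_three_halves[OF s(3)[OF q] d(2)
        DERIV_divide[OF d(4) DERIV_mult[OF DERIV_mult[OF d(1) DERIV_diff[OF d(1) DERIV_const]] d(5)] nz]]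
    show "\<exists>D. (r has_real_derivative D) (at q)" using p(1) by (simp add: r_def[abs_def])
    have "(r q)^2 * (s q * (s q - 1) * dt q)^2 = (s' q)^3 * (C (t q))^2"
      using p(2) nz by (simp add: r_def power_divide)
    also have "\<dots> = \<kappa> * dt q * (s q * (s q - 1) * dt q)^2"
      unfolding \<kappa>(1)[OF q] by (simp add: power_mult_distrib power3_eq_cube power2_eq_square)
    finally show "(r q)^2 = \<kappa> * dt q" using nz by (simp only: mult_cancel_right power_eq_0_iff) simp
  qed
  show "(G has_real_derivative r q * dt q / C (t q)) (at q)" if q: "q \<in> I" for q
  proof -
    have "r q * dt q / C (t q) = s' q powr (3/2) / (s q * (s q - 1))"
      using s[OF q] dt_nz[OF q] C[OF q] by (simp add: r_def)
    then show ?thesis using F(2)[OF q] by (simp only:)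
  qed
  fix x assume x: "C x \<noteq> 0"
  note q1 = quotient_second_derivative[of C dC x N1 "\<lambda>x. C x * ddcubic g2 g3 x - ddcubic c2 c3 x * cubic g0 g1 g2 g3 x"
      D1 dD1 w, OF C' N1' D(1) x N1, unfolded N1_def]
  note q2 = quotient_second_derivative[of C dC x N2 "\<lambda>x. C x * ddcubic h2 h3 x - ddcubic c2 c3 x * cubic h0 h1 h2 h3 x"
      D2 dD2 w, OF C' N2' D(2) x N2, unfolded N2_def]
  show "((\<lambda>x. (C x * dcubic g1 g2 g3 x - dC x * cubic g0 g1 g2 g3 x) / C x) has_real_derivative (\<lambda>x. D1 x / (C x)^2) x) (at x)"
    "((\<lambda>x. D1 x / (C x)^2) has_real_derivative - (\<lambda>x. w x / (C x)^2) x *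
      ((C x * dcubic g1 g2 g3 x - dC x * cubic g0 g1 g2 g3 x) / C x)) (at x)"
    using q1 by simp_all
  show "((\<lambda>x. (C x * dcubic h1 h2 h3 x - dC x * cubic h0 h1 h2 h3 x) / C x) has_real_derivative (\<lambda>x. D2 x / (C x)^2) x) (at x)"
    "((\<lambda>x. D2 x / (C x)^2) has_real_derivative - (\<lambda>x. w x / (C x)^2) x *
      ((C x * dcubic h1 h2 h3 x - dC x * cubic h0 h1 h2 h3 x) / C x)) (at x)"
    using q2 by simp_all
  have "N1 x / C x * (D2 x / (C x)^2) - N2 x / C x * (D1 x / (C x)^2) = (N1 x * D2 x - N2 x * D1 x) / (C x)^3"
    by (simp add: diff_divide_distrib power3_eq_cube power2_eq_square)
  also have "\<dots> = \<rho>" using x by (simp add: Wronskian(1))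
  finally show "(C x * dcubic g1 g2 g3 x - dC x * cubic g0 g1 g2 g3 x) / C x * (\<lambda>x. D2 x / (C x)^2) x
      - (C x * dcubic h1 h2 h3 x - dC x * cubic h0 h1 h2 h3 x) / C x * (\<lambda>x. D1 x / (C x)^2) x = \<rho>"
    by (simp only: N1_def N2_def)
qed (use I smooth_t t dt v dt_nz C \<kappa>(2) F(1) Wronskian(2) ap in auto)

section \<open>The four parameter triples\<close>

lemma chart_333:
  assumes "\<alpha> = 3" "\<beta> = 3" "\<gamma> = 3"
  shows "\<exists>t c0 c1 c2 c3 a0 a1 a2 a3 b0 b1 b2 b3. solution_chart I F t c0 c1 c2 c3 a0 a1 a2 a3 b0 b1 b2 b3"
proof -
  \<comment> \<open>With t = s the singular points 0, 1 and infinity already have exponent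
    difference 3. \<open>C\<close> is x^2 - x, and 1 and x^3 are apolar to it.\<close>
  have "\<exists>a0 a1 a2 a3 b0 b1 b2 b3. solution_chart I F s 0 (-1) 1 0 a0 a1 a2 a3 b0 b1 b2 b3"
  proof (rule chart_exists[where dt=s' and v=u and w="\<lambda>x. - 2 * (x^2 - x + 1)" and \<kappa>=1 and \<rho>="-6"
      and ?g0.0=1 and ?g1.0=0 and ?g2.0=0 and ?g3.0=0 and ?h0.0=0 and ?h1.0=0 and ?h2.0=0 and ?h3.0=1
      and ?D1.0="\<lambda>x. 2*x^2 - 2*x + 1" and ?D2.0="\<lambda>x. x^3 * (2*x^2 - 5*x + 4)"
      and ?dD1.0="\<lambda>x. 4*x - 2" and ?dD2.0="\<lambda>x. 10*x^4 - 20*x^3 + 12*x^2"])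
    have C: "cubic 0 (-1) 1 0 x = x * (x - 1)" for x :: real by (simp add: cubic_def algebra_simps power2_eq_square)
    have mult_half: "a / 2 * b = 2 * a * X" if "b / 2 = 2 * X" for a b X :: real using that by simp
    fix q assume q: "q \<in> I"
    have "potential \<alpha> \<beta> \<gamma> (s q) / 2 = 2 * (- 2 * ((s q)^2 - s q + 1) / (s q * (s q - 1))^2)"
      using s[OF q] by (simp add: potential_def assms field_simps) algebra
    then have "(s' q)^2 / 2 * potential \<alpha> \<beta> \<gamma> (s q) = 2 * (s' q)^2 * (- 2 * ((s q)^2 - s q + 1) / (s q * (s q - 1))^2)"
      by (rule mult_half)
    then show "(u has_real_derivative (u q)^2 / 2 - 2 * (s' q)^2 * (- 2 * ((s q)^2 - s q + 1) / (cubic 0 (-1) 1 0 (s q))^2)) (at q)"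
      unfolding C using s_derivatives(3)[OF q] by (simp only:)
    show "cubic 0 (-1) 1 0 (s q) \<noteq> 0" unfolding C using s[OF q] by simp
    show "(s' q)^3 * (cubic 0 (-1) 1 0 (s q))^2 = 1 * (s' q)^3 * (s q * (s q - 1))^2" unfolding C by simp
    show "s' q \<noteq> 0" using s(3)[OF q] by simp
  next
    show "((\<lambda>x. 2*x^2 - 2*x + 1) has_real_derivative 4*x - 2) (at x)" for x :: real
      by (auto intro!: derivative_eq_intros)
    show "((\<lambda>x. x^3 * (2*x^2 - 5*x + 4)) has_real_derivative 10*x^4 - 20*x^3 + 12*x^2) (at x)" for x :: real
      by (auto intro!: derivative_eq_intros simp: algebra_simps power_def)
  qed (use s_derivatives smooth_s in \<open>auto simp: cubic_def dcubic_def ddcubic_def apolar_def algebra_simps power_def\<close>)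
  then show ?thesis by blast
qed

text \<open>Here t^3 = e(s), m = e' / (3 e) is the logarithmic derivative of t with respect to s,
  and n = m' / m + m makes v = u + s' n equal to t'' / t'. The condition \<open>ode'\<close> is the
  transformation of the Schwarzian equation from s to t, with potential - 18 t / (t^3 - 1)^2.
  \<open>C\<close> is x^3 - 1, to which x and x^2 are apolar.\<close>

lemma chart_cube_root:
  fixes e m n dn :: "real \<Rightarrow> real" and \<kappa> :: real
  assumes e: "\<And>x. x \<noteq> 0 \<Longrightarrow> x \<noteq> 1 \<Longrightarrow> e x \<noteq> 0 \<and> e x \<noteq> 1 \<and> m x \<noteq> 0 \<and> (e has_real_derivative 3 * m x * e x) (at x)"
    and m: "\<And>x. x \<noteq> 0 \<Longrightarrow> x \<noteq> 1 \<Longrightarrow> (m has_real_derivative m x * (n x - m x)) (at x)"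
    and n: "\<And>x. x \<noteq> 0 \<Longrightarrow> x \<noteq> 1 \<Longrightarrow> (n has_real_derivative dn x) (at x)"
    and ode': "\<And>x. x \<noteq> 0 \<Longrightarrow> x \<noteq> 1 \<Longrightarrow> dn x = potential \<alpha> \<beta> \<gamma> x / 2 + (n x)^2 / 2 + 36 * (m x)^2 * e x / (e x - 1)^2"
    and \<kappa>: "\<And>x. x \<noteq> 0 \<Longrightarrow> x \<noteq> 1 \<Longrightarrow> (e x - 1)^2 = \<kappa> * (m x)^3 * e x * (x * (x - 1))^2" "\<kappa> \<noteq> 0"
    and smooth_e: "smooth_on I (\<lambda>q. e (s q))"
  shows "\<exists>t c0 c1 c2 c3 a0 a1 a2 a3 b0 b1 b2 b3. solution_chart I F t c0 c1 c2 c3 a0 a1 a2 a3 b0 b1 b2 b3"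
proof -
  \<comment> \<open>\<open>root 3\<close> is the odd real root, so \<open>e\<close> may have either
    sign.\<close>
  define t where "t q = root 3 (e (s q))" for q
  define dt where "dt q = m (s q) * s' q * t q" for q
  define v where "v q = u q + s' q * n (s q)" for q
  have t3: "(t q)^3 = e (s q)" for q by (simp add: t_def odd_real_root_pow)
  have tnz: "t q \<noteq> 0" if "q \<in> I" for q using e[OF s(1,2)[OF that]] by (auto simp: t_def)
  have smooth_t: "smooth_on I t"
    unfolding t_def[abs_def] using e s(1,2) by (intro smooth_on_compose[OF I(1) _ smooth_e smooth_on_root3]) auto
  have C: "cubic (-1) 0 0 1 x = x^3 - 1" for x :: real by (simp add: cubic_def)
  have "\<exists>a0 a1 a2 a3 b0 b1 b2 b3. solution_chart I F t (-1) 0 0 1 a0 a1 a2 a3 b0 b1 b2 b3"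
  proof (rule chart_exists[where dt=dt and v=v and w="\<lambda>x. - 18 * x" and \<kappa>=\<kappa> and \<rho>=2
      and ?g0.0=0 and ?g1.0=1 and ?g2.0=0 and ?g3.0=0 and ?h0.0=0 and ?h1.0=0 and ?h2.0=1 and ?h3.0=0
      and ?D1.0="\<lambda>x. 9 * x^2" and ?D2.0="\<lambda>x. - (x^6) + 8 * x^3 + 2"
      and ?dD1.0="\<lambda>x. 18 * x" and ?dD2.0="\<lambda>x. - 6 * x^5 + 24 * x^2"])
    fix q assume q: "q \<in> I"
    note s01 = s(1,2)[OF q] and d = s_derivatives[OF q]
    note e = e[OF s01] and ee = DERIV_chain2[OF _ d(1), of e] and mm = DERIV_chain2[OF m[OF s01] d(1)]
      and nn = DERIV_chain2[OF n[OF s01] d(1)]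
    have tt: "(t has_real_derivative deriv t q) (at q)" by (rule smooth_on_deriv(2)[OF I(1) smooth_t q])
    have "((\<lambda>q. (t q)^3) has_real_derivative 3 * (t q)^2 * deriv t q) (at q)"
      using DERIV_power[OF tt, of 3] by (simp add: mult_ac)
    moreover have "((\<lambda>q. e (s q)) has_real_derivative 3 * m (s q) * e (s q) * s' q) (at q)"
      by (rule ee) (use e in blast)
    ultimately have "3 * (t q)^2 * deriv t q = 3 * m (s q) * e (s q) * s' q" unfolding t3 by (rule DERIV_unique)
    also have "\<dots> = 3 * (t q)^2 * dt q" unfolding t3[symmetric] by (simp add: dt_def power2_eq_square power3_eq_cube)
    finally have "deriv t q = dt q" using tnz[OF q] by simp
    then show t': "(t has_real_derivative dt q) (at q)" using tt by simp
    show "(dt has_real_derivative dt q * v q) (at q)"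
      unfolding dt_def[abs_def] v_def
      by (rule derivative_eq_intros mm d(2) t' refl)+ (simp add: dt_def algebra_simps)
    have "(v has_real_derivative ((u q)^2 / 2 - (s' q)^2 / 2 * potential \<alpha> \<beta> \<gamma> (s q))
        + (s' q * u q * n (s q) + dn (s q) * s' q * s' q)) (at q)"
      unfolding v_def[abs_def] by (rule derivative_eq_intros nn d refl)+
    moreover have "((u q)^2 / 2 - (s' q)^2 / 2 * potential \<alpha> \<beta> \<gamma> (s q)) + (s' q * u q * n (s q) + dn (s q) * s' q * s' q)
        = (v q)^2 / 2 - 2 * (dt q)^2 * (- 18 * t q / (cubic (-1) 0 0 1 (t q))^2)"
    proof -
      have "2 * (dt q)^2 * (- 18 * t q / (cubic (-1) 0 0 1 (t q))^2)
          = - ((s' q)^2 * (36 * (m (s q))^2 * e (s q) / (e (s q) - 1)^2))"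
        unfolding C t3 by (simp add: dt_def t3[symmetric] power_mult_distrib power2_eq_square power3_eq_cube)
      then show ?thesis unfolding ode'[OF s01] by (simp add: v_def power2_eq_square algebra_simps add_divide_distrib)
    qed
    ultimately show "(v has_real_derivative (v q)^2 / 2 - 2 * (dt q)^2 * (- 18 * t q / (cubic (-1) 0 0 1 (t q))^2)) (at q)"
      by (simp only:)
    show "dt q \<noteq> 0" using e s(3)[OF q] tnz[OF q] by (simp add: dt_def)
    show "cubic (-1) 0 0 1 (t q) \<noteq> 0" unfolding C t3 using e by simp
    show "(s' q)^3 * (cubic (-1) 0 0 1 (t q))^2 = \<kappa> * (dt q)^3 * (s q * (s q - 1))^2"
      unfolding C t3 \<kappa>(1)[OF s01] by (simp add: dt_def power_mult_distrib t3 mult_ac)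
  next
    show "((\<lambda>x. 9 * x^2) has_real_derivative 18 * x) (at x)" for x :: real
      by (auto intro!: derivative_eq_intros)
    show "((\<lambda>x. - (x^6) + 8 * x^3 + 2) has_real_derivative - 6 * x^5 + 24 * x^2) (at x)" for x :: real
      by (auto intro!: derivative_eq_intros)
  qed (use smooth_t \<kappa>(2) in \<open>auto simp: cubic_def dcubic_def ddcubic_def apolar_def algebra_simps power_def\<close>)
  then show ?thesis by blast
qed

end

context schwarz_solution begin

text \<open>The parameters \<alpha>, \<beta>, \<gamma> belong to infinity, 0 and 1. The map x / (x -
  1) sends infinity, which carries the parameter 3, to 1, and the other two points to 0 and
  infinity.\<close>

lemma chart_3_third_third:
  assumes "\<alpha> = 3" "\<beta> = 1/3" "\<gamma> = 1/3"
  shows "\<exists>t c0 c1 c2 c3 a0 a1 a2 a3 b0 b1 b2 b3. solution_chart I F t c0 c1 c2 c3 a0 a1 a2 a3 b0 b1 b2 b3"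
proof (rule chart_cube_root[where e="\<lambda>x. x / (x - 1)" and m="\<lambda>x. - 1 / (3 * x * (x - 1))" and n="\<lambda>x. (2 - 6 * x) / (3 * x * (x - 1))"
    and dn="\<lambda>x. (6 * x^2 - 4 * x + 2) / (3 * (x * (x - 1))^2)" and \<kappa>="-27"])
  fix x :: real assume x: "x \<noteq> 0" "x \<noteq> 1"
  have d: "x - 1 \<noteq> 0" using x by simp
  have "((\<lambda>x. x / (x - 1)) has_real_derivative 3 * (- 1 / (3 * x * (x - 1))) * (x / (x - 1))) (at x)"
    using d by (auto intro!: derivative_eq_intros) (use x in \<open>simp add: field_simps\<close>)
  then show "x / (x - 1) \<noteq> 0 \<and> x / (x - 1) \<noteq> 1 \<and> - 1 / (3 * x * (x - 1)) \<noteq> 0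
    \<and> ((\<lambda>x. x / (x - 1)) has_real_derivative 3 * (- 1 / (3 * x * (x - 1))) * (x / (x - 1))) (at x)"
    using x by (simp add: field_simps)
  show "((\<lambda>x. - 1 / (3 * x * (x - 1))) has_real_derivative - 1 / (3 * x * (x - 1)) *
      ((2 - 6 * x) / (3 * x * (x - 1)) - - 1 / (3 * x * (x - 1)))) (at x)"
    using x by (auto intro!: derivative_eq_intros) (simp add: field_simps)
  show "((\<lambda>x. (2 - 6 * x) / (3 * x * (x - 1))) has_real_derivative (6 * x^2 - 4 * x + 2) / (3 * (x * (x - 1))^2)) (at x)"
    using x by (auto intro!: derivative_eq_intros) (simp add: divide_simps, algebra)
  have e1: "x / (x - 1) - 1 = 1 / (x - 1)" using d by (simp add: field_simps)
  show "(6 * x^2 - 4 * x + 2) / (3 * (x * (x - 1))^2) = potential \<alpha> \<beta> \<gamma> x / 2 + ((2 - 6 * x) / (3 * x * (x - 1)))^2 / 2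
      + 36 * (- 1 / (3 * x * (x - 1)))^2 * (x / (x - 1)) / (x / (x - 1) - 1)^2"
    unfolding e1 potential_def assms using x d by (simp add: divide_simps) algebra
  show "(x / (x - 1) - 1)^2 = -27 * (- 1 / (3 * x * (x - 1)))^3 * (x / (x - 1)) * (x * (x - 1))^2"
    unfolding e1 using x d by (simp add: divide_simps) algebra
next
  show "smooth_on I (\<lambda>q. s q / (s q - 1))" using s(2) by (intro smooth_intros I(1) smooth_s) auto
qed simp

text \<open>The parameter 3 sits at 0, which 1 - x sends to 1.\<close>

lemma chart_third_3_third:
  assumes "\<alpha> = 1/3" "\<beta> = 3" "\<gamma> = 1/3"
  shows "\<exists>t c0 c1 c2 c3 a0 a1 a2 a3 b0 b1 b2 b3. solution_chart I F t c0 c1 c2 c3 a0 a1 a2 a3 b0 b1 b2 b3"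
proof (rule chart_cube_root[where e="\<lambda>x. 1 - x" and m="\<lambda>x. 1 / (3 * (x - 1))" and n="\<lambda>x. - 2 / (3 * (x - 1))"
    and dn="\<lambda>x. 2 / (3 * (x - 1)^2)" and \<kappa>="-27"])
  fix x :: real assume x: "x \<noteq> 0" "x \<noteq> 1"
  have d: "x - 1 \<noteq> 0" using x by simp
  have "((\<lambda>x. 1 - x) has_real_derivative 3 * (1 / (3 * (x - 1))) * (1 - x)) (at x)"
    using d by (auto intro!: derivative_eq_intros simp: field_simps)
  then show "1 - x \<noteq> 0 \<and> 1 - x \<noteq> 1 \<and> 1 / (3 * (x - 1)) \<noteq> 0
    \<and> ((\<lambda>x. 1 - x) has_real_derivative 3 * (1 / (3 * (x - 1))) * (1 - x)) (at x)"
    using x by simp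
  show "((\<lambda>x. 1 / (3 * (x - 1))) has_real_derivative 1 / (3 * (x - 1)) * (- 2 / (3 * (x - 1)) - 1 / (3 * (x - 1)))) (at x)"
    using x by (auto intro!: derivative_eq_intros)
  show "((\<lambda>x. - 2 / (3 * (x - 1))) has_real_derivative 2 / (3 * (x - 1)^2)) (at x)"
    using x by (auto intro!: derivative_eq_intros) (simp add: divide_simps, algebra)
  have e1: "1 - x - 1 = - x" by simp
  show "2 / (3 * (x - 1)^2) = potential \<alpha> \<beta> \<gamma> x / 2 + (- 2 / (3 * (x - 1)))^2 / 2
      + 36 * (1 / (3 * (x - 1)))^2 * (1 - x) / (1 - x - 1)^2"
    unfolding e1 potential_def assms using x d by (simp add: divide_simps) algebra
  show "(1 - x - 1)^2 = -27 * (1 / (3 * (x - 1)))^3 * (1 - x) * (x * (x - 1))^2"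
    unfolding e1 using x d by (simp add: divide_simps) algebra
next
  show "smooth_on I (\<lambda>q. 1 - s q)" by (intro smooth_intros I(1) smooth_s)
qed simp

text \<open>The parameter 3 already sits at 1.\<close>

lemma chart_third_third_3:
  assumes "\<alpha> = 1/3" "\<beta> = 1/3" "\<gamma> = 3"
  shows "\<exists>t c0 c1 c2 c3 a0 a1 a2 a3 b0 b1 b2 b3. solution_chart I F t c0 c1 c2 c3 a0 a1 a2 a3 b0 b1 b2 b3"
proof (rule chart_cube_root[where e="\<lambda>x. x" and m="\<lambda>x. 1 / (3 * x)" and n="\<lambda>x. - 2 / (3 * x)"
    and dn="\<lambda>x. 2 / (3 * x^2)" and \<kappa>="27"])
  fix x :: real assume x: "x \<noteq> 0" "x \<noteq> 1"
  have d: "x - 1 \<noteq> 0" using x by simp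
  have "((\<lambda>x. x) has_real_derivative 3 * (1 / (3 * x)) * x) (at x)"
    using x by simp
  then show "x \<noteq> 0 \<and> x \<noteq> 1 \<and> 1 / (3 * x) \<noteq> 0 \<and> ((\<lambda>x. x) has_real_derivative 3 * (1 / (3 * x)) * x) (at x)"
    using x by simp
  show "((\<lambda>x. 1 / (3 * x)) has_real_derivative 1 / (3 * x) * (- 2 / (3 * x) - 1 / (3 * x))) (at x)"
    using x by (auto intro!: derivative_eq_intros simp: field_simps)
  show "((\<lambda>x. - 2 / (3 * x)) has_real_derivative 2 / (3 * x^2)) (at x)"
    using x by (auto intro!: derivative_eq_intros) (simp add: divide_simps power2_eq_square)
  show "2 / (3 * x^2) = potential \<alpha> \<beta> \<gamma> x / 2 + (- 2 / (3 * x))^2 / 2 + 36 * (1 / (3 * x))^2 * x / (x - 1)^2"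
    unfolding potential_def assms using x d by (simp add: divide_simps) algebra
  show "(x - 1)^2 = 27 * (1 / (3 * x))^3 * x * (x * (x - 1))^2"
    using x d by (simp add: divide_simps) algebra
qed (use smooth_s in simp_all)

end

theorem theorem6p3:
  fixes s F :: "real \<Rightarrow> real" and I :: "real set" and \<alpha> \<beta> \<gamma> :: real
  assumes "open I" and "is_interval I"
    and "smooth_on I s"
    and "\<And>q. q \<in> I \<Longrightarrow> s q \<noteq> 0 \<and> s q \<noteq> 1 \<and> deriv s q > 0"
    and "(\<alpha>, \<beta>, \<gamma>) \<in> {(3, 3, 3), (3, 1/3, 1/3), (1/3, 3, 1/3), (1/3, 1/3, 3)}"
    and "\<And>q. q \<in> I \<Longrightarrow> schwarzian s q + (deriv s q)^2 / 2 * potential \<alpha> \<beta> \<gamma> (s q) = 0"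
    and "iterated_antiderivative_on I (\<lambda>q. deriv s q powr (3/2) / (s q * (s q - 1))) F"
  shows "distribution_235 (M_xyzpq I) (distribution_F F)
    \<and> pseudo_riemannian_on (M_xyzpq I) (nurowski_metric F)
    \<and> (\<forall>v\<in>M_xyzpq I. \<forall>a b c d. weyl (nurowski_metric F) a b c d v = 0)
    \<and> conformally_flat_on (M_xyzpq I) (nurowski_metric F)
    \<and> (\<forall>v\<in>M_xyzpq I.
         lie_isomorphic (symmetry_algebra_at (M_xyzpq I) (distribution_F F) v) split_g2)"
proof (cases "I = {}")
  \<comment> \<open>An empty interval has no base point \<open>q0\<close>; all claims then concern
    the empty set.\<close>
  case True
  then have "M_xyzpq I = {}" by (simp add: M_xyzpq_def)
  moreover have "Ck_on k {} f" for k and f :: "real^5 \<Rightarrow> real"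
    by (induction k arbitrary: f) (simp_all add: differentiable_on_def)
  then have smooth: "smooth_on {} f" for f :: "real^5 \<Rightarrow> real" by (simp add: smooth_on_def)
  ultimately show ?thesis
    by (simp add: distribution_235_def distribution_of_rank_def pseudo_riemannian_on_def smooth conformally_flat_on_def)
next
  case False
  then obtain q0 where q0: "q0 \<in> I" by blast
  obtain G where G: "\<And>q. q \<in> I \<Longrightarrow> (F has_real_derivative G q) (at q)"
    "\<And>q. q \<in> I \<Longrightarrow> (G has_real_derivative deriv s q powr (3/2) / (s q * (s q - 1))) (at q)"
    using assms(7) by (auto simp: iterated_antiderivative_on_def)
  interpret schwarz_solution s F G I q0 \<alpha> \<beta> \<gamma>
    by unfold_locales (use assms G q0 is_interval_connected in auto)
  have "\<exists>t c0 c1 c2 c3 a0 a1 a2 a3 b0 b1 b2 b3. solution_chart I F t c0 c1 c2 c3 a0 a1 a2 a3 b0 b1 b2 b3"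
    using assms(5) chart_333 chart_3_third_third chart_third_3_third chart_third_third_3 by auto
  then obtain t c0 c1 c2 c3 a0 a1 a2 a3 b0 b1 b2 b3
    where "solution_chart I F t c0 c1 c2 c3 a0 a1 a2 a3 b0 b1 b2 b3" by (elim exE)
  note chart = this
  show ?thesis
    by (intro conjI ballI allI solution_chart.distribution_235_F[OF chart] solution_chart.pseudo_riemannian_nurowski[OF chart]
        solution_chart.weyl_nurowski[OF chart] solution_chart.conformally_flat_nurowski[OF chart]
        solution_chart.symmetry_algebra_F[OF chart])
qed

end
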